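(* Let $\mathcal H$ and $\mathcal K$ be Hilbert spaces, $\mathbb V$ an $\mathcal L(\mathcal H)$-module, $(\Omega,\Sigma)$ a measurable space and $\nu:\Sigma\to[0,\infty]$ a $\sigma$-finite measure. Let $S:\mathcal L(\mathcal K)\otimes L^\infty(\nu)\to S_{\mathcal L(\mathcal H)}(\mathbb V)$ be a normal CP map. Then there exist a Hilbert space $\mathcal H_0$, a spectral measure $\mathsf F:\Sigma\to\mathcal L(\mathcal H_0)$ vanishing on $\nu$-null sets, and an $\mathcal L(\mathcal H)$-linear map $Y:\mathbb V\to\mathcal L(\mathcal H;\mathcal K\otimes\mathcal H_0)$ such that $$S_{b\otimes f}(v,w)=(Yv)^*\Big[b\otimes\int_\Omega f\,d\mathsf F\Big](Yw)$$ for all $b\in\mathcal L(\mathcal K)$, $f\in L^\infty(\nu)$, and $v,w\in\mathbb V$, and $$\mathrm{lin}_{\mathbb C}\{(b\otimes\mathsf F(X))(Yv)\mid b\in\mathcal L(\mathcal K),\ X\in\Sigma,\ v\in\mathbb V\}$$ is $\sigma$-strongly dense in $\mathcal L(\mathcal H;\mathcal K\otimes\mathcal H_0)$.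
   Context: $\mathcal L(\mathcal H;\mathcal H')$ denotes bounded linear operators between Hilbert spaces and $\mathcal L(\mathcal H)=\mathcal L(\mathcal H;\mathcal H)$. An $\mathcal L(\mathcal H)$-module is a complex vector space with a (compatible) right $\mathcal L(\mathcal H)$-module structure (no inner product assumed); $\mathcal L(\mathcal H;\mathcal H')$ is such a module by composition. The $\sigma$-strong topology of $\mathcal L(\mathcal H;\mathcal H')$ is generated by the seminorms $m\mapsto\big(\sum_j\|m\xi_j\|^2\big)^{1/2}$ for sequences $(\xi_j)$ in $\mathcal H$ with $\sum_j\|\xi_j\|^2<\infty$. $L^\infty(\nu)$ is the von Neumann algebra of (classes of) essentially bounded measurable functions, and $\mathcal L(\mathcal K)\otimes L^\infty(\nu)$ is the $W^*$-tensor product. A spectral measure is a normalized projection-valued measure. $S_{\mathcal L(\mathcal H)}(\mathbb V)$ is the set of maps $s:\mathbb V\times\mathbb V\to\mathcal L(\mathcal H)$ that are linear in the second and conjugate linear in the first argument with $s(u,va)=s(u,v)a$, $s(ua,v)=a^*s(u,v)$ for $a\in\mathcal L(\mathcal H)$. A linear map $S:\mathcal D\to S_{\mathcal L(\mathcal H)}(\mathbb V)$ on a $W^*$-algebra $\mathcal D$ is CP if $\sum_{j,k=1}^nS_{d_j^*d_k}(v_j,v_k)\ge0$ for all $n\in\mathbb N$, $d_j\in\mathcal D$, $v_j\in\mathbb V$, and normal if $d\mapsto S_d(v,v)\in\mathcal L(\mathcal H)$ is $\sigma$-weakly continuous for all $v\in\mathbb V$. *)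

theory Defs
  imports "HOL-Analysis.Analysis" "HOL-Algebra.Module"
begin

text \<open>
  The Hilbert space to be constructed depends on terms (operators, measures), so all spaces are
  structures with an explicit carrier. The fields \<open>mult\<close> and \<open>one\<close>, which \<open>module\<close> inherits from
  \<open>ring\<close>, only have a meaning for the algebras of operators below; elsewhere they are ignored.
\<close>

definition complex_ring :: "complex ring" where
  "complex_ring = \<lparr>carrier = UNIV, mult = (*), one = 1, zero = 0, add = (+)\<rparr>"

lemma cring_complex_ring: "cring complex_ring"
proof (rule cringI)
  show "abelian_group complex_ring"
  proof (rule abelian_groupI)
    fix x :: complex
    show "\<exists>y\<in>carrier complex_ring. y \<oplus>\<^bsub>complex_ring\<^esub> x = \<zero>\<^bsub>complex_ring\<^esub>"
      by (rule bexI[of _ "- x"]) (simp_all add: complex_ring_def)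
  qed (simp_all add: complex_ring_def)
  show "Group.comm_monoid complex_ring"
    by (rule comm_monoidI) (simp_all add: complex_ring_def)
qed (simp_all add: complex_ring_def distrib_right)

definition linear_map :: "(complex,'a,'m) module_scheme \<Rightarrow> (complex,'b,'n) module_scheme \<Rightarrow> ('a \<Rightarrow> 'b) \<Rightarrow> bool" where
  "linear_map E E' f \<longleftrightarrow> f \<in> carrier E \<rightarrow> carrier E'
    \<and> (\<forall>x\<in>carrier E. \<forall>y\<in>carrier E. f (x \<oplus>\<^bsub>E\<^esub> y) = f x \<oplus>\<^bsub>E'\<^esub> f y)
    \<and> (\<forall>c. \<forall>x\<in>carrier E. f (c \<odot>\<^bsub>E\<^esub> x) = c \<odot>\<^bsub>E'\<^esub> f x)"

definition lin_span :: "(complex,'a,'m) module_scheme \<Rightarrow> 'a set \<Rightarrow> 'a set" where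
  "lin_span E A = (\<lambda>N. submodule N complex_ring E) hull A"

text \<open>Inner products are linear in the second argument.\<close>

record 'a hilb = "(complex,'a) module" +
  ip :: "'a \<Rightarrow> 'a \<Rightarrow> complex"

definition hnorm :: "'a hilb \<Rightarrow> 'a \<Rightarrow> real" where
  "hnorm H x = sqrt (Re (ip H x x))"

text \<open>The value \<open>0\<close> off the carrier is there because \<open>Metric_space\<close> wants total symmetry and positivity.\<close>

definition hdist :: "'a hilb \<Rightarrow> 'a \<Rightarrow> 'a \<Rightarrow> real" where
  "hdist H x y = (if x \<in> carrier H \<and> y \<in> carrier H then hnorm H (x \<ominus>\<^bsub>H\<^esub> y) else 0)"

locale hilbert_space =
  fixes H :: "'a hilb" (structure)
  assumes vector_space: "Module.module complex_ring H"
    and ip_add: "\<lbrakk>x \<in> carrier H; y \<in> carrier H; z \<in> carrier H\<rbrakk> \<Longrightarrow> ip H x (y \<oplus> z) = ip H x y + ip H x z"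
    and ip_smult: "\<lbrakk>x \<in> carrier H; y \<in> carrier H\<rbrakk> \<Longrightarrow> ip H x (c \<odot> y) = c * ip H x y"
    and ip_commute: "\<lbrakk>x \<in> carrier H; y \<in> carrier H\<rbrakk> \<Longrightarrow> ip H y x = cnj (ip H x y)"
    and ip_nonneg: "x \<in> carrier H \<Longrightarrow> 0 \<le> Re (ip H x x)"
    and ip_definite: "\<lbrakk>x \<in> carrier H; ip H x x = 0\<rbrakk> \<Longrightarrow> x = \<zero>"
    and complete: "Metric_space.mcomplete (carrier H) (hdist H)"

definition is_onb :: "'a hilb \<Rightarrow> 'a set \<Rightarrow> bool" where
  "is_onb H B \<longleftrightarrow> B \<subseteq> carrier H
    \<and> (\<forall>e\<in>B. \<forall>f\<in>B. ip H e f = (if e = f then 1 else 0))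
    \<and> (\<forall>x\<in>carrier H. (\<forall>e\<in>B. ip H e x = 0) \<longrightarrow> x = \<zero>\<^bsub>H\<^esub>)"

definition some_onb :: "'a hilb \<Rightarrow> 'a set" where
  "some_onb H = (SOME B. is_onb H B)"

text \<open>Operators are extensional functions on the carrier, so that equality of operators is equality in HOL.\<close>

definition bounded_ops :: "'a hilb \<Rightarrow> 'b hilb \<Rightarrow> (complex, 'a \<Rightarrow> 'b) module" where
  "bounded_ops H H' =
    \<lparr>carrier = {T \<in> carrier H \<rightarrow>\<^sub>E carrier H'. linear_map H H' T \<and>
                 (\<exists>C. \<forall>x\<in>carrier H. hnorm H' (T x) \<le> C * hnorm H x)},
     mult = undefined, one = undefined,
     zero = (\<lambda>x\<in>carrier H. \<zero>\<^bsub>H'\<^esub>),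
     add = (\<lambda>T U. \<lambda>x\<in>carrier H. T x \<oplus>\<^bsub>H'\<^esub> U x),
     smult = (\<lambda>c T. \<lambda>x\<in>carrier H. c \<odot>\<^bsub>H'\<^esub> T x)\<rparr>"

definition op_algebra :: "'a hilb \<Rightarrow> (complex, 'a \<Rightarrow> 'a) module" where
  "op_algebra H = (bounded_ops H H)
    \<lparr>mult := (\<lambda>T U. compose (carrier H) T U), one := (\<lambda>x\<in>carrier H. x)\<rparr>"

definition adj :: "'a hilb \<Rightarrow> 'b hilb \<Rightarrow> ('a \<Rightarrow> 'b) \<Rightarrow> 'b \<Rightarrow> 'a" where
  "adj H H' T = (\<lambda>y\<in>carrier H'. THE x. x \<in> carrier H \<and> (\<forall>z\<in>carrier H. ip H' (T z) y = ip H z x))"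

definition positive_op :: "'a hilb \<Rightarrow> ('a \<Rightarrow> 'a) \<Rightarrow> bool" where
  "positive_op H T \<longleftrightarrow> T \<in> carrier (op_algebra H) \<and> (\<forall>x\<in>carrier H. ip H x (T x) \<in> \<real>\<^sub>\<ge>\<^sub>0)"

definition projection_op :: "'a hilb \<Rightarrow> ('a \<Rightarrow> 'a) \<Rightarrow> bool" where
  "projection_op H P \<longleftrightarrow> P \<in> carrier (op_algebra H) \<and> P \<otimes>\<^bsub>op_algebra H\<^esub> P = P \<and> adj H H P = P"

definition square_summable_seqs :: "'a hilb \<Rightarrow> (nat \<Rightarrow> 'a) set" where
  "square_summable_seqs H = {\<xi>. range \<xi> \<subseteq> carrier H \<and> summable (\<lambda>j. (hnorm H (\<xi> j))\<^sup>2)}"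

text \<open>The coarsest topology making the functionals
  \<open>T \<mapsto> \<Sum>j. \<langle>\<eta> j, T (\<xi> j)\<rangle>\<close> continuous; they are exactly the elements of the predual.\<close>

definition sigma_weak :: "'a hilb \<Rightarrow> 'b hilb \<Rightarrow> ('a \<Rightarrow> 'b) topology" where
  "sigma_weak H H' = topology_generated_by
    {{T \<in> carrier (bounded_ops H H'). (\<Sum>j. ip H' (\<eta> j) (T (\<xi> j))) \<in> U} | \<xi> \<eta> U.
      \<xi> \<in> square_summable_seqs H \<and> \<eta> \<in> square_summable_seqs H' \<and> open U}"

definition sigma_strong :: "'a hilb \<Rightarrow> 'b hilb \<Rightarrow> ('a \<Rightarrow> 'b) topology" where
  "sigma_strong H H' = topology_generated_by
    {{T \<in> carrier (bounded_ops H H').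
        sqrt (\<Sum>j. (hnorm H' ((T \<ominus>\<^bsub>bounded_ops H H'\<^esub> T\<^sub>0) (\<xi> j)))\<^sup>2) < r} | \<xi> T\<^sub>0 r.
      \<xi> \<in> square_summable_seqs H \<and> T\<^sub>0 \<in> carrier (bounded_ops H H') \<and> r > 0}"

definition commutant :: "'a hilb \<Rightarrow> ('a \<Rightarrow> 'a) set \<Rightarrow> ('a \<Rightarrow> 'a) set" where
  "commutant H A = {T \<in> carrier (op_algebra H). \<forall>U\<in>A. T \<otimes>\<^bsub>op_algebra H\<^esub> U = U \<otimes>\<^bsub>op_algebra H\<^esub> T}"

text \<open>
  The tensor product of \<open>K\<close> and \<open>H\<close> is the space of Hilbert-Schmidt functionals on the product of
  the conjugate spaces (Kadison and Ringrose, Fundamentals of the Theory of Operator Algebras I,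
  Section 2.6), i.e. of bounded functionals on \<open>K \<times> H\<close> that are conjugate linear in both arguments
  and square summable over a product of orthonormal bases; neither the space nor its inner product
  depends on the bases chosen. The elementary tensor of \<open>x\<close> and \<open>y\<close> is
  \<open>(a, b) \<mapsto> \<langle>a, x\<rangle> \<langle>b, y\<rangle>\<close>.
\<close>

definition hs_functionals :: "'k hilb \<Rightarrow> 'h hilb \<Rightarrow> ('k \<times> 'h \<Rightarrow> complex) set" where
  "hs_functionals K H = {\<phi> \<in> extensional (carrier K \<times> carrier H).
      (\<forall>a\<in>carrier K. \<forall>a'\<in>carrier K. \<forall>b\<in>carrier H. \<phi> (a \<oplus>\<^bsub>K\<^esub> a', b) = \<phi> (a, b) + \<phi> (a', b))
    \<and> (\<forall>a\<in>carrier K. \<forall>b\<in>carrier H. \<forall>b'\<in>carrier H. \<phi> (a, b \<oplus>\<^bsub>H\<^esub> b') = \<phi> (a, b) + \<phi> (a, b'))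
    \<and> (\<forall>c. \<forall>a\<in>carrier K. \<forall>b\<in>carrier H. \<phi> (c \<odot>\<^bsub>K\<^esub> a, b) = cnj c * \<phi> (a, b) \<and> \<phi> (a, c \<odot>\<^bsub>H\<^esub> b) = cnj c * \<phi> (a, b))
    \<and> (\<exists>C. \<forall>a\<in>carrier K. \<forall>b\<in>carrier H. cmod (\<phi> (a, b)) \<le> C * (hnorm K a * hnorm H b))
    \<and> (\<lambda>p. (cmod (\<phi> p))\<^sup>2) summable_on (some_onb K \<times> some_onb H)}"

definition htensor :: "'k hilb \<Rightarrow> 'h hilb \<Rightarrow> ('k \<times> 'h \<Rightarrow> complex) hilb" where
  "htensor K H =
    \<lparr>carrier = hs_functionals K H,
     mult = undefined, one = undefined,
     zero = (\<lambda>p\<in>carrier K \<times> carrier H. 0),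
     add = (\<lambda>\<phi> \<psi>. \<lambda>p\<in>carrier K \<times> carrier H. \<phi> p + \<psi> p),
     smult = (\<lambda>c \<phi>. \<lambda>p\<in>carrier K \<times> carrier H. c * \<phi> p),
     ip = (\<lambda>\<phi> \<psi>. \<Sum>\<^sub>\<infinity>p\<in>some_onb K \<times> some_onb H. cnj (\<phi> p) * \<psi> p)\<rparr>"

definition vec_tensor :: "'k hilb \<Rightarrow> 'h hilb \<Rightarrow> 'k \<Rightarrow> 'h \<Rightarrow> ('k \<times> 'h \<Rightarrow> complex)" where
  "vec_tensor K H x y = (\<lambda>(a, b)\<in>carrier K \<times> carrier H. ip K a x * ip H b y)"

definition op_tensor :: "'k hilb \<Rightarrow> 'h hilb \<Rightarrow> ('k \<Rightarrow> 'k) \<Rightarrow> ('h \<Rightarrow> 'h) \<Rightarrow> ('k \<times> 'h \<Rightarrow> complex) \<Rightarrow> ('k \<times> 'h \<Rightarrow> complex)" where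
  "op_tensor K H b c = (THE T. T \<in> carrier (op_algebra (htensor K H)) \<and>
     (\<forall>x\<in>carrier K. \<forall>y\<in>carrier H. T (vec_tensor K H x y) = vec_tensor K H (b x) (c y)))"

definition ae_class :: "'o measure \<Rightarrow> ('o \<Rightarrow> complex) \<Rightarrow> ('o \<Rightarrow> complex) set" where
  "ae_class \<nu> f = {g \<in> borel_measurable \<nu>. AE x in \<nu>. g x = f x}"

definition ae_rep :: "('o \<Rightarrow> complex) set \<Rightarrow> 'o \<Rightarrow> complex" where
  "ae_rep c = (SOME f. f \<in> c)"

definition L2 :: "'o measure \<Rightarrow> ('o \<Rightarrow> complex) set hilb" where
  "L2 \<nu> =
    \<lparr>carrier = ae_class \<nu> ` {f \<in> borel_measurable \<nu>. integrable \<nu> (\<lambda>x. (cmod (f x))\<^sup>2)},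
     mult = undefined, one = undefined,
     zero = ae_class \<nu> (\<lambda>x. 0),
     add = (\<lambda>f g. ae_class \<nu> (\<lambda>x. ae_rep f x + ae_rep g x)),
     smult = (\<lambda>c f. ae_class \<nu> (\<lambda>x. c * ae_rep f x)),
     ip = (\<lambda>f g. \<integral>x. cnj (ae_rep f x) * ae_rep g x \<partial>\<nu>)\<rparr>"

definition Linf :: "'o measure \<Rightarrow> ('o \<Rightarrow> complex) set set" where
  "Linf \<nu> = ae_class \<nu> ` {f \<in> borel_measurable \<nu>. \<exists>C. AE x in \<nu>. cmod (f x) \<le> C}"

definition mult_op :: "'o measure \<Rightarrow> ('o \<Rightarrow> complex) set \<Rightarrow> ('o \<Rightarrow> complex) set \<Rightarrow> ('o \<Rightarrow> complex) set" where
  "mult_op \<nu> f = (\<lambda>g\<in>carrier (L2 \<nu>). ae_class \<nu> (\<lambda>x. ae_rep f x * ae_rep g x))"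

definition elem_tensor :: "'k hilb \<Rightarrow> 'o measure \<Rightarrow> ('k \<Rightarrow> 'k) \<Rightarrow> ('o \<Rightarrow> complex) set
    \<Rightarrow> ('k \<times> ('o \<Rightarrow> complex) set \<Rightarrow> complex) \<Rightarrow> ('k \<times> ('o \<Rightarrow> complex) set \<Rightarrow> complex)" where
  "elem_tensor K \<nu> b f = op_tensor K (L2 \<nu>) b (mult_op \<nu> f)"

text \<open>
  For \<open>\<sigma>\<close>-finite \<open>\<nu>\<close>, \<open>L\<^sup>\<infinity>(\<nu>)\<close> acts on \<open>L\<^sup>2(\<nu>)\<close> as a von Neumann algebra, and the \<open>W\<^sup>*\<close>-tensor
  product is the von Neumann algebra (double commutant) generated by the elementary tensors.
\<close>

definition wstar_tensor :: "'k hilb \<Rightarrow> 'o measure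
    \<Rightarrow> (complex, ('k \<times> ('o \<Rightarrow> complex) set \<Rightarrow> complex) \<Rightarrow> ('k \<times> ('o \<Rightarrow> complex) set \<Rightarrow> complex)) module" where
  "wstar_tensor K \<nu> = (let G = htensor K (L2 \<nu>) in (op_algebra G)
    \<lparr>carrier := commutant G (commutant G
      {elem_tensor K \<nu> b f | b f. b \<in> carrier (op_algebra K) \<and> f \<in> Linf \<nu>})\<rparr>)"

record ('r, 'v) rmodule = "(complex, 'v) module" +
  ract :: "'v \<Rightarrow> 'r \<Rightarrow> 'v"  (infixl \<open>\<cdot>\<index>\<close> 72)

locale op_module =
  fixes H :: "'h hilb" and V :: "('h \<Rightarrow> 'h, 'v) rmodule" (structure)
  assumes vector_space: "Module.module complex_ring V"
    and act_closed: "\<lbrakk>v \<in> carrier V; a \<in> carrier (op_algebra H)\<rbrakk> \<Longrightarrow> v \<cdot> a \<in> carrier V"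
    and act_add: "\<lbrakk>v \<in> carrier V; w \<in> carrier V; a \<in> carrier (op_algebra H)\<rbrakk>
        \<Longrightarrow> (v \<oplus> w) \<cdot> a = v \<cdot> a \<oplus> w \<cdot> a"
    and act_op_add: "\<lbrakk>v \<in> carrier V; a \<in> carrier (op_algebra H); b \<in> carrier (op_algebra H)\<rbrakk>
        \<Longrightarrow> v \<cdot> (a \<oplus>\<^bsub>op_algebra H\<^esub> b) = v \<cdot> a \<oplus> v \<cdot> b"
    and act_op_mult: "\<lbrakk>v \<in> carrier V; a \<in> carrier (op_algebra H); b \<in> carrier (op_algebra H)\<rbrakk>
        \<Longrightarrow> v \<cdot> (a \<otimes>\<^bsub>op_algebra H\<^esub> b) = (v \<cdot> a) \<cdot> b"
    and act_one: "v \<in> carrier V \<Longrightarrow> v \<cdot> \<one>\<^bsub>op_algebra H\<^esub> = v"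
    and act_smult: "\<lbrakk>v \<in> carrier V; a \<in> carrier (op_algebra H)\<rbrakk> \<Longrightarrow> (c \<odot> v) \<cdot> a = c \<odot> (v \<cdot> a)"
    and act_op_smult: "\<lbrakk>v \<in> carrier V; a \<in> carrier (op_algebra H)\<rbrakk>
        \<Longrightarrow> v \<cdot> (c \<odot>\<^bsub>op_algebra H\<^esub> a) = c \<odot> (v \<cdot> a)"

definition op_linear :: "'h hilb \<Rightarrow> ('h \<Rightarrow> 'h, 'v) rmodule \<Rightarrow> 'g hilb \<Rightarrow> ('v \<Rightarrow> 'h \<Rightarrow> 'g) \<Rightarrow> bool" where
  "op_linear H V G Y \<longleftrightarrow> linear_map V (bounded_ops H G) Y \<and>
    (\<forall>v\<in>carrier V. \<forall>a\<in>carrier (op_algebra H). Y (v \<cdot>\<^bsub>V\<^esub> a) = compose (carrier H) (Y v) a)"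

definition sesq_forms :: "'h hilb \<Rightarrow> ('h \<Rightarrow> 'h, 'v) rmodule \<Rightarrow> (complex, 'v \<times> 'v \<Rightarrow> 'h \<Rightarrow> 'h) module" where
  "sesq_forms H V = (let A = op_algebra H in
    \<lparr>carrier = {s \<in> carrier V \<times> carrier V \<rightarrow>\<^sub>E carrier A.
        (\<forall>u\<in>carrier V. \<forall>v\<in>carrier V. \<forall>w\<in>carrier V.
          s (u, v \<oplus>\<^bsub>V\<^esub> w) = s (u, v) \<oplus>\<^bsub>A\<^esub> s (u, w) \<and> s (u \<oplus>\<^bsub>V\<^esub> v, w) = s (u, w) \<oplus>\<^bsub>A\<^esub> s (v, w))
      \<and> (\<forall>u\<in>carrier V. \<forall>v\<in>carrier V. \<forall>c.
          s (u, c \<odot>\<^bsub>V\<^esub> v) = c \<odot>\<^bsub>A\<^esub> s (u, v) \<and> s (c \<odot>\<^bsub>V\<^esub> u, v) = cnj c \<odot>\<^bsub>A\<^esub> s (u, v))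
      \<and> (\<forall>u\<in>carrier V. \<forall>v\<in>carrier V. \<forall>a\<in>carrier A.
          s (u, v \<cdot>\<^bsub>V\<^esub> a) = s (u, v) \<otimes>\<^bsub>A\<^esub> a \<and> s (u \<cdot>\<^bsub>V\<^esub> a, v) = adj H H a \<otimes>\<^bsub>A\<^esub> s (u, v))},
     mult = undefined, one = undefined,
     zero = (\<lambda>p\<in>carrier V \<times> carrier V. \<zero>\<^bsub>A\<^esub>),
     add = (\<lambda>s t. \<lambda>p\<in>carrier V \<times> carrier V. s p \<oplus>\<^bsub>A\<^esub> t p),
     smult = (\<lambda>c s. \<lambda>p\<in>carrier V \<times> carrier V. c \<odot>\<^bsub>A\<^esub> s p)\<rparr>)"

text \<open>In the next two definitions, \<open>D\<close> is a von Neumann algebra acting on \<open>G\<close>.\<close>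

definition cp_map :: "'g hilb \<Rightarrow> (complex, 'g \<Rightarrow> 'g) module \<Rightarrow> 'h hilb \<Rightarrow> ('h \<Rightarrow> 'h, 'v) rmodule
    \<Rightarrow> (('g \<Rightarrow> 'g) \<Rightarrow> 'v \<times> 'v \<Rightarrow> 'h \<Rightarrow> 'h) \<Rightarrow> bool" where
  "cp_map G D H V S \<longleftrightarrow> linear_map D (sesq_forms H V) S \<and>
    (\<forall>(n::nat) d v. d \<in> {1..n} \<rightarrow> carrier D \<and> v \<in> {1..n} \<rightarrow> carrier V \<longrightarrow>
      positive_op H (\<Oplus>\<^bsub>op_algebra H\<^esub>j\<in>{1..n}. \<Oplus>\<^bsub>op_algebra H\<^esub>k\<in>{1..n}.
        S (adj G G (d j) \<otimes>\<^bsub>D\<^esub> d k) (v j, v k)))"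

definition normal_map :: "'g hilb \<Rightarrow> (complex, 'g \<Rightarrow> 'g) module \<Rightarrow> 'h hilb \<Rightarrow> ('h \<Rightarrow> 'h, 'v) rmodule
    \<Rightarrow> (('g \<Rightarrow> 'g) \<Rightarrow> 'v \<times> 'v \<Rightarrow> 'h \<Rightarrow> 'h) \<Rightarrow> bool" where
  "normal_map G D H V S \<longleftrightarrow> (\<forall>v\<in>carrier V.
    continuous_map (subtopology (sigma_weak G G) (carrier D)) (sigma_weak H H) (\<lambda>d. S d (v, v)))"

text \<open>Only the measurable space underlying \<open>\<nu>\<close> matters here.\<close>

definition spectral_measure :: "'o measure \<Rightarrow> 'a hilb \<Rightarrow> ('o set \<Rightarrow> 'a \<Rightarrow> 'a) \<Rightarrow> bool" where
  "spectral_measure \<nu> H F \<longleftrightarrow>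
    (\<forall>X\<in>sets \<nu>. projection_op H (F X)) \<and>
    F (space \<nu>) = \<one>\<^bsub>op_algebra H\<^esub> \<and>
    (\<forall>X :: nat \<Rightarrow> 'o set. range X \<subseteq> sets \<nu> \<longrightarrow> disjoint_family X \<longrightarrow>
      (\<forall>x\<in>carrier H. \<forall>y\<in>carrier H. (\<lambda>n. ip H x (F (X n) y)) sums ip H x (F (\<Union>n. X n) y)))"

text \<open>The operator \<open>\<integral>f dF\<close> is determined by its quadratic form \<open>x \<mapsto> \<integral>f d\<langle>x, F(\<cdot>) x\<rangle>\<close>.\<close>

definition spectral_integral :: "'o measure \<Rightarrow> 'a hilb \<Rightarrow> ('o set \<Rightarrow> 'a \<Rightarrow> 'a) \<Rightarrow> ('o \<Rightarrow> complex) \<Rightarrow> 'a \<Rightarrow> 'a" where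
  "spectral_integral \<nu> H F f = (THE T. T \<in> carrier (op_algebra H) \<and> (\<forall>x\<in>carrier H.
     ip H x (T x) = (\<integral>\<omega>. f \<omega> \<partial>measure_of (space \<nu>) (sets \<nu>) (\<lambda>X. ennreal (Re (ip H x (F X x)))))))"

text \<open>
  An existential statement over Hilbert spaces has to name a type of vectors. The following one is
  large enough for a reproducing kernel space indexed by an operator \<open>b\<close>, a measurable set \<open>X\<close>, a
  module element \<open>v\<close> and a vector \<open>\<xi>\<close>, i.e. for the closed linear span of the
  \<open>(b \<otimes> F(X)) (Y v) \<xi>\<close>.
\<close>

type_synonym ('k, 'o, 'v, 'h) dilation_vec = "('k \<Rightarrow> 'k) \<times> 'o set \<times> 'v \<times> 'h \<Rightarrow> complex"

end

theory Submission
  imports Defs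
begin

text \<open>
  The map \<open>S\<close> is dilated by a direct construction of the multiplicity space \<open>H\<^sub>0\<close>. In a dilation of the
  desired form, the vector \<open>ph k X v \<xi>\<close> that arises from \<open>(Y v) \<xi>\<close> by the partial inner product with
  \<open>k\<close> in the first factor and by the projection \<open>F X\<close> in the second factor satisfies
  \<open>\<langle>ph k X v \<xi>, ph k' X' v' \<xi>'\<rangle> = \<langle>\<xi>, S (|k\<rangle>\<langle>k'| \<otimes> \<chi>(X \<inter> X')) (v, v') \<xi>'\<rangle>\<close>.
  The right-hand side does not refer to the dilation. It is a positive kernel on the quadruples
  \<open>(k, X, v, \<xi>)\<close> (\<open>kern_positive\<close>): complete positivity is an operator inequality for finite families in
  the module, and different vectors \<open>\<xi>\<close> are absorbed into the module by rank-one operators, because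
  \<open>\<xi> = a \<zeta>\<close> turns \<open>v, \<xi>\<close> into \<open>v \<cdot> a, \<zeta>\<close> (\<open>s_positive\<close>). The Hilbert space \<open>H\<^sub>0\<close> of this kernel
  (\<open>Kolmogorov_decomposition\<close>) carries vectors \<open>ph k X v \<xi>\<close> with these inner products, and they are total.

  Intersection of the sets with \<open>X\<close> defines projections \<open>F X\<close> on \<open>H\<^sub>0\<close>; they form a spectral measure,
  since normality of \<open>S\<close> makes the kernel countably additive in the set (\<open>F_countably_additive\<close>). A bounded
  function is a linear combination of functions with values in \<open>[0, 1)\<close>, and the binary digits of such a
  function expand its spectral integral into a series of projections (\<open>integral_op_exists\<close>); the matrix
  elements of the integral between the vectors \<open>ph k \<Omega> v \<xi>\<close> are those of \<open>S (|k\<rangle>\<langle>l| \<otimes> f)\<close>.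

  The vector \<open>(Y v) \<xi>\<close> is \<open>\<Sum>e. e \<otimes> ph e \<Omega> v \<xi>\<close>, over an orthonormal basis of \<open>K\<close>. That this series
  converges, and that the dilation formula holds for every bounded \<open>b\<close> rather than for finite-rank operators
  only, is the normality of \<open>S\<close> in the first factor: the finite-rank operators \<open>\<Sum>e. |e\<rangle>\<langle>e| b\<close> converge
  \<open>\<sigma>\<close>-weakly to \<open>b\<close> (\<open>t_has_sum\<close>), which gives \<open>S_dilation\<close>.

  Density is again a matter of rank-one operators. The operator \<open>|k\<rangle>\<langle>l| \<otimes> F X\<close> maps \<open>(Y v) \<xi>\<close> to
  \<open>k \<otimes> ph l X v \<xi>\<close>, and replacing \<open>v\<close> by \<open>v \<cdot> |\<xi>\<rangle>\<langle>w|\<close> produces the rank-one operator from \<open>w\<close> to this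
  vector. Such vectors are total, and a linear space that contains all these rank-one operators is
  \<open>\<sigma>\<close>-strongly dense (\<open>sigma_strong_dense\<close>).
\<close>

section \<open>Inner product spaces with a carrier\<close>

text \<open>The form may be degenerate, because the free vector space over a positive kernel has null vectors;
  the estimates up to the triangle inequality are needed there as well.\<close>

locale semi_inner_space =
  fixes H :: "'a hilb" (structure)
  assumes vector_space: "Module.module complex_ring H"
    and ip_add: "\<lbrakk>x \<in> carrier H; y \<in> carrier H; z \<in> carrier H\<rbrakk> \<Longrightarrow> ip H x (y \<oplus> z) = ip H x y + ip H x z"
    and ip_smult: "\<lbrakk>x \<in> carrier H; y \<in> carrier H\<rbrakk> \<Longrightarrow> ip H x (c \<odot> y) = c * ip H x y"
    and ip_commute: "\<lbrakk>x \<in> carrier H; y \<in> carrier H\<rbrakk> \<Longrightarrow> ip H y x = cnj (ip H x y)"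
    and ip_nonneg: "x \<in> carrier H \<Longrightarrow> 0 \<le> Re (ip H x x)"
begin

sublocale M: Module.module complex_ring H
  by (rule vector_space)

lemma smult_carrier [simp, intro]: "x \<in> carrier H \<Longrightarrow> c \<odot> x \<in> carrier H"
  using M.smult_closed[of c x] by (simp add: complex_ring_def)

lemma add_carrier [simp, intro]: "\<lbrakk>x \<in> carrier H; y \<in> carrier H\<rbrakk> \<Longrightarrow> x \<oplus> y \<in> carrier H"
  by simp

lemma minus_carrier [simp, intro]: "\<lbrakk>x \<in> carrier H; y \<in> carrier H\<rbrakk> \<Longrightarrow> x \<ominus> y \<in> carrier H"
  by simp

lemma ip_zero_right [simp]: "x \<in> carrier H \<Longrightarrow> ip H x \<zero> = 0"
  using ip_add[of x \<zero> \<zero>] by simp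

lemma ip_zero_left [simp]: "x \<in> carrier H \<Longrightarrow> ip H \<zero> x = 0"
  using ip_commute[of x \<zero>] by simp

lemma ip_add_left: "\<lbrakk>x \<in> carrier H; y \<in> carrier H; z \<in> carrier H\<rbrakk> \<Longrightarrow> ip H (y \<oplus> z) x = ip H y x + ip H z x"
  using ip_commute[of x "y \<oplus> z"] ip_commute[of x y] ip_commute[of x z] by (simp add: ip_add)

lemma ip_smult_left: "\<lbrakk>x \<in> carrier H; y \<in> carrier H\<rbrakk> \<Longrightarrow> ip H (c \<odot> y) x = cnj c * ip H y x"
  using ip_commute[of x "c \<odot> y"] ip_commute[of x y] by (simp add: ip_smult)

lemma ip_inv: assumes "x \<in> carrier H" "y \<in> carrier H" shows "ip H x (\<ominus> y) = - ip H x y"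
proof -
  have "ip H x (y \<oplus> \<ominus> y) = ip H x y + ip H x (\<ominus> y)"
    using assms by (intro ip_add) auto
  moreover have "y \<oplus> \<ominus> y = \<zero>" using assms by (simp add: M.r_neg)
  ultimately show ?thesis using assms by (simp add: eq_neg_iff_add_eq_0 add.commute)
qed

lemma ip_inv_left: "\<lbrakk>x \<in> carrier H; y \<in> carrier H\<rbrakk> \<Longrightarrow> ip H (\<ominus> y) x = - ip H y x"
  using ip_commute[of x "\<ominus> y"] ip_commute[of x y] by (simp add: ip_inv)

lemma ip_minus: "\<lbrakk>x \<in> carrier H; y \<in> carrier H; z \<in> carrier H\<rbrakk> \<Longrightarrow> ip H x (y \<ominus> z) = ip H x y - ip H x z"
  by (simp add: a_minus_def ip_add ip_inv)

lemma ip_minus_left: "\<lbrakk>x \<in> carrier H; y \<in> carrier H; z \<in> carrier H\<rbrakk> \<Longrightarrow> ip H (y \<ominus> z) x = ip H y x - ip H z x"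
  by (simp add: a_minus_def ip_add_left ip_inv_left)

lemmas ip_simps = ip_add ip_smult ip_add_left ip_smult_left ip_inv ip_inv_left ip_minus ip_minus_left

lemma Im_ip_self [simp]: "x \<in> carrier H \<Longrightarrow> Im (ip H x x) = 0"
  using ip_commute[of x x] by (metis add_self_div_2 cnj.simps(2) complex_cnj_cancel_iff equal_neg_zero)

lemma hnorm_nonneg [simp]: "x \<in> carrier H \<Longrightarrow> 0 \<le> hnorm H x"
  by (simp add: hnorm_def ip_nonneg)

lemma power2_hnorm: "x \<in> carrier H \<Longrightarrow> (hnorm H x)\<^sup>2 = Re (ip H x x)"
  by (simp add: hnorm_def ip_nonneg)

lemma ip_self: "x \<in> carrier H \<Longrightarrow> ip H x x = of_real ((hnorm H x)\<^sup>2)"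
  by (simp add: power2_hnorm complex_eq_iff)

lemma hnorm_zero [simp]: "hnorm H \<zero> = 0"
  by (simp add: hnorm_def)

lemma hnorm_smult: "x \<in> carrier H \<Longrightarrow> hnorm H (c \<odot> x) = cmod c * hnorm H x"
proof -
  assume x: "x \<in> carrier H"
  have "ip H (c \<odot> x) (c \<odot> x) = (c * cnj c) * ip H x x"
    using x by (simp add: ip_simps)
  also have "\<dots> = of_real ((cmod c * hnorm H x)\<^sup>2)"
    using x by (simp only: complex_norm_square[symmetric] ip_self power_mult_distrib of_real_mult of_real_power)
  finally have "Re (ip H (c \<odot> x) (c \<odot> x)) = (cmod c * hnorm H x)\<^sup>2" by simp
  then show ?thesis using x by (simp add: hnorm_def[of H "c \<odot> x"])
qed

lemma power2_hnorm_add: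
  assumes x: "x \<in> carrier H" and y: "y \<in> carrier H"
  shows "(hnorm H (x \<oplus> y))\<^sup>2 = (hnorm H x)\<^sup>2 + 2 * Re (ip H x y) + (hnorm H y)\<^sup>2"
  using x y ip_commute[OF x y] by (simp add: power2_hnorm ip_simps)

lemma power2_hnorm_minus:
  assumes x: "x \<in> carrier H" and y: "y \<in> carrier H"
  shows "(hnorm H (x \<ominus> y))\<^sup>2 = (hnorm H x)\<^sup>2 - 2 * Re (ip H x y) + (hnorm H y)\<^sup>2"
  using x y ip_commute[OF x y] by (simp add: power2_hnorm ip_simps)

text \<open>The discriminant argument is run for \<open>x + c \<odot> y\<close> with real multiples \<open>c\<close> of \<open>cnj \<langle>x, y\<rangle>\<close>, so
  that it also covers the case of a vector \<open>y\<close> of norm \<open>0\<close> in a degenerate space.\<close>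

lemma Cauchy_Schwarz:
  assumes x: "x \<in> carrier H" and y: "y \<in> carrier H"
  shows "cmod (ip H x y) \<le> hnorm H x * hnorm H y"
proof -
  define a b c where "a = (hnorm H x)\<^sup>2" and "b = (hnorm H y)\<^sup>2" and "c = cmod (ip H x y)"
  have key: "0 \<le> a - 2 * t * c\<^sup>2 + t\<^sup>2 * c\<^sup>2 * b" for t :: real
  proof -
    define s where "s = - of_real t * cnj (ip H x y)"
    have "0 \<le> (hnorm H (x \<oplus> s \<odot> y))\<^sup>2" by simp
    also have "\<dots> = a + 2 * Re (s * ip H x y) + (cmod s * hnorm H y)\<^sup>2"
      using x y by (simp add: power2_hnorm_add ip_simps hnorm_smult a_def)
    also have "s * ip H x y = - of_real (t * c\<^sup>2)"
      unfolding s_def c_def using complex_norm_square[of "ip H x y"] by (simp add: mult.commute)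
    also have "(cmod s * hnorm H y)\<^sup>2 = t\<^sup>2 * c\<^sup>2 * b"
      by (simp add: s_def c_def b_def norm_mult power_mult_distrib)
    finally show ?thesis by simp
  qed
  have "c\<^sup>2 \<le> a * b"
  proof (cases "b = 0")
    case True
    have "c\<^sup>2 = 0"
    proof (rule ccontr)
      assume "c\<^sup>2 \<noteq> 0"
      then have "c\<^sup>2 > 0" by simp
      with key[of "(a + 1) / (2 * c\<^sup>2)"] True show False by (simp add: field_simps)
    qed
    then show ?thesis by (simp add: True)
  next
    case False
    then have b: "b > 0" by (simp add: b_def)
    have "a - 2 * (1/b) * c\<^sup>2 + (1/b)\<^sup>2 * c\<^sup>2 * b = a - c\<^sup>2 / b"
      using b by (simp add: field_simps power2_eq_square)
    then have "0 \<le> a - c\<^sup>2 / b" using key[of "1/b"] by linarith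
    then show ?thesis using b by (simp add: field_simps)
  qed
  then have "c\<^sup>2 \<le> (hnorm H x * hnorm H y)\<^sup>2" by (simp add: a_def b_def power_mult_distrib)
  then show ?thesis unfolding c_def by (rule power2_le_imp_le) (use x y in simp)
qed

lemma hnorm_triangle:
  assumes x: "x \<in> carrier H" and y: "y \<in> carrier H"
  shows "hnorm H (x \<oplus> y) \<le> hnorm H x + hnorm H y"
proof (rule power2_le_imp_le)
  have "Re (ip H x y) \<le> hnorm H x * hnorm H y"
    using Cauchy_Schwarz[OF x y] complex_Re_le_cmod order_trans by blast
  then show "(hnorm H (x \<oplus> y))\<^sup>2 \<le> (hnorm H x + hnorm H y)\<^sup>2"
    using x y by (simp add: power2_hnorm_add power2_sum)
qed (use x y in simp)

lemma hnorm_inv: "x \<in> carrier H \<Longrightarrow> hnorm H (\<ominus> x) = hnorm H x"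
  by (simp add: hnorm_def ip_simps)

lemma hnorm_minus_commute: "\<lbrakk>x \<in> carrier H; y \<in> carrier H\<rbrakk> \<Longrightarrow> hnorm H (x \<ominus> y) = hnorm H (y \<ominus> x)"
  by (simp add: hnorm_def ip_simps)

lemma minus_add_minus:
  assumes "x \<in> carrier H" "y \<in> carrier H" "z \<in> carrier H"
  shows "(x \<ominus> y) \<oplus> (y \<ominus> z) = x \<ominus> z"
  using assms by (simp add: a_minus_def M.a_ac M.r_neg2 M.r_neg1)

lemma hnorm_triangle_minus:
  assumes "x \<in> carrier H" "y \<in> carrier H" "z \<in> carrier H"
  shows "hnorm H (x \<ominus> z) \<le> hnorm H (x \<ominus> y) + hnorm H (y \<ominus> z)"
  using hnorm_triangle[of "x \<ominus> y" "y \<ominus> z"] assms by (simp add: minus_add_minus)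

lemma hnorm_triangle_minus':
  assumes "x \<in> carrier H" "y \<in> carrier H"
  shows "hnorm H (x \<ominus> y) \<le> hnorm H x + hnorm H y"
  using hnorm_triangle[of x "\<ominus> y"] assms by (simp add: a_minus_def hnorm_inv)

lemma hnorm_diff_le:
  assumes "x \<in> carrier H" "y \<in> carrier H"
  shows "\<bar>hnorm H x - hnorm H y\<bar> \<le> hnorm H (x \<ominus> y)"
proof -
  have *: "x' = (x' \<ominus> y') \<oplus> y'" if "x' \<in> carrier H" "y' \<in> carrier H" for x' y'
    using that by (simp add: a_minus_def M.a_ac M.r_neg)
  have "hnorm H x \<le> hnorm H (x \<ominus> y) + hnorm H y"
    using hnorm_triangle[of "x \<ominus> y" y] *[of x y] assms by simp
  moreover have "hnorm H y \<le> hnorm H (x \<ominus> y) + hnorm H x"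
    using hnorm_triangle[of "y \<ominus> x" x] *[of y x] assms hnorm_minus_commute[of x y] by simp
  ultimately show ?thesis by linarith
qed

lemma parallelogram:
  assumes x: "x \<in> carrier H" and y: "y \<in> carrier H"
  shows "(hnorm H (x \<oplus> y))\<^sup>2 + (hnorm H (x \<ominus> y))\<^sup>2 = 2 * (hnorm H x)\<^sup>2 + 2 * (hnorm H y)\<^sup>2"
  using x y by (simp add: power2_hnorm_add power2_hnorm_minus)

lemma minus_eq_zero_iff: "\<lbrakk>x \<in> carrier H; y \<in> carrier H\<rbrakk> \<Longrightarrow> x \<ominus> y = \<zero> \<longleftrightarrow> x = y"
  by (metis a_minus_def M.a_inv_closed M.minus_equality M.minus_minus M.r_neg)

definition lincomb :: "('i \<Rightarrow> complex) \<Rightarrow> ('i \<Rightarrow> 'a) \<Rightarrow> 'i set \<Rightarrow> 'a" where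
  "lincomb c f A = (\<Oplus>i\<in>A. c i \<odot> f i)"

lemma lincomb_carrier [simp, intro]: "(\<And>i. i \<in> A \<Longrightarrow> f i \<in> carrier H) \<Longrightarrow> lincomb c f A \<in> carrier H"
  unfolding lincomb_def by (rule M.finsum_closed) auto

lemma lincomb_empty [simp]: "lincomb c f {} = \<zero>"
  by (simp add: lincomb_def)

lemma lincomb_insert:
  assumes "finite A" "a \<notin> A" "\<And>i. i \<in> insert a A \<Longrightarrow> f i \<in> carrier H"
  shows "lincomb c f (insert a A) = c a \<odot> f a \<oplus> lincomb c f A"
  unfolding lincomb_def using assms by (intro M.finsum_insert) auto

lemma ip_lincomb:
  assumes "finite A" "\<And>i. i \<in> A \<Longrightarrow> f i \<in> carrier H" "z \<in> carrier H"
  shows "ip H z (lincomb c f A) = (\<Sum>i\<in>A. c i * ip H z (f i))"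
  using assms
proof (induction A)
  case (insert a A)
  then have "lincomb c f (insert a A) = c a \<odot> f a \<oplus> lincomb c f A"
    by (intro lincomb_insert) auto
  then show ?case using insert by (simp add: ip_simps)
qed simp

lemma ip_lincomb_left:
  assumes "finite A" "\<And>i. i \<in> A \<Longrightarrow> f i \<in> carrier H" "z \<in> carrier H"
  shows "ip H (lincomb c f A) z = (\<Sum>i\<in>A. cnj (c i) * ip H (f i) z)"
proof -
  have "ip H (lincomb c f A) z = cnj (\<Sum>i\<in>A. c i * ip H z (f i))"
    using assms ip_commute[of z "lincomb c f A"] by (simp add: ip_lincomb)
  also have "\<dots> = (\<Sum>i\<in>A. cnj (c i) * ip H (f i) z)"
    using assms by (auto simp: ip_commute[of z] intro!: sum.cong)
  finally show ?thesis .
qed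

definition converges :: "('i \<Rightarrow> 'a) \<Rightarrow> 'a \<Rightarrow> 'i filter \<Rightarrow> bool" where
  "converges x l F \<longleftrightarrow> l \<in> carrier H \<and> (\<forall>i. x i \<in> carrier H) \<and> ((\<lambda>i. hnorm H (x i \<ominus> l)) \<longlongrightarrow> 0) F"

definition cauchy :: "(nat \<Rightarrow> 'a) \<Rightarrow> bool" where
  "cauchy x \<longleftrightarrow> (\<forall>n. x n \<in> carrier H) \<and> (\<forall>e>0. \<exists>N. \<forall>m\<ge>N. \<forall>n\<ge>N. hnorm H (x m \<ominus> x n) < e)"

lemma cauchy_carrier [simp]: "cauchy x \<Longrightarrow> x n \<in> carrier H"
  by (simp add: cauchy_def)

lemma cauchy_bounded:
  assumes "cauchy x"
  shows "\<exists>B. \<forall>n. hnorm H (x n) \<le> B"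
proof -
  obtain N where N: "\<forall>m\<ge>N. \<forall>n\<ge>N. hnorm H (x m \<ominus> x n) < 1"
    using assms unfolding cauchy_def by (meson zero_less_one)
  have "hnorm H (x n) \<le> Max ((\<lambda>n. hnorm H (x n)) ` {..N}) + 1" for n
  proof (cases "n \<le> N")
    case True
    then have "hnorm H (x n) \<le> Max ((\<lambda>n. hnorm H (x n)) ` {..N})" by (intro Max_ge) auto
    then show ?thesis by simp
  next
    case False
    then have "hnorm H (x n \<ominus> x N) < 1" using N by auto
    moreover have "\<bar>hnorm H (x n) - hnorm H (x N)\<bar> \<le> hnorm H (x n \<ominus> x N)"
      using assms by (intro hnorm_diff_le) auto
    moreover have "hnorm H (x N) \<le> Max ((\<lambda>n. hnorm H (x n)) ` {..N})" by (intro Max_ge) auto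
    ultimately show ?thesis by linarith
  qed
  then show ?thesis by blast
qed

lemma converges_hnorm:
  assumes "converges x l F"
  shows "((\<lambda>i. hnorm H (x i)) \<longlongrightarrow> hnorm H l) F"
proof (rule LIM_zero_cancel, rule Lim_null_comparison)
  show "\<forall>\<^sub>F i in F. norm (hnorm H (x i) - hnorm H l) \<le> hnorm H (x i \<ominus> l)"
    using assms hnorm_diff_le unfolding converges_def by (auto intro!: always_eventually)
  show "((\<lambda>i. hnorm H (x i \<ominus> l)) \<longlongrightarrow> 0) F"
    using assms unfolding converges_def by auto
qed

end

locale inner_space = semi_inner_space +
  assumes ip_definite: "\<lbrakk>x \<in> carrier H; ip H x x = 0\<rbrakk> \<Longrightarrow> x = \<zero>"
begin

lemma hnorm_eq_zero: "x \<in> carrier H \<Longrightarrow> hnorm H x = 0 \<longleftrightarrow> x = \<zero>"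
  using ip_definite[of x] ip_self[of x] by auto

lemma vec_eqI:
  assumes "x \<in> carrier H" "y \<in> carrier H" "\<And>z. z \<in> carrier H \<Longrightarrow> ip H z x = ip H z y"
  shows "x = y"
proof -
  have "ip H (x \<ominus> y) (x \<ominus> y) = 0" using assms by (simp add: ip_minus)
  then have "x \<ominus> y = \<zero>" using assms by (intro ip_definite) auto
  then show ?thesis using assms minus_eq_zero_iff by blast
qed

lemma metric_space: "Metric_space (carrier H) (hdist H)"
proof
  show "0 \<le> hdist H x y" for x y by (simp add: hdist_def)
  show "hdist H x y = hdist H y x" for x y by (simp add: hdist_def hnorm_minus_commute)
  show "x \<in> carrier H \<Longrightarrow> y \<in> carrier H \<Longrightarrow> (hdist H x y = 0) = (x = y)" for x y
    by (simp add: hdist_def hnorm_eq_zero minus_eq_zero_iff)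
  show "\<lbrakk>x \<in> carrier H; y \<in> carrier H; z \<in> carrier H\<rbrakk> \<Longrightarrow> hdist H x z \<le> hdist H x y + hdist H y z" for x y z
    by (simp add: hdist_def hnorm_triangle_minus)
qed

lemma MCauchy_iff: "Metric_space.MCauchy (carrier H) (hdist H) x \<longleftrightarrow> cauchy x"
  unfolding Metric_space.MCauchy_def[OF metric_space] cauchy_def
  by (auto simp: hdist_def image_subset_iff)

lemma limitin_iff:
  assumes "\<And>n. x n \<in> carrier H"
  shows "limitin (Metric_space.mtopology (carrier H) (hdist H)) x l sequentially \<longleftrightarrow> converges x l sequentially"
proof -
  have "l \<in> carrier H \<Longrightarrow> (\<forall>e>0. \<forall>\<^sub>F i in sequentially. hnorm H (x i \<ominus> l) < e) \<longleftrightarrow> ((\<lambda>i. hnorm H (x i \<ominus> l)) \<longlongrightarrow> 0) sequentially"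
    using assms by (simp add: tendsto_iff)
  then show ?thesis
    unfolding Metric_space.limitin_metric[OF metric_space] converges_def using assms
    by (auto simp: hdist_def)
qed

lemma hilbert_spaceI:
  assumes "\<And>x. cauchy x \<Longrightarrow> \<exists>l. converges x l sequentially"
  shows "hilbert_space H"
proof (intro hilbert_space.intro)
  show "Metric_space.mcomplete (carrier H) (hdist H)"
    unfolding Metric_space.mcomplete_def[OF metric_space] MCauchy_iff
    using assms limitin_iff cauchy_carrier by blast
qed (fact vector_space ip_add ip_smult ip_commute ip_nonneg ip_definite)+

end

context hilbert_space
begin

sublocale inner_space H
  by (intro inner_space.intro semi_inner_space.intro inner_space_axioms.intro)
    (fact vector_space ip_add ip_smult ip_commute ip_nonneg ip_definite)+

lemma cauchy_converges: "cauchy x \<Longrightarrow> \<exists>l. converges x l sequentially"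
  using complete unfolding Metric_space.mcomplete_def[OF metric_space] MCauchy_iff
  using limitin_iff cauchy_carrier by blast

end


section \<open>Projections, the Riesz representation and orthonormal bases\<close>

context hilbert_space
begin

definition closed_subspace :: "'a set \<Rightarrow> bool" where
  "closed_subspace W \<longleftrightarrow> W \<subseteq> carrier H \<and> \<zero> \<in> W \<and> (\<forall>x\<in>W. \<forall>y\<in>W. x \<oplus> y \<in> W) \<and> (\<forall>c. \<forall>x\<in>W. c \<odot> x \<in> W)
    \<and> (\<forall>x\<in>carrier H. (\<forall>e>0. \<exists>w\<in>W. hnorm H (x \<ominus> w) < e) \<longrightarrow> x \<in> W)"

lemma minus_eq_smult: "\<lbrakk>x \<in> carrier H; y \<in> carrier H\<rbrakk> \<Longrightarrow> x \<ominus> y = x \<oplus> (-1) \<odot> y"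
  by (rule vec_eqI) (auto simp: ip_simps)

lemma smult_zero [simp]: "x \<in> carrier H \<Longrightarrow> 0 \<odot> x = \<zero>"
  by (rule vec_eqI) (auto simp: ip_simps)

lemma minus_zero [simp]: "x \<in> carrier H \<Longrightarrow> x \<ominus> \<zero> = x"
  by (rule vec_eqI) (auto simp: ip_simps)

lemma minus_self [simp]: "x \<in> carrier H \<Longrightarrow> x \<ominus> x = \<zero>"
  by (rule vec_eqI) (auto simp: ip_simps)

lemma closed_subspace_carrier: "\<lbrakk>closed_subspace W; x \<in> W\<rbrakk> \<Longrightarrow> x \<in> carrier H"
  by (auto simp: closed_subspace_def)

text \<open>A minimizing sequence for the distance of \<open>x\<close> to \<open>W\<close> is Cauchy by the parallelogram law.\<close>

lemma nearest_point_exists: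
  assumes W: "closed_subspace W" and x: "x \<in> carrier H"
  shows "\<exists>y\<in>W. \<forall>w\<in>W. hnorm H (x \<ominus> y) \<le> hnorm H (x \<ominus> w)"
proof -
  define D where "D = (\<lambda>w. (hnorm H (x \<ominus> w))\<^sup>2) ` W"
  define d where "d = Inf D"
  have WC: "\<And>w. w \<in> W \<Longrightarrow> w \<in> carrier H" using W closed_subspace_carrier by blast
  have bdd: "bdd_below D" unfolding D_def by (rule bdd_belowI[of _ 0]) auto
  have ne: "D \<noteq> {}" using W by (auto simp: D_def closed_subspace_def)
  have low: "d \<le> (hnorm H (x \<ominus> w))\<^sup>2" if "w \<in> W" for w
    unfolding d_def by (rule cInf_lower) (use that bdd in \<open>auto simp: D_def\<close>)
  have "\<exists>w\<in>W. (hnorm H (x \<ominus> w))\<^sup>2 < d + 1 / Suc n" for n :: nat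
  proof -
    have "Inf D < d + 1 / Suc n" by (simp add: d_def)
    from cInf_lessD[OF ne this] show ?thesis by (auto simp: D_def)
  qed
  then obtain w where w: "\<And>n. w n \<in> W" "\<And>n. (hnorm H (x \<ominus> w n))\<^sup>2 < d + 1 / Suc n" by metis
  have close: "(hnorm H (w m \<ominus> w n))\<^sup>2 < 4 / Suc N" if "m \<ge> N" "n \<ge> N" for m n N
  proof -
    define z where "z = (1/2) \<odot> (w m \<oplus> w n)"
    have c: "w m \<in> carrier H" "w n \<in> carrier H" using w WC by auto
    have z: "z \<in> W" using W w by (simp add: z_def closed_subspace_def)
    have "(hnorm H ((x \<ominus> w m) \<oplus> (x \<ominus> w n)))\<^sup>2 = 4 * (hnorm H (x \<ominus> z))\<^sup>2"
      using c x unfolding z_def by (simp add: power2_hnorm ip_simps field_simps)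
    moreover have "(hnorm H ((x \<ominus> w m) \<ominus> (x \<ominus> w n)))\<^sup>2 = (hnorm H (w m \<ominus> w n))\<^sup>2"
      using c x by (simp add: power2_hnorm ip_simps field_simps)
    moreover have "(hnorm H ((x \<ominus> w m) \<oplus> (x \<ominus> w n)))\<^sup>2 + (hnorm H ((x \<ominus> w m) \<ominus> (x \<ominus> w n)))\<^sup>2
        = 2 * (hnorm H (x \<ominus> w m))\<^sup>2 + 2 * (hnorm H (x \<ominus> w n))\<^sup>2"
      using c x by (intro parallelogram) auto
    moreover have "1 / real (Suc m) \<le> 1 / Suc N" "1 / real (Suc n) \<le> 1 / Suc N"
      using that by (auto simp: frac_le)
    moreover have "(4::real) / Suc N = 4 * (1 / Suc N)" by simp
    ultimately show ?thesis using low[OF z] w(2)[of m] w(2)[of n] by linarith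
  qed
  have "cauchy w"
    unfolding cauchy_def
  proof (intro conjI allI impI)
    fix e :: real assume e: "e > 0"
    obtain N where N: "4 / e\<^sup>2 < real N" using reals_Archimedean2 by blast
    have "hnorm H (w m \<ominus> w n) < e" if "m \<ge> N" "n \<ge> N" for m n
    proof (rule power2_less_imp_less)
      have "(4::real) / Suc N < e\<^sup>2" using N e by (simp add: field_simps add_strict_increasing)
      then show "(hnorm H (w m \<ominus> w n))\<^sup>2 < e\<^sup>2" using close[OF that] by linarith
    qed (use e in simp)
    then show "\<exists>N. \<forall>m\<ge>N. \<forall>n\<ge>N. hnorm H (w m \<ominus> w n) < e" by blast
  qed (use w WC in auto)
  then obtain y where y: "converges w y sequentially" using cauchy_converges by blast
  have yC: "y \<in> carrier H" using y by (simp add: converges_def)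
  have yW: "y \<in> W"
  proof -
    have "\<exists>v\<in>W. hnorm H (y \<ominus> v) < e" if "e > 0" for e
    proof -
      have "\<forall>\<^sub>F n in sequentially. hnorm H (w n \<ominus> y) < e"
        using y that unfolding converges_def by (auto simp: order_tendstoD)
      then obtain n where "hnorm H (w n \<ominus> y) < e" by (auto simp: eventually_sequentially)
      then show ?thesis using w(1)[of n] WC[of "w n"] yC by (auto simp: hnorm_minus_commute)
    qed
    then show ?thesis using W yC unfolding closed_subspace_def by blast
  qed
  have "converges (\<lambda>n. x \<ominus> w n) (x \<ominus> y) sequentially"
  proof -
    have "hnorm H ((x \<ominus> w n) \<ominus> (x \<ominus> y)) = hnorm H (w n \<ominus> y)" for n
      using x yC WC[OF w(1)[of n]] by (simp add: hnorm_def ip_simps)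
    then show ?thesis using y x yC WC[OF w(1)] unfolding converges_def by auto
  qed
  then have lim: "(\<lambda>n. (hnorm H (x \<ominus> w n))\<^sup>2) \<longlonglongrightarrow> (hnorm H (x \<ominus> y))\<^sup>2"
    by (intro tendsto_power converges_hnorm)
  have "(\<lambda>n. d + 1 / real (Suc n)) \<longlonglongrightarrow> d + 0"
    by (intro tendsto_add tendsto_const LIMSEQ_Suc[OF lim_1_over_n])
  then have "(hnorm H (x \<ominus> y))\<^sup>2 \<le> d"
    using lim w(2) by (intro LIMSEQ_le[OF lim]) (auto intro: less_imp_le)
  then have "\<forall>v\<in>W. hnorm H (x \<ominus> y) \<le> hnorm H (x \<ominus> v)"
    using low x WC by (meson hnorm_nonneg minus_carrier order_trans power2_le_imp_le)
  then show ?thesis using yW by blast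
qed

text \<open>The nearest point \<open>y\<close> works: moving it in the direction of \<open>w\<close> by a small multiple of
  \<open>\<langle>w, x - y\<rangle>\<close> would decrease the distance to \<open>x\<close> to first order unless this inner product is \<open>0\<close>.\<close>

theorem projection_exists:
  assumes W: "closed_subspace W" and x: "x \<in> carrier H"
  shows "\<exists>y\<in>W. \<forall>w\<in>W. ip H w (x \<ominus> y) = 0"
proof -
  obtain y where y: "y \<in> W" "\<And>w. w \<in> W \<Longrightarrow> hnorm H (x \<ominus> y) \<le> hnorm H (x \<ominus> w)"
    using nearest_point_exists[OF assms] by blast
  have WC: "\<And>w. w \<in> W \<Longrightarrow> w \<in> carrier H" using W closed_subspace_carrier by blast
  have "ip H w (x \<ominus> y) = 0" if w: "w \<in> W" for w
  proof -
    define z c where "z = x \<ominus> y" and "c = ip H w z"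
    have zC: "z \<in> carrier H" and wC: "w \<in> carrier H" using x y WC w by (auto simp: z_def)
    \<comment> \<open>so small that the quadratic term does not outweigh the linear one\<close>
    define t where "t = 1 / ((hnorm H w)\<^sup>2 + 1)"
    have t: "t > 0" "t * (hnorm H w)\<^sup>2 < 1"
      using add_nonneg_pos[of "(hnorm H w)\<^sup>2" 1] by (auto simp: t_def divide_simps)
    define s where "s = of_real t * c"
    have "y \<oplus> s \<odot> w \<in> W" using y w W by (simp add: closed_subspace_def)
    then have "hnorm H z \<le> hnorm H (x \<ominus> (y \<oplus> s \<odot> w))" using y(2) z_def by blast
    also have "x \<ominus> (y \<oplus> s \<odot> w) = z \<ominus> s \<odot> w"
      using x y WC wC by (intro vec_eqI) (auto simp: z_def ip_simps)
    finally have "(hnorm H z)\<^sup>2 \<le> (hnorm H (z \<ominus> s \<odot> w))\<^sup>2" using zC by (intro power_mono) auto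
    also have "\<dots> = (hnorm H z)\<^sup>2 - 2 * Re (s * ip H z w) + (cmod s * hnorm H w)\<^sup>2"
      using zC wC by (simp add: power2_hnorm_minus ip_simps hnorm_smult)
    also have "s * ip H z w = of_real (t * (cmod c)\<^sup>2)"
      unfolding s_def using ip_commute[OF wC zC] complex_norm_square[of c] by (simp add: c_def mult.assoc)
    also have "(cmod s * hnorm H w)\<^sup>2 = t * (cmod c)\<^sup>2 * (t * (hnorm H w)\<^sup>2)"
      using t by (simp add: s_def norm_mult power_mult_distrib power2_eq_square)
    finally have "2 * (t * (cmod c)\<^sup>2) \<le> t * (cmod c)\<^sup>2 * (t * (hnorm H w)\<^sup>2)" by simp
    also have "\<dots> \<le> t * (cmod c)\<^sup>2 * 1" using t by (intro mult_left_mono) auto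
    finally have "t * (cmod c)\<^sup>2 \<le> 0" by simp
    then have "(cmod c)\<^sup>2 \<le> 0" using t(1) by (simp add: mult_le_0_iff)
    then show ?thesis by (simp add: c_def z_def)
  qed
  then show ?thesis using y by blast
qed

definition total :: "('i \<Rightarrow> 'a) \<Rightarrow> 'i set \<Rightarrow> bool" where
  "total f I \<longleftrightarrow> f ` I \<subseteq> carrier H \<and> (\<forall>x\<in>carrier H. (\<forall>i\<in>I. ip H (f i) x = 0) \<longrightarrow> x = \<zero>)"

text \<open>The component of \<open>x\<close> orthogonal to \<open>W\<close> is orthogonal to the family, hence \<open>0\<close>. Statements about all
  vectors are reduced to a total family in this way, without reference to linear spans.\<close>

lemma closed_subspace_total:
  assumes W: "closed_subspace W" and f: "total f I" "\<And>i. i \<in> I \<Longrightarrow> f i \<in> W" and x: "x \<in> carrier H"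
  shows "x \<in> W"
proof -
  obtain y where y: "y \<in> W" "\<forall>w\<in>W. ip H w (x \<ominus> y) = 0" using projection_exists[OF W x] by blast
  have "y \<in> carrier H" using y W closed_subspace_carrier by blast
  then have "x \<ominus> y = \<zero>" using f y x by (simp add: total_def)
  then show ?thesis using y x \<open>y \<in> carrier H\<close> by (simp add: minus_eq_zero_iff)
qed

lemma total_eqI:
  assumes "total f I" "x \<in> carrier H" "y \<in> carrier H" "\<And>i. i \<in> I \<Longrightarrow> ip H (f i) x = ip H (f i) y"
  shows "x = y"
proof -
  have "\<forall>i\<in>I. ip H (f i) (x \<ominus> y) = 0" using assms by (auto simp: total_def ip_minus image_subset_iff)
  then have "x \<ominus> y = \<zero>" using assms unfolding total_def by blast
  then show ?thesis using assms by (simp add: minus_eq_zero_iff)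
qed

text \<open>For norm-bounded nets, weak convergence may be tested on a total family, because the set of
  all vectors on which it holds is a closed subspace.\<close>

lemma weak_convergence_total:
  assumes f: "total f I"
    and z: "\<forall>\<^sub>F n in F. z n \<in> carrier H \<and> hnorm H (z n) \<le> C" and l: "l \<in> carrier H"
    and conv: "\<And>i. i \<in> I \<Longrightarrow> ((\<lambda>n. ip H (f i) (z n)) \<longlongrightarrow> ip H (f i) l) F"
    and x: "x \<in> carrier H"
  shows "((\<lambda>n. ip H x (z n)) \<longlongrightarrow> ip H x l) F"
proof -
  define W where "W = {x \<in> carrier H. ((\<lambda>n. ip H x (z n)) \<longlongrightarrow> ip H x l) F}"
  have "closed_subspace W"
    unfolding closed_subspace_def
  proof (intro conjI ballI allI impI)
    show "\<zero> \<in> W" using z l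
      by (auto simp: W_def intro!: tendsto_eventually elim!: eventually_mono)
  next
    fix x y assume xy: "x \<in> W" "y \<in> W"
    then have "((\<lambda>n. ip H x (z n) + ip H y (z n)) \<longlongrightarrow> ip H x l + ip H y l) F"
      by (auto simp: W_def intro: tendsto_add)
    moreover have "\<forall>\<^sub>F n in F. ip H x (z n) + ip H y (z n) = ip H (x \<oplus> y) (z n)"
      using z by eventually_elim (use xy in \<open>auto simp: W_def ip_simps\<close>)
    ultimately have "((\<lambda>n. ip H (x \<oplus> y) (z n)) \<longlongrightarrow> ip H x l + ip H y l) F"
      by (rule Lim_transform_eventually)
    then show "x \<oplus> y \<in> W" using xy l by (auto simp: W_def ip_simps)
  next
    fix c x assume x: "x \<in> W"
    then have "((\<lambda>n. cnj c * ip H x (z n)) \<longlongrightarrow> cnj c * ip H x l) F"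
      by (auto simp: W_def intro: tendsto_mult)
    moreover have "\<forall>\<^sub>F n in F. cnj c * ip H x (z n) = ip H (c \<odot> x) (z n)"
      using z by eventually_elim (use x in \<open>auto simp: W_def ip_simps\<close>)
    ultimately have "((\<lambda>n. ip H (c \<odot> x) (z n)) \<longlongrightarrow> cnj c * ip H x l) F"
      by (rule Lim_transform_eventually)
    then show "c \<odot> x \<in> W" using x l by (auto simp: W_def ip_simps)
  next
    fix x assume x: "x \<in> carrier H" and app: "\<forall>e>0. \<exists>w\<in>W. hnorm H (x \<ominus> w) < e"
    define B where "B = max C 0 + hnorm H l + 1"
    have B: "B > 0" using l by (simp add: B_def add_nonneg_pos)
    have "\<forall>\<^sub>F n in F. dist (ip H x (z n)) (ip H x l) < e" if e: "e > 0" for e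
    proof -
      obtain w where w: "w \<in> W" "hnorm H (x \<ominus> w) < e / (2 * B)"
        using app e B by (meson divide_pos_pos mult_pos_pos zero_less_numeral)
      have wC: "w \<in> carrier H" using w by (simp add: W_def)
      have "\<forall>\<^sub>F n in F. dist (ip H w (z n)) (ip H w l) < e / 2"
        using w half_gt_zero[OF e] unfolding W_def tendsto_iff mem_Collect_eq by (metis (no_types))
      with z show ?thesis
      proof eventually_elim
        case (elim n)
        have "cmod (ip H (x \<ominus> w) (z n \<ominus> l)) \<le> hnorm H (x \<ominus> w) * hnorm H (z n \<ominus> l)"
          using elim x wC l by (intro Cauchy_Schwarz) auto
        also have "\<dots> \<le> e / (2 * B) * B"
        proof (intro mult_mono)
          show "hnorm H (z n \<ominus> l) \<le> B"
            using hnorm_triangle_minus'[of "z n" l] elim l by (auto simp: B_def)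
        qed (use w elim x wC l B e in auto)
        finally have "cmod (ip H (x \<ominus> w) (z n \<ominus> l)) \<le> e / 2" using B by simp
        moreover have "ip H x (z n) - ip H x l = ip H (x \<ominus> w) (z n \<ominus> l) + (ip H w (z n) - ip H w l)"
          using elim x wC l by (simp add: ip_simps)
        ultimately show ?case
          using elim(2) norm_triangle_ineq[of "ip H (x \<ominus> w) (z n \<ominus> l)" "ip H w (z n) - ip H w l"]
          by (simp add: dist_norm)
      qed
    qed
    then show "x \<in> W" using x by (simp add: W_def tendsto_iff)
  qed (auto simp: W_def)
  then have "x \<in> W"
    by (rule closed_subspace_total[OF _ f _ x]) (use f conv in \<open>auto simp: W_def total_def\<close>)
  then show ?thesis by (simp add: W_def)
qed

text \<open>The representing vector is a multiple of a vector orthogonal to the kernel of \<open>f\<close>.\<close>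

theorem Riesz_representation:
  assumes add: "\<And>x y. \<lbrakk>x \<in> carrier H; y \<in> carrier H\<rbrakk> \<Longrightarrow> f (x \<oplus> y) = f x + f y"
    and smult: "\<And>c x. x \<in> carrier H \<Longrightarrow> f (c \<odot> x) = c * f x"
    and bounded: "\<And>x. x \<in> carrier H \<Longrightarrow> cmod (f x) \<le> C * hnorm H x"
  shows "\<exists>z\<in>carrier H. \<forall>x\<in>carrier H. f x = ip H z x"
proof (cases "\<forall>x\<in>carrier H. f x = 0")
  case True
  then show ?thesis by (intro bexI[of _ \<zero>]) auto
next
  case False
  then obtain x0 where x0: "x0 \<in> carrier H" "f x0 \<noteq> 0" by blast
  have f_minus: "f (x \<ominus> y) = f x - f y" if "x \<in> carrier H" "y \<in> carrier H" for x y
    using add[of x "(-1) \<odot> y"] smult[of y "-1"] that by (simp add: minus_eq_smult)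
  define W where "W = {x \<in> carrier H. f x = 0}"
  have W: "closed_subspace W"
    unfolding closed_subspace_def
  proof (intro conjI ballI allI impI)
    show "\<zero> \<in> W" using smult[OF x0(1), of 0] x0 by (simp add: W_def)
  next
    fix x assume x: "x \<in> carrier H" and app: "\<forall>e>0. \<exists>w\<in>W. hnorm H (x \<ominus> w) < e"
    have "cmod (f x) \<le> e" if e: "e > 0" for e
    proof -
      obtain w where w: "w \<in> W" "hnorm H (x \<ominus> w) < e / (\<bar>C\<bar> + 1)"
        using app e by (metis abs_ge_zero add_nonneg_pos divide_pos_pos zero_less_one)
      have "cmod (f x) = cmod (f (x \<ominus> w))" using w x by (simp add: W_def f_minus)
      also have "\<dots> \<le> C * hnorm H (x \<ominus> w)" using w x by (intro bounded) (auto simp: W_def)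
      also have "\<dots> \<le> (\<bar>C\<bar> + 1) * hnorm H (x \<ominus> w)" using w x by (intro mult_right_mono) (auto simp: W_def)
      also have "\<dots> \<le> e" using w by (simp add: field_simps add_nonneg_pos)
      finally show ?thesis .
    qed
    then have "cmod (f x) \<le> 0" using field_le_epsilon[of "cmod (f x)" 0] by auto
    then show "x \<in> W" using x by (simp add: W_def)
  qed (auto simp: W_def add smult)
  obtain y where y: "y \<in> W" "\<And>w. w \<in> W \<Longrightarrow> ip H w (x0 \<ominus> y) = 0" using projection_exists[OF W x0(1)] by blast
  define u where "u = x0 \<ominus> y"
  have u: "u \<in> carrier H" "f u \<noteq> 0" "\<And>w. w \<in> W \<Longrightarrow> ip H w u = 0"
    using x0 y by (auto simp: u_def f_minus W_def)
  have "u \<noteq> \<zero>" using u smult[OF u(1), of 0] by auto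
  then have nu: "ip H u u \<noteq> 0" using ip_definite u by blast
  define z where "z = cnj (f u / ip H u u) \<odot> u"
  have "f x = ip H z x" if x: "x \<in> carrier H" for x
  proof -
    have "x \<ominus> (f x / f u) \<odot> u \<in> W" using x u by (simp add: W_def f_minus smult)
    then have "ip H (x \<ominus> (f x / f u) \<odot> u) u = 0" by (rule u(3))
    then have "ip H u (x \<ominus> (f x / f u) \<odot> u) = 0"
      using ip_commute[of "x \<ominus> (f x / f u) \<odot> u" u] x u by simp
    then have "ip H u x = (f x / f u) * ip H u u" using x u by (simp add: ip_simps)
    then show ?thesis using x u nu by (simp add: z_def ip_simps)
  qed
  moreover have "z \<in> carrier H" using u by (simp add: z_def)
  ultimately show ?thesis by blast
qed

text \<open>By Zorn's lemma there is a maximal orthonormal set. It is total, since a vector orthogonal to it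
  could be normalized and adjoined.\<close>

lemma is_onb_some_onb: "is_onb H (some_onb H)"
proof -
  define P where "P = {B. B \<subseteq> carrier H \<and> (\<forall>e\<in>B. \<forall>f\<in>B. ip H e f = (if e = f then 1 else 0))}"
  have "\<exists>M\<in>P. \<forall>X\<in>P. M \<subseteq> X \<longrightarrow> X = M"
  proof (rule subset_Zorn_nonempty)
    show "P \<noteq> {}" by (auto simp: P_def)
    fix \<C> assume C: "\<C> \<noteq> {}" "subset.chain P \<C>"
    have "ip H e f = (if e = f then 1 else 0)" if "e \<in> \<Union>\<C>" "f \<in> \<Union>\<C>" for e f
    proof -
      obtain X Y where "X \<in> \<C>" "Y \<in> \<C>" "e \<in> X" "f \<in> Y" using \<open>e \<in> \<Union>\<C>\<close> \<open>f \<in> \<Union>\<C>\<close> by blast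
      then obtain Z where "Z \<in> \<C>" "e \<in> Z" "f \<in> Z"
        using C(2) unfolding subset_chain_def by blast
      then show ?thesis using C(2) unfolding subset_chain_def P_def by blast
    qed
    moreover have "\<Union>\<C> \<subseteq> carrier H" using C(2) by (auto simp: subset_chain_def P_def)
    ultimately show "\<Union>\<C> \<in> P" unfolding P_def by blast
  qed
  then obtain M where M: "M \<in> P" "\<And>X. X \<in> P \<Longrightarrow> M \<subseteq> X \<Longrightarrow> X = M" by blast
  have "is_onb H M"
    unfolding is_onb_def
  proof (intro conjI ballI impI)
    fix x assume x: "x \<in> carrier H" and orth: "\<forall>e\<in>M. ip H e x = 0"
    show "x = \<zero>"
    proof (rule ccontr)
      assume "x \<noteq> \<zero>"
      then have n: "hnorm H x > 0" using x hnorm_eq_zero[OF x] hnorm_nonneg[OF x] by linarith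
      define u where "u = of_real (1 / hnorm H x) \<odot> x"
      have u: "u \<in> carrier H" using x by (simp add: u_def)
      have uu: "ip H u u = 1" using n x ip_self[OF x] by (simp add: u_def ip_simps power2_eq_square)
      have o: "ip H e u = 0" "ip H u e = 0" if "e \<in> M" for e
      proof -
        have "e \<in> carrier H" using that M by (auto simp: P_def)
        then show "ip H e u = 0" using orth that x by (simp add: u_def ip_simps)
        then show "ip H u e = 0" using ip_commute[OF \<open>e \<in> carrier H\<close> u] by simp
      qed
      have "insert u M \<in> P" using M(1) u uu o by (auto simp: P_def)
      then have "u \<in> M" using M(2)[of "insert u M"] by blast
      then show False using o uu by auto
    qed
  qed (use M(1) in \<open>auto simp: P_def\<close>)
  then show ?thesis unfolding some_onb_def by (rule someI)
qed

text \<open>For orthonormal \<open>A\<close>, the projection of \<open>x\<close> onto the span of \<open>A\<close>.\<close>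

definition fourier :: "'a set \<Rightarrow> 'a \<Rightarrow> 'a" where
  "fourier A x = lincomb (\<lambda>e. ip H e x) (\<lambda>e. e) A"

context
  fixes B assumes B: "is_onb H B"
begin

lemma onb_carrier: "e \<in> B \<Longrightarrow> e \<in> carrier H"
  using B by (auto simp: is_onb_def)

lemma onb_ip: "\<lbrakk>e \<in> B; f \<in> B\<rbrakk> \<Longrightarrow> ip H e f = (if e = f then 1 else 0)"
  using B by (auto simp: is_onb_def)

lemma onb_total: "total (\<lambda>e. e) B"
  using B by (auto simp: total_def is_onb_def)

context
  fixes A assumes A: "finite A" "A \<subseteq> B"
begin

lemma fourier_carrier [simp]: "x \<in> carrier H \<Longrightarrow> fourier A x \<in> carrier H"
  unfolding fourier_def using A onb_carrier by blast

lemma ip_fourier: "\<lbrakk>x \<in> carrier H; z \<in> carrier H\<rbrakk> \<Longrightarrow> ip H z (fourier A x) = (\<Sum>e\<in>A. ip H e x * ip H z e)"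
  unfolding fourier_def using A onb_carrier by (intro ip_lincomb) auto

lemma ip_fourier_left: "\<lbrakk>x \<in> carrier H; z \<in> carrier H\<rbrakk> \<Longrightarrow> ip H (fourier A x) z = (\<Sum>e\<in>A. cnj (ip H e x) * ip H e z)"
  unfolding fourier_def using A onb_carrier by (intro ip_lincomb_left) auto

lemma power2_hnorm_fourier:
  assumes x: "x \<in> carrier H"
  shows "(hnorm H (x \<ominus> fourier A x))\<^sup>2 = (hnorm H x)\<^sup>2 - (\<Sum>e\<in>A. (cmod (ip H e x))\<^sup>2)"
proof -
  have 1: "ip H x (fourier A x) = of_real (\<Sum>e\<in>A. (cmod (ip H e x))\<^sup>2)"
    using x A onb_carrier by (auto simp: ip_fourier ip_commute[of _ x] complex_norm_square simp del: of_real_power intro!: sum.cong)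
  have "ip H e (fourier A x) = ip H e x" if e: "e \<in> A" for e
  proof -
    have "ip H e (fourier A x) = (\<Sum>f\<in>A. ip H f x * ip H e f)"
      using x e A onb_carrier by (intro ip_fourier) auto
    also have "\<dots> = (\<Sum>f\<in>A. if e = f then ip H f x else 0)"
      using A e by (intro sum.cong) (auto simp: onb_ip subset_iff)
    finally show ?thesis using A e by simp
  qed
  then have 2: "ip H (fourier A x) (fourier A x) = of_real (\<Sum>e\<in>A. (cmod (ip H e x))\<^sup>2)"
    using x by (auto simp: ip_fourier_left mult.commute[of "cnj _"] complex_norm_square simp del: of_real_power intro!: sum.cong)
  show ?thesis
    using x 1 2 by (simp add: power2_hnorm_minus) (simp add: power2_hnorm)
qed

end

text \<open>The remainder of \<open>x\<close> decreases as \<open>A\<close> grows and depends contractively on \<open>x\<close>. Hence the vectors with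
  arbitrarily small remainder form a closed subspace, which contains the basis.\<close>

lemma fourier_tendsto:
  assumes x: "x \<in> carrier H"
  shows "((\<lambda>A. hnorm H (x \<ominus> fourier A x)) \<longlongrightarrow> 0) (finite_subsets_at_top B)"
proof -
  define R where "R A x = x \<ominus> fourier A x" for A x
  have RC: "R A x \<in> carrier H" if "finite A" "A \<subseteq> B" "x \<in> carrier H" for A x
    using that by (simp add: R_def)
  have R_mono: "hnorm H (R A' x) \<le> hnorm H (R A x)" if "finite A'" "A \<subseteq> A'" "A' \<subseteq> B" "x \<in> carrier H" for A A' x
  proof (rule power2_le_imp_le)
    have fA: "finite A" "A \<subseteq> B" using that finite_subset by blast+
    have "(\<Sum>e\<in>A. (cmod (ip H e x))\<^sup>2) \<le> (\<Sum>e\<in>A'. (cmod (ip H e x))\<^sup>2)"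
      using that by (intro sum_mono2) auto
    then show "(hnorm H (R A' x))\<^sup>2 \<le> (hnorm H (R A x))\<^sup>2"
      using that fA power2_hnorm_fourier[of A' x] power2_hnorm_fourier[of A x] by (simp add: R_def)
    show "0 \<le> hnorm H (R A x)" using RC fA that by simp
  qed
  have R_contr: "hnorm H (R A x) \<le> hnorm H x" if "finite A" "A \<subseteq> B" "x \<in> carrier H" for A x
    using R_mono[of A "{}" x] that by (simp add: R_def fourier_def)
  have R_add: "R A (x \<oplus> y) = R A x \<oplus> R A y" if "finite A" "A \<subseteq> B" "x \<in> carrier H" "y \<in> carrier H" for A x y
    using that onb_carrier
    by (intro vec_eqI) (auto simp: R_def ip_simps ip_fourier subset_iff algebra_simps sum.distrib intro!: sum.cong)
  have R_smult: "R A (c \<odot> x) = c \<odot> R A x" if "finite A" "A \<subseteq> B" "x \<in> carrier H" for A c x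
    using that onb_carrier
    by (intro vec_eqI) (auto simp: R_def ip_simps ip_fourier subset_iff right_diff_distrib sum_distrib_left mult.assoc intro!: sum.cong)
  define W where "W = {x \<in> carrier H. \<forall>e>0. \<exists>A. finite A \<and> A \<subseteq> B \<and> hnorm H (R A x) < e}"
  have "closed_subspace W"
    unfolding closed_subspace_def
  proof (intro conjI ballI allI impI)
    show "W \<subseteq> carrier H" by (auto simp: W_def)
    show "\<zero> \<in> W" unfolding W_def by (auto simp: R_def fourier_def intro!: exI[of _ "{}"])
  next
    fix x y assume xy: "x \<in> W" "y \<in> W"
    have "\<exists>A. finite A \<and> A \<subseteq> B \<and> hnorm H (R A (x \<oplus> y)) < e" if e: "e > 0" for e
    proof -
      obtain A1 where A1: "finite A1" "A1 \<subseteq> B" "hnorm H (R A1 x) < e/2" using xy e by (auto simp: W_def dest: spec[of _ "e/2"])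
      obtain A2 where A2: "finite A2" "A2 \<subseteq> B" "hnorm H (R A2 y) < e/2" using xy e by (auto simp: W_def dest: spec[of _ "e/2"])
      let ?A = "A1 \<union> A2"
      have xyC: "x \<in> carrier H" "y \<in> carrier H" using xy by (auto simp: W_def)
      have "hnorm H (R ?A (x \<oplus> y)) \<le> hnorm H (R ?A x) + hnorm H (R ?A y)"
        using R_add[of ?A x y] hnorm_triangle[of "R ?A x" "R ?A y"] RC[of ?A] A1 A2 xyC by simp
      also have "\<dots> \<le> hnorm H (R A1 x) + hnorm H (R A2 y)"
        using A1 A2 xyC by (intro add_mono R_mono) auto
      finally show ?thesis using A1 A2 by (intro exI[of _ ?A]) auto
    qed
    then show "x \<oplus> y \<in> W" using xy by (auto simp: W_def)
  next
    fix c x assume x: "x \<in> W"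
    have "\<exists>A. finite A \<and> A \<subseteq> B \<and> hnorm H (R A (c \<odot> x)) < e" if e: "e > 0" for e
    proof -
      have "e / (cmod c + 1) > 0" using e by (simp add: add_nonneg_pos)
      then obtain A where A: "finite A" "A \<subseteq> B" "hnorm H (R A x) < e / (cmod c + 1)"
        using x unfolding W_def by blast
      have xC: "x \<in> carrier H" using x by (auto simp: W_def)
      have "hnorm H (R A (c \<odot> x)) = cmod c * hnorm H (R A x)"
        using R_smult A xC RC hnorm_smult by simp
      also have "\<dots> \<le> (cmod c + 1) * hnorm H (R A x)" using RC A xC by (intro mult_right_mono) auto
      also have "\<dots> < e" using A(3) pos_less_divide_eq[of "cmod c + 1"] by (simp add: add_nonneg_pos mult.commute)
      finally show ?thesis using A by blast
    qed
    then show "c \<odot> x \<in> W" using x by (auto simp: W_def)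
  next
    fix x assume x: "x \<in> carrier H" and app: "\<forall>e>0. \<exists>w\<in>W. hnorm H (x \<ominus> w) < e"
    have "\<exists>A. finite A \<and> A \<subseteq> B \<and> hnorm H (R A x) < e" if e: "e > 0" for e
    proof -
      obtain w where w: "w \<in> W" "hnorm H (x \<ominus> w) < e / 2" using app e half_gt_zero by blast
      then obtain A where A: "finite A" "A \<subseteq> B" "hnorm H (R A w) < e/2" using e by (auto simp: W_def dest: spec[of _ "e/2"])
      have wC: "w \<in> carrier H" using w by (auto simp: W_def)
      have "x = (x \<ominus> w) \<oplus> w" using x wC by (intro vec_eqI) (auto simp: ip_simps)
      then have "R A x = R A (x \<ominus> w) \<oplus> R A w" using R_add[of A "x \<ominus> w" w] A x wC by simp
      then have "hnorm H (R A x) \<le> hnorm H (R A (x \<ominus> w)) + hnorm H (R A w)"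
        using hnorm_triangle[of "R A (x \<ominus> w)" "R A w"] RC A x wC by simp
      then show ?thesis using R_contr[of A "x \<ominus> w"] A w x wC by (intro exI[of _ A]) auto
    qed
    then show "x \<in> W" using x by (simp add: W_def)
  qed
  moreover have "e \<in> W" if "e \<in> B" for e
  proof -
    have "fourier {e} e = e" using that onb_carrier onb_ip
      by (intro vec_eqI) (auto simp: ip_fourier)
    then have "R {e} e = \<zero>" using that onb_carrier by (simp add: R_def)
    then show ?thesis using that onb_carrier unfolding W_def by (auto intro!: exI[of _ "{e}"])
  qed
  ultimately have W: "x \<in> W" using closed_subspace_total[OF _ onb_total _ x] by blast
  show ?thesis
    unfolding tendsto_iff
  proof (intro allI impI)
    fix e :: real assume "e > 0"
    then obtain A where A: "finite A" "A \<subseteq> B" "hnorm H (R A x) < e" using W by (auto simp: W_def)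
    show "\<forall>\<^sub>F A in finite_subsets_at_top B. dist (hnorm H (x \<ominus> fourier A x)) 0 < e"
      unfolding eventually_finite_subsets_at_top
    proof (intro exI[of _ A] conjI allI impI A)
      fix Y assume Y: "finite Y \<and> A \<subseteq> Y \<and> Y \<subseteq> B"
      then have "0 \<le> hnorm H (R Y x)" "hnorm H (R Y x) \<le> hnorm H (R A x)" using R_mono x RC by auto
      then show "dist (hnorm H (x \<ominus> fourier Y x)) 0 < e" using A by (simp add: R_def)
    qed
  qed
qed

theorem Parseval:
  assumes x: "x \<in> carrier H" and y: "y \<in> carrier H"
  shows "((\<lambda>e. cnj (ip H e x) * ip H e y) has_sum ip H x y) B"
  unfolding has_sum_def
proof (rule LIM_zero_cancel, rule Lim_null_comparison)
  show "\<forall>\<^sub>F A in finite_subsets_at_top B. norm ((\<Sum>e\<in>A. cnj (ip H e x) * ip H e y) - ip H x y)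
      \<le> hnorm H (x \<ominus> fourier A x) * hnorm H y"
  proof (rule eventually_finite_subsets_at_top_weakI)
    fix A assume A: "finite A" "A \<subseteq> B"
    have "(\<Sum>e\<in>A. cnj (ip H e x) * ip H e y) - ip H x y = - ip H (x \<ominus> fourier A x) y"
      using A x y by (simp add: ip_simps ip_fourier_left)
    then show "norm ((\<Sum>e\<in>A. cnj (ip H e x) * ip H e y) - ip H x y) \<le> hnorm H (x \<ominus> fourier A x) * hnorm H y"
      using A x y Cauchy_Schwarz[of "x \<ominus> fourier A x" y] by simp
  qed
  show "((\<lambda>A. hnorm H (x \<ominus> fourier A x) * hnorm H y) \<longlongrightarrow> 0) (finite_subsets_at_top B)"
    by (intro tendsto_mult_left_zero fourier_tendsto x)
qed

lemma Parseval_norm: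
  assumes x: "x \<in> carrier H"
  shows "((\<lambda>e. (cmod (ip H e x))\<^sup>2) has_sum (hnorm H x)\<^sup>2) B"
proof -
  have "((\<lambda>e. Re (cnj (ip H e x) * ip H e x)) has_sum Re (ip H x x)) B"
    by (intro has_sum_Re Parseval x)
  then show ?thesis using x by (simp add: power2_hnorm cmod_power2) (simp add: power2_eq_square)
qed

end

lemma hnorm_fourier_le:
  assumes B: "is_onb H B" and A: "finite A" "A \<subseteq> B" and x: "x \<in> carrier H"
  shows "hnorm H (fourier A x) \<le> hnorm H x"
proof -
  have F: "fourier A x \<in> carrier H" by (rule fourier_carrier[OF B A x])
  have "ip H e (fourier A x) = ip H e x" if e: "e \<in> A" for e
  proof -
    have "ip H e (fourier A x) = (\<Sum>f\<in>A. ip H f x * ip H e f)"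
      using x e A onb_carrier[OF B] by (intro ip_fourier[OF B A]) auto
    also have "\<dots> = (\<Sum>f\<in>A. if e = f then ip H f x else 0)"
      using A e by (intro sum.cong) (auto simp: onb_ip[OF B] subset_iff)
    finally show ?thesis using A e by simp
  qed
  then have "ip H (fourier A x) (fourier A x) = ip H (fourier A x) x"
    using x F by (simp add: ip_fourier_left[OF B A])
  then have "(hnorm H (fourier A x))\<^sup>2 = cmod (ip H (fourier A x) x)"
    using ip_self[OF F] by (metis abs_power2 norm_of_real)
  then have *: "hnorm H (fourier A x) * hnorm H (fourier A x) \<le> hnorm H (fourier A x) * hnorm H x"
    using Cauchy_Schwarz[OF F x] by (simp add: power2_eq_square)
  show ?thesis
  proof (cases "hnorm H (fourier A x) = 0")
    case False
    then have "hnorm H (fourier A x) > 0" using hnorm_nonneg[OF F] by linarith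
    then show ?thesis using * by simp
  qed (use x in simp)
qed

end


section \<open>Bounded operators\<close>

lemma bounded_ops_simps [simp]:
  "\<zero>\<^bsub>bounded_ops H H'\<^esub> = (\<lambda>x\<in>carrier H. \<zero>\<^bsub>H'\<^esub>)"
  "T \<oplus>\<^bsub>bounded_ops H H'\<^esub> U = (\<lambda>x\<in>carrier H. T x \<oplus>\<^bsub>H'\<^esub> U x)"
  "c \<odot>\<^bsub>bounded_ops H H'\<^esub> T = (\<lambda>x\<in>carrier H. c \<odot>\<^bsub>H'\<^esub> T x)"
  by (simp_all add: bounded_ops_def)

lemma op_algebra_simps [simp]:
  "carrier (op_algebra H) = carrier (bounded_ops H H)"
  "\<zero>\<^bsub>op_algebra H\<^esub> = (\<lambda>x\<in>carrier H. \<zero>\<^bsub>H\<^esub>)"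
  "\<one>\<^bsub>op_algebra H\<^esub> = (\<lambda>x\<in>carrier H. x)"
  "T \<oplus>\<^bsub>op_algebra H\<^esub> U = (\<lambda>x\<in>carrier H. T x \<oplus>\<^bsub>H\<^esub> U x)"
  "c \<odot>\<^bsub>op_algebra H\<^esub> T = (\<lambda>x\<in>carrier H. c \<odot>\<^bsub>H\<^esub> T x)"
  "T \<otimes>\<^bsub>op_algebra H\<^esub> U = compose (carrier H) T U"
  by (simp_all add: bounded_ops_def op_algebra_def)

lemma bounded_opsD:
  assumes "T \<in> carrier (bounded_ops H H')"
  shows "T \<in> extensional (carrier H)"
    and "x \<in> carrier H \<Longrightarrow> T x \<in> carrier H'"
    and "\<lbrakk>x \<in> carrier H; y \<in> carrier H\<rbrakk> \<Longrightarrow> T (x \<oplus>\<^bsub>H\<^esub> y) = T x \<oplus>\<^bsub>H'\<^esub> T y"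
    and "x \<in> carrier H \<Longrightarrow> T (c \<odot>\<^bsub>H\<^esub> x) = c \<odot>\<^bsub>H'\<^esub> T x"
  using assms by (auto simp: bounded_ops_def linear_map_def PiE_iff)

lemma bounded_ops_eqI:
  assumes "T \<in> carrier (bounded_ops H H')" "U \<in> carrier (bounded_ops H H')"
    and "\<And>x. x \<in> carrier H \<Longrightarrow> T x = U x"
  shows "T = U"
  using assms bounded_opsD(1) by (metis extensionalityI)

lemma bounded_opsI:
  assumes "T \<in> extensional (carrier H)"
    and "\<And>x. x \<in> carrier H \<Longrightarrow> T x \<in> carrier H'"
    and "\<And>x y. \<lbrakk>x \<in> carrier H; y \<in> carrier H\<rbrakk> \<Longrightarrow> T (x \<oplus>\<^bsub>H\<^esub> y) = T x \<oplus>\<^bsub>H'\<^esub> T y"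
    and "\<And>c x. x \<in> carrier H \<Longrightarrow> T (c \<odot>\<^bsub>H\<^esub> x) = c \<odot>\<^bsub>H'\<^esub> T x"
    and "\<And>x. x \<in> carrier H \<Longrightarrow> hnorm H' (T x) \<le> C * hnorm H x"
  shows "T \<in> carrier (bounded_ops H H')"
  using assms(1-4) exI[of "\<lambda>C. \<forall>x\<in>carrier H. hnorm H' (T x) \<le> C * hnorm H x" C] assms(5)
  by (simp add: bounded_ops_def linear_map_def PiE_iff)

text \<open>The operator \<open>|u\<rangle>\<langle>w|\<close>.\<close>

definition rank_one :: "'a hilb \<Rightarrow> 'b hilb \<Rightarrow> 'b \<Rightarrow> 'a \<Rightarrow> 'a \<Rightarrow> 'b" where
  "rank_one H H' u w = (\<lambda>x\<in>carrier H. ip H w x \<odot>\<^bsub>H'\<^esub> u)"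

locale hilbert_pair = A: hilbert_space H + B: hilbert_space H'
  for H :: "'a hilb" and H' :: "'b hilb"
begin

abbreviation "ops \<equiv> carrier (bounded_ops H H')"

lemma op_bound:
  assumes "T \<in> ops"
  shows "\<exists>C\<ge>0. \<forall>x\<in>carrier H. hnorm H' (T x) \<le> C * hnorm H x"
proof -
  obtain C where C: "\<forall>x\<in>carrier H. hnorm H' (T x) \<le> C * hnorm H x"
    using assms by (auto simp: bounded_ops_def)
  have "\<forall>x\<in>carrier H. hnorm H' (T x) \<le> max C 0 * hnorm H x"
    using C by (meson A.hnorm_nonneg max.cobounded1 mult_right_mono order_trans)
  then show ?thesis by (metis max.cobounded2)
qed

lemma ops_zero [simp]: "T \<in> ops \<Longrightarrow> T \<zero>\<^bsub>H\<^esub> = \<zero>\<^bsub>H'\<^esub>"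
  using bounded_opsD(4)[of T H H' "\<zero>\<^bsub>H\<^esub>" 0] bounded_opsD(2)[of T H H' "\<zero>\<^bsub>H\<^esub>"] by simp

lemma ops_minus: "\<lbrakk>T \<in> ops; x \<in> carrier H; y \<in> carrier H\<rbrakk> \<Longrightarrow> T (x \<ominus>\<^bsub>H\<^esub> y) = T x \<ominus>\<^bsub>H'\<^esub> T y"
  by (simp add: A.minus_eq_smult B.minus_eq_smult bounded_opsD)

lemma zero_ops: "(\<lambda>x\<in>carrier H. \<zero>\<^bsub>H'\<^esub>) \<in> ops"
  by (rule bounded_opsI[where C = 0]) (auto intro: B.vec_eqI simp: B.ip_simps)

lemma add_ops:
  assumes "T \<in> ops" "U \<in> ops"
  shows "(\<lambda>x\<in>carrier H. T x \<oplus>\<^bsub>H'\<^esub> U x) \<in> ops"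
proof -
  obtain C where C: "\<And>x. x \<in> carrier H \<Longrightarrow> hnorm H' (T x) \<le> C * hnorm H x" using op_bound[OF assms(1)] by blast
  obtain D where D: "\<And>x. x \<in> carrier H \<Longrightarrow> hnorm H' (U x) \<le> D * hnorm H x" using op_bound[OF assms(2)] by blast
  note [simp] = bounded_opsD[OF assms(1)] bounded_opsD[OF assms(2)]
  show ?thesis
  proof (rule bounded_opsI[where C = "C + D"])
    fix x assume x: "x \<in> carrier H"
    then show "hnorm H' ((\<lambda>x\<in>carrier H. T x \<oplus>\<^bsub>H'\<^esub> U x) x) \<le> (C + D) * hnorm H x"
      using B.hnorm_triangle[of "T x" "U x"] C[OF x] D[OF x] by (simp add: distrib_right)
  qed (auto intro!: B.vec_eqI simp: B.ip_simps algebra_simps)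
qed

lemma smult_ops:
  assumes "T \<in> ops"
  shows "(\<lambda>x\<in>carrier H. c \<odot>\<^bsub>H'\<^esub> T x) \<in> ops"
proof -
  obtain C where C: "\<And>x. x \<in> carrier H \<Longrightarrow> hnorm H' (T x) \<le> C * hnorm H x" using op_bound[OF assms(1)] by blast
  note [simp] = bounded_opsD[OF assms(1)]
  show ?thesis
  proof (rule bounded_opsI[where C = "cmod c * C"])
    fix x assume x: "x \<in> carrier H"
    then show "hnorm H' ((\<lambda>x\<in>carrier H. c \<odot>\<^bsub>H'\<^esub> T x) x) \<le> (cmod c * C) * hnorm H x"
      using C[OF x] by (simp add: B.hnorm_smult mult.assoc mult_left_mono)
  qed (auto intro!: B.vec_eqI simp: B.ip_simps algebra_simps)
qed

lemma abelian_group_ops: "abelian_group (bounded_ops H H')"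
proof (rule abelian_groupI)
  fix T assume T: "T \<in> ops"
  show "\<exists>U\<in>ops. U \<oplus>\<^bsub>bounded_ops H H'\<^esub> T = \<zero>\<^bsub>bounded_ops H H'\<^esub>"
    by (rule bexI[OF _ smult_ops[OF T, of "-1"]])
      (auto intro!: restrict_ext B.vec_eqI simp: B.ip_simps bounded_opsD[OF T])
next
  fix T assume "T \<in> ops"
  then show "\<zero>\<^bsub>bounded_ops H H'\<^esub> \<oplus>\<^bsub>bounded_ops H H'\<^esub> T = T"
    using add_ops[OF zero_ops] by (intro bounded_ops_eqI[OF _ \<open>T \<in> ops\<close>]) (auto simp: bounded_opsD)
qed (auto simp: zero_ops add_ops bounded_opsD B.M.a_ac intro!: restrict_ext)

lemma minus_ops_apply:
  assumes "T \<in> ops" "U \<in> ops" and x: "x \<in> carrier H"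
  shows "(T \<ominus>\<^bsub>bounded_ops H H'\<^esub> U) x = T x \<ominus>\<^bsub>H'\<^esub> U x"
proof -
  interpret G: abelian_group "bounded_ops H H'" by (rule abelian_group_ops)
  have "\<ominus>\<^bsub>bounded_ops H H'\<^esub> U = (-1) \<odot>\<^bsub>bounded_ops H H'\<^esub> U"
    by (rule G.minus_equality)
      (use assms in \<open>auto simp: smult_ops bounded_opsD intro!: restrict_ext B.vec_eqI simp: B.ip_simps\<close>)
  then show ?thesis
    using assms by (simp add: a_minus_def[of "bounded_ops H H'"] B.minus_eq_smult bounded_opsD)
qed

text \<open>The operator maps \<open>y\<close> to the Riesz representative of \<open>x \<mapsto> cnj (b x y)\<close>.\<close>

lemma op_of_form:
  assumes add_left: "\<And>x x' y. \<lbrakk>x \<in> carrier H'; x' \<in> carrier H'; y \<in> carrier H\<rbrakk> \<Longrightarrow> b (x \<oplus>\<^bsub>H'\<^esub> x') y = b x y + b x' y"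
    and smult_left: "\<And>c x y. \<lbrakk>x \<in> carrier H'; y \<in> carrier H\<rbrakk> \<Longrightarrow> b (c \<odot>\<^bsub>H'\<^esub> x) y = cnj c * b x y"
    and add_right: "\<And>x y y'. \<lbrakk>x \<in> carrier H'; y \<in> carrier H; y' \<in> carrier H\<rbrakk> \<Longrightarrow> b x (y \<oplus>\<^bsub>H\<^esub> y') = b x y + b x y'"
    and smult_right: "\<And>c x y. \<lbrakk>x \<in> carrier H'; y \<in> carrier H\<rbrakk> \<Longrightarrow> b x (c \<odot>\<^bsub>H\<^esub> y) = c * b x y"
    and bound: "\<And>x y. \<lbrakk>x \<in> carrier H'; y \<in> carrier H\<rbrakk> \<Longrightarrow> cmod (b x y) \<le> C * hnorm H' x * hnorm H y"
  shows "\<exists>T\<in>ops. \<forall>x\<in>carrier H'. \<forall>y\<in>carrier H. ip H' x (T y) = b x y"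
proof -
  have "\<exists>z\<in>carrier H'. \<forall>x\<in>carrier H'. b x y = ip H' x z" if y: "y \<in> carrier H" for y
  proof -
    have "\<exists>z\<in>carrier H'. \<forall>x\<in>carrier H'. cnj (b x y) = ip H' z x"
      by (rule B.Riesz_representation[where C = "C * hnorm H y"])
        (use y bound in \<open>auto simp: add_left smult_left mult_ac\<close>)
    then show ?thesis using B.ip_commute by (metis complex_cnj_cnj)
  qed
  then obtain T where T: "\<And>y. y \<in> carrier H \<Longrightarrow> T y \<in> carrier H'"
      "\<And>x y. \<lbrakk>x \<in> carrier H'; y \<in> carrier H\<rbrakk> \<Longrightarrow> b x y = ip H' x (T y)"
    by metis
  have "restrict T (carrier H) \<in> ops"
  proof (rule bounded_opsI)
    fix y assume y: "y \<in> carrier H"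
    have "(hnorm H' (T y))\<^sup>2 = cmod (b (T y) y)" using y T B.ip_self[of "T y"] by (simp add: norm_power)
    also have "\<dots> \<le> C * hnorm H' (T y) * hnorm H y" using y T by (intro bound)
    also have "\<dots> \<le> \<bar>C\<bar> * hnorm H' (T y) * hnorm H y" using y T by (intro mult_right_mono) auto
    finally have *: "hnorm H' (T y) * hnorm H' (T y) \<le> hnorm H' (T y) * (\<bar>C\<bar> * hnorm H y)"
      by (simp add: power2_eq_square mult_ac)
    show "hnorm H' (restrict T (carrier H) y) \<le> \<bar>C\<bar> * hnorm H y"
    proof (cases "hnorm H' (T y) = 0")
      case True then show ?thesis using y by simp
    next
      case False
      then have "hnorm H' (T y) > 0" using T y by (metis B.hnorm_nonneg less_eq_real_def)
      then show ?thesis using * y by simp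
    qed
  qed (use T in \<open>auto intro!: B.vec_eqI simp: B.ip_simps add_right smult_right simp flip: T(2)\<close>)
  then show ?thesis using T by (intro bexI[of _ "restrict T (carrier H)"]) auto
qed

lemma rank_one_ops:
  assumes u: "u \<in> carrier H'" and w: "w \<in> carrier H"
  shows "rank_one H H' u w \<in> ops"
proof (rule bounded_opsI)
  fix x assume x: "x \<in> carrier H"
  show "hnorm H' (rank_one H H' u w x) \<le> (hnorm H w * hnorm H' u) * hnorm H x"
    using u w x A.Cauchy_Schwarz[OF w x] by (simp add: rank_one_def B.hnorm_smult mult_right_mono mult.commute mult.left_commute)
      (metis B.hnorm_nonneg mult.commute mult.left_commute mult_left_mono)
qed (use assms in \<open>auto simp: rank_one_def A.ip_simps B.ip_simps algebra_simps intro!: B.vec_eqI\<close>)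

end

lemma hilbert_pair_sym: "hilbert_pair H H' \<Longrightarrow> hilbert_pair H' H"
  by (simp add: hilbert_pair_def)

context hilbert_pair
begin

lemma adj_exists:
  assumes T: "T \<in> ops"
  shows "\<exists>U\<in>carrier (bounded_ops H' H). \<forall>x\<in>carrier H. \<forall>y\<in>carrier H'. ip H x (U y) = ip H' (T x) y"
proof -
  interpret P: hilbert_pair H' H by (rule hilbert_pair_sym) unfold_locales
  obtain C where C: "C \<ge> 0" "\<And>x. x \<in> carrier H \<Longrightarrow> hnorm H' (T x) \<le> C * hnorm H x" using op_bound[OF T] by blast
  show ?thesis
  proof (rule P.op_of_form)
    fix x y assume xy: "x \<in> carrier H" "y \<in> carrier H'"
    have "cmod (ip H' (T x) y) \<le> hnorm H' (T x) * hnorm H' y"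
      using xy bounded_opsD[OF T] by (intro B.Cauchy_Schwarz) auto
    also have "\<dots> \<le> C * hnorm H x * hnorm H' y" using C xy by (intro mult_right_mono) auto
    finally show "cmod (ip H' (T x) y) \<le> C * hnorm H x * hnorm H' y" .
  qed (auto simp: bounded_opsD[OF T] B.ip_simps)
qed

lemma adj_eqI:
  assumes "y \<in> carrier H'" "z \<in> carrier H" "\<And>x. x \<in> carrier H \<Longrightarrow> ip H' (T x) y = ip H x z"
  shows "adj H H' T y = z"
proof -
  have "(THE x. x \<in> carrier H \<and> (\<forall>z\<in>carrier H. ip H' (T z) y = ip H z x)) = z"
    by (rule the_equality) (use assms in \<open>auto intro!: A.vec_eqI\<close>)
  then show ?thesis using assms by (simp add: adj_def)
qed

lemma adj_eq:
  assumes "U \<in> carrier (bounded_ops H' H)" "\<And>x y. \<lbrakk>x \<in> carrier H; y \<in> carrier H'\<rbrakk> \<Longrightarrow> ip H' (T x) y = ip H x (U y)"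
  shows "adj H H' T = U"
proof (rule extensionalityI[of _ "carrier H'"])
  show "adj H H' T \<in> extensional (carrier H')" by (simp add: adj_def)
  show "U \<in> extensional (carrier H')" by (rule bounded_opsD(1)[OF assms(1)])
qed (use assms bounded_opsD[OF assms(1)] in \<open>auto intro!: adj_eqI\<close>)

lemma adj_ops: "T \<in> ops \<Longrightarrow> adj H H' T \<in> carrier (bounded_ops H' H)"
  using adj_exists adj_eq by (metis (no_types, lifting))

lemma ip_adj:
  assumes "T \<in> ops" "x \<in> carrier H" "y \<in> carrier H'"
  shows "ip H x (adj H H' T y) = ip H' (T x) y"
  using adj_exists[OF assms(1)] adj_eq[of _ T] assms by (metis (no_types, lifting))

lemma ip_adj_left:
  assumes "T \<in> ops" "x \<in> carrier H" "y \<in> carrier H'"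
  shows "ip H (adj H H' T y) x = ip H' y (T x)"
  using ip_adj[OF assms] A.ip_commute[of x "adj H H' T y"] B.ip_commute[of "T x" y]
    bounded_opsD(2)[OF adj_ops[OF assms(1)]] bounded_opsD(2)[OF assms(1)] assms by simp

lemma ops_total_eqI:
  assumes f: "A.total f I" and T: "T \<in> ops" and U: "U \<in> ops" and eq: "\<And>i. i \<in> I \<Longrightarrow> T (f i) = U (f i)"
  shows "T = U"
proof (rule bounded_ops_eqI[OF T U], rule B.vec_eqI)
  fix x z assume x: "x \<in> carrier H" and z: "z \<in> carrier H'"
  have "adj H H' T z = adj H H' U z"
    using f eq z bounded_opsD(2)[OF adj_ops[OF T]] bounded_opsD(2)[OF adj_ops[OF U]]
    by (intro A.total_eqI[OF f]) (auto simp: A.total_def image_subset_iff ip_adj T U)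
  then show "ip H' z (T x) = ip H' z (U x)" using ip_adj_left[OF T x z] ip_adj_left[OF U x z] by simp
qed (use bounded_opsD(2)[OF T] bounded_opsD(2)[OF U] in auto)

lemma adj_rank_one:
  assumes u: "u \<in> carrier H'" and w: "w \<in> carrier H"
  shows "adj H H' (rank_one H H' u w) = rank_one H' H w u"
proof -
  interpret P: hilbert_pair H' H by (rule hilbert_pair_sym) unfold_locales
  show ?thesis
  proof (rule adj_eq[OF P.rank_one_ops[OF w u]])
    fix x y assume x: "x \<in> carrier H" and y: "y \<in> carrier H'"
    show "ip H' (rank_one H H' u w x) y = ip H x (rank_one H' H w u y)"
      using x y u w A.ip_commute[OF w x] by (simp add: rank_one_def A.ip_simps B.ip_simps)
  qed
qed

lemma rank_one_add:
  assumes "u \<in> carrier H'" "u' \<in> carrier H'" "w \<in> carrier H"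
  shows "rank_one H H' (u \<oplus>\<^bsub>H'\<^esub> u') w = rank_one H H' u w \<oplus>\<^bsub>bounded_ops H H'\<^esub> rank_one H H' u' w"
  using assms by (auto simp: rank_one_def B.ip_simps algebra_simps intro!: restrict_ext B.vec_eqI)

lemma rank_one_smult:
  assumes "u \<in> carrier H'" "w \<in> carrier H"
  shows "rank_one H H' (c \<odot>\<^bsub>H'\<^esub> u) w = c \<odot>\<^bsub>bounded_ops H H'\<^esub> rank_one H H' u w"
  using assms by (auto simp: rank_one_def B.ip_simps algebra_simps intro!: restrict_ext B.vec_eqI)

lemma rank_one_add_right:
  assumes "u \<in> carrier H'" "w \<in> carrier H" "w' \<in> carrier H"
  shows "rank_one H H' u (w \<oplus>\<^bsub>H\<^esub> w') = rank_one H H' u w \<oplus>\<^bsub>bounded_ops H H'\<^esub> rank_one H H' u w'"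
  using assms by (auto simp: rank_one_def A.ip_simps B.ip_simps algebra_simps intro!: restrict_ext B.vec_eqI)

lemma rank_one_smult_right:
  assumes "u \<in> carrier H'" "w \<in> carrier H"
  shows "rank_one H H' u (c \<odot>\<^bsub>H\<^esub> w) = cnj c \<odot>\<^bsub>bounded_ops H H'\<^esub> rank_one H H' u w"
  using assms by (auto simp: rank_one_def A.ip_simps B.ip_simps algebra_simps intro!: restrict_ext B.vec_eqI)

end

context hilbert_space
begin

interpretation self: hilbert_pair H H
  by unfold_locales

lemma compose_ops:
  assumes "T \<in> carrier (bounded_ops H H')" "U \<in> carrier (bounded_ops H'' H)" "hilbert_space H'" "hilbert_space H''"
  shows "compose (carrier H'') T U \<in> carrier (bounded_ops H'' H')"
proof -
  interpret B: hilbert_space H' by fact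
  interpret C: hilbert_space H'' by fact
  interpret P: hilbert_pair H H' by unfold_locales
  interpret Q: hilbert_pair H'' H by unfold_locales
  obtain C where C: "C \<ge> 0" "\<And>x. x \<in> carrier H \<Longrightarrow> hnorm H' (T x) \<le> C * hnorm H x" using P.op_bound[OF assms(1)] by blast
  obtain D where D: "D \<ge> 0" "\<And>x. x \<in> carrier H'' \<Longrightarrow> hnorm H (U x) \<le> D * hnorm H'' x" using Q.op_bound[OF assms(2)] by blast
  show ?thesis
  proof (rule bounded_opsI)
    fix x assume x: "x \<in> carrier H''"
    have "hnorm H' (T (U x)) \<le> C * hnorm H (U x)" using x bounded_opsD(2)[OF assms(2)] by (intro C)
    also have "\<dots> \<le> C * (D * hnorm H'' x)" using C D x by (intro mult_left_mono) auto
    finally show "hnorm H' (compose (carrier H'') T U x) \<le> (C * D) * hnorm H'' x"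
      using x by (simp add: compose_def mult.assoc)
  qed (auto simp: compose_def bounded_opsD[OF assms(1)] bounded_opsD[OF assms(2)])
qed

lemma one_ops: "(\<lambda>x\<in>carrier H. x) \<in> carrier (bounded_ops H H)"
  by (rule bounded_opsI[where C = 1]) auto

lemma abelian_group_op_algebra: "abelian_group (op_algebra H)"
proof -
  have "add_monoid (op_algebra H) = add_monoid (bounded_ops H H)"
    by (simp add: op_algebra_def)
  then show ?thesis using self.abelian_group_ops
    unfolding abelian_group_def abelian_monoid_def abelian_group_axioms_def by simp
qed

lemma ip_finsum_ops:
  assumes "finite A" "\<And>i. i \<in> A \<Longrightarrow> T i \<in> carrier (op_algebra H)" "x \<in> carrier H" "y \<in> carrier H"
  shows "(\<Oplus>\<^bsub>op_algebra H\<^esub>i\<in>A. T i) \<in> carrier (op_algebra H)"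
    "ip H x ((\<Oplus>\<^bsub>op_algebra H\<^esub>i\<in>A. T i) y) = (\<Sum>i\<in>A. ip H x (T i y))"
proof -
  interpret G: abelian_group "op_algebra H" by (rule abelian_group_op_algebra)
  show *: "(\<Oplus>\<^bsub>op_algebra H\<^esub>i\<in>A. T i) \<in> carrier (op_algebra H)"
    by (rule G.finsum_closed) (use assms in auto)
  show "ip H x ((\<Oplus>\<^bsub>op_algebra H\<^esub>i\<in>A. T i) y) = (\<Sum>i\<in>A. ip H x (T i y))"
    using assms(1,2)
  proof (induction A)
    case (insert a A)
    have "(\<Oplus>\<^bsub>op_algebra H\<^esub>i\<in>A. T i) \<in> carrier (op_algebra H)"
      by (rule G.finsum_closed) (use insert in auto)
    then have c: "(\<Oplus>\<^bsub>op_algebra H\<^esub>i\<in>A. T i) y \<in> carrier H" "T a y \<in> carrier H"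
      using bounded_opsD(2) assms insert by (metis op_algebra_simps(1) insertI1)+
    have "(\<Oplus>\<^bsub>op_algebra H\<^esub>i\<in>insert a A. T i) = T a \<oplus>\<^bsub>op_algebra H\<^esub> (\<Oplus>\<^bsub>op_algebra H\<^esub>i\<in>A. T i)"
      using insert by (intro G.finsum_insert) auto
    then show ?case using insert c assms by (simp add: ip_simps)
  qed (use assms in simp)
qed

lemma polarization:
  assumes T: "T \<in> carrier (bounded_ops H H)" and x: "x \<in> carrier H" and y: "y \<in> carrier H"
  defines "q \<equiv> \<lambda>z. ip H z (T z)"
  shows "ip H x (T y) = (q (x \<oplus> y) - q (x \<oplus> (-1) \<odot> y) - \<i> * q (x \<oplus> \<i> \<odot> y) + \<i> * q (x \<oplus> (-\<i>) \<odot> y)) / 4"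
  using x y by (simp add: q_def bounded_opsD[OF T] ip_simps algebra_simps)

lemma ops_quadratic_eqI:
  assumes "T \<in> carrier (bounded_ops H H)" "U \<in> carrier (bounded_ops H H)"
    and "\<And>x. x \<in> carrier H \<Longrightarrow> ip H x (T x) = ip H x (U x)"
  shows "T = U"
proof (intro bounded_ops_eqI[OF assms(1,2)] vec_eqI)
  fix x y assume "x \<in> carrier H" "y \<in> carrier H"
  then show "ip H y (T x) = ip H y (U x)"
    using assms(3) by (simp only: polarization[OF assms(1), of y x] polarization[OF assms(2), of y x] add_carrier smult_carrier)
qed (use bounded_opsD(2)[OF assms(1)] bounded_opsD(2)[OF assms(2)] in auto)

lemma projection_opD:
  assumes P: "projection_op H P"
  shows "P \<in> carrier (bounded_ops H H)" "x \<in> carrier H \<Longrightarrow> P x \<in> carrier H"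
    and "x \<in> carrier H \<Longrightarrow> P (P x) = P x"
    and "\<lbrakk>x \<in> carrier H; y \<in> carrier H\<rbrakk> \<Longrightarrow> ip H (P x) y = ip H x (P y)"
    and "x \<in> carrier H \<Longrightarrow> ip H x (P x) = of_real ((hnorm H (P x))\<^sup>2)"
    and "x \<in> carrier H \<Longrightarrow> hnorm H (P x) \<le> hnorm H x"
proof -
  show 1: "P \<in> carrier (bounded_ops H H)" using P by (simp add: projection_op_def)
  show 2: "P x \<in> carrier H" if "x \<in> carrier H" for x using bounded_opsD[OF 1] that by blast
  show 3: "P (P x) = P x" if "x \<in> carrier H" for x
    using P that unfolding projection_op_def by (metis compose_eq op_algebra_simps(6))
  show 4: "ip H (P x) y = ip H x (P y)" if "x \<in> carrier H" "y \<in> carrier H" for x y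
    using self.ip_adj[OF 1 that] P by (simp add: projection_op_def)
  show 5: "ip H x (P x) = of_real ((hnorm H (P x))\<^sup>2)" if "x \<in> carrier H" for x
    using 4[of x "P x"] that 2 3 ip_self by simp
  show "hnorm H (P x) \<le> hnorm H x" if x: "x \<in> carrier H" for x
  proof -
    have "(hnorm H (P x))\<^sup>2 = cmod (ip H x (P x))" using x by (simp add: 5 norm_power)
    then have *: "hnorm H (P x) * hnorm H (P x) \<le> hnorm H x * hnorm H (P x)"
      using Cauchy_Schwarz[of x "P x"] x 2 by (simp add: power2_eq_square)
    show ?thesis
    proof (cases "hnorm H (P x) = 0")
      case False
      then have "hnorm H (P x) > 0" using hnorm_nonneg[OF 2[OF x]] by linarith
      then show ?thesis using * by simp
    qed (use x in simp)
  qed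
qed

lemma orthogonal_projection:
  assumes W: "closed_subspace W"
  shows "\<exists>P. projection_op H P \<and> (\<forall>x\<in>carrier H. P x \<in> W \<and> (\<forall>w\<in>W. ip H w (P x) = ip H w x))"
proof -
  have WC: "\<And>w. w \<in> W \<Longrightarrow> w \<in> carrier H" using W closed_subspace_carrier by blast
  have "\<forall>x\<in>carrier H. \<exists>y\<in>W. \<forall>w\<in>W. ip H w y = ip H w x"
    using projection_exists[OF W] WC ip_minus by (metis right_minus_eq)
  then obtain P0 where P0: "\<And>x. x \<in> carrier H \<Longrightarrow> P0 x \<in> W" "\<And>x w. x \<in> carrier H \<Longrightarrow> w \<in> W \<Longrightarrow> ip H w (P0 x) = ip H w x"
    by metis
  define P where "P = restrict P0 (carrier H)"
  have PW: "\<And>x. x \<in> carrier H \<Longrightarrow> P x \<in> W" and Pip: "\<And>x w. x \<in> carrier H \<Longrightarrow> w \<in> W \<Longrightarrow> ip H w (P x) = ip H w x"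
    using P0 by (auto simp: P_def)
  have eqI: "u = v" if "u \<in> W" "v \<in> W" "\<And>w. w \<in> W \<Longrightarrow> ip H w u = ip H w v" for u v
  proof -
    have "u \<oplus> (-1) \<odot> v \<in> W" using W that by (simp add: closed_subspace_def)
    then have "ip H (u \<ominus> v) (u \<ominus> v) = 0"
      using that WC by (simp add: minus_eq_smult[symmetric] ip_minus)
    then have "u \<ominus> v = \<zero>" using that WC by (intro ip_definite) auto
    then show ?thesis using that WC by (simp add: minus_eq_zero_iff)
  qed
  have adjP: "ip H (P x) y = ip H x (P y)" if "x \<in> carrier H" "y \<in> carrier H" for x y
  proof -
    have "ip H (P x) y = ip H (P x) (P y)" using that PW Pip by simp
    also have "\<dots> = cnj (ip H (P y) (P x))" using that PW WC ip_commute by blast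
    also have "\<dots> = cnj (ip H (P y) x)" using that PW Pip by simp
    also have "\<dots> = ip H x (P y)" using that PW WC ip_commute by metis
    finally show ?thesis .
  qed
  have opsP: "P \<in> carrier (bounded_ops H H)"
  proof (rule bounded_opsI[where C = 1])
    fix x y c assume xy: "x \<in> carrier H" "y \<in> carrier H"
    have sub: "P x \<oplus> P y \<in> W" "c \<odot> P x \<in> W" using W xy PW by (auto simp: closed_subspace_def)
    show "P (x \<oplus> y) = P x \<oplus> P y" using sub xy PW Pip WC by (intro eqI) (auto simp: ip_simps)
    show "P (c \<odot> x) = c \<odot> P x" using sub xy PW Pip WC by (intro eqI) (auto simp: ip_simps)
    have "(hnorm H (P x))\<^sup>2 = cmod (ip H (P x) x)" using xy PW Pip WC ip_self[of "P x"] by (metis abs_power2 norm_of_real)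
    then have *: "hnorm H (P x) * hnorm H (P x) \<le> hnorm H (P x) * hnorm H x"
      using Cauchy_Schwarz[of "P x" x] xy PW WC by (simp add: power2_eq_square)
    show "hnorm H (P x) \<le> 1 * hnorm H x"
    proof (cases "hnorm H (P x) = 0")
      case False
      then have "hnorm H (P x) > 0" using hnorm_nonneg[OF WC[OF PW[OF xy(1)]]] by linarith
      then show ?thesis using * by simp
    qed (use xy in simp)
  qed (use PW WC in \<open>auto simp: P_def\<close>)
  have "P (P x) = P x" if "x \<in> carrier H" for x
    using that PW Pip WC by (intro eqI) auto
  then have "compose (carrier H) P P = P"
    using bounded_opsD(1)[OF opsP] by (intro extensionalityI[of _ "carrier H"]) (auto simp: compose_def)
  then have "projection_op H P"
    unfolding projection_op_def using opsP self.adj_eq[OF opsP, of P] adjP by simp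
  then show ?thesis using PW Pip by blast
qed

lemma closed_subspace_orthogonal:
  assumes "f ` I \<subseteq> carrier H"
  shows "closed_subspace {x \<in> carrier H. \<forall>i\<in>I. ip H (f i) x = 0}" (is "closed_subspace ?W")
proof -
  have fC: "f i \<in> carrier H" if "i \<in> I" for i using assms that by blast
  have *: "x \<in> ?W" if x: "x \<in> carrier H" and app: "\<forall>e>0. \<exists>w\<in>?W. hnorm H (x \<ominus> w) < e" for x
  proof -
    have "ip H (f i) x = 0" if i: "i \<in> I" for i
    proof -
      have "cmod (ip H (f i) x) \<le> 0 + e" if e: "e > 0" for e
      proof -
        obtain w where w: "w \<in> ?W" "hnorm H (x \<ominus> w) < e / (hnorm H (f i) + 1)"
          using app e fC[OF i] by (meson add_nonneg_pos divide_pos_pos hnorm_nonneg zero_less_one)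
        have "cmod (ip H (f i) x) = cmod (ip H (f i) (x \<ominus> w))" using w x fC[OF i] i by (simp add: ip_minus)
        also have "\<dots> \<le> hnorm H (f i) * hnorm H (x \<ominus> w)" using w x fC[OF i] by (intro Cauchy_Schwarz) auto
        also have "\<dots> \<le> (hnorm H (f i) + 1) * hnorm H (x \<ominus> w)" using w x fC[OF i] by (intro mult_right_mono) auto
        also have "\<dots> \<le> e" using w(2) pos_less_divide_eq[of "hnorm H (f i) + 1" "hnorm H (x \<ominus> w)" e] fC[OF i]
          by (simp add: add_nonneg_pos mult.commute)
        finally show ?thesis by simp
      qed
      then have "cmod (ip H (f i) x) \<le> 0" by (rule field_le_epsilon)
      then show ?thesis by simp
    qed
    then show ?thesis using x by blast
  qed
  show ?thesis unfolding closed_subspace_def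
  proof (intro conjI ballI allI impI)
    show "?W \<subseteq> carrier H" by blast
    show "\<zero> \<in> ?W" using fC by simp
    show "x \<oplus> y \<in> ?W" if "x \<in> ?W" "y \<in> ?W" for x y using fC that by (simp add: ip_add)
    show "c \<odot> x \<in> ?W" if "x \<in> ?W" for c x using fC that by (simp add: ip_smult)
    fix x assume "x \<in> carrier H" "\<forall>e>0. \<exists>w\<in>?W. hnorm H (x \<ominus> w) < e"
    then show "x \<in> ?W" by (rule *)
  qed
qed

end


section \<open>Convergence in the operator topologies\<close>

text \<open>The sets that eventually contain the net, if they contain its limit, are closed under finite
  intersections and unions, so that a subbasis decides convergence.\<close>

lemma limitin_topology_generated_byI:
  assumes l: "l \<in> \<Union>S" and ev: "\<And>U. \<lbrakk>U \<in> S; l \<in> U\<rbrakk> \<Longrightarrow> \<forall>\<^sub>F i in F. f i \<in> U"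
  shows "limitin (topology_generated_by S) f l F"
  unfolding limitin_def
proof (intro conjI allI impI)
  show "l \<in> topspace (topology_generated_by S)"
    using l by (simp add: topology_generated_by_topspace)
  fix U assume U: "openin (topology_generated_by S) U \<and> l \<in> U"
  then have "generate_topology_on S U" by (simp add: openin_topology_generated_by_iff)
  then have "l \<in> U \<longrightarrow> (\<forall>\<^sub>F i in F. f i \<in> U)"
  proof (induction rule: generate_topology_on.induct)
    case (Int a b)
    then show ?case by (simp add: eventually_conj_iff)
  next
    case (UN K)
    show ?case
    proof
      assume "l \<in> \<Union>K"
      then obtain k where k: "k \<in> K" "l \<in> k" by blast
      then have "\<forall>\<^sub>F i in F. f i \<in> k" using UN.IH by blast
      then show "\<forall>\<^sub>F i in F. f i \<in> \<Union>K" by (rule eventually_mono) (use k in blast)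
    qed
  next
    case (Basis s)
    then show ?case using ev by blast
  qed simp
  then show "\<forall>\<^sub>F i in F. f i \<in> U" using U by blast
qed

lemma summable_power2_product:
  fixes a b :: "nat \<Rightarrow> real"
  assumes "summable (\<lambda>j. (a j)\<^sup>2)" "summable (\<lambda>j. (b j)\<^sup>2)"
  shows "summable (\<lambda>j. \<bar>a j\<bar> * \<bar>b j\<bar>)"
proof (rule summable_comparison_test')
  show "summable (\<lambda>j. (a j)\<^sup>2 + (b j)\<^sup>2)" using assms by (rule summable_add)
  fix n
  have "2 * (\<bar>a n\<bar> * \<bar>b n\<bar>) \<le> \<bar>a n\<bar>\<^sup>2 + \<bar>b n\<bar>\<^sup>2" using sum_squares_bound[of "\<bar>a n\<bar>" "\<bar>b n\<bar>"] by simp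
  moreover have "0 \<le> \<bar>a n\<bar> * \<bar>b n\<bar>" by simp
  ultimately show "norm (\<bar>a n\<bar> * \<bar>b n\<bar>) \<le> (a n)\<^sup>2 + (b n)\<^sup>2"
    by (simp only: real_norm_def power2_abs)
qed

text \<open>Tannery's theorem for a bound that holds for all terms of the series at once, eventually along the
  filter.\<close>

lemma tendsto_suminf_dominated:
  fixes g :: "nat \<Rightarrow> 'i \<Rightarrow> 'c :: {real_normed_algebra, banach}"
  assumes "F \<noteq> bot" "\<forall>\<^sub>F n in F. \<forall>j. norm (g j n) \<le> M j" "summable M"
    and "\<And>j. ((\<lambda>n. g j n) \<longlongrightarrow> h j) F"
  shows "((\<lambda>n. \<Sum>j. g j n) \<longlongrightarrow> (\<Sum>j. h j)) F"
proof -
  have "\<forall>\<^sub>F (j, n) in at_top \<times>\<^sub>F F. norm (g j n) \<le> M j"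
    using eventually_prodI[OF always_eventually assms(2), of "\<lambda>_. True" sequentially]
    by (rule eventually_mono) auto
  then show ?thesis using tannerys_theorem[of g h, OF assms(4) _ assms(3,1)] by blast
qed

context hilbert_pair
begin

lemma zero_square_summable:
  "(\<lambda>j. \<zero>\<^bsub>H\<^esub>) \<in> square_summable_seqs H" "(\<lambda>j. \<zero>\<^bsub>H'\<^esub>) \<in> square_summable_seqs H'"
  by (auto simp: square_summable_seqs_def)

text \<open>A bounded net of operators converges \<open>\<sigma>\<close>-weakly as soon as all matrix elements converge: the
  series that define the \<open>\<sigma>\<close>-weak topology are dominated, so that Tannery's theorem applies.\<close>

lemma limitin_sigma_weakI:
  assumes F: "F \<noteq> bot"
    and T: "\<forall>\<^sub>F n in F. T n \<in> ops \<and> (\<forall>x\<in>carrier H. hnorm H' (T n x) \<le> C * hnorm H x)"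
    and L: "L \<in> ops"
    and conv: "\<And>x y. \<lbrakk>x \<in> carrier H'; y \<in> carrier H\<rbrakk> \<Longrightarrow> ((\<lambda>n. ip H' x (T n y)) \<longlongrightarrow> ip H' x (L y)) F"
  shows "limitin (sigma_weak H H') T L F"
  unfolding sigma_weak_def
proof (rule limitin_topology_generated_byI)
  show "L \<in> \<Union> {{T \<in> ops. (\<Sum>j. ip H' (\<eta> j) (T (\<xi> j))) \<in> U} |\<xi> \<eta> U.
      \<xi> \<in> square_summable_seqs H \<and> \<eta> \<in> square_summable_seqs H' \<and> open U}"
  proof (rule UnionI)
    show "{T \<in> ops. (\<Sum>j::nat. ip H' \<zero>\<^bsub>H'\<^esub> (T \<zero>\<^bsub>H\<^esub>)) \<in> UNIV} \<in> {{T \<in> ops. (\<Sum>j. ip H' (\<eta> j) (T (\<xi> j))) \<in> U} |\<xi> \<eta> U.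
        \<xi> \<in> square_summable_seqs H \<and> \<eta> \<in> square_summable_seqs H' \<and> open U}"
      by (rule CollectI, rule exI[of _ "\<lambda>_. \<zero>\<^bsub>H\<^esub>"], rule exI[of _ "\<lambda>_. \<zero>\<^bsub>H'\<^esub>"], rule exI[of _ UNIV])
        (simp add: zero_square_summable)
  qed (use L in simp)
  fix N assume "N \<in> {{T \<in> ops. (\<Sum>j. ip H' (\<eta> j) (T (\<xi> j))) \<in> U} |\<xi> \<eta> U.
      \<xi> \<in> square_summable_seqs H \<and> \<eta> \<in> square_summable_seqs H' \<and> open U}" and LN: "L \<in> N"
  then obtain \<xi> \<eta> U where N: "N = {T \<in> ops. (\<Sum>j. ip H' (\<eta> j) (T (\<xi> j))) \<in> U}"
    and \<xi>: "\<xi> \<in> square_summable_seqs H" and \<eta>: "\<eta> \<in> square_summable_seqs H'" and U: "open U"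
    by (elim CollectE exE conjE) (rule that)
  have c: "\<xi> j \<in> carrier H" "\<eta> j \<in> carrier H'" for j using \<xi> \<eta> by (auto simp: square_summable_seqs_def)
  define M where "M j = \<bar>C\<bar> * (\<bar>hnorm H' (\<eta> j)\<bar> * \<bar>hnorm H (\<xi> j)\<bar>)" for j
  have "((\<lambda>n. \<Sum>j. ip H' (\<eta> j) (T n (\<xi> j))) \<longlongrightarrow> (\<Sum>j. ip H' (\<eta> j) (L (\<xi> j)))) F"
  proof (rule tendsto_suminf_dominated[OF F])
    have "summable (\<lambda>j. \<bar>hnorm H' (\<eta> j)\<bar> * \<bar>hnorm H (\<xi> j)\<bar>)"
      by (rule summable_power2_product) (use \<xi> \<eta> in \<open>simp_all add: square_summable_seqs_def\<close>)
    then show "summable M" unfolding M_def by (rule summable_mult)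
    show "\<forall>\<^sub>F n in F. \<forall>j. norm (ip H' (\<eta> j) (T n (\<xi> j))) \<le> M j"
      using T
    proof eventually_elim
      case (elim n)
      show ?case
      proof
        fix j
        have Tc: "T n (\<xi> j) \<in> carrier H'" using bounded_opsD(2)[of "T n" H H' "\<xi> j"] elim c by simp
        have "norm (ip H' (\<eta> j) (T n (\<xi> j))) \<le> hnorm H' (\<eta> j) * hnorm H' (T n (\<xi> j))"
          using c Tc by (intro B.Cauchy_Schwarz)
        also have "\<dots> \<le> hnorm H' (\<eta> j) * (C * hnorm H (\<xi> j))" using elim c by (intro mult_left_mono) auto
        also have "\<dots> = C * (hnorm H' (\<eta> j) * hnorm H (\<xi> j))" by (rule mult.left_commute)
        also have "\<dots> \<le> \<bar>C\<bar> * (hnorm H' (\<eta> j) * hnorm H (\<xi> j))" using c by (intro mult_right_mono) auto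
        also have "\<dots> = M j" using c by (simp add: M_def)
        finally show "norm (ip H' (\<eta> j) (T n (\<xi> j))) \<le> M j" .
      qed
    qed
  qed (intro conv c)
  then have "\<forall>\<^sub>F n in F. (\<Sum>j. ip H' (\<eta> j) (T n (\<xi> j))) \<in> U"
    using LN U by (intro topological_tendstoD) (auto simp: N)
  then show "\<forall>\<^sub>F n in F. T n \<in> N" using T by eventually_elim (simp add: N)
qed

text \<open>Sequences with one nonzero vector are square summable, so that matrix elements are among the
  functionals that define the topology.\<close>

lemma limitin_sigma_weakD:
  assumes T: "limitin (sigma_weak H H') T L F" and x: "x \<in> carrier H'" and y: "y \<in> carrier H"
  shows "((\<lambda>n. ip H' x (T n y)) \<longlongrightarrow> ip H' x (L y)) F"
proof (rule topological_tendstoI)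
  fix U assume U: "open U" "ip H' x (L y) \<in> U"
  define \<xi> where "\<xi> j = (if j = 0 then y else \<zero>\<^bsub>H\<^esub>)" for j :: nat
  define \<eta> where "\<eta> j = (if j = 0 then x else \<zero>\<^bsub>H'\<^esub>)" for j :: nat
  have "summable (\<lambda>j. (hnorm H (\<xi> j))\<^sup>2)" "summable (\<lambda>j. (hnorm H' (\<eta> j))\<^sup>2)"
    by (rule summable_finite[of "{0}"]; simp add: \<xi>_def \<eta>_def)+
  then have ss: "\<xi> \<in> square_summable_seqs H" "\<eta> \<in> square_summable_seqs H'"
    using x y by (auto simp: square_summable_seqs_def \<xi>_def \<eta>_def)
  have sum: "(\<Sum>j. ip H' (\<eta> j) (A (\<xi> j))) = ip H' x (A y)" if "A \<in> ops" for A
  proof -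
    have "ip H' (\<eta> j) (A (\<xi> j)) = 0" if "j \<noteq> 0" for j
      using that \<open>A \<in> ops\<close> by (simp add: \<eta>_def \<xi>_def)
    then have "(\<Sum>j. ip H' (\<eta> j) (A (\<xi> j))) = (\<Sum>j\<in>{0}. ip H' (\<eta> j) (A (\<xi> j)))"
      by (intro suminf_finite) auto
    then show ?thesis by (simp add: \<eta>_def \<xi>_def)
  qed
  define N where "N = {T \<in> ops. (\<Sum>j. ip H' (\<eta> j) (T (\<xi> j))) \<in> U}"
  have "L \<in> topspace (sigma_weak H H')" using T by (simp add: limitin_def)
  then have L: "L \<in> ops" by (auto simp: sigma_weak_def topology_generated_by_topspace)
  have "openin (sigma_weak H H') N"
    unfolding sigma_weak_def N_def using ss U by (intro topology_generated_by_Basis) blast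
  moreover have "L \<in> N" using L U sum by (simp add: N_def)
  ultimately have "\<forall>\<^sub>F n in F. T n \<in> N" using T unfolding limitin_def by blast
  then show "\<forall>\<^sub>F n in F. ip H' x (T n y) \<in> U"
    by eventually_elim (auto simp: N_def sum)
qed

lemma topspace_sigma_strong: "topspace (sigma_strong H H') \<subseteq> ops"
  by (auto simp: sigma_strong_def topology_generated_by_topspace)

text \<open>The seminorms are series dominated by a multiple of \<open>\<Sum>j. \<parallel>\<xi> j\<parallel>\<^sup>2\<close>, as for the \<open>\<sigma>\<close>-weak topology.\<close>

lemma limitin_sigma_strongI:
  assumes F: "F \<noteq> bot"
    and T: "\<forall>\<^sub>F n in F. T n \<in> ops \<and> (\<forall>x\<in>carrier H. hnorm H' (T n x) \<le> C * hnorm H x)"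
    and L: "L \<in> ops"
    and conv: "\<And>x. x \<in> carrier H \<Longrightarrow> ((\<lambda>n. hnorm H' (T n x \<ominus>\<^bsub>H'\<^esub> L x)) \<longlongrightarrow> 0) F"
  shows "limitin (sigma_strong H H') T L F"
  unfolding sigma_strong_def
proof (rule limitin_topology_generated_byI)
  let ?S = "{{T \<in> ops. sqrt (\<Sum>j. (hnorm H' ((T \<ominus>\<^bsub>bounded_ops H H'\<^esub> T\<^sub>0) (\<xi> j)))\<^sup>2) < r} |\<xi> T\<^sub>0 r.
      \<xi> \<in> square_summable_seqs H \<and> T\<^sub>0 \<in> ops \<and> 0 < r}"
  define N where "N = {T \<in> ops. sqrt (\<Sum>j::nat. (hnorm H' ((T \<ominus>\<^bsub>bounded_ops H H'\<^esub> L) \<zero>\<^bsub>H\<^esub>))\<^sup>2) < 1}"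
  have "N \<in> ?S" unfolding N_def
    by (rule CollectI, rule exI[of _ "\<lambda>_. \<zero>\<^bsub>H\<^esub>"], rule exI[of _ L], rule exI[of _ 1]) (simp add: zero_square_summable L)
  moreover have "L \<in> N" using L by (simp add: N_def minus_ops_apply)
  ultimately show "L \<in> \<Union> ?S" by blast
  fix N assume "N \<in> ?S" and LN: "L \<in> N"
  then obtain \<xi> T0 r where N: "N = {T \<in> ops. sqrt (\<Sum>j. (hnorm H' ((T \<ominus>\<^bsub>bounded_ops H H'\<^esub> T0) (\<xi> j)))\<^sup>2) < r}"
    and \<xi>: "\<xi> \<in> square_summable_seqs H" and T0: "T0 \<in> ops" and r: "r > 0"
    by (elim CollectE exE conjE) (rule that)
  have c: "\<xi> j \<in> carrier H" for j using \<xi> by (auto simp: square_summable_seqs_def)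
  obtain D where D: "D \<ge> 0" "\<And>x. x \<in> carrier H \<Longrightarrow> hnorm H' (T0 x) \<le> D * hnorm H x" using op_bound[OF T0] by blast
  have lim: "((\<lambda>n. \<Sum>j. (hnorm H' (T n (\<xi> j) \<ominus>\<^bsub>H'\<^esub> T0 (\<xi> j)))\<^sup>2) \<longlongrightarrow> (\<Sum>j. (hnorm H' (L (\<xi> j) \<ominus>\<^bsub>H'\<^esub> T0 (\<xi> j)))\<^sup>2)) F"
  proof (rule tendsto_suminf_dominated[OF F])
    show "summable (\<lambda>j. (C + D)\<^sup>2 * (hnorm H (\<xi> j))\<^sup>2)"
      by (rule summable_mult) (use \<xi> in \<open>simp add: square_summable_seqs_def\<close>)
    show "\<forall>\<^sub>F n in F. \<forall>j. norm ((hnorm H' (T n (\<xi> j) \<ominus>\<^bsub>H'\<^esub> T0 (\<xi> j)))\<^sup>2) \<le> (C + D)\<^sup>2 * (hnorm H (\<xi> j))\<^sup>2"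
      using T
    proof eventually_elim
      case (elim n)
      show ?case
      proof
        fix j
        have Tc: "T n (\<xi> j) \<in> carrier H'" "T0 (\<xi> j) \<in> carrier H'" using bounded_opsD(2)[of "T n" H H' "\<xi> j"] elim c bounded_opsD(2)[OF T0 c] by simp_all
        have "hnorm H' (T n (\<xi> j) \<ominus>\<^bsub>H'\<^esub> T0 (\<xi> j)) \<le> hnorm H' (T n (\<xi> j)) + hnorm H' (T0 (\<xi> j))"
          using Tc by (intro B.hnorm_triangle_minus')
        also have "\<dots> \<le> (C + D) * hnorm H (\<xi> j)" using elim D c by (simp add: distrib_right add_mono)
        finally have "(hnorm H' (T n (\<xi> j) \<ominus>\<^bsub>H'\<^esub> T0 (\<xi> j)))\<^sup>2 \<le> ((C + D) * hnorm H (\<xi> j))\<^sup>2"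
          using Tc by (intro power_mono) auto
        then show "norm ((hnorm H' (T n (\<xi> j) \<ominus>\<^bsub>H'\<^esub> T0 (\<xi> j)))\<^sup>2) \<le> (C + D)\<^sup>2 * (hnorm H (\<xi> j))\<^sup>2"
          by (simp add: power_mult_distrib)
      qed
    qed
    fix j
    have Lc: "L (\<xi> j) \<in> carrier H'" "T0 (\<xi> j) \<in> carrier H'" using bounded_opsD(2)[OF L c] bounded_opsD(2)[OF T0 c] by simp_all
    have "((\<lambda>n. hnorm H' (T n (\<xi> j) \<ominus>\<^bsub>H'\<^esub> T0 (\<xi> j)) - hnorm H' (L (\<xi> j) \<ominus>\<^bsub>H'\<^esub> T0 (\<xi> j))) \<longlongrightarrow> 0) F"
    proof (rule Lim_null_comparison)
      show "\<forall>\<^sub>F n in F. norm (hnorm H' (T n (\<xi> j) \<ominus>\<^bsub>H'\<^esub> T0 (\<xi> j)) - hnorm H' (L (\<xi> j) \<ominus>\<^bsub>H'\<^esub> T0 (\<xi> j)))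
          \<le> hnorm H' (T n (\<xi> j) \<ominus>\<^bsub>H'\<^esub> L (\<xi> j))"
        using T
      proof eventually_elim
        case (elim n)
        have Tc: "T n (\<xi> j) \<in> carrier H'" using bounded_opsD(2)[of "T n" H H' "\<xi> j"] elim c by simp
        have "T n (\<xi> j) \<ominus>\<^bsub>H'\<^esub> T0 (\<xi> j) \<ominus>\<^bsub>H'\<^esub> (L (\<xi> j) \<ominus>\<^bsub>H'\<^esub> T0 (\<xi> j)) = T n (\<xi> j) \<ominus>\<^bsub>H'\<^esub> L (\<xi> j)"
          using Tc Lc by (intro B.vec_eqI) (auto simp: B.ip_simps)
        then show ?case
          using B.hnorm_diff_le[of "T n (\<xi> j) \<ominus>\<^bsub>H'\<^esub> T0 (\<xi> j)" "L (\<xi> j) \<ominus>\<^bsub>H'\<^esub> T0 (\<xi> j)"] Tc Lc by simp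
      qed
    qed (use conv c in auto)
    then show "((\<lambda>n. (hnorm H' (T n (\<xi> j) \<ominus>\<^bsub>H'\<^esub> T0 (\<xi> j)))\<^sup>2) \<longlongrightarrow> (hnorm H' (L (\<xi> j) \<ominus>\<^bsub>H'\<^esub> T0 (\<xi> j)))\<^sup>2) F"
      by (intro tendsto_power) (rule LIM_zero_cancel)
  qed
  have "((\<lambda>n. sqrt (\<Sum>j. (hnorm H' (T n (\<xi> j) \<ominus>\<^bsub>H'\<^esub> T0 (\<xi> j)))\<^sup>2)) \<longlongrightarrow> sqrt (\<Sum>j. (hnorm H' (L (\<xi> j) \<ominus>\<^bsub>H'\<^esub> T0 (\<xi> j)))\<^sup>2)) F"
    by (intro tendsto_real_sqrt lim)
  moreover have "sqrt (\<Sum>j. (hnorm H' (L (\<xi> j) \<ominus>\<^bsub>H'\<^esub> T0 (\<xi> j)))\<^sup>2) < r"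
    using LN L T0 c by (simp add: N minus_ops_apply)
  ultimately have "\<forall>\<^sub>F n in F. sqrt (\<Sum>j. (hnorm H' (T n (\<xi> j) \<ominus>\<^bsub>H'\<^esub> T0 (\<xi> j)))\<^sup>2) < r"
    by (rule order_tendstoD)
  then show "\<forall>\<^sub>F n in F. T n \<in> N" using T by eventually_elim (simp add: N minus_ops_apply T0 c)
qed

end


section \<open>Tensor products\<close>

lemma abs_summable_product:
  fixes f g :: "'i \<Rightarrow> complex"
  assumes "(\<lambda>p. (cmod (f p))\<^sup>2) summable_on A" "(\<lambda>p. (cmod (g p))\<^sup>2) summable_on A"
  shows "(\<lambda>p. norm (cnj (f p) * g p)) summable_on A"
proof (rule summable_on_comparison_test)
  show "(\<lambda>p. (cmod (f p))\<^sup>2 + (cmod (g p))\<^sup>2) summable_on A" using assms by (rule summable_on_add)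
  fix p
  have "2 * (cmod (f p) * cmod (g p)) \<le> (cmod (f p))\<^sup>2 + (cmod (g p))\<^sup>2"
    using sum_squares_bound[of "cmod (f p)" "cmod (g p)"] by simp
  moreover have "0 \<le> cmod (f p) * cmod (g p)" by simp
  ultimately have "cmod (f p) * cmod (g p) \<le> (cmod (f p))\<^sup>2 + (cmod (g p))\<^sup>2" by linarith
  then show "norm (cnj (f p) * g p) \<le> (cmod (f p))\<^sup>2 + (cmod (g p))\<^sup>2"
    by (simp add: norm_mult)
qed auto

lemma square_summable_add:
  fixes f g :: "'i \<Rightarrow> complex"
  assumes "(\<lambda>p. (cmod (f p))\<^sup>2) summable_on A" "(\<lambda>p. (cmod (g p))\<^sup>2) summable_on A"
  shows "(\<lambda>p. (cmod (f p + g p))\<^sup>2) summable_on A"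
proof (rule summable_on_comparison_test)
  show "(\<lambda>p. 2 * (cmod (f p))\<^sup>2 + 2 * (cmod (g p))\<^sup>2) summable_on A"
    using assms by (intro summable_on_add summable_on_cmult_right)
  fix p
  have "(cmod (f p + g p))\<^sup>2 \<le> (cmod (f p) + cmod (g p))\<^sup>2"
    by (intro power_mono norm_triangle_ineq) auto
  also have "\<dots> \<le> 2 * (cmod (f p))\<^sup>2 + 2 * (cmod (g p))\<^sup>2"
    using sum_squares_bound[of "cmod (f p)" "cmod (g p)"] by (simp add: power2_sum)
  finally show "(cmod (f p + g p))\<^sup>2 \<le> 2 * (cmod (f p))\<^sup>2 + 2 * (cmod (g p))\<^sup>2" .
qed auto

text \<open>Slicewise comparison bounds operators that act on one factor of a tensor product.\<close>

lemma double_sum_le: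
  fixes u v :: "'i \<times> 'j \<Rightarrow> real"
  assumes u: "\<And>p. 0 \<le> u p" and v: "v summable_on A \<times> B"
    and le: "\<And>x. x \<in> A \<Longrightarrow> (\<lambda>y. u (x, y)) summable_on B"
      "\<And>x. x \<in> A \<Longrightarrow> (\<Sum>\<^sub>\<infinity>y\<in>B. u (x, y)) \<le> C * (\<Sum>\<^sub>\<infinity>y\<in>B. v (x, y))"
  shows "u summable_on A \<times> B" "(\<Sum>\<^sub>\<infinity>p\<in>A \<times> B. u p) \<le> C * (\<Sum>\<^sub>\<infinity>p\<in>A \<times> B. v p)"
proof -
  have vs: "(\<lambda>x. \<Sum>\<^sub>\<infinity>y\<in>B. v (x, y)) summable_on A"
    using summable_on_Sigma_banach[of "\<lambda>x y. v (x, y)" A "\<lambda>_. B"] v by simp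
  have us: "(\<lambda>x. \<Sum>\<^sub>\<infinity>y\<in>B. u (x, y)) summable_on A"
  proof (rule summable_on_comparison_test)
    show "(\<lambda>x. C * (\<Sum>\<^sub>\<infinity>y\<in>B. v (x, y))) summable_on A" using vs by (rule summable_on_cmult_right)
  qed (use le u in \<open>auto intro: infsum_nonneg\<close>)
  show s: "u summable_on A \<times> B"
    by (rule summable_on_SigmaI[where g = "\<lambda>x. \<Sum>\<^sub>\<infinity>y\<in>B. u (x, y)"]) (use le us u in \<open>auto intro: has_sum_infsum\<close>)
  have "(\<Sum>\<^sub>\<infinity>p\<in>A \<times> B. u p) = (\<Sum>\<^sub>\<infinity>x\<in>A. \<Sum>\<^sub>\<infinity>y\<in>B. u (x, y))"
    using infsum_Sigma_banach[of u A "\<lambda>_. B"] s by simp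
  also have "\<dots> \<le> (\<Sum>\<^sub>\<infinity>x\<in>A. C * (\<Sum>\<^sub>\<infinity>y\<in>B. v (x, y)))"
    by (intro infsum_mono us summable_on_cmult_right vs le)
  also have "\<dots> = C * (\<Sum>\<^sub>\<infinity>x\<in>A. \<Sum>\<^sub>\<infinity>y\<in>B. v (x, y))"
    by (intro infsum_cmult_right vs)
  also have "(\<Sum>\<^sub>\<infinity>x\<in>A. \<Sum>\<^sub>\<infinity>y\<in>B. v (x, y)) = (\<Sum>\<^sub>\<infinity>p\<in>A \<times> B. v p)"
    using infsum_Sigma_banach[of v A "\<lambda>_. B"] v by simp
  finally show "(\<Sum>\<^sub>\<infinity>p\<in>A \<times> B. u p) \<le> C * (\<Sum>\<^sub>\<infinity>p\<in>A \<times> B. v p)" .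
qed

lemma htensor_simps [simp]:
  "carrier (htensor K H) = hs_functionals K H"
  "\<zero>\<^bsub>htensor K H\<^esub> = (\<lambda>p\<in>carrier K \<times> carrier H. 0)"
  "\<phi> \<oplus>\<^bsub>htensor K H\<^esub> \<psi> = (\<lambda>p\<in>carrier K \<times> carrier H. \<phi> p + \<psi> p)"
  "c \<odot>\<^bsub>htensor K H\<^esub> \<phi> = (\<lambda>p\<in>carrier K \<times> carrier H. c * \<phi> p)"
  by (simp_all add: htensor_def)

lemma hs_functionalsD:
  assumes "\<phi> \<in> hs_functionals K H"
  shows "\<phi> \<in> extensional (carrier K \<times> carrier H)"
    and "\<lbrakk>a \<in> carrier K; a' \<in> carrier K; b \<in> carrier H\<rbrakk> \<Longrightarrow> \<phi> (a \<oplus>\<^bsub>K\<^esub> a', b) = \<phi> (a, b) + \<phi> (a', b)"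
    and "\<lbrakk>a \<in> carrier K; b \<in> carrier H; b' \<in> carrier H\<rbrakk> \<Longrightarrow> \<phi> (a, b \<oplus>\<^bsub>H\<^esub> b') = \<phi> (a, b) + \<phi> (a, b')"
    and "\<lbrakk>a \<in> carrier K; b \<in> carrier H\<rbrakk> \<Longrightarrow> \<phi> (c \<odot>\<^bsub>K\<^esub> a, b) = cnj c * \<phi> (a, b)"
    and "\<lbrakk>a \<in> carrier K; b \<in> carrier H\<rbrakk> \<Longrightarrow> \<phi> (a, c \<odot>\<^bsub>H\<^esub> b) = cnj c * \<phi> (a, b)"
    and "\<exists>C. \<forall>a\<in>carrier K. \<forall>b\<in>carrier H. cmod (\<phi> (a, b)) \<le> C * (hnorm K a * hnorm H b)"
    and "(\<lambda>p. (cmod (\<phi> p))\<^sup>2) summable_on (some_onb K \<times> some_onb H)"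
  using assms by (auto simp: hs_functionals_def)

lemma hs_functionalsI:
  assumes "\<phi> \<in> extensional (carrier K \<times> carrier H)"
    and "\<And>a a' b. \<lbrakk>a \<in> carrier K; a' \<in> carrier K; b \<in> carrier H\<rbrakk> \<Longrightarrow> \<phi> (a \<oplus>\<^bsub>K\<^esub> a', b) = \<phi> (a, b) + \<phi> (a', b)"
    and "\<And>a b b'. \<lbrakk>a \<in> carrier K; b \<in> carrier H; b' \<in> carrier H\<rbrakk> \<Longrightarrow> \<phi> (a, b \<oplus>\<^bsub>H\<^esub> b') = \<phi> (a, b) + \<phi> (a, b')"
    and "\<And>c a b. \<lbrakk>a \<in> carrier K; b \<in> carrier H\<rbrakk> \<Longrightarrow> \<phi> (c \<odot>\<^bsub>K\<^esub> a, b) = cnj c * \<phi> (a, b)"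
    and "\<And>c a b. \<lbrakk>a \<in> carrier K; b \<in> carrier H\<rbrakk> \<Longrightarrow> \<phi> (a, c \<odot>\<^bsub>H\<^esub> b) = cnj c * \<phi> (a, b)"
    and "\<And>a b. \<lbrakk>a \<in> carrier K; b \<in> carrier H\<rbrakk> \<Longrightarrow> cmod (\<phi> (a, b)) \<le> C * (hnorm K a * hnorm H b)"
    and "(\<lambda>p. (cmod (\<phi> p))\<^sup>2) summable_on (some_onb K \<times> some_onb H)"
  shows "\<phi> \<in> hs_functionals K H"
  using assms(1-5,7) exI[of "\<lambda>C. \<forall>a\<in>carrier K. \<forall>b\<in>carrier H. cmod (\<phi> (a, b)) \<le> C * (hnorm K a * hnorm H b)" C] assms(6)
  by (simp add: hs_functionals_def)

locale tensor_pair = K: hilbert_space K + H: hilbert_space H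
  for K :: "'k hilb" and H :: "'h hilb"
begin

abbreviation "G \<equiv> htensor K H"
abbreviation "B \<equiv> some_onb K \<times> some_onb H"

lemma onbs: "e \<in> some_onb K \<Longrightarrow> e \<in> carrier K" "f \<in> some_onb H \<Longrightarrow> f \<in> carrier H"
  using K.onb_carrier[OF K.is_onb_some_onb] H.onb_carrier[OF H.is_onb_some_onb] by auto

lemma onb_pair: "p \<in> B \<Longrightarrow> p \<in> carrier K \<times> carrier H"
  using onbs by auto

lemma add_hs:
  assumes "\<phi> \<in> hs_functionals K H" "\<psi> \<in> hs_functionals K H"
  shows "(\<lambda>p\<in>carrier K \<times> carrier H. \<phi> p + \<psi> p) \<in> hs_functionals K H"
proof -
  obtain C where C: "\<And>a b. \<lbrakk>a \<in> carrier K; b \<in> carrier H\<rbrakk> \<Longrightarrow> cmod (\<phi> (a, b)) \<le> C * (hnorm K a * hnorm H b)"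
    using hs_functionalsD(6)[OF assms(1)] by blast
  obtain D where D: "\<And>a b. \<lbrakk>a \<in> carrier K; b \<in> carrier H\<rbrakk> \<Longrightarrow> cmod (\<psi> (a, b)) \<le> D * (hnorm K a * hnorm H b)"
    using hs_functionalsD(6)[OF assms(2)] by blast
  show ?thesis
  proof (rule hs_functionalsI[where C = "C + D"])
    show "cmod ((\<lambda>p\<in>carrier K \<times> carrier H. \<phi> p + \<psi> p) (a, b)) \<le> (C + D) * (hnorm K a * hnorm H b)"
      if "a \<in> carrier K" "b \<in> carrier H" for a b
      using C[OF that] D[OF that] that norm_triangle_ineq[of "\<phi> (a, b)" "\<psi> (a, b)"] by (simp add: distrib_right)
    have "(\<lambda>p. (cmod (\<phi> p + \<psi> p))\<^sup>2) summable_on B"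
      using hs_functionalsD(7)[OF assms(1)] hs_functionalsD(7)[OF assms(2)] by (rule square_summable_add)
    then show "(\<lambda>p. (cmod ((\<lambda>p\<in>carrier K \<times> carrier H. \<phi> p + \<psi> p) p))\<^sup>2) summable_on B"
      by (rule summable_on_cong[THEN iffD1, rotated]) (use onb_pair in auto)
  qed (auto simp: hs_functionalsD[OF assms(1)] hs_functionalsD[OF assms(2)] algebra_simps)
qed

lemma smult_hs:
  assumes "\<phi> \<in> hs_functionals K H"
  shows "(\<lambda>p\<in>carrier K \<times> carrier H. c * \<phi> p) \<in> hs_functionals K H"
proof -
  obtain C where C: "\<And>a b. \<lbrakk>a \<in> carrier K; b \<in> carrier H\<rbrakk> \<Longrightarrow> cmod (\<phi> (a, b)) \<le> C * (hnorm K a * hnorm H b)"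
    using hs_functionalsD(6)[OF assms(1)] by blast
  show ?thesis
  proof (rule hs_functionalsI[where C = "cmod c * C"])
    show "cmod ((\<lambda>p\<in>carrier K \<times> carrier H. c * \<phi> p) (a, b)) \<le> (cmod c * C) * (hnorm K a * hnorm H b)"
      if "a \<in> carrier K" "b \<in> carrier H" for a b
      using mult_left_mono[OF C[OF that], of "cmod c"] that by (simp add: norm_mult mult.assoc)
    have "(\<lambda>p. (cmod c)\<^sup>2 * (cmod (\<phi> p))\<^sup>2) summable_on B"
      using hs_functionalsD(7)[OF assms(1)] by (rule summable_on_cmult_right)
    then show "(\<lambda>p. (cmod ((\<lambda>p\<in>carrier K \<times> carrier H. c * \<phi> p) p))\<^sup>2) summable_on B"
      by (rule summable_on_cong[THEN iffD1, rotated]) (use onb_pair in \<open>auto simp: norm_mult power_mult_distrib\<close>)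
  qed (auto simp: hs_functionalsD[OF assms(1)] algebra_simps)
qed

lemma zero_hs: "(\<lambda>p\<in>carrier K \<times> carrier H. 0) \<in> hs_functionals K H"
proof (rule hs_functionalsI[where C = 0])
  have "(\<lambda>p. (cmod 0)\<^sup>2) summable_on B" by simp
  then show "(\<lambda>p. (cmod ((\<lambda>p\<in>carrier K \<times> carrier H. 0) p))\<^sup>2) summable_on B"
    by (rule summable_on_cong[THEN iffD1, rotated]) (use onb_pair in auto)
qed auto

lemma module_htensor: "Module.module complex_ring G"
proof (rule Module.moduleI[OF cring_complex_ring])
  show "abelian_group G"
  proof (rule abelian_groupI)
    fix \<phi> assume "\<phi> \<in> carrier G"
    then show "\<exists>\<psi>\<in>carrier G. \<psi> \<oplus>\<^bsub>G\<^esub> \<phi> = \<zero>\<^bsub>G\<^esub>"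
      using smult_hs[of \<phi> "-1"] by (intro bexI[of _ "(-1) \<odot>\<^bsub>G\<^esub> \<phi>"]) auto
  next
    fix \<phi> assume \<phi>: "\<phi> \<in> carrier G"
    then show "\<zero>\<^bsub>G\<^esub> \<oplus>\<^bsub>G\<^esub> \<phi> = \<phi>"
      by (intro extensionalityI[of _ "carrier K \<times> carrier H"]) (auto dest: hs_functionalsD(1))
  qed (auto simp: zero_hs add_hs add_ac intro!: restrict_ext)
  fix \<phi> assume \<phi>: "\<phi> \<in> carrier G"
  then show "\<one>\<^bsub>complex_ring\<^esub> \<odot>\<^bsub>G\<^esub> \<phi> = \<phi>"
    by (intro extensionalityI[of _ "carrier K \<times> carrier H"]) (auto simp: complex_ring_def dest: hs_functionalsD(1))
qed (auto simp: smult_hs complex_ring_def algebra_simps intro!: restrict_ext)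

lemma ip_htensor_summable:
  "\<lbrakk>\<phi> \<in> hs_functionals K H; \<psi> \<in> hs_functionals K H\<rbrakk> \<Longrightarrow> (\<lambda>p. cnj (\<phi> p) * \<psi> p) summable_on B"
  by (rule abs_summable_summable, rule abs_summable_product) (rule hs_functionalsD(7), assumption)+

lemma ip_htensor: "ip G \<phi> \<psi> = (\<Sum>\<^sub>\<infinity>p\<in>B. cnj (\<phi> p) * \<psi> p)"
  by (simp add: htensor_def)

lemma ip_htensor_self:
  assumes \<phi>: "\<phi> \<in> hs_functionals K H"
  shows "ip G \<phi> \<phi> = of_real (\<Sum>\<^sub>\<infinity>p\<in>B. (cmod (\<phi> p))\<^sup>2)"
proof -
  have "((\<lambda>p. complex_of_real ((cmod (\<phi> p))\<^sup>2)) has_sum of_real (\<Sum>\<^sub>\<infinity>p\<in>B. (cmod (\<phi> p))\<^sup>2)) B"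
    unfolding has_sum_of_real_iff by (rule has_sum_infsum[OF hs_functionalsD(7)[OF \<phi>]])
  moreover have "complex_of_real ((cmod (\<phi> p))\<^sup>2) = cnj (\<phi> p) * \<phi> p" for p
    using complex_norm_square[of "\<phi> p"] by (simp add: mult.commute)
  ultimately show ?thesis unfolding ip_htensor by (simp add: infsumI)
qed

text \<open>The Riesz representatives of the slices of a Hilbert-Schmidt functional make Parseval's identity
  available in one variable at a time.\<close>

lemma slice_right:
  assumes \<phi>: "\<phi> \<in> hs_functionals K H" and a: "a \<in> carrier K"
  shows "\<exists>y\<in>carrier H. \<forall>b\<in>carrier H. \<phi> (a, b) = ip H b y"
proof -
  obtain C where C: "\<And>a b. \<lbrakk>a \<in> carrier K; b \<in> carrier H\<rbrakk> \<Longrightarrow> cmod (\<phi> (a, b)) \<le> C * (hnorm K a * hnorm H b)"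
    using hs_functionalsD(6)[OF \<phi>] by blast
  have "\<exists>y\<in>carrier H. \<forall>b\<in>carrier H. cnj (\<phi> (a, b)) = ip H y b"
    by (rule H.Riesz_representation[where C = "C * hnorm K a"])
      (use C a in \<open>auto simp: hs_functionalsD[OF \<phi>] mult.assoc\<close>)
  then show ?thesis using H.ip_commute by (metis complex_cnj_cnj)
qed

lemma slice_left:
  assumes \<phi>: "\<phi> \<in> hs_functionals K H" and b: "b \<in> carrier H"
  shows "\<exists>x\<in>carrier K. \<forall>a\<in>carrier K. \<phi> (a, b) = ip K a x"
proof -
  obtain C where C: "\<And>a b. \<lbrakk>a \<in> carrier K; b \<in> carrier H\<rbrakk> \<Longrightarrow> cmod (\<phi> (a, b)) \<le> C * (hnorm K a * hnorm H b)"
    using hs_functionalsD(6)[OF \<phi>] by blast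
  have "\<exists>x\<in>carrier K. \<forall>a\<in>carrier K. cnj (\<phi> (a, b)) = ip K x a"
  proof (rule K.Riesz_representation[where C = "C * hnorm H b"])
    show "cmod (cnj (\<phi> (a, b))) \<le> C * hnorm H b * hnorm K a" if "a \<in> carrier K" for a
      using C[OF that b] by (simp add: mult_ac)
  qed (use b in \<open>auto simp: hs_functionalsD[OF \<phi>]\<close>)
  then show ?thesis using K.ip_commute by (metis complex_cnj_cnj)
qed

lemma hs_onb_eqI:
  assumes \<phi>: "\<phi> \<in> hs_functionals K H" and \<psi>: "\<psi> \<in> hs_functionals K H"
    and eq: "\<And>p. p \<in> B \<Longrightarrow> \<phi> p = \<psi> p"
  shows "\<phi> = \<psi>"
proof (rule extensionalityI[OF hs_functionalsD(1)[OF \<phi>] hs_functionalsD(1)[OF \<psi>]])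
  fix p assume "p \<in> carrier K \<times> carrier H"
  then obtain a b where p: "p = (a, b)" and a: "a \<in> carrier K" and b: "b \<in> carrier H" by auto
  have *: "\<phi> (e, b) = \<psi> (e, b)" if e: "e \<in> some_onb K" for e
  proof -
    obtain y where y: "y \<in> carrier H" "\<forall>b\<in>carrier H. \<phi> (e, b) = ip H b y" using slice_right[OF \<phi>] e onbs by blast
    obtain z where z: "z \<in> carrier H" "\<forall>b\<in>carrier H. \<psi> (e, b) = ip H b z" using slice_right[OF \<psi>] e onbs by blast
    have "y = z"
    proof (rule H.total_eqI[OF H.onb_total[OF H.is_onb_some_onb] y(1) z(1)])
      fix f assume "f \<in> some_onb H"
      then show "ip H f y = ip H f z" using eq[of "(e, f)"] e y z onbs by auto
    qed
    then show ?thesis using y z b by simp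
  qed
  obtain y where y: "y \<in> carrier K" "\<forall>a\<in>carrier K. \<phi> (a, b) = ip K a y" using slice_left[OF \<phi> b] by blast
  obtain z where z: "z \<in> carrier K" "\<forall>a\<in>carrier K. \<psi> (a, b) = ip K a z" using slice_left[OF \<psi> b] by blast
  have "y = z"
  proof (rule K.total_eqI[OF K.onb_total[OF K.is_onb_some_onb] y(1) z(1)])
    fix e assume "e \<in> some_onb K"
    then show "ip K e y = ip K e z" using * y z onbs by auto
  qed
  then show "\<phi> p = \<psi> p" using y z a p by simp
qed

lemma inner_space_htensor: "inner_space G"
proof (intro inner_space.intro semi_inner_space.intro inner_space_axioms.intro)
  show "Module.module complex_ring G" by (rule module_htensor)
  fix x y z c assume x: "x \<in> carrier G" and y: "y \<in> carrier G"
  have *: "ip G x (\<lambda>p\<in>carrier K \<times> carrier H. g p) = infsum (\<lambda>p. cnj (x p) * g p) B" for g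
    unfolding ip_htensor by (rule infsum_cong) (use onb_pair in auto)
  show "ip G x (c \<odot>\<^bsub>G\<^esub> y) = c * ip G x y"
    using ip_htensor_summable[of x y] x y
    by (simp add: *) (simp add: ip_htensor mult.left_commute[of _ c] infsum_cmult_right)
  show "ip G y x = cnj (ip G x y)"
    by (simp add: ip_htensor mult.commute flip: infsum_cnj)
  assume z: "z \<in> carrier G"
  show "ip G x (y \<oplus>\<^bsub>G\<^esub> z) = ip G x y + ip G x z"
    using ip_htensor_summable[of x y] ip_htensor_summable[of x z] x y z
    by (simp add: *) (simp add: ip_htensor[of x y] ip_htensor[of x z] distrib_left infsum_add)
next
  fix x assume x: "x \<in> carrier G"
  then show "0 \<le> Re (ip G x x)" by (simp add: ip_htensor_self infsum_nonneg)
  assume "ip G x x = 0"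
  then have s0: "(\<Sum>\<^sub>\<infinity>p\<in>B. (cmod (x p))\<^sup>2) = 0" using x by (simp add: ip_htensor_self)
  have "x p = 0" if p: "p \<in> B" for p
  proof -
    have "(cmod (x p))\<^sup>2 = 0"
      using nonneg_infsum_le_0D[of "\<lambda>p. (cmod (x p))\<^sup>2" B p] s0 hs_functionalsD(7)[of x K H] x p by simp
    then show ?thesis by simp
  qed
  then show "x = \<zero>\<^bsub>G\<^esub>"
    using x onb_pair by (simp add: hs_onb_eqI zero_hs)
qed

sublocale G: inner_space G
  by (rule inner_space_htensor)

lemma hnorm_htensor: "\<phi> \<in> hs_functionals K H \<Longrightarrow> (hnorm G \<phi>)\<^sup>2 = (\<Sum>\<^sub>\<infinity>p\<in>B. (cmod (\<phi> p))\<^sup>2)"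
  using G.power2_hnorm[of \<phi>] by (simp add: ip_htensor_self)

lemma vec_tensor_hs:
  assumes x: "x \<in> carrier K" and y: "y \<in> carrier H"
  shows "vec_tensor K H x y \<in> hs_functionals K H"
proof (rule hs_functionalsI[where C = "hnorm K x * hnorm H y"])
  fix a b assume a: "a \<in> carrier K" and b: "b \<in> carrier H"
  have "cmod (ip K a x) * cmod (ip H b y) \<le> (hnorm K a * hnorm K x) * (hnorm H b * hnorm H y)"
    using K.Cauchy_Schwarz[OF a x] H.Cauchy_Schwarz[OF b y] a x by (intro mult_mono) auto
  then show "cmod (vec_tensor K H x y (a, b)) \<le> hnorm K x * hnorm H y * (hnorm K a * hnorm H b)"
    using a b by (simp add: vec_tensor_def norm_mult mult_ac)
next
  note P = K.Parseval_norm[OF K.is_onb_some_onb x] H.Parseval_norm[OF H.is_onb_some_onb y]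
  have "(\<lambda>(e, f). (cmod (ip K e x))\<^sup>2 * (cmod (ip H f y))\<^sup>2) summable_on B"
  proof (rule summable_on_SigmaI[where g = "\<lambda>e. (cmod (ip K e x))\<^sup>2 * (hnorm H y)\<^sup>2"])
    show "(\<lambda>e. (cmod (ip K e x))\<^sup>2 * (hnorm H y)\<^sup>2) summable_on some_onb K"
      by (intro summable_on_cmult_left has_sum_imp_summable[OF P(1)])
  qed (auto intro!: has_sum_cmult_right P(2))
  then show "(\<lambda>p. (cmod (vec_tensor K H x y p))\<^sup>2) summable_on B"
    by (rule summable_on_cong[THEN iffD1, rotated])
      (use onbs in \<open>auto simp: vec_tensor_def norm_mult power_mult_distrib\<close>)
qed (use x y in \<open>auto simp: vec_tensor_def K.ip_simps H.ip_simps algebra_simps\<close>)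

text \<open>Elementary tensors represent the point evaluations: summing first over the second basis and then over
  the first one, Parseval's identity collapses the double sum.\<close>

lemma ip_vec_tensor:
  assumes x: "x \<in> carrier K" and y: "y \<in> carrier H" and \<phi>: "\<phi> \<in> hs_functionals K H"
  shows "ip G (vec_tensor K H x y) \<phi> = \<phi> (x, y)"
proof -
  have "ip G (vec_tensor K H x y) \<phi> = (\<Sum>\<^sub>\<infinity>e\<in>some_onb K. \<Sum>\<^sub>\<infinity>f\<in>some_onb H. cnj (vec_tensor K H x y (e, f)) * \<phi> (e, f))"
    unfolding ip_htensor using infsum_Sigma_banach[OF ip_htensor_summable[OF vec_tensor_hs[OF x y] \<phi>]] by simp
  also have "\<dots> = (\<Sum>\<^sub>\<infinity>e\<in>some_onb K. cnj (ip K e x) * \<phi> (e, y))"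
  proof (rule infsum_cong)
    fix e assume e: "e \<in> some_onb K"
    obtain z where z: "z \<in> carrier H" "\<forall>b\<in>carrier H. \<phi> (e, b) = ip H b z" using slice_right[OF \<phi>] e onbs by blast
    have "((\<lambda>f. cnj (ip K e x) * (cnj (ip H f y) * ip H f z)) has_sum cnj (ip K e x) * ip H y z) (some_onb H)"
      by (intro has_sum_cmult_right H.Parseval H.is_onb_some_onb y z)
    then have "(\<Sum>\<^sub>\<infinity>f\<in>some_onb H. cnj (ip K e x) * (cnj (ip H f y) * ip H f z)) = cnj (ip K e x) * ip H y z"
      by (rule infsumI)
    moreover have "(\<Sum>\<^sub>\<infinity>f\<in>some_onb H. cnj (vec_tensor K H x y (e, f)) * \<phi> (e, f))
        = (\<Sum>\<^sub>\<infinity>f\<in>some_onb H. cnj (ip K e x) * (cnj (ip H f y) * ip H f z))"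
      by (rule infsum_cong) (use e onbs z in \<open>auto simp: vec_tensor_def\<close>)
    ultimately show "(\<Sum>\<^sub>\<infinity>f\<in>some_onb H. cnj (vec_tensor K H x y (e, f)) * \<phi> (e, f)) = cnj (ip K e x) * \<phi> (e, y)"
      using z y by simp
  qed
  also have "\<dots> = \<phi> (x, y)"
  proof -
    obtain z where z: "z \<in> carrier K" "\<forall>a\<in>carrier K. \<phi> (a, y) = ip K a z" using slice_left[OF \<phi> y] by blast
    have "(\<Sum>\<^sub>\<infinity>e\<in>some_onb K. cnj (ip K e x) * \<phi> (e, y)) = (\<Sum>\<^sub>\<infinity>e\<in>some_onb K. cnj (ip K e x) * ip K e z)"
      by (rule infsum_cong) (use z onbs in auto)
    also have "\<dots> = ip K x z" by (intro infsumI K.Parseval K.is_onb_some_onb x z)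
    finally show ?thesis using z x by simp
  qed
  finally show ?thesis .
qed

lemma hnorm_vec_tensor:
  assumes x: "x \<in> carrier K" and y: "y \<in> carrier H"
  shows "hnorm G (vec_tensor K H x y) = hnorm K x * hnorm H y"
proof -
  have "complex_of_real ((hnorm G (vec_tensor K H x y))\<^sup>2) = ip G (vec_tensor K H x y) (vec_tensor K H x y)"
    using x y by (intro G.ip_self[symmetric]) (simp add: vec_tensor_hs)
  also have "\<dots> = vec_tensor K H x y (x, y)" using x y by (intro ip_vec_tensor vec_tensor_hs)
  also have "\<dots> = ip K x x * ip H y y" using x y by (simp add: vec_tensor_def)
  also have "\<dots> = complex_of_real ((hnorm K x * hnorm H y)\<^sup>2)"
    unfolding K.ip_self[OF x] H.ip_self[OF y] power_mult_distrib of_real_mult ..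
  finally have "(hnorm G (vec_tensor K H x y))\<^sup>2 = (hnorm K x * hnorm H y)\<^sup>2"
    unfolding of_real_eq_iff .
  then show ?thesis by (rule power2_eq_imp_eq) (use x y in \<open>simp_all add: vec_tensor_hs\<close>)
qed

lemma hs_bound:
  assumes "\<phi> \<in> hs_functionals K H" "a \<in> carrier K" "b \<in> carrier H"
  shows "cmod (\<phi> (a, b)) \<le> hnorm G \<phi> * (hnorm K a * hnorm H b)"
proof -
  have "cmod (ip G (vec_tensor K H a b) \<phi>) \<le> hnorm G (vec_tensor K H a b) * hnorm G \<phi>"
    by (rule G.Cauchy_Schwarz) (use assms in \<open>simp_all add: vec_tensor_hs\<close>)
  then show ?thesis
    unfolding ip_vec_tensor[OF assms(2,3,1)] hnorm_vec_tensor[OF assms(2,3)] by (simp only: mult.commute)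
qed

lemma minus_htensor_apply:
  assumes "\<phi> \<in> hs_functionals K H" "\<psi> \<in> hs_functionals K H" "p \<in> carrier K \<times> carrier H"
  shows "(\<phi> \<ominus>\<^bsub>G\<^esub> \<psi>) p = \<phi> p - \<psi> p"
  using assms G.ip_minus[of "vec_tensor K H (fst p) (snd p)" \<phi> \<psi>] G.minus_carrier[of \<phi> \<psi>]
  by (auto simp: ip_vec_tensor vec_tensor_hs simp del: G.minus_carrier)

text \<open>Point evaluations are bounded by the norm, so that a Cauchy sequence converges pointwise. Square sums
  over finite sets of basis vectors pass to the limit, which bounds the full square sums.\<close>

lemma hilbert_space_htensor: "hilbert_space G"
proof (rule G.hilbert_spaceI)
  fix \<phi> assume \<phi>: "G.cauchy \<phi>"
  have hs: "\<phi> n \<in> hs_functionals K H" for n using G.cauchy_carrier[OF \<phi>] by simp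
  obtain M where M: "\<And>n. hnorm G (\<phi> n) \<le> M" using G.cauchy_bounded[OF \<phi>] by blast
  have "convergent (\<lambda>n. \<phi> n p)" if p: "p \<in> carrier K \<times> carrier H" for p
  proof (rule Cauchy_convergent, rule CauchyI)
    fix e :: real assume e: "e > 0"
    obtain a b where ab: "p = (a, b)" "a \<in> carrier K" "b \<in> carrier H" using p by auto
    define c where "c = hnorm K a * hnorm H b + 1"
    have c: "c > 0" using ab by (simp add: c_def add_nonneg_pos)
    obtain N where N: "\<forall>m\<ge>N. \<forall>n\<ge>N. hnorm G (\<phi> m \<ominus>\<^bsub>G\<^esub> \<phi> n) < e / c"
      using \<phi> e c unfolding G.cauchy_def by (meson divide_pos_pos)
    have "norm (\<phi> m p - \<phi> n p) < e" if "m \<ge> N" "n \<ge> N" for m n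
    proof -
      have "norm (\<phi> m p - \<phi> n p) = cmod ((\<phi> m \<ominus>\<^bsub>G\<^esub> \<phi> n) (a, b))"
        using p ab hs by (simp add: minus_htensor_apply)
      also have "\<dots> \<le> hnorm G (\<phi> m \<ominus>\<^bsub>G\<^esub> \<phi> n) * (hnorm K a * hnorm H b)"
        using G.minus_carrier[of "\<phi> m" "\<phi> n"] hs ab by (intro hs_bound) auto
      also have "\<dots> \<le> hnorm G (\<phi> m \<ominus>\<^bsub>G\<^esub> \<phi> n) * c"
        using G.minus_carrier[of "\<phi> m" "\<phi> n"] hs by (intro mult_left_mono) (auto simp: c_def)
      also have "\<dots> < e" using N that c by (simp add: pos_less_divide_eq)
      finally show ?thesis .
    qed
    then show "\<exists>N. \<forall>m\<ge>N. \<forall>n\<ge>N. norm (\<phi> m p - \<phi> n p) < e" by blast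
  qed
  then obtain l0 where l0: "\<And>p. p \<in> carrier K \<times> carrier H \<Longrightarrow> (\<lambda>n. \<phi> n p) \<longlonglongrightarrow> l0 p"
    unfolding convergent_def by metis
  define l where "l = restrict l0 (carrier K \<times> carrier H)"
  have l: "\<And>p. p \<in> carrier K \<times> carrier H \<Longrightarrow> (\<lambda>n. \<phi> n p) \<longlonglongrightarrow> l p" using l0 by (simp add: l_def)
  have finite_le: "(\<Sum>p\<in>A. (cmod (\<psi> p))\<^sup>2) \<le> (hnorm G \<psi>)\<^sup>2" if "finite A" "A \<subseteq> B" "\<psi> \<in> hs_functionals K H" for A \<psi>
    unfolding hnorm_htensor[OF that(3)] using that hs_functionalsD(7)[OF that(3)]
    by (intro finite_sum_le_infsum) auto
  have lhs: "l \<in> hs_functionals K H"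
  proof (rule hs_functionalsI)
    show "l \<in> extensional (carrier K \<times> carrier H)" by (simp add: l_def)
    show "l (a \<oplus>\<^bsub>K\<^esub> a', b) = l (a, b) + l (a', b)" if "a \<in> carrier K" "a' \<in> carrier K" "b \<in> carrier H" for a a' b
      using that l[of "(a \<oplus>\<^bsub>K\<^esub> a', b)"] tendsto_add[OF l[of "(a, b)"] l[of "(a', b)"]]
      by (intro LIMSEQ_unique[of "\<lambda>n. \<phi> n (a \<oplus>\<^bsub>K\<^esub> a', b)"]) (auto simp: hs_functionalsD[OF hs])
    show "l (a, b \<oplus>\<^bsub>H\<^esub> b') = l (a, b) + l (a, b')" if "a \<in> carrier K" "b' \<in> carrier H" "b \<in> carrier H" for a b b'
      using that l[of "(a, b \<oplus>\<^bsub>H\<^esub> b')"] tendsto_add[OF l[of "(a, b)"] l[of "(a, b')"]]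
      by (intro LIMSEQ_unique[of "\<lambda>n. \<phi> n (a, b \<oplus>\<^bsub>H\<^esub> b')"]) (auto simp: hs_functionalsD[OF hs])
    show "l (c \<odot>\<^bsub>K\<^esub> a, b) = cnj c * l (a, b)" if "a \<in> carrier K" "b \<in> carrier H" for a b c
      using that l[of "(c \<odot>\<^bsub>K\<^esub> a, b)"] tendsto_mult[OF tendsto_const[of "cnj c"] l[of "(a, b)"]]
      by (intro LIMSEQ_unique[of "\<lambda>n. \<phi> n (c \<odot>\<^bsub>K\<^esub> a, b)"]) (auto simp: hs_functionalsD[OF hs])
    show "l (a, c \<odot>\<^bsub>H\<^esub> b) = cnj c * l (a, b)" if "a \<in> carrier K" "b \<in> carrier H" for a b c
      using that l[of "(a, c \<odot>\<^bsub>H\<^esub> b)"] tendsto_mult[OF tendsto_const[of "cnj c"] l[of "(a, b)"]]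
      by (intro LIMSEQ_unique[of "\<lambda>n. \<phi> n (a, c \<odot>\<^bsub>H\<^esub> b)"]) (auto simp: hs_functionalsD[OF hs])
    show "cmod (l (a, b)) \<le> M * (hnorm K a * hnorm H b)" if "a \<in> carrier K" "b \<in> carrier H" for a b
    proof (rule LIMSEQ_le_const2[OF tendsto_norm[OF l[of "(a, b)"]]])
      have "cmod (\<phi> n (a, b)) \<le> M * (hnorm K a * hnorm H b)" for n
        using hs_bound[OF hs that, of n] mult_right_mono[OF M[of n], of "hnorm K a * hnorm H b"] that by simp
      then show "\<exists>N. \<forall>n\<ge>N. cmod (\<phi> n (a, b)) \<le> M * (hnorm K a * hnorm H b)" by blast
    qed (use that in auto)
    show "(\<lambda>p. (cmod (l p))\<^sup>2) summable_on B"
    proof (rule nonneg_bdd_above_summable_on)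
      show "bdd_above (sum (\<lambda>p. (cmod (l p))\<^sup>2) ` {F. F \<subseteq> B \<and> finite F})"
      proof (rule bdd_aboveI2)
        fix A assume A: "A \<in> {F. F \<subseteq> B \<and> finite F}"
        have "(\<lambda>n. \<Sum>p\<in>A. (cmod (\<phi> n p))\<^sup>2) \<longlonglongrightarrow> (\<Sum>p\<in>A. (cmod (l p))\<^sup>2)"
          using A onb_pair by (intro tendsto_sum tendsto_power tendsto_norm l) auto
        then show "(\<Sum>p\<in>A. (cmod (l p))\<^sup>2) \<le> M\<^sup>2"
        proof (rule LIMSEQ_le_const2)
          have "(\<Sum>p\<in>A. (cmod (\<phi> n p))\<^sup>2) \<le> M\<^sup>2" for n
            using finite_le[of A "\<phi> n"] power_mono[OF M[of n], of 2] A hs G.hnorm_nonneg[of "\<phi> n"] by simp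
          then show "\<exists>N. \<forall>n\<ge>N. (\<Sum>p\<in>A. (cmod (\<phi> n p))\<^sup>2) \<le> M\<^sup>2" by blast
        qed
      qed
    qed auto
  qed
  have "(\<lambda>n. hnorm G (\<phi> n \<ominus>\<^bsub>G\<^esub> l)) \<longlonglongrightarrow> 0"
  proof (rule LIMSEQ_I)
    fix e :: real assume e: "e > 0"
    obtain N where N: "\<forall>m\<ge>N. \<forall>n\<ge>N. hnorm G (\<phi> m \<ominus>\<^bsub>G\<^esub> \<phi> n) < e / 2"
      using \<phi> e unfolding G.cauchy_def by (meson half_gt_zero)
    have "norm (hnorm G (\<phi> m \<ominus>\<^bsub>G\<^esub> l) - 0) < e" if m: "m \<ge> N" for m
    proof -
      have dhs: "\<phi> m \<ominus>\<^bsub>G\<^esub> l \<in> hs_functionals K H" using G.minus_carrier[of "\<phi> m" l] hs lhs by simp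
      have "(hnorm G (\<phi> m \<ominus>\<^bsub>G\<^esub> l))\<^sup>2 \<le> (e / 2)\<^sup>2"
        unfolding hnorm_htensor[OF dhs]
      proof (rule infsum_le_finite_sums[OF hs_functionalsD(7)[OF dhs]])
        fix A assume A: "finite A" "A \<subseteq> B"
        have "(\<lambda>n. \<Sum>p\<in>A. (cmod ((\<phi> m \<ominus>\<^bsub>G\<^esub> \<phi> n) p))\<^sup>2) \<longlonglongrightarrow> (\<Sum>p\<in>A. (cmod ((\<phi> m \<ominus>\<^bsub>G\<^esub> l) p))\<^sup>2)"
        proof (intro tendsto_sum tendsto_power tendsto_norm)
          fix p assume "p \<in> A"
          then have p: "p \<in> carrier K \<times> carrier H" using A onb_pair by blast
          show "(\<lambda>n. (\<phi> m \<ominus>\<^bsub>G\<^esub> \<phi> n) p) \<longlonglongrightarrow> (\<phi> m \<ominus>\<^bsub>G\<^esub> l) p"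
            using p hs lhs by (simp add: minus_htensor_apply tendsto_diff l)
        qed
        then show "(\<Sum>p\<in>A. (cmod ((\<phi> m \<ominus>\<^bsub>G\<^esub> l) p))\<^sup>2) \<le> (e / 2)\<^sup>2"
        proof (rule LIMSEQ_le_const2)
          have "(\<Sum>p\<in>A. (cmod ((\<phi> m \<ominus>\<^bsub>G\<^esub> \<phi> n) p))\<^sup>2) \<le> (e / 2)\<^sup>2" if n: "n \<ge> N" for n
          proof -
            have mn: "\<phi> m \<ominus>\<^bsub>G\<^esub> \<phi> n \<in> hs_functionals K H" using G.minus_carrier[of "\<phi> m" "\<phi> n"] hs by simp
            have "hnorm G (\<phi> m \<ominus>\<^bsub>G\<^esub> \<phi> n) \<le> e / 2" using N n m by (simp add: less_imp_le)
            then have "(hnorm G (\<phi> m \<ominus>\<^bsub>G\<^esub> \<phi> n))\<^sup>2 \<le> (e / 2)\<^sup>2"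
              using mn G.hnorm_nonneg[of "\<phi> m \<ominus>\<^bsub>G\<^esub> \<phi> n"] by (intro power_mono) auto
            then show ?thesis using finite_le[OF A mn] by linarith
          qed
          then show "\<exists>N. \<forall>n\<ge>N. (\<Sum>p\<in>A. (cmod ((\<phi> m \<ominus>\<^bsub>G\<^esub> \<phi> n) p))\<^sup>2) \<le> (e / 2)\<^sup>2" by blast
        qed
      qed
      then have "hnorm G (\<phi> m \<ominus>\<^bsub>G\<^esub> l) \<le> e / 2" by (rule power2_le_imp_le) (use e in simp)
      then show ?thesis using e G.hnorm_nonneg[of "\<phi> m \<ominus>\<^bsub>G\<^esub> l"] dhs by simp
    qed
    then show "\<exists>no. \<forall>n\<ge>no. norm (hnorm G (\<phi> n \<ominus>\<^bsub>G\<^esub> l) - 0) < e" by blast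
  qed
  then have "G.converges \<phi> l sequentially" using hs lhs by (simp add: G.converges_def)
  then show "\<exists>l. G.converges \<phi> l sequentially" by blast
qed

sublocale G: hilbert_space G
  by (rule hilbert_space_htensor)

lemma vec_tensor_total: "G.total (\<lambda>(x, y). vec_tensor K H x y) (carrier K \<times> carrier H)"
  unfolding G.total_def
proof (intro conjI ballI impI)
  fix \<phi> assume \<phi>: "\<phi> \<in> carrier G"
    and z: "\<forall>i\<in>carrier K \<times> carrier H. ip G ((\<lambda>(x, y). vec_tensor K H x y) i) \<phi> = 0"
  then have "\<phi> p = 0" if "p \<in> carrier K \<times> carrier H" for p using that by (auto simp: ip_vec_tensor)
  then show "\<phi> = \<zero>\<^bsub>G\<^esub>"
    using \<phi> hs_functionalsD(1)[of \<phi>] by (intro extensionalityI[of _ "carrier K \<times> carrier H"]) auto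
qed (auto simp: vec_tensor_hs)

end


section \<open>Tensor products of operators\<close>

context tensor_pair
begin

interpretation KK: hilbert_pair K K by unfold_locales
interpretation HH: hilbert_pair H H by unfold_locales
interpretation GG: hilbert_pair G G by unfold_locales

lemma vec_tensor_add_left:
  "\<lbrakk>x \<in> carrier K; x' \<in> carrier K; y \<in> carrier H\<rbrakk> \<Longrightarrow>
    vec_tensor K H (x \<oplus>\<^bsub>K\<^esub> x') y = vec_tensor K H x y \<oplus>\<^bsub>G\<^esub> vec_tensor K H x' y"
  by (auto simp: vec_tensor_def K.ip_simps distrib_right intro!: restrict_ext)

lemma vec_tensor_add_right:
  "\<lbrakk>x \<in> carrier K; y \<in> carrier H; y' \<in> carrier H\<rbrakk> \<Longrightarrow>
    vec_tensor K H x (y \<oplus>\<^bsub>H\<^esub> y') = vec_tensor K H x y \<oplus>\<^bsub>G\<^esub> vec_tensor K H x y'"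
  by (auto simp: vec_tensor_def H.ip_simps distrib_left intro!: restrict_ext)

lemma vec_tensor_smult_left:
  "\<lbrakk>x \<in> carrier K; y \<in> carrier H\<rbrakk> \<Longrightarrow> vec_tensor K H (c \<odot>\<^bsub>K\<^esub> x) y = c \<odot>\<^bsub>G\<^esub> vec_tensor K H x y"
  by (auto simp: vec_tensor_def K.ip_simps intro!: restrict_ext)

lemma vec_tensor_smult_right:
  "\<lbrakk>x \<in> carrier K; y \<in> carrier H\<rbrakk> \<Longrightarrow> vec_tensor K H x (c \<odot>\<^bsub>H\<^esub> y) = c \<odot>\<^bsub>G\<^esub> vec_tensor K H x y"
  by (auto simp: vec_tensor_def H.ip_simps intro!: restrict_ext)

text \<open>The functional of \<open>(b \<otimes> c) \<phi>\<close> is \<open>\<phi>\<close> precomposed with the adjoints of \<open>b\<close> and \<open>c\<close>. The square sum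
  is estimated in one variable at a time, by Parseval's identity for the slices of \<open>\<phi>\<close>.\<close>

lemma hs_precompose:
  assumes b: "b \<in> carrier (bounded_ops K K)" and c: "c \<in> carrier (bounded_ops H H)"
    and Cb: "0 \<le> Cb" "\<And>x. x \<in> carrier K \<Longrightarrow> hnorm K (b x) \<le> Cb * hnorm K x"
    and Cc: "0 \<le> Cc" "\<And>y. y \<in> carrier H \<Longrightarrow> hnorm H (c y) \<le> Cc * hnorm H y"
    and \<phi>: "\<phi> \<in> hs_functionals K H"
  defines "\<psi> \<equiv> (\<lambda>p\<in>carrier K \<times> carrier H. \<phi> (adj K K b (fst p), adj H H c (snd p)))"
  shows "\<psi> \<in> hs_functionals K H" "hnorm G \<psi> \<le> Cb * Cc * hnorm G \<phi>"
proof -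
  note b' = KK.adj_ops[OF b] and c' = HH.adj_ops[OF c]
  note [simp] = bounded_opsD[OF b'] bounded_opsD[OF c']
  let ?v = "\<lambda>p. (cmod (\<phi> p))\<^sup>2" and ?w = "\<lambda>(e, f). (cmod (\<phi> (e, adj H H c f)))\<^sup>2"
    and ?u = "\<lambda>(e, f). (cmod (\<phi> (adj K K b e, adj H H c f)))\<^sup>2"
  have 1: "(\<lambda>f. ?w (e, f)) summable_on some_onb H"
    "(\<Sum>\<^sub>\<infinity>f\<in>some_onb H. ?w (e, f)) \<le> Cc\<^sup>2 * (\<Sum>\<^sub>\<infinity>f\<in>some_onb H. ?v (e, f))" if e: "e \<in> some_onb K" for e
  proof -
    obtain y where y: "y \<in> carrier H" "\<forall>h\<in>carrier H. \<phi> (e, h) = ip H h y" using slice_right[OF \<phi>] e onbs by blast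
    have cy: "c y \<in> carrier H" using bounded_opsD(2)[OF c y(1)] .
    have v: "((\<lambda>f. ?v (e, f)) has_sum (hnorm H y)\<^sup>2) (some_onb H)"
      using H.Parseval_norm[OF H.is_onb_some_onb y(1)]
      by (rule has_sum_cong[THEN iffD1, rotated]) (use y onbs in auto)
    have w: "((\<lambda>f. ?w (e, f)) has_sum (hnorm H (c y))\<^sup>2) (some_onb H)"
      using H.Parseval_norm[OF H.is_onb_some_onb cy]
      by (rule has_sum_cong[THEN iffD1, rotated]) (use y onbs in \<open>auto simp: HH.ip_adj_left[OF c]\<close>)
    show "(\<lambda>f. ?w (e, f)) summable_on some_onb H" using w by (rule has_sum_imp_summable)
    have "(hnorm H (c y))\<^sup>2 \<le> (Cc * hnorm H y)\<^sup>2" using Cc(2)[OF y(1)] cy by (intro power_mono) auto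
    then show "(\<Sum>\<^sub>\<infinity>f\<in>some_onb H. ?w (e, f)) \<le> Cc\<^sup>2 * (\<Sum>\<^sub>\<infinity>f\<in>some_onb H. ?v (e, f))"
      unfolding infsumI[OF v] infsumI[OF w] by (simp add: power_mult_distrib)
  qed
  have w: "?w summable_on B" "(\<Sum>\<^sub>\<infinity>p\<in>B. ?w p) \<le> Cc\<^sup>2 * (\<Sum>\<^sub>\<infinity>p\<in>B. ?v p)"
    using double_sum_le[of ?w ?v "some_onb K" "some_onb H" "Cc\<^sup>2", OF _ hs_functionalsD(7)[OF \<phi>] 1] by auto
  let ?B' = "some_onb H \<times> some_onb K"
  let ?w' = "\<lambda>(f, e). ?w (e, f)" and ?u' = "\<lambda>(f, e). ?u (e, f)"
  have 2: "(\<lambda>e. ?u' (f, e)) summable_on some_onb K"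
    "(\<Sum>\<^sub>\<infinity>e\<in>some_onb K. ?u' (f, e)) \<le> Cb\<^sup>2 * (\<Sum>\<^sub>\<infinity>e\<in>some_onb K. ?w' (f, e))" if f: "f \<in> some_onb H" for f
  proof -
    have "adj H H c f \<in> carrier H" using onbs f by simp
    then obtain x where x: "x \<in> carrier K" "\<forall>a\<in>carrier K. \<phi> (a, adj H H c f) = ip K a x" using slice_left[OF \<phi>] by blast
    have bx: "b x \<in> carrier K" using bounded_opsD(2)[OF b x(1)] .
    have v: "((\<lambda>e. ?w' (f, e)) has_sum (hnorm K x)\<^sup>2) (some_onb K)"
      using K.Parseval_norm[OF K.is_onb_some_onb x(1)]
      by (rule has_sum_cong[THEN iffD1, rotated]) (use x onbs in auto)
    have w: "((\<lambda>e. ?u' (f, e)) has_sum (hnorm K (b x))\<^sup>2) (some_onb K)"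
      using K.Parseval_norm[OF K.is_onb_some_onb bx]
      by (rule has_sum_cong[THEN iffD1, rotated]) (use x onbs in \<open>auto simp: KK.ip_adj_left[OF b]\<close>)
    show "(\<lambda>e. ?u' (f, e)) summable_on some_onb K" using w by (rule has_sum_imp_summable)
    have "(hnorm K (b x))\<^sup>2 \<le> (Cb * hnorm K x)\<^sup>2" using Cb(2)[OF x(1)] bx by (intro power_mono) auto
    then show "(\<Sum>\<^sub>\<infinity>e\<in>some_onb K. ?u' (f, e)) \<le> Cb\<^sup>2 * (\<Sum>\<^sub>\<infinity>e\<in>some_onb K. ?w' (f, e))"
      unfolding infsumI[OF v] infsumI[OF w] by (simp add: power_mult_distrib)
  qed
  have w': "(?w' has_sum (\<Sum>\<^sub>\<infinity>p\<in>B. ?w p)) ?B'"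
    using has_sum_infsum[OF w(1)] has_sum_swap[where f = ?w] by simp
  have u': "?u' summable_on ?B'" "(\<Sum>\<^sub>\<infinity>p\<in>?B'. ?u' p) \<le> Cb\<^sup>2 * (\<Sum>\<^sub>\<infinity>p\<in>?B'. ?w' p)"
    using double_sum_le[of ?u' ?w' "some_onb H" "some_onb K" "Cb\<^sup>2", OF _ has_sum_imp_summable[OF w'] 2] by auto
  have u: "(?u has_sum (\<Sum>\<^sub>\<infinity>p\<in>?B'. ?u' p)) B"
    using has_sum_infsum[OF u'(1)] has_sum_swap[where f = ?u'] by simp
  have \<psi>u: "((\<lambda>p. (cmod (\<psi> p))\<^sup>2) has_sum (\<Sum>\<^sub>\<infinity>p\<in>?B'. ?u' p)) B"
    using u by (rule has_sum_cong[THEN iffD1, rotated]) (use onbs in \<open>auto simp: \<psi>_def\<close>)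
  obtain Db where Db: "Db \<ge> 0" "\<And>x. x \<in> carrier K \<Longrightarrow> hnorm K (adj K K b x) \<le> Db * hnorm K x" using KK.op_bound[OF b'] by blast
  obtain Dc where Dc: "Dc \<ge> 0" "\<And>x. x \<in> carrier H \<Longrightarrow> hnorm H (adj H H c x) \<le> Dc * hnorm H x" using HH.op_bound[OF c'] by blast
  show hs: "\<psi> \<in> hs_functionals K H"
  proof (rule hs_functionalsI)
    show "cmod (\<psi> (x, y)) \<le> (hnorm G \<phi> * (Db * Dc)) * (hnorm K x * hnorm H y)" if x: "x \<in> carrier K" and y: "y \<in> carrier H" for x y
    proof -
      have "cmod (\<psi> (x, y)) \<le> hnorm G \<phi> * (hnorm K (adj K K b x) * hnorm H (adj H H c y))"
        using hs_bound[OF \<phi>, of "adj K K b x" "adj H H c y"] x y by (simp add: \<psi>_def)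
      also have "\<dots> \<le> hnorm G \<phi> * ((Db * hnorm K x) * (Dc * hnorm H y))"
        using Db Dc x y \<phi> by (intro mult_left_mono mult_mono) auto
      finally show ?thesis by (simp add: mult_ac)
    qed
    show "(\<lambda>p. (cmod (\<psi> p))\<^sup>2) summable_on B" using \<psi>u by (rule has_sum_imp_summable)
  qed (auto simp: \<psi>_def hs_functionalsD[OF \<phi>])
  show "hnorm G \<psi> \<le> Cb * Cc * hnorm G \<phi>"
  proof (rule power2_le_imp_le)
    have "(hnorm G \<psi>)\<^sup>2 \<le> Cb\<^sup>2 * (Cc\<^sup>2 * (hnorm G \<phi>)\<^sup>2)"
      unfolding hnorm_htensor[OF hs] hnorm_htensor[OF \<phi>] infsumI[OF \<psi>u]
      using u'(2) mult_left_mono[OF w(2), of "Cb\<^sup>2"] unfolding infsumI[OF w'] by simp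
    then show "(hnorm G \<psi>)\<^sup>2 \<le> (Cb * Cc * hnorm G \<phi>)\<^sup>2" by (simp add: power_mult_distrib mult_ac)
    show "0 \<le> Cb * Cc * hnorm G \<phi>" using Cb(1) Cc(1) \<phi> by simp
  qed
qed

context
  fixes b c assumes b: "b \<in> carrier (bounded_ops K K)" and c: "c \<in> carrier (bounded_ops H H)"
begin

text \<open>Precomposition with the adjoints has the defining property of the tensor product, and no other operator
  has it because the elementary tensors are total.\<close>

lemma op_tensor_eq:
  "op_tensor K H b c = (\<lambda>\<phi>\<in>hs_functionals K H. \<lambda>p\<in>carrier K \<times> carrier H. \<phi> (adj K K b (fst p), adj H H c (snd p)))"
    (is "_ = ?T")
  and op_tensor_ops: "op_tensor K H b c \<in> carrier (bounded_ops G G)"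
  and op_tensor_vec: "\<lbrakk>x \<in> carrier K; y \<in> carrier H\<rbrakk> \<Longrightarrow> op_tensor K H b c (vec_tensor K H x y) = vec_tensor K H (b x) (c y)"
proof -
  obtain Cb where Cb: "Cb \<ge> 0" "\<And>x. x \<in> carrier K \<Longrightarrow> hnorm K (b x) \<le> Cb * hnorm K x" using KK.op_bound[OF b] by blast
  obtain Cc where Cc: "Cc \<ge> 0" "\<And>x. x \<in> carrier H \<Longrightarrow> hnorm H (c x) \<le> Cc * hnorm H x" using HH.op_bound[OF c] by blast
  note pre = hs_precompose[OF b c Cb Cc]
  note b' = KK.adj_ops[OF b] and c' = HH.adj_ops[OF c]
  have T: "?T \<in> carrier (bounded_ops G G)"
    by (rule bounded_opsI) (use pre bounded_opsD(2)[OF b'] bounded_opsD(2)[OF c'] in \<open>auto simp: smult_hs add_hs intro!: restrict_ext\<close>)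
  have vec: "?T (vec_tensor K H x y) = vec_tensor K H (b x) (c y)" if x: "x \<in> carrier K" and y: "y \<in> carrier H" for x y
    using x y bounded_opsD(2)[OF b'] bounded_opsD(2)[OF c']
    by (auto simp: vec_tensor_hs vec_tensor_def[of K H "b x"] intro!: restrict_ext)
      (simp add: vec_tensor_def KK.ip_adj_left[OF b] HH.ip_adj_left[OF c])
  show eq: "op_tensor K H b c = ?T"
    unfolding op_tensor_def op_algebra_simps
  proof (rule the_equality)
    show "?T \<in> carrier (bounded_ops G G) \<and> (\<forall>x\<in>carrier K. \<forall>y\<in>carrier H. ?T (vec_tensor K H x y) = vec_tensor K H (b x) (c y))"
      using T vec by blast
    fix U assume U: "U \<in> carrier (bounded_ops G G) \<and> (\<forall>x\<in>carrier K. \<forall>y\<in>carrier H. U (vec_tensor K H x y) = vec_tensor K H (b x) (c y))"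
    show "U = ?T"
    proof (rule GG.ops_total_eqI[OF vec_tensor_total _ T])
      fix i assume "i \<in> carrier K \<times> carrier H"
      then obtain x y where i: "i = (x, y)" and xy: "x \<in> carrier K" "y \<in> carrier H" by blast
      have "U (vec_tensor K H x y) = vec_tensor K H (b x) (c y)" using U xy by blast
      also have "\<dots> = ?T (vec_tensor K H x y)" by (rule vec[OF xy, symmetric])
      finally show "U ((\<lambda>(x, y). vec_tensor K H x y) i) = ?T ((\<lambda>(x, y). vec_tensor K H x y) i)"
        unfolding i prod.case .
    qed (use U in blast)
  qed
  show "op_tensor K H b c \<in> carrier (bounded_ops G G)" unfolding eq by (rule T)
  show "\<lbrakk>x \<in> carrier K; y \<in> carrier H\<rbrakk> \<Longrightarrow> op_tensor K H b c (vec_tensor K H x y) = vec_tensor K H (b x) (c y)"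
    unfolding eq by (rule vec)
qed

lemma op_tensor_apply:
  "\<lbrakk>\<phi> \<in> hs_functionals K H; x \<in> carrier K; y \<in> carrier H\<rbrakk> \<Longrightarrow> op_tensor K H b c \<phi> (x, y) = \<phi> (adj K K b x, adj H H c y)"
  by (simp add: op_tensor_eq)

lemma op_tensor_bound:
  assumes "0 \<le> Cb" "\<And>x. x \<in> carrier K \<Longrightarrow> hnorm K (b x) \<le> Cb * hnorm K x"
    and "0 \<le> Cc" "\<And>y. y \<in> carrier H \<Longrightarrow> hnorm H (c y) \<le> Cc * hnorm H y"
    and "\<phi> \<in> hs_functionals K H"
  shows "hnorm G (op_tensor K H b c \<phi>) \<le> Cb * Cc * hnorm G \<phi>"
  using hs_precompose(2)[OF b c assms] assms(5) by (simp add: op_tensor_eq)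

lemma op_tensor_eqI:
  assumes "T \<in> carrier (bounded_ops G G)"
    and "\<And>x y. \<lbrakk>x \<in> carrier K; y \<in> carrier H\<rbrakk> \<Longrightarrow> T (vec_tensor K H x y) = vec_tensor K H (b x) (c y)"
  shows "T = op_tensor K H b c"
  by (rule GG.ops_total_eqI[OF vec_tensor_total assms(1) op_tensor_ops]) (use assms op_tensor_vec in auto)

end

lemma adj_op_tensor:
  assumes b: "b \<in> carrier (bounded_ops K K)" and c: "c \<in> carrier (bounded_ops H H)"
  shows "adj G G (op_tensor K H b c) = op_tensor K H (adj K K b) (adj H H c)"
proof -
  note b' = KK.adj_ops[OF b] and c' = HH.adj_ops[OF c]
  have "adj G G (op_tensor K H b c) (vec_tensor K H x y) = vec_tensor K H (adj K K b x) (adj H H c y)"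
    if x: "x \<in> carrier K" and y: "y \<in> carrier H" for x y
  proof (rule GG.adj_eqI)
    fix \<phi> assume \<phi>: "\<phi> \<in> carrier G"
    have T: "op_tensor K H b c \<phi> \<in> carrier G" using bounded_opsD(2)[OF op_tensor_ops[OF b c] \<phi>] .
    have "ip G (op_tensor K H b c \<phi>) (vec_tensor K H x y) = cnj (ip G (vec_tensor K H x y) (op_tensor K H b c \<phi>))"
      using T vec_tensor_hs[OF x y] by (intro G.ip_commute) auto
    also have "\<dots> = cnj (\<phi> (adj K K b x, adj H H c y))"
      using T x y \<phi> by (simp add: ip_vec_tensor op_tensor_apply[OF b c])
    also have "\<dots> = cnj (ip G (vec_tensor K H (adj K K b x) (adj H H c y)) \<phi>)"
      using \<phi> bounded_opsD(2)[OF b' x] bounded_opsD(2)[OF c' y] by (simp add: ip_vec_tensor)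
    also have "\<dots> = ip G \<phi> (vec_tensor K H (adj K K b x) (adj H H c y))"
      using \<phi> bounded_opsD(2)[OF b' x] bounded_opsD(2)[OF c' y] vec_tensor_hs by (intro G.ip_commute[symmetric]) auto
    finally show "ip G (op_tensor K H b c \<phi>) (vec_tensor K H x y) = ip G \<phi> (vec_tensor K H (adj K K b x) (adj H H c y))" .
  qed (use x y vec_tensor_hs bounded_opsD(2)[OF b' x] bounded_opsD(2)[OF c' y] in auto)
  then show ?thesis
    using GG.ops_total_eqI[OF vec_tensor_total GG.adj_ops[OF op_tensor_ops[OF b c]], of "op_tensor K H (adj K K b) (adj H H c)"]
      op_tensor_ops[OF b' c'] op_tensor_vec[OF b' c'] by auto
qed

lemma compose_op_tensor:
  assumes b: "b \<in> carrier (bounded_ops K K)" "b' \<in> carrier (bounded_ops K K)"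
    and c: "c \<in> carrier (bounded_ops H H)" "c' \<in> carrier (bounded_ops H H)"
  shows "compose (carrier G) (op_tensor K H b c) (op_tensor K H b' c') =
    op_tensor K H (compose (carrier K) b b') (compose (carrier H) c c')"
proof (rule op_tensor_eqI)
  show "compose (carrier K) b b' \<in> carrier (bounded_ops K K)"
    by (rule K.compose_ops[OF b]) unfold_locales
  show "compose (carrier H) c c' \<in> carrier (bounded_ops H H)"
    by (rule H.compose_ops[OF c]) unfold_locales
  show "compose (carrier G) (op_tensor K H b c) (op_tensor K H b' c') \<in> carrier (bounded_ops G G)"
    by (rule G.compose_ops[OF op_tensor_ops[OF b(1) c(1)] op_tensor_ops[OF b(2) c(2)]]) unfold_locales
  fix x y assume xy: "x \<in> carrier K" "y \<in> carrier H"
  then show "compose (carrier G) (op_tensor K H b c) (op_tensor K H b' c') (vec_tensor K H x y)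
      = vec_tensor K H (compose (carrier K) b b' x) (compose (carrier H) c c' y)"
    using bounded_opsD(2)[OF b(2) xy(1)] bounded_opsD(2)[OF c(2) xy(2)]
    by (simp add: compose_def vec_tensor_hs op_tensor_vec[OF b(1) c(1)] op_tensor_vec[OF b(2) c(2)])
qed

lemma op_tensor_add_left:
  assumes b: "b \<in> carrier (bounded_ops K K)" "b' \<in> carrier (bounded_ops K K)" and c: "c \<in> carrier (bounded_ops H H)"
  shows "op_tensor K H b c \<oplus>\<^bsub>bounded_ops G G\<^esub> op_tensor K H b' c = op_tensor K H (b \<oplus>\<^bsub>bounded_ops K K\<^esub> b') c"
proof (rule op_tensor_eqI[OF _ c])
  show "b \<oplus>\<^bsub>bounded_ops K K\<^esub> b' \<in> carrier (bounded_ops K K)" using KK.add_ops[OF b] by simp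
  show "op_tensor K H b c \<oplus>\<^bsub>bounded_ops G G\<^esub> op_tensor K H b' c \<in> carrier (bounded_ops G G)"
    using GG.add_ops[OF op_tensor_ops[OF b(1) c] op_tensor_ops[OF b(2) c]] by simp
  fix x y assume "x \<in> carrier K" "y \<in> carrier H"
  then show "(op_tensor K H b c \<oplus>\<^bsub>bounded_ops G G\<^esub> op_tensor K H b' c) (vec_tensor K H x y)
      = vec_tensor K H ((b \<oplus>\<^bsub>bounded_ops K K\<^esub> b') x) (c y)"
    using bounded_opsD(2)[OF b(1)] bounded_opsD(2)[OF b(2)] bounded_opsD(2)[OF c]
    by (simp add: op_tensor_vec[OF b(1) c] op_tensor_vec[OF b(2) c] vec_tensor_hs vec_tensor_add_left)
qed

lemma op_tensor_add_right:
  assumes b: "b \<in> carrier (bounded_ops K K)" and c: "c \<in> carrier (bounded_ops H H)" "c' \<in> carrier (bounded_ops H H)"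
  shows "op_tensor K H b c \<oplus>\<^bsub>bounded_ops G G\<^esub> op_tensor K H b c' = op_tensor K H b (c \<oplus>\<^bsub>bounded_ops H H\<^esub> c')"
proof (rule op_tensor_eqI[OF b])
  show "c \<oplus>\<^bsub>bounded_ops H H\<^esub> c' \<in> carrier (bounded_ops H H)" using HH.add_ops[OF c] by simp
  show "op_tensor K H b c \<oplus>\<^bsub>bounded_ops G G\<^esub> op_tensor K H b c' \<in> carrier (bounded_ops G G)"
    using GG.add_ops[OF op_tensor_ops[OF b c(1)] op_tensor_ops[OF b c(2)]] by simp
  fix x y assume "x \<in> carrier K" "y \<in> carrier H"
  then show "(op_tensor K H b c \<oplus>\<^bsub>bounded_ops G G\<^esub> op_tensor K H b c') (vec_tensor K H x y)
      = vec_tensor K H (b x) ((c \<oplus>\<^bsub>bounded_ops H H\<^esub> c') y)"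
    using bounded_opsD(2)[OF c(1)] bounded_opsD(2)[OF c(2)] bounded_opsD(2)[OF b]
    by (simp add: op_tensor_vec[OF b c(1)] op_tensor_vec[OF b c(2)] vec_tensor_hs vec_tensor_add_right)
qed

lemma op_tensor_smult_left:
  assumes b: "b \<in> carrier (bounded_ops K K)" and c: "c \<in> carrier (bounded_ops H H)"
  shows "z \<odot>\<^bsub>bounded_ops G G\<^esub> op_tensor K H b c = op_tensor K H (z \<odot>\<^bsub>bounded_ops K K\<^esub> b) c"
proof (rule op_tensor_eqI[OF _ c])
  show "z \<odot>\<^bsub>bounded_ops K K\<^esub> b \<in> carrier (bounded_ops K K)" using KK.smult_ops[OF b] by simp
  show "z \<odot>\<^bsub>bounded_ops G G\<^esub> op_tensor K H b c \<in> carrier (bounded_ops G G)"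
    using GG.smult_ops[OF op_tensor_ops[OF b c]] by simp
  fix x y assume "x \<in> carrier K" "y \<in> carrier H"
  then show "(z \<odot>\<^bsub>bounded_ops G G\<^esub> op_tensor K H b c) (vec_tensor K H x y)
      = vec_tensor K H ((z \<odot>\<^bsub>bounded_ops K K\<^esub> b) x) (c y)"
    using bounded_opsD(2)[OF b] bounded_opsD(2)[OF c]
    by (simp add: op_tensor_vec[OF b c] vec_tensor_hs vec_tensor_smult_left)
qed

lemma op_tensor_smult_right:
  assumes b: "b \<in> carrier (bounded_ops K K)" and c: "c \<in> carrier (bounded_ops H H)"
  shows "z \<odot>\<^bsub>bounded_ops G G\<^esub> op_tensor K H b c = op_tensor K H b (z \<odot>\<^bsub>bounded_ops H H\<^esub> c)"
proof (rule op_tensor_eqI[OF b])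
  show "z \<odot>\<^bsub>bounded_ops H H\<^esub> c \<in> carrier (bounded_ops H H)" using HH.smult_ops[OF c] by simp
  show "z \<odot>\<^bsub>bounded_ops G G\<^esub> op_tensor K H b c \<in> carrier (bounded_ops G G)"
    using GG.smult_ops[OF op_tensor_ops[OF b c]] by simp
  fix x y assume "x \<in> carrier K" "y \<in> carrier H"
  then show "(z \<odot>\<^bsub>bounded_ops G G\<^esub> op_tensor K H b c) (vec_tensor K H x y)
      = vec_tensor K H (b x) ((z \<odot>\<^bsub>bounded_ops H H\<^esub> c) y)"
    using bounded_opsD(2)[OF b] bounded_opsD(2)[OF c]
    by (simp add: op_tensor_vec[OF b c] vec_tensor_hs vec_tensor_smult_right)
qed

text \<open>The value of a functional at \<open>(x, y)\<close> is its inner product with the elementary tensor of \<open>x\<close> and \<open>y\<close>.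
  On bounded sets it is therefore enough to test convergence at a total set of such points.\<close>

lemma limitin_sigma_weak_tensorI:
  assumes F: "F \<noteq> bot"
    and T: "\<forall>\<^sub>F n in F. T n \<in> carrier (bounded_ops G G) \<and> (\<forall>\<phi>\<in>hs_functionals K H. hnorm G (T n \<phi>) \<le> C * hnorm G \<phi>)"
    and L: "L \<in> carrier (bounded_ops G G)"
    and I: "G.total (\<lambda>(x, y). vec_tensor K H x y) I" "I \<subseteq> carrier K \<times> carrier H"
    and conv: "\<And>\<phi> p. \<lbrakk>\<phi> \<in> hs_functionals K H; p \<in> I\<rbrakk> \<Longrightarrow> ((\<lambda>n. T n \<phi> p) \<longlongrightarrow> L \<phi> p) F"
  shows "limitin (sigma_weak G G) T L F"
proof (rule GG.limitin_sigma_weakI[OF F _ L])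
  show "\<forall>\<^sub>F n in F. T n \<in> carrier (bounded_ops G G) \<and> (\<forall>\<phi>\<in>carrier G. hnorm G (T n \<phi>) \<le> C * hnorm G \<phi>)"
    using T by simp
  fix \<psi> \<phi> assume \<psi>: "\<psi> \<in> carrier G" and \<phi>: "\<phi> \<in> carrier G"
  show "((\<lambda>n. ip G \<psi> (T n \<phi>)) \<longlongrightarrow> ip G \<psi> (L \<phi>)) F"
  proof (rule G.weak_convergence_total[OF I(1) _ _ _ \<psi>])
    show "\<forall>\<^sub>F n in F. T n \<phi> \<in> carrier G \<and> hnorm G (T n \<phi>) \<le> C * hnorm G \<phi>"
      using T
    proof eventually_elim
      case (elim n)
      then show ?case using bounded_opsD(2)[of "T n" G G \<phi>] \<phi> by simp
    qed
    show "L \<phi> \<in> carrier G" using bounded_opsD(2)[OF L \<phi>] .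
    fix p assume p: "p \<in> I"
    then obtain x y where xy: "p = (x, y)" "x \<in> carrier K" "y \<in> carrier H" using I by auto
    have "ip G (vec_tensor K H x y) (L \<phi>) = L \<phi> p"
      using xy bounded_opsD(2)[OF L \<phi>] by (simp add: ip_vec_tensor)
    moreover have "\<forall>\<^sub>F n in F. T n \<phi> p = ip G (vec_tensor K H x y) (T n \<phi>)"
      using T
    proof eventually_elim
      case (elim n)
      then show ?case using bounded_opsD(2)[of "T n" G G \<phi>] \<phi> xy by (simp add: ip_vec_tensor)
    qed
    ultimately show "((\<lambda>n. ip G ((\<lambda>(x, y). vec_tensor K H x y) p) (T n \<phi>)) \<longlongrightarrow> ip G ((\<lambda>(x, y). vec_tensor K H x y) p) (L \<phi>)) F"
      using Lim_transform_eventually[OF conv[of \<phi> p]] p \<phi> xy by simp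
  qed
qed

lemma onb_tensor_total: "G.total (\<lambda>(x, y). vec_tensor K H x y) B"
  unfolding G.total_def
proof (intro conjI ballI impI)
  fix \<phi> assume \<phi>: "\<phi> \<in> carrier G" and z: "\<forall>i\<in>B. ip G ((\<lambda>(x, y). vec_tensor K H x y) i) \<phi> = 0"
  then have "\<phi> p = 0" if "p \<in> B" for p using that onbs by (auto simp: ip_vec_tensor)
  then show "\<phi> = \<zero>\<^bsub>G\<^esub>"
    using \<phi> onb_pair by (simp add: hs_onb_eqI zero_hs)
qed (auto simp: vec_tensor_hs onbs)

end


section \<open>Square integrable functions and multiplication operators\<close>

lemma ae_class_eqI:
  assumes "AE x in \<nu>. f x = g x"
  shows "ae_class \<nu> f = ae_class \<nu> g"
proof -
  have "(AE x in \<nu>. h x = f x) \<longleftrightarrow> (AE x in \<nu>. h x = g x)" for h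
  proof
    assume "AE x in \<nu>. h x = f x" then show "AE x in \<nu>. h x = g x" using assms by eventually_elim simp
  next
    assume "AE x in \<nu>. h x = g x" then show "AE x in \<nu>. h x = f x" using assms by eventually_elim simp
  qed
  then show ?thesis by (simp add: ae_class_def)
qed

lemma ae_rep_in:
  assumes "f \<in> borel_measurable \<nu>"
  shows "ae_rep (ae_class \<nu> f) \<in> borel_measurable \<nu>" "AE x in \<nu>. ae_rep (ae_class \<nu> f) x = f x"
proof -
  have "f \<in> ae_class \<nu> f" using assms by (simp add: ae_class_def)
  then have "ae_rep (ae_class \<nu> f) \<in> ae_class \<nu> f" unfolding ae_rep_def by (rule someI[of "\<lambda>h. h \<in> ae_class \<nu> f"])
  then show "ae_rep (ae_class \<nu> f) \<in> borel_measurable \<nu>" "AE x in \<nu>. ae_rep (ae_class \<nu> f) x = f x"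
    by (auto simp: ae_class_def)
qed

definition sq_int :: "'o measure \<Rightarrow> ('o \<Rightarrow> complex) set" where
  "sq_int \<nu> = {f \<in> borel_measurable \<nu>. integrable \<nu> (\<lambda>x. (cmod (f x))\<^sup>2)}"

definition ess_bounded :: "'o measure \<Rightarrow> ('o \<Rightarrow> complex) set" where
  "ess_bounded \<nu> = {f \<in> borel_measurable \<nu>. \<exists>C. AE x in \<nu>. cmod (f x) \<le> C}"

lemma carrier_L2: "carrier (L2 \<nu>) = ae_class \<nu> ` sq_int \<nu>"
  by (simp add: L2_def sq_int_def)

lemma Linf_eq: "Linf \<nu> = ae_class \<nu> ` ess_bounded \<nu>"
  by (simp add: Linf_def ess_bounded_def)

lemma sq_int_measurable: "f \<in> sq_int \<nu> \<Longrightarrow> f \<in> borel_measurable \<nu>"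
  by (simp add: sq_int_def)

lemma sq_int_integrable: "f \<in> sq_int \<nu> \<Longrightarrow> integrable \<nu> (\<lambda>x. (cmod (f x))\<^sup>2)"
  unfolding sq_int_def by blast

lemma ess_bounded_measurable: "f \<in> ess_bounded \<nu> \<Longrightarrow> f \<in> borel_measurable \<nu>"
  by (simp add: ess_bounded_def)

lemma sq_int_add:
  assumes "f \<in> sq_int \<nu>" "g \<in> sq_int \<nu>"
  shows "(\<lambda>x. f x + g x) \<in> sq_int \<nu>"
proof -
  have [measurable]: "f \<in> borel_measurable \<nu>" "g \<in> borel_measurable \<nu>" using assms by (auto simp: sq_int_def)
  have "integrable \<nu> (\<lambda>x. (cmod (f x + g x))\<^sup>2)"
  proof (rule Bochner_Integration.integrable_bound)
    show "integrable \<nu> (\<lambda>x. 2 * (cmod (f x))\<^sup>2 + 2 * (cmod (g x))\<^sup>2)" using assms by (auto simp: sq_int_def)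
    have "(cmod (f x + g x))\<^sup>2 \<le> 2 * (cmod (f x))\<^sup>2 + 2 * (cmod (g x))\<^sup>2" for x
    proof -
      have "(cmod (f x + g x))\<^sup>2 \<le> (cmod (f x) + cmod (g x))\<^sup>2"
        by (intro power_mono norm_triangle_ineq) auto
      also have "\<dots> \<le> 2 * (cmod (f x))\<^sup>2 + 2 * (cmod (g x))\<^sup>2"
        using sum_squares_bound[of "cmod (f x)" "cmod (g x)"] by (simp add: power2_sum)
      finally show ?thesis .
    qed
    then show "AE x in \<nu>. norm ((cmod (f x + g x))\<^sup>2) \<le> norm (2 * (cmod (f x))\<^sup>2 + 2 * (cmod (g x))\<^sup>2)"
      by (intro AE_I2, simp only: real_norm_def abs_power2) (rule order_trans[OF _ abs_ge_self])
  qed measurable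
  then show ?thesis by (simp add: sq_int_def)
qed

lemma sq_int_mult:
  assumes f: "f \<in> ess_bounded \<nu>" and g: "g \<in> sq_int \<nu>"
  shows "(\<lambda>x. f x * g x) \<in> sq_int \<nu>"
proof -
  have [measurable]: "f \<in> borel_measurable \<nu>" "g \<in> borel_measurable \<nu>" using assms by (auto simp: sq_int_def ess_bounded_def)
  obtain C where C: "AE x in \<nu>. cmod (f x) \<le> C" using f by (auto simp: ess_bounded_def)
  have "integrable \<nu> (\<lambda>x. (cmod (f x * g x))\<^sup>2)"
  proof (rule Bochner_Integration.integrable_bound)
    show "integrable \<nu> (\<lambda>x. C\<^sup>2 * (cmod (g x))\<^sup>2)" using assms by (auto simp: sq_int_def)
    show "AE x in \<nu>. norm ((cmod (f x * g x))\<^sup>2) \<le> norm (C\<^sup>2 * (cmod (g x))\<^sup>2)"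
      using C
    proof eventually_elim
      case (elim x)
      then have "(cmod (f x))\<^sup>2 \<le> C\<^sup>2" by (intro power_mono) auto
      then show ?case by (simp add: norm_mult power_mult_distrib mult_right_mono)
    qed
  qed measurable
  then show ?thesis by (simp add: sq_int_def)
qed

lemma ess_boundedI: "\<lbrakk>f \<in> borel_measurable \<nu>; \<And>x. cmod (f x) \<le> C\<rbrakk> \<Longrightarrow> f \<in> ess_bounded \<nu>"
  unfolding ess_bounded_def by (simp add: AE_I2) blast

lemma ess_bounded_indicator: "X \<in> sets \<nu> \<Longrightarrow> (indicator X :: 'o \<Rightarrow> complex) \<in> ess_bounded \<nu>"
  by (rule ess_boundedI[where C = 1]) (simp_all add: indicator_def)

lemma ess_bounded_const: "(\<lambda>x. c) \<in> ess_bounded \<nu>"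
  by (auto simp: ess_bounded_def)

lemma sq_int_smult: "f \<in> sq_int \<nu> \<Longrightarrow> (\<lambda>x. c * f x) \<in> sq_int \<nu>"
  using sq_int_mult[OF ess_bounded_const] .

lemma sq_int_zero: "(\<lambda>x. 0) \<in> sq_int \<nu>"
  by (simp add: sq_int_def)

lemma sq_int_minus: "\<lbrakk>f \<in> sq_int \<nu>; g \<in> sq_int \<nu>\<rbrakk> \<Longrightarrow> (\<lambda>x. f x - g x) \<in> sq_int \<nu>"
  using sq_int_add[of f \<nu> "\<lambda>x. (-1) * g x"] sq_int_smult[of g \<nu> "-1"] by simp

lemma borel_measurable_cnj:
  fixes f :: "'o \<Rightarrow> complex"
  assumes "f \<in> borel_measurable \<nu>"
  shows "(\<lambda>x. cnj (f x)) \<in> borel_measurable \<nu>"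
proof (rule measurable_compose[OF assms])
  show "cnj \<in> borel_measurable borel"
    by (rule borel_measurable_continuous_onI) (intro continuous_intros)
qed

lemma integrable_sq_product:
  assumes "f \<in> sq_int \<nu>" "g \<in> sq_int \<nu>"
  shows "integrable \<nu> (\<lambda>x. cnj (f x) * g x)"
proof (rule Bochner_Integration.integrable_bound)
  show "integrable \<nu> (\<lambda>x. (cmod (f x))\<^sup>2 + (cmod (g x))\<^sup>2)" using assms by (auto simp: sq_int_def)
  show "(\<lambda>x. cnj (f x) * g x) \<in> borel_measurable \<nu>"
    by (intro borel_measurable_times borel_measurable_cnj sq_int_measurable assms)
  have "norm (cnj (f x) * g x) \<le> norm ((cmod (f x))\<^sup>2 + (cmod (g x))\<^sup>2)" for x
  proof -
    have "2 * (cmod (f x) * cmod (g x)) \<le> (cmod (f x))\<^sup>2 + (cmod (g x))\<^sup>2"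
      using sum_squares_bound[of "cmod (f x)" "cmod (g x)"] by simp
    moreover have "0 \<le> cmod (f x) * cmod (g x)" by simp
    ultimately have "cmod (f x) * cmod (g x) \<le> (cmod (f x))\<^sup>2 + (cmod (g x))\<^sup>2" by linarith
    then show ?thesis by (simp add: norm_mult)
  qed
  then show "AE x in \<nu>. norm (cnj (f x) * g x) \<le> norm ((cmod (f x))\<^sup>2 + (cmod (g x))\<^sup>2)" by simp
qed

lemma sq_int_AE_cong:
  assumes "f \<in> sq_int \<nu>" "g \<in> borel_measurable \<nu>" "AE x in \<nu>. g x = f x"
  shows "g \<in> sq_int \<nu>"
proof -
  have [measurable]: "f \<in> borel_measurable \<nu>" "g \<in> borel_measurable \<nu>" using assms by (auto simp: sq_int_def)
  have "integrable \<nu> (\<lambda>x. (cmod (g x))\<^sup>2) \<longleftrightarrow> integrable \<nu> (\<lambda>x. (cmod (f x))\<^sup>2)"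
  proof (rule integrable_cong_AE)
    show "AE x in \<nu>. (cmod (g x))\<^sup>2 = (cmod (f x))\<^sup>2" using assms(3) by eventually_elim simp
  qed measurable
  then show ?thesis using assms by (simp add: sq_int_def)
qed

lemma ae_rep_sq_int: "f \<in> sq_int \<nu> \<Longrightarrow> ae_rep (ae_class \<nu> f) \<in> sq_int \<nu>"
  by (rule sq_int_AE_cong[OF _ ae_rep_in]) (simp_all add: sq_int_measurable)

lemma L2_ops:
  "F \<oplus>\<^bsub>L2 \<nu>\<^esub> G = ae_class \<nu> (\<lambda>x. ae_rep F x + ae_rep G x)"
  "c \<odot>\<^bsub>L2 \<nu>\<^esub> F = ae_class \<nu> (\<lambda>x. c * ae_rep F x)"
  "\<zero>\<^bsub>L2 \<nu>\<^esub> = ae_class \<nu> (\<lambda>x. 0)"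
  "ip (L2 \<nu>) F G = (\<integral>x. cnj (ae_rep F x) * ae_rep G x \<partial>\<nu>)"
  by (simp_all add: L2_def)

lemma L2_class:
  assumes f: "f \<in> sq_int \<nu>" and g: "g \<in> sq_int \<nu>"
  shows "ae_class \<nu> f \<oplus>\<^bsub>L2 \<nu>\<^esub> ae_class \<nu> g = ae_class \<nu> (\<lambda>x. f x + g x)"
    and "c \<odot>\<^bsub>L2 \<nu>\<^esub> ae_class \<nu> f = ae_class \<nu> (\<lambda>x. c * f x)"
    and "\<zero>\<^bsub>L2 \<nu>\<^esub> = ae_class \<nu> (\<lambda>x. 0)"
    and "ip (L2 \<nu>) (ae_class \<nu> f) (ae_class \<nu> g) = (\<integral>x. cnj (f x) * g x \<partial>\<nu>)"
proof -
  note F = ae_rep_in[OF sq_int_measurable[OF f]] and G = ae_rep_in[OF sq_int_measurable[OF g]]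
  show "ae_class \<nu> f \<oplus>\<^bsub>L2 \<nu>\<^esub> ae_class \<nu> g = ae_class \<nu> (\<lambda>x. f x + g x)"
    unfolding L2_ops
    by (rule ae_class_eqI, use F(2) G(2) in eventually_elim) simp
  show "c \<odot>\<^bsub>L2 \<nu>\<^esub> ae_class \<nu> f = ae_class \<nu> (\<lambda>x. c * f x)"
    unfolding L2_ops
    by (rule ae_class_eqI, use F(2) in eventually_elim) simp
  show "\<zero>\<^bsub>L2 \<nu>\<^esub> = ae_class \<nu> (\<lambda>x. 0)" by (rule L2_ops(3))
  have 1: "integrable \<nu> (\<lambda>x. cnj (ae_rep (ae_class \<nu> f) x) * ae_rep (ae_class \<nu> g) x)"
    by (intro integrable_sq_product ae_rep_sq_int f g)
  show "ip (L2 \<nu>) (ae_class \<nu> f) (ae_class \<nu> g) = (\<integral>x. cnj (f x) * g x \<partial>\<nu>)"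
    unfolding L2_ops
  proof (rule integral_cong_AE)
    show "AE x in \<nu>. cnj (ae_rep (ae_class \<nu> f) x) * ae_rep (ae_class \<nu> g) x = cnj (f x) * g x"
      using F(2) G(2) by eventually_elim simp
  qed (rule borel_measurable_integrable[OF 1], rule borel_measurable_integrable[OF integrable_sq_product[OF f g]])
qed

lemma inner_space_L2: "inner_space (L2 \<nu>)"
proof (intro inner_space.intro semi_inner_space.intro inner_space_axioms.intro)
  have ex: "\<exists>f\<in>sq_int \<nu>. x = ae_class \<nu> f" if "x \<in> carrier (L2 \<nu>)" for x using that by (auto simp: carrier_L2)
  have zero: "\<zero>\<^bsub>L2 \<nu>\<^esub> = ae_class \<nu> (\<lambda>x. 0)" by (simp add: L2_def)
  show "Module.module complex_ring (L2 \<nu>)"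
  proof (rule Module.moduleI[OF cring_complex_ring])
    show "abelian_group (L2 \<nu>)"
    proof (rule abelian_groupI)
      fix x y z assume "x \<in> carrier (L2 \<nu>)" "y \<in> carrier (L2 \<nu>)" "z \<in> carrier (L2 \<nu>)"
      then obtain f g h where *: "f \<in> sq_int \<nu>" "g \<in> sq_int \<nu>" "h \<in> sq_int \<nu>" "x = ae_class \<nu> f" "y = ae_class \<nu> g" "z = ae_class \<nu> h"
        using ex by metis
      then show "x \<oplus>\<^bsub>L2 \<nu>\<^esub> y \<oplus>\<^bsub>L2 \<nu>\<^esub> z = x \<oplus>\<^bsub>L2 \<nu>\<^esub> (y \<oplus>\<^bsub>L2 \<nu>\<^esub> z)" by (simp add: L2_class sq_int_add add.assoc)
    next
      fix x y assume "x \<in> carrier (L2 \<nu>)" "y \<in> carrier (L2 \<nu>)"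
      then obtain f g where *: "f \<in> sq_int \<nu>" "g \<in> sq_int \<nu>" "x = ae_class \<nu> f" "y = ae_class \<nu> g"
        using ex by metis
      then show "x \<oplus>\<^bsub>L2 \<nu>\<^esub> y = y \<oplus>\<^bsub>L2 \<nu>\<^esub> x" "x \<oplus>\<^bsub>L2 \<nu>\<^esub> y \<in> carrier (L2 \<nu>)"
        by (auto simp: L2_class sq_int_add add.commute carrier_L2)
    next
      fix x assume "x \<in> carrier (L2 \<nu>)"
      then obtain f where *: "f \<in> sq_int \<nu>" "x = ae_class \<nu> f" using ex by metis
      then show "\<zero>\<^bsub>L2 \<nu>\<^esub> \<oplus>\<^bsub>L2 \<nu>\<^esub> x = x" by (simp add: zero L2_class(1) sq_int_zero)
      show "\<exists>y\<in>carrier (L2 \<nu>). y \<oplus>\<^bsub>L2 \<nu>\<^esub> x = \<zero>\<^bsub>L2 \<nu>\<^esub>"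
        using * sq_int_smult[of f \<nu> "-1"]
        by (intro bexI[of _ "ae_class \<nu> (\<lambda>x. - f x)"]) (auto simp: zero L2_class(1) carrier_L2)
    qed (auto simp: zero carrier_L2 sq_int_zero)
  next
    fix a b x assume "x \<in> carrier (L2 \<nu>)"
    then obtain f where *: "f \<in> sq_int \<nu>" "x = ae_class \<nu> f" using ex by metis
    show "a \<odot>\<^bsub>L2 \<nu>\<^esub> x \<in> carrier (L2 \<nu>)" using * by (auto simp: L2_class(2)[OF *(1,1)] carrier_L2 sq_int_smult)
    show "(a \<oplus>\<^bsub>complex_ring\<^esub> b) \<odot>\<^bsub>L2 \<nu>\<^esub> x = a \<odot>\<^bsub>L2 \<nu>\<^esub> x \<oplus>\<^bsub>L2 \<nu>\<^esub> b \<odot>\<^bsub>L2 \<nu>\<^esub> x"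
      using * by (simp add: L2_class(2)[OF *(1,1)] L2_class(1) sq_int_smult complex_ring_def distrib_right)
    show "(a \<otimes>\<^bsub>complex_ring\<^esub> b) \<odot>\<^bsub>L2 \<nu>\<^esub> x = a \<odot>\<^bsub>L2 \<nu>\<^esub> (b \<odot>\<^bsub>L2 \<nu>\<^esub> x)"
      using * by (simp add: L2_class(2)[OF *(1,1)] L2_class(2)[OF sq_int_smult[OF *(1)] *(1)] complex_ring_def mult.assoc)
    show "\<one>\<^bsub>complex_ring\<^esub> \<odot>\<^bsub>L2 \<nu>\<^esub> x = x"
      using * by (simp add: L2_class(2)[OF *(1,1)] complex_ring_def)
    fix y assume "y \<in> carrier (L2 \<nu>)"
    then obtain g where g: "g \<in> sq_int \<nu>" "y = ae_class \<nu> g" using ex by metis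
    show "a \<odot>\<^bsub>L2 \<nu>\<^esub> (x \<oplus>\<^bsub>L2 \<nu>\<^esub> y) = a \<odot>\<^bsub>L2 \<nu>\<^esub> x \<oplus>\<^bsub>L2 \<nu>\<^esub> a \<odot>\<^bsub>L2 \<nu>\<^esub> y"
      using * g by (simp add: L2_class(1) L2_class(2)[OF *(1,1)] L2_class(2)[OF g(1,1)] L2_class(2)[OF sq_int_add[OF *(1) g(1)] *(1)] sq_int_smult distrib_left)
  qed
  fix x y z c assume "x \<in> carrier (L2 \<nu>)" "y \<in> carrier (L2 \<nu>)"
  then obtain f g where *: "f \<in> sq_int \<nu>" "g \<in> sq_int \<nu>" "x = ae_class \<nu> f" "y = ae_class \<nu> g"
    using ex by metis
  note I = integrable_sq_product
  show "ip (L2 \<nu>) x (c \<odot>\<^bsub>L2 \<nu>\<^esub> y) = c * ip (L2 \<nu>) x y"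
    using * by (simp add: L2_class(2)[OF *(2,2)] L2_class(4) sq_int_smult mult.left_commute[of _ c])
  show "ip (L2 \<nu>) y x = cnj (ip (L2 \<nu>) x y)"
    unfolding *(3,4) L2_class(4)[OF *(1,2)] L2_class(4)[OF *(2,1)] Bochner_Integration.integral_cnj[symmetric]
    by (simp add: mult.commute)
  assume "z \<in> carrier (L2 \<nu>)"
  then obtain h where h: "h \<in> sq_int \<nu>" "z = ae_class \<nu> h" using ex by metis
  show "ip (L2 \<nu>) x (y \<oplus>\<^bsub>L2 \<nu>\<^esub> z) = ip (L2 \<nu>) x y + ip (L2 \<nu>) x z"
    using * h I[OF *(1,2)] I[OF *(1) h(1)] by (simp add: L2_class(1) L2_class(4) sq_int_add distrib_left)
next
  fix x assume "x \<in> carrier (L2 \<nu>)"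
  then obtain f where *: "f \<in> sq_int \<nu>" "x = ae_class \<nu> f" by (auto simp: carrier_L2)
  have "ip (L2 \<nu>) x x = (\<integral>x. complex_of_real ((cmod (f x))\<^sup>2) \<partial>\<nu>)"
    unfolding *(2) L2_class(4)[OF *(1,1)] by (rule Bochner_Integration.integral_cong) (simp_all add: complex_norm_square mult.commute del: of_real_power)
  also have "\<dots> = complex_of_real (\<integral>x. (cmod (f x))\<^sup>2 \<partial>\<nu>)" by (rule integral_of_real[OF sq_int_integrable[OF *(1)]])
  finally have e: "ip (L2 \<nu>) x x = complex_of_real (\<integral>x. (cmod (f x))\<^sup>2 \<partial>\<nu>)" .
  then show "0 \<le> Re (ip (L2 \<nu>) x x)" by simp
  assume "ip (L2 \<nu>) x x = 0"
  then have "(\<integral>x. (cmod (f x))\<^sup>2 \<partial>\<nu>) = 0" using e by simp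
  moreover have "integrable \<nu> (\<lambda>x. (cmod (f x))\<^sup>2)" by (rule sq_int_integrable[OF *(1)])
  ultimately have "AE x in \<nu>. (cmod (f x))\<^sup>2 = 0" by (subst (asm) integral_nonneg_eq_0_iff_AE) auto
  then show "x = \<zero>\<^bsub>L2 \<nu>\<^esub>" unfolding *(2) L2_class(3)[OF *(1,1)] by (intro ae_class_eqI) auto
qed

lemma power2_hnorm_L2:
  assumes f: "f \<in> sq_int \<nu>"
  shows "(hnorm (L2 \<nu>) (ae_class \<nu> f))\<^sup>2 = (\<integral>x. (cmod (f x))\<^sup>2 \<partial>\<nu>)"
    and "ennreal ((hnorm (L2 \<nu>) (ae_class \<nu> f))\<^sup>2) = (\<integral>\<^sup>+x. ennreal ((cmod (f x))\<^sup>2) \<partial>\<nu>)"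
proof -
  interpret L: inner_space "L2 \<nu>" by (rule inner_space_L2)
  have "ip (L2 \<nu>) (ae_class \<nu> f) (ae_class \<nu> f) = (\<integral>x. complex_of_real ((cmod (f x))\<^sup>2) \<partial>\<nu>)"
    unfolding L2_class(4)[OF f f] by (rule Bochner_Integration.integral_cong) (simp_all add: complex_norm_square mult.commute del: of_real_power)
  also have "\<dots> = complex_of_real (\<integral>x. (cmod (f x))\<^sup>2 \<partial>\<nu>)" by (rule integral_of_real[OF sq_int_integrable[OF f]])
  finally show *: "(hnorm (L2 \<nu>) (ae_class \<nu> f))\<^sup>2 = (\<integral>x. (cmod (f x))\<^sup>2 \<partial>\<nu>)"
    using f by (subst L.power2_hnorm) (auto simp: carrier_L2)
  show "ennreal ((hnorm (L2 \<nu>) (ae_class \<nu> f))\<^sup>2) = (\<integral>\<^sup>+x. ennreal ((cmod (f x))\<^sup>2) \<partial>\<nu>)"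
    unfolding * by (rule nn_integral_eq_integral[symmetric]) (simp_all add: sq_int_integrable[OF f])
qed

lemma L2_minus:
  assumes f: "f \<in> sq_int \<nu>" and g: "g \<in> sq_int \<nu>"
  shows "ae_class \<nu> f \<ominus>\<^bsub>L2 \<nu>\<^esub> ae_class \<nu> g = ae_class \<nu> (\<lambda>x. f x - g x)"
proof -
  interpret L: inner_space "L2 \<nu>" by (rule inner_space_L2)
  have c: "ae_class \<nu> (\<lambda>x. f x - g x) \<in> carrier (L2 \<nu>)" "ae_class \<nu> f \<in> carrier (L2 \<nu>)" "ae_class \<nu> g \<in> carrier (L2 \<nu>)"
    using f g sq_int_minus by (auto simp: carrier_L2)
  have "ae_class \<nu> f = ae_class \<nu> (\<lambda>x. f x - g x) \<oplus>\<^bsub>L2 \<nu>\<^esub> ae_class \<nu> g"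
    using f g by (simp add: L2_class(1) sq_int_minus)
  then have "ip (L2 \<nu>) z (ae_class \<nu> f) = ip (L2 \<nu>) z (ae_class \<nu> (\<lambda>x. f x - g x)) + ip (L2 \<nu>) z (ae_class \<nu> g)"
    if "z \<in> carrier (L2 \<nu>)" for z using L.ip_add[OF that c(1,3)] by simp
  then show ?thesis using c by (intro L.vec_eqI L.minus_carrier) (simp_all add: L.ip_minus)
qed

text \<open>Riesz and Fischer: a subsequence with \<open>\<Sum>k. 4 ^ k * \<parallel>f (k + 1) - f k\<parallel>\<^sup>2\<close> finite converges
  almost everywhere, and Fatou's lemma identifies its pointwise limit with the limit in norm.\<close>

theorem hilbert_space_L2: "hilbert_space (L2 \<nu>)"
proof -
  interpret L: inner_space "L2 \<nu>" by (rule inner_space_L2)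
  show ?thesis
  proof (rule L.hilbert_spaceI)
    fix u assume u: "L.cauchy u"
    then have "\<forall>n. \<exists>f\<in>sq_int \<nu>. u n = ae_class \<nu> f" using L.cauchy_carrier[OF u] by (auto simp: carrier_L2)
    then obtain f where f: "\<And>n. f n \<in> sq_int \<nu>" "\<And>n. u n = ae_class \<nu> (f n)" by metis
    have [measurable]: "f n \<in> borel_measurable \<nu>" for n using f(1) sq_int_measurable by blast
    have diff: "(\<integral>\<^sup>+x. ennreal ((cmod (f m x - f n x))\<^sup>2) \<partial>\<nu>) = ennreal ((hnorm (L2 \<nu>) (u m \<ominus>\<^bsub>L2 \<nu>\<^esub> u n))\<^sup>2)" for m n
      unfolding f(2) L2_minus[OF f(1) f(1)] using power2_hnorm_L2(2)[OF sq_int_minus[OF f(1) f(1)]] by simp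
    have cau: "\<exists>N. \<forall>m\<ge>N. \<forall>n\<ge>N. (\<integral>\<^sup>+x. ennreal ((cmod (f m x - f n x))\<^sup>2) \<partial>\<nu>) \<le> ennreal (e\<^sup>2)" if e: "e > 0" for e
    proof -
      obtain N where N: "\<forall>m\<ge>N. \<forall>n\<ge>N. hnorm (L2 \<nu>) (u m \<ominus>\<^bsub>L2 \<nu>\<^esub> u n) < e" using u e unfolding L.cauchy_def by blast
      have "(hnorm (L2 \<nu>) (u m \<ominus>\<^bsub>L2 \<nu>\<^esub> u n))\<^sup>2 \<le> e\<^sup>2" if "m \<ge> N" "n \<ge> N" for m n
        using N that L.cauchy_carrier[OF u] by (intro power_mono) (auto intro: less_imp_le)
      then show ?thesis unfolding diff by (intro exI[of _ N]) (auto intro: ennreal_leI)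
    qed
    have "\<forall>k. \<exists>N. \<forall>m\<ge>N. \<forall>n\<ge>N. (\<integral>\<^sup>+x. ennreal ((cmod (f m x - f n x))\<^sup>2) \<partial>\<nu>) \<le> ennreal (((1/4)^k)\<^sup>2)"
      by (intro allI cau) simp
    then obtain N0 where N0: "\<And>k m n. m \<ge> N0 k \<Longrightarrow> n \<ge> N0 k \<Longrightarrow> (\<integral>\<^sup>+x. ennreal ((cmod (f m x - f n x))\<^sup>2) \<partial>\<nu>) \<le> ennreal (((1/4)^k)\<^sup>2)"
      by metis
    \<comment> \<open>an increasing sequence of indices, \<open>r k\<close> beyond \<open>N0 k\<close>\<close>
    define r where "r k = (\<Sum>i\<le>k. N0 i) + k" for k
    have r: "r k \<ge> N0 k" "r (Suc k) \<ge> r k" "r k \<ge> k" for k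
      using member_le_sum[of k "{..k}" N0] by (simp_all add: r_def)
    have r': "r (Suc k) \<ge> N0 k" for k using r(1,2)[of k] by linarith
    define d where "d k x = f (r (Suc k)) x - f (r k) x" for k x
    have [measurable]: "d k \<in> borel_measurable \<nu>" for k unfolding d_def by measurable
    have "(\<integral>\<^sup>+x. (\<Sum>k. ennreal (4 ^ k * (cmod (d k x))\<^sup>2)) \<partial>\<nu>) = (\<Sum>k. \<integral>\<^sup>+x. ennreal (4 ^ k * (cmod (d k x))\<^sup>2) \<partial>\<nu>)"
      by (rule nn_integral_suminf) measurable
    also have "\<dots> \<le> (\<Sum>k. ennreal ((1/4) ^ k))"
    proof (rule suminf_le)
      fix k
      have "(\<integral>\<^sup>+x. ennreal (4 ^ k * (cmod (d k x))\<^sup>2) \<partial>\<nu>) = ennreal (4 ^ k) * (\<integral>\<^sup>+x. ennreal ((cmod (d k x))\<^sup>2) \<partial>\<nu>)"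
        unfolding ennreal_mult[OF zero_le_power[OF zero_le_numeral] zero_le_power2]
        by (rule nn_integral_cmult) measurable
      also have "\<dots> \<le> ennreal (4 ^ k) * ennreal (((1/4)^k)\<^sup>2)"
        unfolding d_def by (rule mult_left_mono[OF N0[OF r' r(1)]]) simp
      also have "\<dots> = ennreal ((1/4) ^ k)"
      proof -
        have "(4::real) ^ k * ((1/4) ^ k)\<^sup>2 = (1/4) ^ k"
          unfolding power2_eq_square power_mult_distrib[symmetric] by simp
        then show ?thesis by (simp only: ennreal_mult[symmetric] zero_le_power zero_le_power2 zero_le_numeral)
      qed
      finally show "(\<integral>\<^sup>+x. ennreal (4 ^ k * (cmod (d k x))\<^sup>2) \<partial>\<nu>) \<le> ennreal ((1/4) ^ k)" .
    qed auto
    also have "\<dots> = ennreal (\<Sum>k. (1/4) ^ k)" by (rule suminf_ennreal2) (simp_all add: summable_geometric)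
    finally have "(\<integral>\<^sup>+x. (\<Sum>k. ennreal (4 ^ k * (cmod (d k x))\<^sup>2)) \<partial>\<nu>) \<noteq> \<infinity>"
    proof -
      assume "(\<integral>\<^sup>+x. (\<Sum>k. ennreal (4 ^ k * (cmod (d k x))\<^sup>2)) \<partial>\<nu>) \<le> ennreal (\<Sum>k. (1/4) ^ k)"
      also have "\<dots> < \<infinity>" by simp
      finally show ?thesis by simp
    qed
    then have fin: "AE x in \<nu>. (\<Sum>k. ennreal (4 ^ k * (cmod (d k x))\<^sup>2)) \<noteq> \<infinity>"
      by (intro nn_integral_noteq_infinite) auto
    have conv: "AE x in \<nu>. convergent (\<lambda>k. f (r k) x)"
      using fin
    proof eventually_elim
      case (elim x)
      define s where "s = enn2real (\<Sum>k. ennreal (4 ^ k * (cmod (d k x))\<^sup>2))"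
      have s: "(\<Sum>k. ennreal (4 ^ k * (cmod (d k x))\<^sup>2)) = ennreal s" "s \<ge> 0"
        using elim unfolding s_def by (simp_all add: ennreal_enn2real_if)
      have le: "cmod (d k x) \<le> sqrt s * (1/2) ^ k" for k
      proof (rule power2_le_imp_le)
        have "(\<Sum>j\<in>{k}. ennreal (4 ^ j * (cmod (d j x))\<^sup>2)) \<le> (\<Sum>j. ennreal (4 ^ j * (cmod (d j x))\<^sup>2))"
          by (rule sum_le_suminf) simp_all
        then have "ennreal (4 ^ k * (cmod (d k x))\<^sup>2) \<le> ennreal s" unfolding s(1) by simp
        then have "4 ^ k * (cmod (d k x))\<^sup>2 \<le> s" unfolding ennreal_le_iff[OF s(2)] .
        then have "(cmod (d k x))\<^sup>2 \<le> s / 4 ^ k" by (simp add: pos_le_divide_eq mult.commute)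
        also have "\<dots> = s * (1/4) ^ k" by (simp add: power_divide)
        also have "(1/4 :: real) ^ k = ((1/2) ^ k)\<^sup>2"
          unfolding power2_eq_square power_mult_distrib[symmetric] by simp
        also have "s * ((1/2) ^ k)\<^sup>2 = (sqrt s * (1/2) ^ k)\<^sup>2"
          using s(2) by (simp only: power_mult_distrib real_sqrt_pow2)
        finally show "(cmod (d k x))\<^sup>2 \<le> (sqrt s * (1/2) ^ k)\<^sup>2" .
      qed (use s in simp)
      have "summable (\<lambda>k. sqrt s * (1/2) ^ k)" by (rule summable_mult, rule summable_geometric) simp
      then have "summable (\<lambda>k. d k x)" by (rule summable_comparison_test') (rule le)
      then have "convergent (\<lambda>n. \<Sum>k<n. d k x)" by (simp add: summable_iff_convergent)
      moreover have "(\<Sum>k<n. d k x) = f (r n) x - f (r 0) x" for n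
        unfolding d_def by (rule sum_lessThan_telescope)
      ultimately have "convergent (\<lambda>n. f (r n) x - f (r 0) x)" by simp
      then have "convergent (\<lambda>n. (f (r n) x - f (r 0) x) + f (r 0) x)" by (intro convergent_add convergent_const)
      then show ?case by simp
    qed
    define l where "l x = lim (\<lambda>k. f (r k) x)" for x
    have [measurable]: "l \<in> borel_measurable \<nu>" unfolding l_def by measurable
    have fatou: "(\<integral>\<^sup>+x. ennreal ((cmod (f m x - l x))\<^sup>2) \<partial>\<nu>) \<le> ennreal (e\<^sup>2)"
      if N: "\<forall>m\<ge>N. \<forall>n\<ge>N. (\<integral>\<^sup>+x. ennreal ((cmod (f m x - f n x))\<^sup>2) \<partial>\<nu>) \<le> ennreal (e\<^sup>2)" and m: "m \<ge> N" for m N e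
    proof -
      have "AE x in \<nu>. ennreal ((cmod (f m x - l x))\<^sup>2) = liminf (\<lambda>k. ennreal ((cmod (f m x - f (r k) x))\<^sup>2))"
        using conv
      proof eventually_elim
        case (elim x)
        then have "(\<lambda>k. f (r k) x) \<longlonglongrightarrow> l x" by (simp add: l_def convergent_LIMSEQ_iff)
        then have "(\<lambda>k. ennreal ((cmod (f m x - f (r k) x))\<^sup>2)) \<longlonglongrightarrow> ennreal ((cmod (f m x - l x))\<^sup>2)"
          by (intro tendsto_ennrealI tendsto_power tendsto_norm tendsto_diff tendsto_const)
        then show ?case by (intro lim_imp_Liminf[symmetric]) auto
      qed
      then have "(\<integral>\<^sup>+x. ennreal ((cmod (f m x - l x))\<^sup>2) \<partial>\<nu>) = (\<integral>\<^sup>+x. liminf (\<lambda>k. ennreal ((cmod (f m x - f (r k) x))\<^sup>2)) \<partial>\<nu>)"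
        by (rule nn_integral_cong_AE)
      also have "\<dots> \<le> liminf (\<lambda>k. \<integral>\<^sup>+x. ennreal ((cmod (f m x - f (r k) x))\<^sup>2) \<partial>\<nu>)"
        by (rule nn_integral_liminf) measurable
      also have "\<dots> \<le> ennreal (e\<^sup>2)"
      proof -
        have "\<forall>\<^sub>F k in sequentially. (\<integral>\<^sup>+x. ennreal ((cmod (f m x - f (r k) x))\<^sup>2) \<partial>\<nu>) \<le> ennreal (e\<^sup>2)"
          using eventually_ge_at_top[of N]
        proof eventually_elim
          case (elim k)
          then show ?case using N m r(3)[of k] by simp
        qed
        then have "liminf (\<lambda>k. \<integral>\<^sup>+x. ennreal ((cmod (f m x - f (r k) x))\<^sup>2) \<partial>\<nu>) \<le> liminf (\<lambda>k. ennreal (e\<^sup>2))"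
          by (rule Liminf_mono)
        then show ?thesis by (simp add: Liminf_const)
      qed
      finally show ?thesis .
    qed
    have sq: "(\<lambda>x. f m x - l x) \<in> sq_int \<nu>"
      if N: "\<forall>m\<ge>N. \<forall>n\<ge>N. (\<integral>\<^sup>+x. ennreal ((cmod (f m x - f n x))\<^sup>2) \<partial>\<nu>) \<le> ennreal (e\<^sup>2)" and m: "m \<ge> N" for m N e
    proof -
      have "integrable \<nu> (\<lambda>x. (cmod (f m x - l x))\<^sup>2)"
      proof (rule integrableI_bounded)
        have "(\<integral>\<^sup>+x. ennreal (norm ((cmod (f m x - l x))\<^sup>2)) \<partial>\<nu>) \<le> ennreal (e\<^sup>2)" using fatou[OF N m] by simp
        then show "(\<integral>\<^sup>+x. ennreal (norm ((cmod (f m x - l x))\<^sup>2)) \<partial>\<nu>) < \<infinity>"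
          by (rule le_less_trans) simp
      qed measurable
      then show ?thesis by (simp add: sq_int_def)
    qed
    have l: "l \<in> sq_int \<nu>"
    proof -
      obtain N where "\<forall>m\<ge>N. \<forall>n\<ge>N. (\<integral>\<^sup>+x. ennreal ((cmod (f m x - f n x))\<^sup>2) \<partial>\<nu>) \<le> ennreal (1\<^sup>2)"
        using cau[OF zero_less_one] by blast
      from sq_int_minus[OF f(1)[of N] sq[OF this order_refl]] show ?thesis by simp
    qed
    have "(\<lambda>n. hnorm (L2 \<nu>) (u n \<ominus>\<^bsub>L2 \<nu>\<^esub> ae_class \<nu> l)) \<longlonglongrightarrow> 0"
    proof (rule LIMSEQ_I)
      fix e :: real assume e: "e > 0"
      obtain N where N: "\<forall>m\<ge>N. \<forall>n\<ge>N. (\<integral>\<^sup>+x. ennreal ((cmod (f m x - f n x))\<^sup>2) \<partial>\<nu>) \<le> ennreal ((e/2)\<^sup>2)"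
        using cau[OF half_gt_zero[OF e]] by blast
      have "norm (hnorm (L2 \<nu>) (u m \<ominus>\<^bsub>L2 \<nu>\<^esub> ae_class \<nu> l) - 0) < e" if m: "m \<ge> N" for m
      proof -
        have "ennreal ((hnorm (L2 \<nu>) (u m \<ominus>\<^bsub>L2 \<nu>\<^esub> ae_class \<nu> l))\<^sup>2) \<le> ennreal ((e/2)\<^sup>2)"
          unfolding f(2) L2_minus[OF f(1) l] power2_hnorm_L2(2)[OF sq_int_minus[OF f(1) l]] by (rule fatou[OF N m])
        then have "(hnorm (L2 \<nu>) (u m \<ominus>\<^bsub>L2 \<nu>\<^esub> ae_class \<nu> l))\<^sup>2 \<le> (e/2)\<^sup>2"
          unfolding ennreal_le_iff[OF zero_le_power2] .
        then have "hnorm (L2 \<nu>) (u m \<ominus>\<^bsub>L2 \<nu>\<^esub> ae_class \<nu> l) \<le> e / 2"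
          by (rule power2_le_imp_le) (use e in simp)
        moreover have "0 \<le> hnorm (L2 \<nu>) (u m \<ominus>\<^bsub>L2 \<nu>\<^esub> ae_class \<nu> l)"
          by (rule L.hnorm_nonneg, rule L.minus_carrier) (simp_all add: f carrier_L2 l)
        ultimately show ?thesis using e by simp
      qed
      then show "\<exists>no. \<forall>n\<ge>no. norm (hnorm (L2 \<nu>) (u n \<ominus>\<^bsub>L2 \<nu>\<^esub> ae_class \<nu> l) - 0) < e" by blast
    qed
    then have "L.converges u (ae_class \<nu> l) sequentially"
      using L.cauchy_carrier[OF u] l by (auto simp: L.converges_def carrier_L2)
    then show "\<exists>l. L.converges u l sequentially" by blast
  qed
qed


lemma mult_op_class:
  assumes f: "f \<in> ess_bounded \<nu>" and g: "g \<in> sq_int \<nu>"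
  shows "mult_op \<nu> (ae_class \<nu> f) (ae_class \<nu> g) = ae_class \<nu> (\<lambda>x. f x * g x)"
proof -
  have "mult_op \<nu> (ae_class \<nu> f) (ae_class \<nu> g) = ae_class \<nu> (\<lambda>x. ae_rep (ae_class \<nu> f) x * ae_rep (ae_class \<nu> g) x)"
    using g by (simp add: mult_op_def carrier_L2)
  also have "\<dots> = ae_class \<nu> (\<lambda>x. f x * g x)"
    by (rule ae_class_eqI, use ae_rep_in(2)[OF ess_bounded_measurable[OF f]] ae_rep_in(2)[OF sq_int_measurable[OF g]] in eventually_elim) simp
  finally show ?thesis .
qed

lemma ess_bounded_cnj: "f \<in> ess_bounded \<nu> \<Longrightarrow> (\<lambda>x. cnj (f x)) \<in> ess_bounded \<nu>"
  by (simp add: ess_bounded_def borel_measurable_cnj)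

lemma ess_bounded_mult:
  assumes "f \<in> ess_bounded \<nu>" "g \<in> ess_bounded \<nu>"
  shows "(\<lambda>x. f x * g x) \<in> ess_bounded \<nu>"
proof -
  obtain C D where C: "AE x in \<nu>. cmod (f x) \<le> C" and D: "AE x in \<nu>. cmod (g x) \<le> D"
    using assms unfolding ess_bounded_def by blast
  have "AE x in \<nu>. cmod (f x * g x) \<le> C * D"
    using C D
  proof eventually_elim
    case (elim x)
    have "0 \<le> C" using elim(1) norm_ge_zero order_trans by blast
    then show ?case using elim by (simp add: norm_mult mult_mono)
  qed
  moreover have "(\<lambda>x. f x * g x) \<in> borel_measurable \<nu>"
    by (intro borel_measurable_times ess_bounded_measurable assms)
  ultimately show ?thesis unfolding ess_bounded_def by blast
qed

lemma ess_bounded_add: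
  assumes "f \<in> ess_bounded \<nu>" "g \<in> ess_bounded \<nu>"
  shows "(\<lambda>x. f x + g x) \<in> ess_bounded \<nu>"
proof -
  obtain C D where C: "AE x in \<nu>. cmod (f x) \<le> C" and D: "AE x in \<nu>. cmod (g x) \<le> D"
    using assms unfolding ess_bounded_def by blast
  have "AE x in \<nu>. cmod (f x + g x) \<le> C + D"
    using C D
  proof eventually_elim
    case (elim x)
    then show ?case using norm_triangle_ineq[of "f x" "g x"] by linarith
  qed
  moreover have "(\<lambda>x. f x + g x) \<in> borel_measurable \<nu>"
    by (intro borel_measurable_add ess_bounded_measurable assms)
  ultimately show ?thesis unfolding ess_bounded_def by blast
qed

lemma mult_op_bound:
  assumes f: "f \<in> borel_measurable \<nu>" and C: "AE x in \<nu>. cmod (f x) \<le> C" "0 \<le> C" and u: "u \<in> carrier (L2 \<nu>)"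
  shows "hnorm (L2 \<nu>) (mult_op \<nu> (ae_class \<nu> f) u) \<le> C * hnorm (L2 \<nu>) u"
proof -
  interpret L: hilbert_space "L2 \<nu>" by (rule hilbert_space_L2)
  have fb: "f \<in> ess_bounded \<nu>" using f C(1) unfolding ess_bounded_def by blast
  obtain g where g: "g \<in> sq_int \<nu>" "u = ae_class \<nu> g" using u by (auto simp: carrier_L2)
  note fg = sq_int_mult[OF fb g(1)]
  have "(hnorm (L2 \<nu>) (mult_op \<nu> (ae_class \<nu> f) u))\<^sup>2 = (\<integral>x. (cmod (f x * g x))\<^sup>2 \<partial>\<nu>)"
    unfolding g(2) mult_op_class[OF fb g(1)] by (rule power2_hnorm_L2(1)[OF fg])
  also have "\<dots> \<le> (\<integral>x. C\<^sup>2 * (cmod (g x))\<^sup>2 \<partial>\<nu>)"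
  proof (rule integral_mono_AE)
    show "integrable \<nu> (\<lambda>x. (cmod (f x * g x))\<^sup>2)" by (rule sq_int_integrable[OF fg])
    show "integrable \<nu> (\<lambda>x. C\<^sup>2 * (cmod (g x))\<^sup>2)" by (rule integrable_mult_right, rule sq_int_integrable[OF g(1)])
    show "AE x in \<nu>. (cmod (f x * g x))\<^sup>2 \<le> C\<^sup>2 * (cmod (g x))\<^sup>2"
      using C(1)
    proof eventually_elim
      case (elim x)
      then have "(cmod (f x))\<^sup>2 \<le> C\<^sup>2" by (intro power_mono) auto
      then show ?case by (simp add: norm_mult power_mult_distrib mult_right_mono)
    qed
  qed
  also have "\<dots> = (C * hnorm (L2 \<nu>) u)\<^sup>2"
    unfolding g(2) power_mult_distrib power2_hnorm_L2(1)[OF g(1)] by (rule integral_mult_right_zero)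
  finally show ?thesis by (rule power2_le_imp_le) (use C(2) u in simp)
qed

lemma ess_boundedE:
  assumes "f \<in> ess_bounded \<nu>"
  obtains C where "AE x in \<nu>. cmod (f x) \<le> C" "0 \<le> C"
proof -
  obtain C where "AE x in \<nu>. cmod (f x) \<le> C" using assms unfolding ess_bounded_def by blast
  then have "AE x in \<nu>. cmod (f x) \<le> max C 0" by eventually_elim simp
  then show thesis using that[of "max C 0"] by simp
qed

lemma mult_op_ops:
  assumes f: "f \<in> ess_bounded \<nu>"
  shows "mult_op \<nu> (ae_class \<nu> f) \<in> carrier (bounded_ops (L2 \<nu>) (L2 \<nu>))"
proof -
  interpret L: hilbert_space "L2 \<nu>" by (rule hilbert_space_L2)
  obtain C where C: "AE x in \<nu>. cmod (f x) \<le> C" "0 \<le> C" using f by (rule ess_boundedE)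
  show ?thesis
  proof (rule bounded_opsI)
    show "mult_op \<nu> (ae_class \<nu> f) \<in> extensional (carrier (L2 \<nu>))" by (simp add: mult_op_def)
    fix u c assume u: "u \<in> carrier (L2 \<nu>)"
    then obtain g where g: "g \<in> sq_int \<nu>" "u = ae_class \<nu> g" by (auto simp: carrier_L2)
    show "mult_op \<nu> (ae_class \<nu> f) u \<in> carrier (L2 \<nu>)"
      using sq_int_mult[OF f g(1)] by (simp add: g(2) mult_op_class[OF f g(1)] carrier_L2)
    show "mult_op \<nu> (ae_class \<nu> f) (c \<odot>\<^bsub>L2 \<nu>\<^esub> u) = c \<odot>\<^bsub>L2 \<nu>\<^esub> mult_op \<nu> (ae_class \<nu> f) u"
      unfolding g(2) L2_class(2)[OF g(1,1)] mult_op_class[OF f g(1)] mult_op_class[OF f sq_int_smult[OF g(1)]]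
        L2_class(2)[OF sq_int_mult[OF f g(1)] g(1)] by (simp add: mult.left_commute)
    show "hnorm (L2 \<nu>) (mult_op \<nu> (ae_class \<nu> f) u) \<le> C * hnorm (L2 \<nu>) u"
      by (rule mult_op_bound[OF ess_bounded_measurable[OF f] C u])
    fix v assume "v \<in> carrier (L2 \<nu>)"
    then obtain h where h: "h \<in> sq_int \<nu>" "v = ae_class \<nu> h" by (auto simp: carrier_L2)
    show "mult_op \<nu> (ae_class \<nu> f) (u \<oplus>\<^bsub>L2 \<nu>\<^esub> v) = mult_op \<nu> (ae_class \<nu> f) u \<oplus>\<^bsub>L2 \<nu>\<^esub> mult_op \<nu> (ae_class \<nu> f) v"
      unfolding g(2) h(2) L2_class(1)[OF g(1) h(1)] mult_op_class[OF f g(1)] mult_op_class[OF f h(1)] mult_op_class[OF f sq_int_add[OF g(1) h(1)]]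
        L2_class(1)[OF sq_int_mult[OF f g(1)] sq_int_mult[OF f h(1)]] by (simp add: distrib_left)
  qed
qed

lemma adj_mult_op:
  assumes f: "f \<in> ess_bounded \<nu>"
  shows "adj (L2 \<nu>) (L2 \<nu>) (mult_op \<nu> (ae_class \<nu> f)) = mult_op \<nu> (ae_class \<nu> (\<lambda>x. cnj (f x)))"
proof -
  interpret L: hilbert_space "L2 \<nu>" by (rule hilbert_space_L2)
  interpret P: hilbert_pair "L2 \<nu>" "L2 \<nu>" by unfold_locales
  note f' = ess_bounded_cnj[OF f]
  show ?thesis
  proof (rule P.adj_eq[OF mult_op_ops[OF f']])
    fix u v assume "u \<in> carrier (L2 \<nu>)" "v \<in> carrier (L2 \<nu>)"
    then obtain g h where g: "g \<in> sq_int \<nu>" "u = ae_class \<nu> g" and h: "h \<in> sq_int \<nu>" "v = ae_class \<nu> h" by (auto simp: carrier_L2)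
    show "ip (L2 \<nu>) (mult_op \<nu> (ae_class \<nu> f) u) v = ip (L2 \<nu>) u (mult_op \<nu> (ae_class \<nu> (\<lambda>x. cnj (f x))) v)"
      unfolding g(2) h(2) mult_op_class[OF f g(1)] mult_op_class[OF f' h(1)]
        L2_class(4)[OF sq_int_mult[OF f g(1)] h(1)] L2_class(4)[OF g(1) sq_int_mult[OF f' h(1)]]
      by (simp add: mult_ac)
  qed
qed

lemma compose_mult_op:
  assumes f: "f \<in> ess_bounded \<nu>" and g: "g \<in> ess_bounded \<nu>"
  shows "compose (carrier (L2 \<nu>)) (mult_op \<nu> (ae_class \<nu> f)) (mult_op \<nu> (ae_class \<nu> g)) = mult_op \<nu> (ae_class \<nu> (\<lambda>x. f x * g x))"
proof (rule extensionalityI[of _ "carrier (L2 \<nu>)"])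
  fix u assume u: "u \<in> carrier (L2 \<nu>)"
  then obtain h where h: "h \<in> sq_int \<nu>" "u = ae_class \<nu> h" by (auto simp: carrier_L2)
  show "compose (carrier (L2 \<nu>)) (mult_op \<nu> (ae_class \<nu> f)) (mult_op \<nu> (ae_class \<nu> g)) u = mult_op \<nu> (ae_class \<nu> (\<lambda>x. f x * g x)) u"
    unfolding compose_eq[OF u] unfolding h(2) mult_op_class[OF g h(1)] mult_op_class[OF f sq_int_mult[OF g h(1)]]
      mult_op_class[OF ess_bounded_mult[OF f g] h(1)] by (simp add: mult.assoc)
qed (simp_all add: mult_op_def)

lemma mult_op_add:
  assumes f: "f \<in> ess_bounded \<nu>" and g: "g \<in> ess_bounded \<nu>"
  shows "mult_op \<nu> (ae_class \<nu> f) \<oplus>\<^bsub>bounded_ops (L2 \<nu>) (L2 \<nu>)\<^esub> mult_op \<nu> (ae_class \<nu> g) = mult_op \<nu> (ae_class \<nu> (\<lambda>x. f x + g x))"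
proof (rule extensionalityI[of _ "carrier (L2 \<nu>)"])
  fix u assume u: "u \<in> carrier (L2 \<nu>)"
  then obtain h where h: "h \<in> sq_int \<nu>" "u = ae_class \<nu> h" by (auto simp: carrier_L2)
  have "mult_op \<nu> (ae_class \<nu> f) u \<oplus>\<^bsub>L2 \<nu>\<^esub> mult_op \<nu> (ae_class \<nu> g) u = mult_op \<nu> (ae_class \<nu> (\<lambda>x. f x + g x)) u"
    unfolding h(2) mult_op_class[OF g h(1)] mult_op_class[OF f h(1)] L2_class(1)[OF sq_int_mult[OF f h(1)] sq_int_mult[OF g h(1)]]
      mult_op_class[OF ess_bounded_add[OF f g] h(1)] by (simp add: distrib_right)
  then show "(mult_op \<nu> (ae_class \<nu> f) \<oplus>\<^bsub>bounded_ops (L2 \<nu>) (L2 \<nu>)\<^esub> mult_op \<nu> (ae_class \<nu> g)) u = mult_op \<nu> (ae_class \<nu> (\<lambda>x. f x + g x)) u"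
    using u by simp
qed (simp_all add: mult_op_def)

lemma mult_op_smult:
  assumes f: "f \<in> ess_bounded \<nu>"
  shows "c \<odot>\<^bsub>bounded_ops (L2 \<nu>) (L2 \<nu>)\<^esub> mult_op \<nu> (ae_class \<nu> f) = mult_op \<nu> (ae_class \<nu> (\<lambda>x. c * f x))"
proof (rule extensionalityI[of _ "carrier (L2 \<nu>)"])
  fix u assume u: "u \<in> carrier (L2 \<nu>)"
  then obtain h where h: "h \<in> sq_int \<nu>" "u = ae_class \<nu> h" by (auto simp: carrier_L2)
  have "c \<odot>\<^bsub>L2 \<nu>\<^esub> mult_op \<nu> (ae_class \<nu> f) u = mult_op \<nu> (ae_class \<nu> (\<lambda>x. c * f x)) u"
    unfolding h(2) mult_op_class[OF f h(1)] L2_class(2)[OF sq_int_mult[OF f h(1)] h(1)]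
      mult_op_class[OF ess_bounded_mult[OF ess_bounded_const f] h(1)] by (simp add: mult.assoc)
  then show "(c \<odot>\<^bsub>bounded_ops (L2 \<nu>) (L2 \<nu>)\<^esub> mult_op \<nu> (ae_class \<nu> f)) u = mult_op \<nu> (ae_class \<nu> (\<lambda>x. c * f x)) u"
    using u by simp
qed (simp_all add: mult_op_def)

text \<open>Dominated convergence: for representatives \<open>h\<close> and \<open>k\<close> of \<open>u\<close> and \<open>v\<close>, the product \<open>cnj h * k\<close> is
  integrable.\<close>

lemma tendsto_ip_mult_op:
  assumes f: "\<And>n. f n \<in> borel_measurable \<nu>" "\<And>n. AE x in \<nu>. cmod (f n x) \<le> C" and g: "g \<in> ess_bounded \<nu>"
    and lim: "AE x in \<nu>. (\<lambda>n. f n x) \<longlonglongrightarrow> g x" and u: "u \<in> carrier (L2 \<nu>)" and v: "v \<in> carrier (L2 \<nu>)"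
  shows "(\<lambda>n. ip (L2 \<nu>) u (mult_op \<nu> (ae_class \<nu> (f n)) v)) \<longlonglongrightarrow> ip (L2 \<nu>) u (mult_op \<nu> (ae_class \<nu> g) v)"
proof -
  have fb: "f n \<in> ess_bounded \<nu>" for n using f unfolding ess_bounded_def by blast
  obtain h where h: "h \<in> sq_int \<nu>" "u = ae_class \<nu> h" using u by (auto simp: carrier_L2)
  obtain k where k: "k \<in> sq_int \<nu>" "v = ae_class \<nu> k" using v by (auto simp: carrier_L2)
  note [measurable] = f(1) ess_bounded_measurable[OF g] borel_measurable_cnj[OF sq_int_measurable[OF h(1)]] sq_int_measurable[OF k(1)]
  have "(\<lambda>n. \<integral>x. cnj (h x) * (f n x * k x) \<partial>\<nu>) \<longlonglongrightarrow> (\<integral>x. cnj (h x) * (g x * k x) \<partial>\<nu>)"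
  proof (rule integral_dominated_convergence[where w = "\<lambda>x. C * norm (cnj (h x) * k x)"])
    show "integrable \<nu> (\<lambda>x. C * norm (cnj (h x) * k x))"
      by (rule integrable_mult_right, rule integrable_norm, rule integrable_sq_product[OF h(1) k(1)])
    show "AE x in \<nu>. (\<lambda>n. cnj (h x) * (f n x * k x)) \<longlonglongrightarrow> cnj (h x) * (g x * k x)"
      using lim by eventually_elim (intro tendsto_mult tendsto_const)
    show "AE x in \<nu>. norm (cnj (h x) * (f n x * k x)) \<le> C * norm (cnj (h x) * k x)" for n
      using f(2)[of n]
    proof eventually_elim
      case (elim x)
      have "norm (cnj (h x) * (f n x * k x)) = cmod (f n x) * norm (cnj (h x) * k x)"
        by (simp add: norm_mult)
      then show ?case using elim by (simp add: mult_right_mono)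
    qed
  qed measurable
  then show ?thesis
    unfolding h(2) k(2) mult_op_class[OF fb k(1)] mult_op_class[OF g k(1)]
      L2_class(4)[OF h(1) sq_int_mult[OF fb k(1)]] L2_class(4)[OF h(1) sq_int_mult[OF g k(1)]] .
qed

section \<open>The von Neumann algebra generated by the elementary tensors\<close>

locale wstar = K: hilbert_space K for K :: "'k hilb" and \<nu> :: "'o measure"
begin

sublocale T: tensor_pair K "L2 \<nu>"
  by (intro tensor_pair.intro hilbert_space_L2) unfold_locales

abbreviation "G \<equiv> htensor K (L2 \<nu>)"
abbreviation "opsK \<equiv> carrier (bounded_ops K K)"
abbreviation "D \<equiv> wstar_tensor K \<nu>"

text \<open>Elementary tensors with functions in place of classes: sums and products are pointwise, and no
  representatives have to be chosen.\<close>

definition ET :: "('k \<Rightarrow> 'k) \<Rightarrow> ('o \<Rightarrow> complex) \<Rightarrow> ('k \<times> ('o \<Rightarrow> complex) set \<Rightarrow> complex) \<Rightarrow> ('k \<times> ('o \<Rightarrow> complex) set \<Rightarrow> complex)" where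
  "ET b f = elem_tensor K \<nu> b (ae_class \<nu> f)"

lemma wstar_simps [simp]:
  "d \<oplus>\<^bsub>D\<^esub> d' = d \<oplus>\<^bsub>bounded_ops G G\<^esub> d'"
  "c \<odot>\<^bsub>D\<^esub> d = c \<odot>\<^bsub>bounded_ops G G\<^esub> d"
  "d \<otimes>\<^bsub>D\<^esub> d' = compose (carrier G) d d'"
  by (simp_all add: wstar_tensor_def Let_def op_algebra_def bounded_ops_def)

lemma ET_eq: "ET b f = op_tensor K (L2 \<nu>) b (mult_op \<nu> (ae_class \<nu> f))"
  by (simp add: ET_def elem_tensor_def)

lemma ET_ops: "\<lbrakk>b \<in> opsK; f \<in> ess_bounded \<nu>\<rbrakk> \<Longrightarrow> ET b f \<in> carrier (bounded_ops G G)"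
  unfolding ET_eq by (rule T.op_tensor_ops[OF _ mult_op_ops])

lemma ET_in:
  assumes "b \<in> opsK" "f \<in> ess_bounded \<nu>"
  shows "ET b f \<in> carrier D"
proof -
  let ?A = "{elem_tensor K \<nu> b f | b f. b \<in> carrier (op_algebra K) \<and> f \<in> Linf \<nu>}"
  have "ET b f \<in> ?A" using assms unfolding ET_def Linf_eq by auto
  moreover have "ET b f \<in> carrier (op_algebra G)" using ET_ops[OF assms] by simp
  ultimately have "ET b f \<in> commutant G (commutant G ?A)" unfolding commutant_def by (auto simp del: op_algebra_simps)
  then show ?thesis by (simp add: wstar_tensor_def Let_def)
qed

interpretation KK: hilbert_pair K K by unfold_locales
interpretation LL: hilbert_pair "L2 \<nu>" "L2 \<nu>" by unfold_locales

lemma adj_ET: "\<lbrakk>b \<in> opsK; f \<in> ess_bounded \<nu>\<rbrakk> \<Longrightarrow> adj G G (ET b f) = ET (adj K K b) (\<lambda>x. cnj (f x))"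
  unfolding ET_eq by (simp only: T.adj_op_tensor mult_op_ops adj_mult_op)

lemma compose_ET:
  "\<lbrakk>b \<in> opsK; b' \<in> opsK; f \<in> ess_bounded \<nu>; f' \<in> ess_bounded \<nu>\<rbrakk> \<Longrightarrow>
    compose (carrier G) (ET b f) (ET b' f') = ET (compose (carrier K) b b') (\<lambda>x. f x * f' x)"
  unfolding ET_eq by (simp only: T.compose_op_tensor mult_op_ops compose_mult_op)

lemma ET_add_left:
  "\<lbrakk>b \<in> opsK; b' \<in> opsK; f \<in> ess_bounded \<nu>\<rbrakk> \<Longrightarrow> ET b f \<oplus>\<^bsub>D\<^esub> ET b' f = ET (b \<oplus>\<^bsub>bounded_ops K K\<^esub> b') f"
  unfolding ET_eq wstar_simps(1) by (simp only: T.op_tensor_add_left mult_op_ops)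

lemma ET_add_right:
  "\<lbrakk>b \<in> opsK; f \<in> ess_bounded \<nu>; f' \<in> ess_bounded \<nu>\<rbrakk> \<Longrightarrow> ET b f \<oplus>\<^bsub>D\<^esub> ET b f' = ET b (\<lambda>x. f x + f' x)"
  unfolding ET_eq wstar_simps(1) by (simp only: T.op_tensor_add_right mult_op_ops mult_op_add)

lemma ET_smult_left:
  "\<lbrakk>b \<in> opsK; f \<in> ess_bounded \<nu>\<rbrakk> \<Longrightarrow> c \<odot>\<^bsub>D\<^esub> ET b f = ET (c \<odot>\<^bsub>bounded_ops K K\<^esub> b) f"
  unfolding ET_eq wstar_simps(2) by (simp only: T.op_tensor_smult_left mult_op_ops)

lemma ET_smult_right:
  "\<lbrakk>b \<in> opsK; f \<in> ess_bounded \<nu>\<rbrakk> \<Longrightarrow> c \<odot>\<^bsub>D\<^esub> ET b f = ET b (\<lambda>x. c * f x)"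
  unfolding ET_eq wstar_simps(2) by (simp only: T.op_tensor_smult_right mult_op_ops mult_op_smult)

lemma ET_cong_AE: "AE x in \<nu>. f x = g x \<Longrightarrow> ET b f = ET b g"
  unfolding ET_def by (simp only: ae_class_eqI[of f g])

text \<open>The value of \<open>(b \<otimes> f) \<phi>\<close> at \<open>(a, u)\<close> is a matrix element of multiplication by \<open>f\<close>, to which dominated
  convergence applies.\<close>

lemma ET_limit_fun:
  assumes b: "b \<in> opsK" and f: "\<And>n. f n \<in> borel_measurable \<nu>" "\<And>n. AE x in \<nu>. cmod (f n x) \<le> C" and g: "g \<in> ess_bounded \<nu>"
    and lim: "AE x in \<nu>. (\<lambda>n. f n x) \<longlonglongrightarrow> g x"
  shows "limitin (sigma_weak G G) (\<lambda>n. ET b (f n)) (ET b g) sequentially"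
proof -
  obtain Cb where Cb: "Cb \<ge> 0" "\<And>x. x \<in> carrier K \<Longrightarrow> hnorm K (b x) \<le> Cb * hnorm K x" using KK.op_bound[OF b] by blast
  have f': "AE x in \<nu>. cmod (f n x) \<le> \<bar>C\<bar>" for n using f(2)[of n] by eventually_elim simp
  have fb: "f n \<in> ess_bounded \<nu>" for n using f unfolding ess_bounded_def by blast
  show ?thesis
  proof (rule T.limitin_sigma_weak_tensorI[OF _ _ ET_ops[OF b g] T.vec_tensor_total order_refl, where C = "Cb * \<bar>C\<bar>"])
    have "hnorm G (ET b (f n) \<phi>) \<le> Cb * \<bar>C\<bar> * hnorm G \<phi>" if "\<phi> \<in> hs_functionals K (L2 \<nu>)" for n \<phi>
      unfolding ET_eq by (rule T.op_tensor_bound[OF b mult_op_ops[OF fb] Cb _ _ that]) (simp_all add: mult_op_bound[OF f(1) f'])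
    then show "\<forall>\<^sub>F n in sequentially. ET b (f n) \<in> carrier (bounded_ops G G) \<and> (\<forall>\<phi>\<in>hs_functionals K (L2 \<nu>). hnorm G (ET b (f n) \<phi>) \<le> Cb * \<bar>C\<bar> * hnorm G \<phi>)"
      using ET_ops[OF b fb] by simp
    fix \<phi> p assume \<phi>: "\<phi> \<in> hs_functionals K (L2 \<nu>)" and "p \<in> carrier K \<times> carrier (L2 \<nu>)"
    then obtain a u where p: "p = (a, u)" and a: "a \<in> carrier K" and u: "u \<in> carrier (L2 \<nu>)" by blast
    have ba: "adj K K b a \<in> carrier K" by (rule bounded_opsD(2)[OF KK.adj_ops[OF b] a])
    obtain y where y: "y \<in> carrier (L2 \<nu>)" "\<forall>u\<in>carrier (L2 \<nu>). \<phi> (adj K K b a, u) = ip (L2 \<nu>) u y"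
      using T.slice_right[OF \<phi> ba] by blast
    have *: "ET b h \<phi> p = ip (L2 \<nu>) u (mult_op \<nu> (ae_class \<nu> h) y)" if h: "h \<in> ess_bounded \<nu>" for h
    proof -
      have "ET b h \<phi> p = \<phi> (adj K K b a, adj (L2 \<nu>) (L2 \<nu>) (mult_op \<nu> (ae_class \<nu> h)) u)"
        unfolding p ET_eq by (rule T.op_tensor_apply[OF b mult_op_ops[OF h] \<phi> a u])
      also have "\<dots> = ip (L2 \<nu>) (adj (L2 \<nu>) (L2 \<nu>) (mult_op \<nu> (ae_class \<nu> h)) u) y"
        using y(2) bounded_opsD(2)[OF LL.adj_ops[OF mult_op_ops[OF h]] u] by blast
      also have "\<dots> = ip (L2 \<nu>) u (mult_op \<nu> (ae_class \<nu> h) y)"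
        by (rule LL.ip_adj_left[OF mult_op_ops[OF h] y(1) u])
      finally show ?thesis .
    qed
    show "(\<lambda>n. ET b (f n) \<phi> p) \<longlonglongrightarrow> ET b g \<phi> p"
      unfolding *[OF fb] *[OF g] by (rule tendsto_ip_mult_op[OF f g lim u y(1)])
  qed simp
qed

text \<open>The product of \<open>b\<close> with the projection onto the span of \<open>A\<close>.\<close>

definition compress :: "'k set \<Rightarrow> ('k \<Rightarrow> 'k) \<Rightarrow> 'k \<Rightarrow> 'k" where
  "compress A b = (\<lambda>x\<in>carrier K. K.fourier A (b x))"

lemma finite_onb_subset_carrier: "\<lbrakk>A \<subseteq> some_onb K; e \<in> A\<rbrakk> \<Longrightarrow> e \<in> carrier K"
  using T.onbs(1) by blast

lemma compress_insert:
  assumes b: "b \<in> opsK" and A: "finite A" "insert e A \<subseteq> some_onb K" "e \<notin> A"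
  shows "compress (insert e A) b = rank_one K K e (adj K K b e) \<oplus>\<^bsub>bounded_ops K K\<^esub> compress A b"
proof (rule extensionalityI[of _ "carrier K"])
  fix x assume x: "x \<in> carrier K"
  have e: "e \<in> carrier K" by (rule finite_onb_subset_carrier[OF A(2)]) simp
  have "K.fourier (insert e A) (b x) = ip K e (b x) \<odot>\<^bsub>K\<^esub> e \<oplus>\<^bsub>K\<^esub> K.fourier A (b x)"
    unfolding K.fourier_def by (rule K.lincomb_insert[OF A(1,3)]) (rule finite_onb_subset_carrier[OF A(2)])
  then show "compress (insert e A) b x = (rank_one K K e (adj K K b e) \<oplus>\<^bsub>bounded_ops K K\<^esub> compress A b) x"
    using x by (simp add: compress_def rank_one_def KK.ip_adj_left[OF b x e])
qed (simp_all add: compress_def)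

lemma compress_ops:
  assumes b: "b \<in> opsK" and A: "finite A" "A \<subseteq> some_onb K"
  shows "compress A b \<in> opsK"
  using A
proof (induction A)
  case empty
  have "compress {} b = (\<lambda>x\<in>carrier K. \<zero>\<^bsub>K\<^esub>)" by (simp add: compress_def K.fourier_def)
  then show ?case using KK.zero_ops by (simp only:)
next
  case (insert e A)
  have "rank_one K K e (adj K K b e) \<in> opsK"
    using insert T.onbs(1) bounded_opsD(2)[OF KK.adj_ops[OF b]] by (intro KK.rank_one_ops) auto
  then show ?case
    unfolding compress_insert[OF b insert(1,4,2)] bounded_ops_simps using insert by (intro KK.add_ops) auto
qed

lemma adj_compress:
  assumes b: "b \<in> opsK" and A: "finite A" "A \<subseteq> some_onb K" and e: "e \<in> A"
  shows "adj K K (compress A b) e = adj K K b e"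
proof (rule KK.adj_eqI)
  note onb = K.is_onb_some_onb
  show eC: "e \<in> carrier K" by (rule finite_onb_subset_carrier[OF A(2) e])
  show "adj K K b e \<in> carrier K" by (rule bounded_opsD(2)[OF KK.adj_ops[OF b] eC])
  fix x assume x: "x \<in> carrier K"
  have bx: "b x \<in> carrier K" by (rule bounded_opsD(2)[OF b x])
  have "ip K (compress A b x) e = (\<Sum>f\<in>A. cnj (ip K f (b x)) * ip K f e)"
    using x by (simp add: compress_def K.ip_fourier_left[OF onb A bx eC])
  also have "\<dots> = (\<Sum>f\<in>A. if f = e then cnj (ip K e (b x)) else 0)"
    using A e by (intro sum.cong) (auto simp: K.onb_ip[OF onb] subset_iff)
  also have "\<dots> = ip K (b x) e" using A e K.ip_commute[OF eC bx] by simp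
  also have "\<dots> = ip K x (adj K K b e)" by (rule KK.ip_adj[OF b x eC, symmetric])
  finally show "ip K (compress A b x) e = ip K x (adj K K b e)" .
qed

text \<open>The operators are bounded uniformly in \<open>A\<close>, and at a basis vector \<open>e\<close> of \<open>K\<close> the adjoint of \<open>compress A b\<close>
  coincides with that of \<open>b\<close> as soon as \<open>e \<in> A\<close>.\<close>

lemma ET_limit_compress:
  assumes b: "b \<in> opsK" and f: "f \<in> ess_bounded \<nu>"
  shows "limitin (sigma_weak G G) (\<lambda>A. ET (compress A b) f) (ET b f) (finite_subsets_at_top (some_onb K))"
proof -
  obtain Cb where Cb: "Cb \<ge> 0" "\<And>x. x \<in> carrier K \<Longrightarrow> hnorm K (b x) \<le> Cb * hnorm K x" using KK.op_bound[OF b] by blast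
  obtain C where C: "AE x in \<nu>. cmod (f x) \<le> C" "0 \<le> C" using f by (rule ess_boundedE)
  show ?thesis
  proof (rule T.limitin_sigma_weak_tensorI[OF _ _ ET_ops[OF b f] T.onb_tensor_total, where C = "Cb * C"])
    show "some_onb K \<times> some_onb (L2 \<nu>) \<subseteq> carrier K \<times> carrier (L2 \<nu>)" using T.onb_pair by blast
    show "\<forall>\<^sub>F A in finite_subsets_at_top (some_onb K). ET (compress A b) f \<in> carrier (bounded_ops G G) \<and> (\<forall>\<phi>\<in>hs_functionals K (L2 \<nu>). hnorm G (ET (compress A b) f \<phi>) \<le> Cb * C * hnorm G \<phi>)"
    proof (rule eventually_finite_subsets_at_top_weakI)
      fix A assume A: "finite A" "A \<subseteq> some_onb K"
      have bound: "hnorm K (compress A b x) \<le> Cb * hnorm K x" if x: "x \<in> carrier K" for x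
        using K.hnorm_fourier_le[OF K.is_onb_some_onb A bounded_opsD(2)[OF b x]] Cb(2)[OF x] x by (simp add: compress_def)
      have "hnorm G (ET (compress A b) f \<phi>) \<le> Cb * C * hnorm G \<phi>" if "\<phi> \<in> hs_functionals K (L2 \<nu>)" for \<phi>
        unfolding ET_eq
        by (rule T.op_tensor_bound[OF compress_ops[OF b A] mult_op_ops[OF f] Cb(1) bound C(2) _ that])
          (simp_all add: mult_op_bound[OF ess_bounded_measurable[OF f] C])
      then show "ET (compress A b) f \<in> carrier (bounded_ops G G) \<and> (\<forall>\<phi>\<in>hs_functionals K (L2 \<nu>). hnorm G (ET (compress A b) f \<phi>) \<le> Cb * C * hnorm G \<phi>)"
        using ET_ops[OF compress_ops[OF b A] f] by simp
    qed
    fix \<phi> p assume \<phi>: "\<phi> \<in> hs_functionals K (L2 \<nu>)" and "p \<in> some_onb K \<times> some_onb (L2 \<nu>)"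
    then obtain e u where p: "p = (e, u)" and e: "e \<in> some_onb K" and u: "u \<in> some_onb (L2 \<nu>)" by blast
    have "\<forall>\<^sub>F A in finite_subsets_at_top (some_onb K). ET (compress A b) f \<phi> p = ET b f \<phi> p"
      unfolding eventually_finite_subsets_at_top
    proof (intro exI[of _ "{e}"] conjI allI impI)
      fix A assume "finite A \<and> {e} \<subseteq> A \<and> A \<subseteq> some_onb K"
      then have A: "finite A" "A \<subseteq> some_onb K" "e \<in> A" by auto
      show "ET (compress A b) f \<phi> p = ET b f \<phi> p"
        unfolding p ET_eq T.op_tensor_apply[OF compress_ops[OF b A(1,2)] mult_op_ops[OF f] \<phi> T.onbs(1)[OF e] T.onbs(2)[OF u]]
          T.op_tensor_apply[OF b mult_op_ops[OF f] \<phi> T.onbs(1)[OF e] T.onbs(2)[OF u]] adj_compress[OF b A] ..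
    qed (use e in auto)
    then show "((\<lambda>A. ET (compress A b) f \<phi> p) \<longlongrightarrow> ET b f \<phi> p) (finite_subsets_at_top (some_onb K))"
      by (rule tendsto_eventually)
  qed simp
qed

end


section \<open>The Hilbert space of a positive kernel\<close>

text \<open>Completion of a semi-inner product space that is spanned by the vectors \<open>\<delta> i\<close>. A point of the
  completion is represented by the function \<open>i \<mapsto> lim \<langle>\<delta> i, x n\<rangle>\<close> of a Cauchy sequence \<open>x\<close>, which
  divides out the null vectors at the same time.\<close>

locale spanned_space = semi_inner_space H for H :: "'a hilb" (structure) +
  fixes \<delta> :: "'i \<Rightarrow> 'a" and I :: "'i set"
  assumes \<delta>: "i \<in> I \<Longrightarrow> \<delta> i \<in> carrier H"
    and spanned: "c \<in> carrier H \<Longrightarrow> \<exists>A a. finite A \<and> A \<subseteq> I \<and> (\<forall>x\<in>carrier H. ip H c x = (\<Sum>i\<in>A. a i * ip H (\<delta> i) x))"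
begin

lemma cauchyE:
  assumes "cauchy x" "e > 0"
  obtains N where "\<And>m n. \<lbrakk>m \<ge> N; n \<ge> N\<rbrakk> \<Longrightarrow> hnorm H (x m \<ominus> x n) < e"
  using assms unfolding cauchy_def by blast

lemma cauchy_const: "c \<in> carrier H \<Longrightarrow> cauchy (\<lambda>n. c)"
  unfolding cauchy_def by (simp add: M.r_neg a_minus_def)

lemma cauchy_add:
  assumes x: "cauchy x" and y: "cauchy y"
  shows "cauchy (\<lambda>n. x n \<oplus> y n)"
  unfolding cauchy_def
proof (intro conjI allI impI)
  fix e :: real assume "e > 0"
  then have e: "e / 2 > 0" by simp
  obtain N1 where N1: "\<And>m n. \<lbrakk>m \<ge> N1; n \<ge> N1\<rbrakk> \<Longrightarrow> hnorm H (x m \<ominus> x n) < e / 2" using cauchyE[OF x e] by blast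
  obtain N2 where N2: "\<And>m n. \<lbrakk>m \<ge> N2; n \<ge> N2\<rbrakk> \<Longrightarrow> hnorm H (y m \<ominus> y n) < e / 2" using cauchyE[OF y e] by blast
  have "hnorm H ((x m \<oplus> y m) \<ominus> (x n \<oplus> y n)) < e" if "m \<ge> max N1 N2" "n \<ge> max N1 N2" for m n
  proof -
    have c: "x m \<in> carrier H" "x n \<in> carrier H" "y m \<in> carrier H" "y n \<in> carrier H" using x y by auto
    have "hnorm H ((x m \<oplus> y m) \<ominus> (x n \<oplus> y n)) = hnorm H ((x m \<ominus> x n) \<oplus> (y m \<ominus> y n))"
      unfolding hnorm_def using c by (simp add: ip_simps algebra_simps)
    also have "\<dots> \<le> hnorm H (x m \<ominus> x n) + hnorm H (y m \<ominus> y n)" using c by (intro hnorm_triangle) auto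
    also have "\<dots> < e" using N1[of m n] N2[of m n] that by simp
    finally show ?thesis .
  qed
  then show "\<exists>N. \<forall>m\<ge>N. \<forall>n\<ge>N. hnorm H ((x m \<oplus> y m) \<ominus> (x n \<oplus> y n)) < e" by blast
qed (use x y in simp)

lemma cauchy_smult:
  assumes x: "cauchy x"
  shows "cauchy (\<lambda>n. c \<odot> x n)"
  unfolding cauchy_def
proof (intro conjI allI impI)
  fix e :: real assume "e > 0"
  then have e: "e / (cmod c + 1) > 0" by (simp add: add_nonneg_pos)
  obtain N where N: "\<And>m n. \<lbrakk>m \<ge> N; n \<ge> N\<rbrakk> \<Longrightarrow> hnorm H (x m \<ominus> x n) < e / (cmod c + 1)" using cauchyE[OF x e] by blast
  have "hnorm H (c \<odot> x m \<ominus> c \<odot> x n) < e" if "m \<ge> N" "n \<ge> N" for m n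
  proof -
    have C: "x m \<in> carrier H" "x n \<in> carrier H" using x by auto
    have "hnorm H (c \<odot> x m \<ominus> c \<odot> x n) = hnorm H (c \<odot> (x m \<ominus> x n))"
      unfolding hnorm_def using C by (simp add: ip_simps algebra_simps)
    also have "\<dots> = cmod c * hnorm H (x m \<ominus> x n)" using C by (intro hnorm_smult) auto
    also have "\<dots> \<le> (cmod c + 1) * hnorm H (x m \<ominus> x n)" using C by (intro mult_right_mono) auto
    also have "\<dots> < e" using N[OF that] pos_less_divide_eq[of "cmod c + 1"] by (simp add: add_nonneg_pos mult.commute)
    finally show ?thesis .
  qed
  then show "\<exists>N. \<forall>m\<ge>N. \<forall>n\<ge>N. hnorm H (c \<odot> x m \<ominus> c \<odot> x n) < e" by blast
qed (use x in simp)

lemma convergent_ip: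
  assumes x: "cauchy x" and y: "cauchy y"
  shows "convergent (\<lambda>n. ip H (x n) (y n))"
proof (rule Cauchy_convergent, rule CauchyI)
  fix e :: real assume e: "e > 0"
  obtain B where B: "\<And>n. hnorm H (x n) \<le> B" using cauchy_bounded[OF x] by blast
  obtain C where C: "\<And>n. hnorm H (y n) \<le> C" using cauchy_bounded[OF y] by blast
  have B0: "0 \<le> B" "0 \<le> C" using order_trans[OF hnorm_nonneg B[of 0]] order_trans[OF hnorm_nonneg C[of 0]] x y by simp_all
  define d where "d = e / (B + C + 1)"
  have d: "d > 0" "(B + C) * d < e"
  proof -
    show "d > 0" using e B0 by (simp add: d_def)
    have "(B + C) * d < (B + C + 1) * d" using \<open>d > 0\<close> by simp
    also have "\<dots> = e" using B0 by (simp add: d_def)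
    finally show "(B + C) * d < e" .
  qed
  obtain N1 where N1: "\<And>m n. \<lbrakk>m \<ge> N1; n \<ge> N1\<rbrakk> \<Longrightarrow> hnorm H (x m \<ominus> x n) < d" using cauchyE[OF x d(1)] by blast
  obtain N2 where N2: "\<And>m n. \<lbrakk>m \<ge> N2; n \<ge> N2\<rbrakk> \<Longrightarrow> hnorm H (y m \<ominus> y n) < d" using cauchyE[OF y d(1)] by blast
  have "norm (ip H (x m) (y m) - ip H (x n) (y n)) < e" if mn: "m \<ge> max N1 N2" "n \<ge> max N1 N2" for m n
  proof -
    have c: "x m \<in> carrier H" "x n \<in> carrier H" "y m \<in> carrier H" "y n \<in> carrier H" using x y by auto
    have "ip H (x m) (y m) - ip H (x n) (y n) = ip H (x m) (y m \<ominus> y n) + ip H (x m \<ominus> x n) (y n)"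
      using c by (simp add: ip_simps)
    then have "norm (ip H (x m) (y m) - ip H (x n) (y n)) \<le> cmod (ip H (x m) (y m \<ominus> y n)) + cmod (ip H (x m \<ominus> x n) (y n))"
      by (simp add: norm_triangle_ineq)
    also have "\<dots> \<le> hnorm H (x m) * hnorm H (y m \<ominus> y n) + hnorm H (x m \<ominus> x n) * hnorm H (y n)"
      using c by (intro add_mono Cauchy_Schwarz) auto
    also have "\<dots> \<le> B * d + d * C"
      using c B[of m] C[of n] N1[of m n] N2[of m n] mn d B0 by (intro add_mono mult_mono) auto
    also have "\<dots> < e" using d(2) by (simp add: algebra_simps)
    finally show ?thesis .
  qed
  then show "\<exists>N. \<forall>m\<ge>N. \<forall>n\<ge>N. norm (ip H (x m) (y m) - ip H (x n) (y n)) < e" by blast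
qed

definition limit_fun :: "(nat \<Rightarrow> 'a) \<Rightarrow> 'i \<Rightarrow> complex" where
  "limit_fun x = (\<lambda>i\<in>I. lim (\<lambda>n. ip H (\<delta> i) (x n)))"

lemma limit_fun_tendsto: "\<lbrakk>cauchy x; i \<in> I\<rbrakk> \<Longrightarrow> (\<lambda>n. ip H (\<delta> i) (x n)) \<longlonglongrightarrow> limit_fun x i"
  using convergent_ip[OF cauchy_const[OF \<delta>]] by (simp add: limit_fun_def convergent_LIMSEQ_iff)

lemma limit_fun_eqI:
  assumes "\<And>i. i \<in> I \<Longrightarrow> (\<lambda>n. ip H (\<delta> i) (x n)) \<longlonglongrightarrow> u i" "u \<in> extensional I"
  shows "limit_fun x = u"
  by (rule extensionalityI[of _ I]) (use assms in \<open>simp_all add: limit_fun_def limI\<close>)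

lemma limit_fun_add: "\<lbrakk>cauchy x; cauchy y\<rbrakk> \<Longrightarrow> limit_fun (\<lambda>n. x n \<oplus> y n) = (\<lambda>i\<in>I. limit_fun x i + limit_fun y i)"
  by (rule limit_fun_eqI) (simp_all add: ip_add \<delta> tendsto_add limit_fun_tendsto)

lemma limit_fun_smult: "cauchy x \<Longrightarrow> limit_fun (\<lambda>n. c \<odot> x n) = (\<lambda>i\<in>I. c * limit_fun x i)"
  by (rule limit_fun_eqI) (simp_all add: ip_smult \<delta> tendsto_mult_left limit_fun_tendsto)

text \<open>This makes the inner product of the completion well defined. A late member \<open>z N\<close> is a combination of
  finitely many \<open>\<delta> i\<close>, so that \<open>\<langle>z N, z n\<rangle>\<close> tends to \<open>0\<close>, while \<open>\<langle>z n - z N, z n\<rangle>\<close> is small by the Cauchy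
  property.\<close>

lemma null_sequence:
  assumes z: "cauchy z" and lim: "\<And>i. i \<in> I \<Longrightarrow> (\<lambda>n. ip H (\<delta> i) (z n)) \<longlonglongrightarrow> 0"
  shows "(\<lambda>n. hnorm H (z n)) \<longlonglongrightarrow> 0"
proof (rule LIMSEQ_I)
  fix e :: real assume e: "e > 0"
  obtain B where B: "\<And>n. hnorm H (z n) \<le> B" using cauchy_bounded[OF z] by blast
  have B0: "0 \<le> B" using order_trans[OF hnorm_nonneg B[of 0]] z by simp
  define d where "d = e\<^sup>2 / (2 * (B + 1))"
  have d: "d > 0" "d * B \<le> e\<^sup>2 / 2"
  proof -
    show "d > 0" using e B0 by (simp add: d_def)
    have "d * B \<le> d * (B + 1)" using \<open>d > 0\<close> by simp
    also have "\<dots> = e\<^sup>2 / 2" using B0 by (simp add: d_def field_simps)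
    finally show "d * B \<le> e\<^sup>2 / 2" .
  qed
  obtain N where N: "\<And>m n. \<lbrakk>m \<ge> N; n \<ge> N\<rbrakk> \<Longrightarrow> hnorm H (z m \<ominus> z n) < d" using cauchyE[OF z d(1)] by blast
  obtain A a where A: "finite A" "A \<subseteq> I" "\<forall>x\<in>carrier H. ip H (z N) x = (\<Sum>i\<in>A. a i * ip H (\<delta> i) x)"
    using spanned[of "z N"] z by auto
  have "(\<lambda>n. \<Sum>i\<in>A. a i * ip H (\<delta> i) (z n)) \<longlonglongrightarrow> (\<Sum>i\<in>A. a i * 0)"
    using A(2) by (intro tendsto_sum tendsto_mult_left lim) auto
  then have "(\<lambda>n. ip H (z N) (z n)) \<longlonglongrightarrow> 0" using A(3) z by simp
  from LIMSEQ_D[OF this, of "e\<^sup>2 / 2"] e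
  obtain N' where N': "\<forall>n\<ge>N'. cmod (ip H (z N) (z n)) < e\<^sup>2 / 2" by auto
  have "norm (hnorm H (z n) - 0) < e" if n: "n \<ge> max N N'" for n
  proof -
    have c: "z n \<in> carrier H" "z N \<in> carrier H" using z by auto
    have "(hnorm H (z n))\<^sup>2 = Re (ip H (z n \<ominus> z N) (z n) + ip H (z N) (z n))" using c by (simp add: power2_hnorm ip_simps)
    also have "\<dots> \<le> cmod (ip H (z n \<ominus> z N) (z n)) + cmod (ip H (z N) (z n))"
      using complex_Re_le_cmod norm_triangle_ineq order_trans by blast
    also have "cmod (ip H (z n \<ominus> z N) (z n)) \<le> hnorm H (z n \<ominus> z N) * hnorm H (z n)"
      using c by (intro Cauchy_Schwarz) auto
    also have "\<dots> \<le> d * B" using N[of n N] n B[of n] d(1) c by (intro mult_mono) auto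
    finally have "(hnorm H (z n))\<^sup>2 < e\<^sup>2" using d(2) N' n by fastforce
    then have "hnorm H (z n) < e" by (rule power2_less_imp_less) (use e in simp)
    then show ?thesis using c by simp
  qed
  then show "\<exists>no. \<forall>n\<ge>no. norm (hnorm H (z n) - 0) < e" by blast
qed

lemma cauchy_minus: "\<lbrakk>cauchy x; cauchy y\<rbrakk> \<Longrightarrow> cauchy (\<lambda>n. x n \<oplus> (-1) \<odot> y n)"
  by (intro cauchy_add cauchy_smult)

lemma tendsto_ip_cong:
  assumes x: "cauchy x" "cauchy x'" "limit_fun x = limit_fun x'" and y: "cauchy y"
  shows "(\<lambda>n. ip H (x n) (y n) - ip H (x' n) (y n)) \<longlonglongrightarrow> 0"
proof -
  define z where "z n = x n \<oplus> (-1) \<odot> x' n" for n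
  have z: "cauchy z" unfolding z_def by (rule cauchy_minus[OF x(1,2)])
  have zc: "z n \<in> carrier H" for n using z by simp
  have "(\<lambda>n. ip H (\<delta> i) (z n)) \<longlonglongrightarrow> 0" if i: "i \<in> I" for i
  proof -
    have "(\<lambda>n. ip H (\<delta> i) (x n) - ip H (\<delta> i) (x' n)) \<longlonglongrightarrow> limit_fun x i - limit_fun x' i"
      by (intro tendsto_diff limit_fun_tendsto x i)
    then show ?thesis using x i \<delta> by (simp add: z_def ip_simps)
  qed
  then have null: "(\<lambda>n. hnorm H (z n)) \<longlonglongrightarrow> 0" by (rule null_sequence[OF z])
  obtain B where B: "\<And>n. hnorm H (y n) \<le> B" using cauchy_bounded[OF y] by blast
  show ?thesis
  proof (rule Lim_null_comparison)
    show "\<forall>\<^sub>F n in sequentially. norm (ip H (x n) (y n) - ip H (x' n) (y n)) \<le> hnorm H (z n) * B"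
    proof (rule always_eventually, rule allI)
      fix n
      have "ip H (x n) (y n) - ip H (x' n) (y n) = ip H (z n) (y n)" using x y by (simp add: z_def ip_simps)
      also have "cmod \<dots> \<le> hnorm H (z n) * hnorm H (y n)" using zc y by (intro Cauchy_Schwarz) auto
      also have "\<dots> \<le> hnorm H (z n) * B" using B zc by (intro mult_left_mono) auto
      finally show "norm (ip H (x n) (y n) - ip H (x' n) (y n)) \<le> hnorm H (z n) * B" .
    qed
    show "(\<lambda>n. hnorm H (z n) * B) \<longlonglongrightarrow> 0" by (rule tendsto_mult_left_zero[OF null])
  qed
qed

lemma lim_ip_cong:
  assumes "cauchy x" "cauchy x'" "limit_fun x = limit_fun x'" "cauchy y" "cauchy y'" "limit_fun y = limit_fun y'"
  shows "lim (\<lambda>n. ip H (x n) (y n)) = lim (\<lambda>n. ip H (x' n) (y' n))"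
proof -
  have 1: "(\<lambda>n. ip H (x n) (y n) - ip H (x' n) (y n)) \<longlonglongrightarrow> 0" by (rule tendsto_ip_cong[OF assms(1-4)])
  have "(\<lambda>n. cnj (ip H (y n) (x' n) - ip H (y' n) (x' n))) \<longlonglongrightarrow> cnj 0"
    by (intro tendsto_cnj tendsto_ip_cong assms)
  moreover have "cnj (ip H (y n) (x' n) - ip H (y' n) (x' n)) = ip H (x' n) (y n) - ip H (x' n) (y' n)" for n
    unfolding complex_cnj_diff using assms ip_commute[of "y n" "x' n"] ip_commute[of "y' n" "x' n"] by simp
  ultimately have "(\<lambda>n. ip H (x' n) (y n) - ip H (x' n) (y' n)) \<longlonglongrightarrow> 0" by simp
  from tendsto_add[OF 1 this] have "(\<lambda>n. ip H (x n) (y n) - ip H (x' n) (y' n)) \<longlonglongrightarrow> 0" by simp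
  from tendsto_add[OF this, of "\<lambda>n. ip H (x' n) (y' n)"] convergent_ip[OF assms(2,5)]
  have "(\<lambda>n. ip H (x n) (y n)) \<longlonglongrightarrow> lim (\<lambda>n. ip H (x' n) (y' n))" by (simp add: convergent_LIMSEQ_iff)
  then show ?thesis by (rule limI)
qed

definition rep :: "('i \<Rightarrow> complex) \<Rightarrow> nat \<Rightarrow> 'a" where
  "rep u = (SOME x. cauchy x \<and> limit_fun x = u)"

definition completion :: "('i \<Rightarrow> complex) hilb" where
  "completion = \<lparr>carrier = limit_fun ` Collect cauchy, mult = undefined, one = undefined,
    zero = (\<lambda>i\<in>I. 0), add = (\<lambda>u v. \<lambda>i\<in>I. u i + v i), smult = (\<lambda>c u. \<lambda>i\<in>I. c * u i),
    ip = (\<lambda>u v. lim (\<lambda>n. ip H (rep u n) (rep v n)))\<rparr>"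

lemma completion_simps [simp]:
  "carrier completion = limit_fun ` Collect cauchy" "\<zero>\<^bsub>completion\<^esub> = (\<lambda>i\<in>I. 0)"
  "u \<oplus>\<^bsub>completion\<^esub> v = (\<lambda>i\<in>I. u i + v i)" "c \<odot>\<^bsub>completion\<^esub> u = (\<lambda>i\<in>I. c * u i)"
  by (simp_all add: completion_def)

lemma rep: "cauchy x \<Longrightarrow> cauchy (rep (limit_fun x))" "cauchy x \<Longrightarrow> limit_fun (rep (limit_fun x)) = limit_fun x"
  using someI[of "\<lambda>y. cauchy y \<and> limit_fun y = limit_fun x" x] unfolding rep_def by auto

lemma ip_completion: "\<lbrakk>cauchy x; cauchy y\<rbrakk> \<Longrightarrow> ip completion (limit_fun x) (limit_fun y) = lim (\<lambda>n. ip H (x n) (y n))"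
  unfolding completion_def hilb.simps by (intro lim_ip_cong rep)

lemma ip_completion_tendsto: "\<lbrakk>cauchy x; cauchy y\<rbrakk> \<Longrightarrow> (\<lambda>n. ip H (x n) (y n)) \<longlonglongrightarrow> ip completion (limit_fun x) (limit_fun y)"
  unfolding ip_completion using convergent_ip by (simp add: ip_completion convergent_LIMSEQ_iff)

lemma limit_fun_ext: "limit_fun x \<in> extensional I"
  by (simp add: limit_fun_def)

lemma limit_fun_zero: "limit_fun (\<lambda>n. \<zero>) = (\<lambda>i\<in>I. 0)"
  by (rule limit_fun_eqI) (simp_all add: \<delta>)

lemma inner_space_completion: "inner_space completion"
proof (intro inner_space.intro semi_inner_space.intro inner_space_axioms.intro)
  have ex: "\<exists>x. cauchy x \<and> u = limit_fun x" if "u \<in> carrier completion" for u using that by auto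
  have add_in: "(\<lambda>i\<in>I. limit_fun x i + limit_fun y i) \<in> carrier completion" if "cauchy x" "cauchy y" for x y
    using that cauchy_add limit_fun_add[symmetric] by auto
  have smult_in: "(\<lambda>i\<in>I. c * limit_fun x i) \<in> carrier completion" if "cauchy x" for x c
    using that cauchy_smult limit_fun_smult[symmetric] by auto
  have zero_in: "(\<lambda>i\<in>I. 0) \<in> carrier completion"
    using cauchy_const[OF M.zero_closed] limit_fun_zero[symmetric] by auto
  show "Module.module complex_ring completion"
  proof (rule Module.moduleI[OF cring_complex_ring])
    show "abelian_group completion"
    proof (rule abelian_groupI)
      fix u v assume "u \<in> carrier completion" "v \<in> carrier completion"
      then obtain x y where "cauchy x" "u = limit_fun x" "cauchy y" "v = limit_fun y" using ex by blast
      then show "u \<oplus>\<^bsub>completion\<^esub> v \<in> carrier completion" using add_in[of x y] by (simp only: completion_simps(3))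
    next
      fix u assume "u \<in> carrier completion"
      then obtain x where x: "cauchy x" "u = limit_fun x" using ex by blast
      show "\<zero>\<^bsub>completion\<^esub> \<oplus>\<^bsub>completion\<^esub> u = u"
        by (rule extensionalityI[of _ I]) (simp_all add: x(2) limit_fun_ext)
      show "\<exists>v\<in>carrier completion. v \<oplus>\<^bsub>completion\<^esub> u = \<zero>\<^bsub>completion\<^esub>"
        by (rule bexI[OF _ smult_in[OF x(1), of "-1"]]) (simp add: x(2) cong: restrict_cong)
    qed (use zero_in in \<open>auto simp: add_ac intro!: restrict_ext\<close>)
    fix u c assume "u \<in> carrier completion"
    then obtain x where x: "cauchy x" "u = limit_fun x" using ex by blast
    show "c \<odot>\<^bsub>completion\<^esub> u \<in> carrier completion" unfolding x(2) completion_simps(4) by (rule smult_in[OF x(1)])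
    show "\<one>\<^bsub>complex_ring\<^esub> \<odot>\<^bsub>completion\<^esub> u = u"
      by (rule extensionalityI[of _ I]) (simp_all add: x(2) limit_fun_ext complex_ring_def)
  qed (auto simp: complex_ring_def algebra_simps intro!: restrict_ext)
  fix u v w c assume "u \<in> carrier completion" "v \<in> carrier completion"
  then obtain x y where x: "cauchy x" "u = limit_fun x" and y: "cauchy y" "v = limit_fun y" using ex by blast
  note L = ip_completion_tendsto
  show "ip completion u (c \<odot>\<^bsub>completion\<^esub> v) = c * ip completion u v"
  proof (rule LIMSEQ_unique)
    show "(\<lambda>n. ip H (x n) (c \<odot> y n)) \<longlonglongrightarrow> ip completion u (c \<odot>\<^bsub>completion\<^esub> v)"
      unfolding x(2) y(2) completion_simps(4) limit_fun_smult[OF y(1), symmetric] by (rule L[OF x(1) cauchy_smult[OF y(1)]])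
    show "(\<lambda>n. ip H (x n) (c \<odot> y n)) \<longlonglongrightarrow> c * ip completion u v"
      unfolding x(2) y(2) using tendsto_mult_left[OF L[OF x(1) y(1)], of c] x(1) y(1) by (simp add: ip_smult)
  qed
  show "ip completion v u = cnj (ip completion u v)"
  proof (rule LIMSEQ_unique)
    show "(\<lambda>n. ip H (y n) (x n)) \<longlonglongrightarrow> ip completion v u" unfolding x(2) y(2) by (rule L[OF y(1) x(1)])
    have "ip H (y n) (x n) = cnj (ip H (x n) (y n))" for n using x(1) y(1) by (intro ip_commute) auto
    then show "(\<lambda>n. ip H (y n) (x n)) \<longlonglongrightarrow> cnj (ip completion u v)"
      unfolding x(2) y(2) using tendsto_cnj[OF L[OF x(1) y(1)]] by simp
  qed
  assume "w \<in> carrier completion"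
  then obtain z where z: "cauchy z" "w = limit_fun z" using ex by blast
  show "ip completion u (v \<oplus>\<^bsub>completion\<^esub> w) = ip completion u v + ip completion u w"
  proof (rule LIMSEQ_unique)
    show "(\<lambda>n. ip H (x n) (y n \<oplus> z n)) \<longlonglongrightarrow> ip completion u (v \<oplus>\<^bsub>completion\<^esub> w)"
      unfolding x(2) y(2) z(2) completion_simps(3) limit_fun_add[OF y(1) z(1), symmetric] by (rule L[OF x(1) cauchy_add[OF y(1) z(1)]])
    show "(\<lambda>n. ip H (x n) (y n \<oplus> z n)) \<longlonglongrightarrow> ip completion u v + ip completion u w"
      unfolding x(2) y(2) z(2) using tendsto_add[OF L[OF x(1) y(1)] L[OF x(1) z(1)]] x(1) y(1) z(1) by (simp add: ip_add)
  qed
next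
  fix u assume "u \<in> carrier completion"
  then obtain x where x: "cauchy x" "u = limit_fun x" by auto
  have L: "(\<lambda>n. ip H (x n) (x n)) \<longlonglongrightarrow> ip completion u u" unfolding x(2) by (rule ip_completion_tendsto[OF x(1) x(1)])
  show "0 \<le> Re (ip completion u u)"
    by (rule LIMSEQ_le_const[OF tendsto_Re[OF L]]) (use x(1) ip_nonneg in auto)
  assume "ip completion u u = 0"
  then have "(\<lambda>n. sqrt (Re (ip H (x n) (x n)))) \<longlonglongrightarrow> sqrt (Re 0)" using L by (intro tendsto_real_sqrt tendsto_Re) simp
  then have n0: "(\<lambda>n. hnorm H (x n)) \<longlonglongrightarrow> 0" by (simp add: hnorm_def)
  have "limit_fun x = (\<lambda>i\<in>I. 0)"
  proof (rule limit_fun_eqI)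
    fix i assume i: "i \<in> I"
    have "(\<lambda>n. ip H (\<delta> i) (x n)) \<longlonglongrightarrow> 0"
    proof (rule Lim_null_comparison)
      show "\<forall>\<^sub>F n in sequentially. norm (ip H (\<delta> i) (x n)) \<le> hnorm H (\<delta> i) * hnorm H (x n)"
        using x(1) i by (intro always_eventually allI Cauchy_Schwarz \<delta>) auto
      show "(\<lambda>n. hnorm H (\<delta> i) * hnorm H (x n)) \<longlonglongrightarrow> 0" by (rule tendsto_mult_right_zero[OF n0])
    qed
    then show "(\<lambda>n. ip H (\<delta> i) (x n)) \<longlonglongrightarrow> (\<lambda>i\<in>I. 0) i" using i by simp
  qed simp
  then show "u = \<zero>\<^bsub>completion\<^esub>" using x(2) by simp
qed

sublocale C: inner_space completion
  by (rule inner_space_completion)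

lemma limit_fun_minus:
  assumes "cauchy x" "cauchy y"
  shows "limit_fun x \<ominus>\<^bsub>completion\<^esub> limit_fun y = limit_fun (\<lambda>n. x n \<oplus> (-1) \<odot> y n)"
proof -
  have "limit_fun x \<in> carrier completion" "limit_fun y \<in> carrier completion" "limit_fun (\<lambda>n. x n \<oplus> (-1) \<odot> y n) \<in> carrier completion"
    using assms cauchy_minus by auto
  moreover have "limit_fun (\<lambda>n. x n \<oplus> (-1) \<odot> y n) = limit_fun x \<oplus>\<^bsub>completion\<^esub> (-1) \<odot>\<^bsub>completion\<^esub> limit_fun y"
    unfolding limit_fun_add[OF assms(1) cauchy_smult[OF assms(2)]] limit_fun_smult[OF assms(2)] by simp
  ultimately show ?thesis
    by (intro C.vec_eqI C.minus_carrier) (simp_all only: C.ip_simps C.smult_carrier mult_minus1 diff_conv_add_uminus)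
qed

lemma hnorm_limit_fun:
  assumes x: "cauchy x"
  shows "(\<lambda>n. hnorm H (x n)) \<longlonglongrightarrow> hnorm completion (limit_fun x)"
  unfolding hnorm_def by (intro tendsto_real_sqrt tendsto_Re ip_completion_tendsto x)

lemma hnorm_limit_fun_minus:
  assumes x: "cauchy x" and y: "cauchy y"
  shows "(\<lambda>n. hnorm H (x n \<ominus> y n)) \<longlonglongrightarrow> hnorm completion (limit_fun x \<ominus>\<^bsub>completion\<^esub> limit_fun y)"
proof -
  have "hnorm H (x n \<ominus> y n) = hnorm H (x n \<oplus> (-1) \<odot> y n)" for n
    unfolding hnorm_def using x y by (simp add: ip_simps)
  then show ?thesis unfolding limit_fun_minus[OF x y] using hnorm_limit_fun[OF cauchy_minus[OF x y]] by simp
qed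

text \<open>Constant sequences are dense: the \<open>m\<close>-th member of a Cauchy sequence of the completion has distance at
  most \<open>1 / (m + 1)\<close> from a vector \<open>p m\<close>, and the sequence \<open>p\<close> represents the limit.\<close>

lemma hilbert_space_completion: "hilbert_space completion"
proof (rule C.hilbert_spaceI)
  fix u assume u: "C.cauchy u"
  have "\<exists>x. cauchy x \<and> u m = limit_fun x" for m using C.cauchy_carrier[OF u, of m] by auto
  then obtain x where x: "\<And>m. cauchy (x m)" "\<And>m. u m = limit_fun (x m)" by metis
  have "\<exists>N. \<forall>n\<ge>N. hnorm H (x m n \<ominus> x m N) < 1 / Suc m" for m
    using cauchyE[OF x(1)[of m], of "1 / Suc m"] by (metis divide_pos_pos of_nat_0_less_iff order_refl zero_less_Suc zero_less_one)
  then obtain N where N: "\<And>m n. n \<ge> N m \<Longrightarrow> hnorm H (x m n \<ominus> x m (N m)) < 1 / Suc m" by metis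
  define p where "p m = x m (N m)" for m
  have pc: "p m \<in> carrier H" for m using x(1) by (simp add: p_def)
  define q where "q m = limit_fun (\<lambda>n. p m)" for m
  have qc: "q m \<in> carrier completion" and uc: "u m \<in> carrier completion" for m
    using cauchy_const[OF pc] C.cauchy_carrier[OF u] by (auto simp: q_def)
  have uq: "hnorm completion (u m \<ominus>\<^bsub>completion\<^esub> q m) \<le> 1 / Suc m" for m
  proof (rule LIMSEQ_le_const2)
    show "(\<lambda>n. hnorm H (x m n \<ominus> p m)) \<longlonglongrightarrow> hnorm completion (u m \<ominus>\<^bsub>completion\<^esub> q m)"
      unfolding x(2) q_def by (rule hnorm_limit_fun_minus[OF x(1) cauchy_const[OF pc]])
    show "\<exists>M. \<forall>n\<ge>M. hnorm H (x m n \<ominus> p m) \<le> 1 / Suc m"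
      using N[of m] unfolding p_def by (intro exI[of _ "N m"] allI impI less_imp_le) auto
  qed
  have qq: "hnorm completion (q m \<ominus>\<^bsub>completion\<^esub> q k) = hnorm H (p m \<ominus> p k)" for m k
    unfolding q_def using LIMSEQ_unique[OF hnorm_limit_fun_minus[OF cauchy_const[OF pc[of m]] cauchy_const[OF pc[of k]]] tendsto_const] .
  have small: "\<exists>M. \<forall>m\<ge>M. 1 / real (Suc m) < e" if "e > 0" for e
  proof -
    have "(\<lambda>m. 1 / real (Suc m)) \<longlonglongrightarrow> 0" by (rule LIMSEQ_Suc[OF lim_1_over_n])
    from order_tendstoD(2)[OF this that] show ?thesis by (simp add: eventually_sequentially)
  qed
  have p: "cauchy p"
    unfolding cauchy_def
  proof (intro conjI allI impI pc)
    fix e :: real assume "e > 0"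
    then have e: "e / 3 > 0" by simp
    obtain M1 where M1: "\<forall>m\<ge>M1. 1 / real (Suc m) < e / 3" using small[OF e] by blast
    obtain M2 where M2: "\<forall>m\<ge>M2. \<forall>n\<ge>M2. hnorm completion (u m \<ominus>\<^bsub>completion\<^esub> u n) < e / 3" using u e unfolding C.cauchy_def by blast
    have "hnorm H (p m \<ominus> p k) < e" if mk: "m \<ge> max M1 M2" "k \<ge> max M1 M2" for m k
    proof -
      have "hnorm H (p m \<ominus> p k) \<le> hnorm completion (q m \<ominus>\<^bsub>completion\<^esub> u m) + hnorm completion (u m \<ominus>\<^bsub>completion\<^esub> q k)"
        unfolding qq[symmetric] by (rule C.hnorm_triangle_minus[OF qc uc qc])
      also have "hnorm completion (u m \<ominus>\<^bsub>completion\<^esub> q k) \<le> hnorm completion (u m \<ominus>\<^bsub>completion\<^esub> u k) + hnorm completion (u k \<ominus>\<^bsub>completion\<^esub> q k)"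
        by (rule C.hnorm_triangle_minus[OF uc uc qc])
      also have "hnorm completion (q m \<ominus>\<^bsub>completion\<^esub> u m) = hnorm completion (u m \<ominus>\<^bsub>completion\<^esub> q m)"
        by (rule C.hnorm_minus_commute[OF qc uc])
      finally have "hnorm H (p m \<ominus> p k) \<le> hnorm completion (u m \<ominus>\<^bsub>completion\<^esub> q m) + (hnorm completion (u m \<ominus>\<^bsub>completion\<^esub> u k) + hnorm completion (u k \<ominus>\<^bsub>completion\<^esub> q k))"
        by simp
      moreover have "1 / real (Suc m) < e / 3" "1 / real (Suc k) < e / 3" "hnorm completion (u m \<ominus>\<^bsub>completion\<^esub> u k) < e / 3"
        using M1 M2 mk by auto
      ultimately show ?thesis using uq[of m] uq[of k] by linarith
    qed
    then show "\<exists>N. \<forall>m\<ge>N. \<forall>n\<ge>N. hnorm H (p m \<ominus> p n) < e" by blast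
  qed
  have lc: "limit_fun p \<in> carrier completion" using p by simp
  have "(\<lambda>m. hnorm completion (u m \<ominus>\<^bsub>completion\<^esub> limit_fun p)) \<longlonglongrightarrow> 0"
  proof (rule LIMSEQ_I)
    fix e :: real assume "e > 0"
    then have e: "e / 2 > 0" "e / 3 > 0" by auto
    obtain M1 where M1: "\<forall>m\<ge>M1. 1 / real (Suc m) < e / 2" using small[OF e(1)] by blast
    obtain M2 where M2: "\<And>m n. \<lbrakk>m \<ge> M2; n \<ge> M2\<rbrakk> \<Longrightarrow> hnorm H (p m \<ominus> p n) < e / 3" using cauchyE[OF p e(2)] by blast
    have "norm (hnorm completion (u m \<ominus>\<^bsub>completion\<^esub> limit_fun p) - 0) < e" if m: "m \<ge> max M1 M2" for m
    proof -
      have "hnorm completion (q m \<ominus>\<^bsub>completion\<^esub> limit_fun p) \<le> e / 3"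
      proof (rule LIMSEQ_le_const2)
        show "(\<lambda>n. hnorm H (p m \<ominus> p n)) \<longlonglongrightarrow> hnorm completion (q m \<ominus>\<^bsub>completion\<^esub> limit_fun p)"
          unfolding q_def by (rule hnorm_limit_fun_minus[OF cauchy_const[OF pc] p])
        show "\<exists>N. \<forall>n\<ge>N. hnorm H (p m \<ominus> p n) \<le> e / 3"
          using M2[of m] m by (intro exI[of _ M2] allI impI less_imp_le) auto
      qed
      moreover have "hnorm completion (u m \<ominus>\<^bsub>completion\<^esub> limit_fun p) \<le> hnorm completion (u m \<ominus>\<^bsub>completion\<^esub> q m) + hnorm completion (q m \<ominus>\<^bsub>completion\<^esub> limit_fun p)"
        by (rule C.hnorm_triangle_minus[OF uc qc lc])
      moreover have "1 / real (Suc m) < e / 2" using M1 m by auto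
      moreover have "0 \<le> hnorm completion (u m \<ominus>\<^bsub>completion\<^esub> limit_fun p)" by (rule C.hnorm_nonneg[OF C.minus_carrier[OF uc lc]])
      ultimately show ?thesis using uq[of m] e by simp
    qed
    then show "\<exists>no. \<forall>n\<ge>no. norm (hnorm completion (u n \<ominus>\<^bsub>completion\<^esub> limit_fun p) - 0) < e" by blast
  qed
  then have "C.converges u (limit_fun p) sequentially" using uc lc unfolding C.converges_def by blast
  then show "\<exists>l. C.converges u l sequentially" by blast
qed

lemma completion_spanned:
  shows "(\<lambda>i. limit_fun (\<lambda>n. \<delta> i)) ` I \<subseteq> carrier completion"
    and "\<lbrakk>i \<in> I; j \<in> I\<rbrakk> \<Longrightarrow> ip completion (limit_fun (\<lambda>n. \<delta> i)) (limit_fun (\<lambda>n. \<delta> j)) = ip H (\<delta> i) (\<delta> j)"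
    and "\<lbrakk>u \<in> carrier completion; \<And>i. i \<in> I \<Longrightarrow> ip completion (limit_fun (\<lambda>n. \<delta> i)) u = 0\<rbrakk> \<Longrightarrow> u = \<zero>\<^bsub>completion\<^esub>"
proof -
  show "(\<lambda>i. limit_fun (\<lambda>n. \<delta> i)) ` I \<subseteq> carrier completion" using cauchy_const[OF \<delta>] by auto
  show "ip completion (limit_fun (\<lambda>n. \<delta> i)) (limit_fun (\<lambda>n. \<delta> j)) = ip H (\<delta> i) (\<delta> j)" if "i \<in> I" "j \<in> I"
    using LIMSEQ_unique[OF ip_completion_tendsto[OF cauchy_const[OF \<delta>[OF that(1)]] cauchy_const[OF \<delta>[OF that(2)]]] tendsto_const] .
  assume u: "u \<in> carrier completion" and z: "\<And>i. i \<in> I \<Longrightarrow> ip completion (limit_fun (\<lambda>n. \<delta> i)) u = 0"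
  then obtain x where x: "cauchy x" "u = limit_fun x" by auto
  have "limit_fun x = (\<lambda>i\<in>I. 0)"
  proof (rule limit_fun_eqI)
    fix i assume i: "i \<in> I"
    show "(\<lambda>n. ip H (\<delta> i) (x n)) \<longlonglongrightarrow> (\<lambda>i\<in>I. 0) i"
      using ip_completion_tendsto[OF cauchy_const[OF \<delta>[OF i]] x(1)] z[OF i] i x(2) by simp
  qed simp
  then show "u = \<zero>\<^bsub>completion\<^esub>" using x(2) by simp
qed

end

text \<open>The free vector space over \<open>I\<close> with the semi-inner product for which \<open>\<langle>i, j\<rangle> = \<kappa> i j\<close>.\<close>

definition kernel_space :: "'i set \<Rightarrow> ('i \<Rightarrow> 'i \<Rightarrow> complex) \<Rightarrow> ('i \<Rightarrow> complex) hilb" where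
  "kernel_space I \<kappa> = \<lparr>carrier = {c. finite {i. c i \<noteq> 0} \<and> {i. c i \<noteq> 0} \<subseteq> I}, mult = undefined, one = undefined,
    zero = (\<lambda>i. 0), add = (\<lambda>c d i. c i + d i), smult = (\<lambda>a c i. a * c i),
    ip = (\<lambda>c d. \<Sum>i\<in>{i. c i \<noteq> 0}. \<Sum>j\<in>{i. d i \<noteq> 0}. cnj (c i) * d j * \<kappa> i j)\<rparr>"

text \<open>This is the completion of the free vector space over the index set. Its vectors are determined by their
  inner products with the \<open>\<phi> i\<close>, so that functions on the index set can represent them.\<close>

theorem Kolmogorov_decomposition:
  fixes \<kappa> :: "'i \<Rightarrow> 'i \<Rightarrow> complex"
  assumes pos: "\<And>A c. \<lbrakk>finite A; A \<subseteq> I\<rbrakk> \<Longrightarrow> (\<Sum>i\<in>A. \<Sum>j\<in>A. cnj (c i) * c j * \<kappa> i j) \<in> \<real>\<^sub>\<ge>\<^sub>0"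
  shows "\<exists>(H :: ('i \<Rightarrow> complex) hilb) \<phi>. hilbert_space H \<and> \<phi> ` I \<subseteq> carrier H \<and>
    (\<forall>i\<in>I. \<forall>j\<in>I. ip H (\<phi> i) (\<phi> j) = \<kappa> i j) \<and>
    (\<forall>u\<in>carrier H. (\<forall>i\<in>I. ip H (\<phi> i) u = 0) \<longrightarrow> u = \<zero>\<^bsub>H\<^esub>)"
proof -
  have herm: "\<kappa> j i = cnj (\<kappa> i j)" if i: "i \<in> I" and j: "j \<in> I" for i j
  proof (cases "i = j")
    case True
    then show ?thesis using pos[of "{i}" "\<lambda>_. 1"] i by (simp add: complex_nonneg_Reals_iff complex_eq_iff)
  next
    case False
    have k: "Im (\<kappa> l l) = 0" if "l \<in> I" for l
      using pos[of "{l}" "\<lambda>_. 1"] that by (simp add: complex_nonneg_Reals_iff)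
    \<comment> \<open>the coefficients \<open>(1, 1)\<close> give the imaginary part and \<open>(1, \<i>)\<close> gives the real part\<close>
    have "Im (\<kappa> i j) + Im (\<kappa> j i) = 0"
      using pos[of "{i, j}" "\<lambda>_. 1"] i j False k[OF i] k[OF j] by (simp add: complex_nonneg_Reals_iff)
    moreover have "Re (\<kappa> i j) - Re (\<kappa> j i) = 0"
      using pos[of "{i, j}" "\<lambda>l. if l = i then 1 else \<i>"] i j False k[OF i] k[OF j] by (simp add: complex_nonneg_Reals_iff)
    ultimately show ?thesis by (simp add: complex_eq_iff)
  qed
  define P where "P = kernel_space I \<kappa>"
  have P [simp]: "carrier P = {c. finite {i. c i \<noteq> 0} \<and> {i. c i \<noteq> 0} \<subseteq> I}" "\<zero>\<^bsub>P\<^esub> = (\<lambda>i. 0)"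
    "c \<oplus>\<^bsub>P\<^esub> d = (\<lambda>i. c i + d i)" "a \<odot>\<^bsub>P\<^esub> c = (\<lambda>i. a * c i)" for c d a
    by (simp_all add: P_def kernel_space_def)
  have ipP: "ip P c d = (\<Sum>i\<in>A. \<Sum>j\<in>A. cnj (c i) * d j * \<kappa> i j)"
    if A: "finite A" "{i. c i \<noteq> 0} \<subseteq> A" "{i. d i \<noteq> 0} \<subseteq> A" for A c d
  proof -
    have "ip P c d = (\<Sum>i\<in>{i. c i \<noteq> 0}. \<Sum>j\<in>{i. d i \<noteq> 0}. cnj (c i) * d j * \<kappa> i j)"
      by (simp add: P_def kernel_space_def)
    also have "\<dots> = (\<Sum>i\<in>A. \<Sum>j\<in>{i. d i \<noteq> 0}. cnj (c i) * d j * \<kappa> i j)"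
      using A by (intro sum.mono_neutral_left) auto
    also have "\<dots> = (\<Sum>i\<in>A. \<Sum>j\<in>A. cnj (c i) * d j * \<kappa> i j)"
      using A by (intro sum.cong sum.mono_neutral_left) auto
    finally show ?thesis .
  qed
  have fin_add: "finite {i. c i + d i \<noteq> 0} \<and> {i. c i + d i \<noteq> 0} \<subseteq> I" if "c \<in> carrier P" "d \<in> carrier P" for c d
  proof -
    have sub: "{i. c i + d i \<noteq> 0} \<subseteq> {i. c i \<noteq> 0} \<union> {i. d i \<noteq> 0}" by auto
    have "finite ({i. c i \<noteq> 0} \<union> {i. d i \<noteq> 0})" "{i. c i \<noteq> 0} \<union> {i. d i \<noteq> 0} \<subseteq> I" using that by simp_all
    then show ?thesis using finite_subset[OF sub] order_trans[OF sub] by blast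
  qed
  have fin_smult: "finite {i. a * c i \<noteq> 0} \<and> {i. a * c i \<noteq> 0} \<subseteq> I" if "c \<in> carrier P" for a c
  proof -
    have sub: "{i. a * c i \<noteq> 0} \<subseteq> {i. c i \<noteq> 0}" by auto
    have "finite {i. c i \<noteq> 0}" "{i. c i \<noteq> 0} \<subseteq> I" using that by simp_all
    then show ?thesis using finite_subset[OF sub] order_trans[OF sub] by blast
  qed
  have sip: "semi_inner_space P"
  proof (intro semi_inner_space.intro)
    show "Module.module complex_ring P"
    proof (rule Module.moduleI[OF cring_complex_ring])
      show "abelian_group P"
      proof (rule abelian_groupI)
        fix c assume "c \<in> carrier P"
        then show "\<exists>d\<in>carrier P. d \<oplus>\<^bsub>P\<^esub> c = \<zero>\<^bsub>P\<^esub>" by (intro bexI[of _ "\<lambda>i. - c i"]) auto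
        show "\<zero>\<^bsub>P\<^esub> \<oplus>\<^bsub>P\<^esub> c = c" by simp
      next
        fix c d assume "c \<in> carrier P" "d \<in> carrier P"
        then show "c \<oplus>\<^bsub>P\<^esub> d \<in> carrier P" using fin_add by simp
      qed (auto simp: add_ac)
      fix a c assume "c \<in> carrier P"
      then show "a \<odot>\<^bsub>P\<^esub> c \<in> carrier P" using fin_smult by simp
    qed (auto simp: complex_ring_def algebra_simps)
    fix x y assume xy: "x \<in> carrier P" "y \<in> carrier P"
    show "ip P x (c \<odot>\<^bsub>P\<^esub> y) = c * ip P x y" for c
    proof -
      let ?A = "{i. x i \<noteq> 0} \<union> {i. y i \<noteq> 0}"
      have "finite ?A" using xy by simp
      then show ?thesis by (subst (1 2) ipP[of ?A]) (auto simp: sum_distrib_left mult_ac)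
    qed
    show "ip P y x = cnj (ip P x y)"
    proof -
      let ?A = "{i. x i \<noteq> 0} \<union> {i. y i \<noteq> 0}"
      have A: "finite ?A" "?A \<subseteq> I" using xy by auto
      have "ip P y x = (\<Sum>i\<in>?A. \<Sum>j\<in>?A. cnj (y i) * x j * \<kappa> i j)" by (rule ipP) (use A in auto)
      also have "\<dots> = (\<Sum>j\<in>?A. \<Sum>i\<in>?A. cnj (y i) * x j * \<kappa> i j)" by (rule sum.swap)
      also have "\<dots> = (\<Sum>j\<in>?A. \<Sum>i\<in>?A. cnj (cnj (x j) * y i * \<kappa> j i))"
      proof (intro sum.cong refl)
        fix j i assume "j \<in> ?A" "i \<in> ?A"
        then have "\<kappa> i j = cnj (\<kappa> j i)" using A(2) by (intro herm) blast+
        then show "cnj (y i) * x j * \<kappa> i j = cnj (cnj (x j) * y i * \<kappa> j i)" by (simp add: mult_ac)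
      qed
      also have "\<dots> = cnj (\<Sum>j\<in>?A. \<Sum>i\<in>?A. cnj (x j) * y i * \<kappa> j i)" by simp
      also have "(\<Sum>j\<in>?A. \<Sum>i\<in>?A. cnj (x j) * y i * \<kappa> j i) = ip P x y" by (rule ipP[symmetric]) (use A in auto)
      finally show ?thesis .
    qed
    fix z assume z: "z \<in> carrier P"
    let ?A = "{i. x i \<noteq> 0} \<union> {i. y i \<noteq> 0} \<union> {i. z i \<noteq> 0}"
    have A: "finite ?A" using xy z by simp
    have sub: "{i. y i \<noteq> 0} \<subseteq> ?A" "{i. z i \<noteq> 0} \<subseteq> ?A" by blast+
    have e: "ip P x w = (\<Sum>i\<in>?A. \<Sum>j\<in>?A. cnj (x i) * w j * \<kappa> i j)" if "{i. w i \<noteq> 0} \<subseteq> ?A" for w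
      by (rule ipP[OF A _ that]) auto
    have "ip P x (y \<oplus>\<^bsub>P\<^esub> z) = (\<Sum>i\<in>?A. \<Sum>j\<in>?A. cnj (x i) * (y j + z j) * \<kappa> i j)" unfolding P by (rule e) auto
    also have "\<dots> = (\<Sum>i\<in>?A. \<Sum>j\<in>?A. cnj (x i) * y j * \<kappa> i j) + (\<Sum>i\<in>?A. \<Sum>j\<in>?A. cnj (x i) * z j * \<kappa> i j)"
      by (simp only: distrib_left distrib_right sum.distrib)
    also have "\<dots> = ip P x y + ip P x z" unfolding e[OF sub(1)] e[OF sub(2)] ..
    finally show "ip P x (y \<oplus>\<^bsub>P\<^esub> z) = ip P x y + ip P x z" .
  next
    fix x assume x: "x \<in> carrier P"
    have "ip P x x \<in> \<real>\<^sub>\<ge>\<^sub>0" by (subst ipP[of "{i. x i \<noteq> 0}"]) (use x pos in auto)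
    then show "0 \<le> Re (ip P x x)" by (simp add: complex_nonneg_Reals_iff)
  qed
  define \<delta> where "\<delta> i = (\<lambda>j. if j = i then 1 else 0 :: complex)" for i :: 'i
  have supp: "{j. \<delta> i j \<noteq> 0} = {i}" for i by (auto simp: \<delta>_def)
  interpret S: spanned_space P \<delta> I
  proof (intro spanned_space.intro spanned_space_axioms.intro sip)
    show "i \<in> I \<Longrightarrow> \<delta> i \<in> carrier P" for i by (simp add: supp)
    fix c assume c: "c \<in> carrier P"
    have "ip P c x = (\<Sum>i\<in>{i. c i \<noteq> 0}. cnj (c i) * ip P (\<delta> i) x)" if x: "x \<in> carrier P" for x
    proof -
      have "ip P (\<delta> i) x = (\<Sum>j\<in>{j. x j \<noteq> 0}. x j * \<kappa> i j)" for i
      proof -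
        have "ip P (\<delta> i) x = (\<Sum>k\<in>{j. \<delta> i j \<noteq> 0}. \<Sum>j\<in>{j. x j \<noteq> 0}. cnj (\<delta> i k) * x j * \<kappa> k j)"
          by (simp add: P_def kernel_space_def)
        then show ?thesis unfolding supp by (simp add: \<delta>_def)
      qed
      moreover have "ip P c x = (\<Sum>i\<in>{i. c i \<noteq> 0}. \<Sum>j\<in>{j. x j \<noteq> 0}. cnj (c i) * x j * \<kappa> i j)"
        by (simp add: P_def kernel_space_def)
      ultimately show ?thesis by (simp add: sum_distrib_left mult.assoc)
    qed
    then show "\<exists>A a. finite A \<and> A \<subseteq> I \<and> (\<forall>x\<in>carrier P. ip P c x = (\<Sum>i\<in>A. a i * ip P (\<delta> i) x))"
      using c by (intro exI[of _ "{i. c i \<noteq> 0}"] exI[of _ "\<lambda>i. cnj (c i)"]) auto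
  qed
  have "ip P (\<delta> i) (\<delta> j) = \<kappa> i j" for i j
  proof -
    have "ip P (\<delta> i) (\<delta> j) = (\<Sum>k\<in>{k. \<delta> i k \<noteq> 0}. \<Sum>l\<in>{l. \<delta> j l \<noteq> 0}. cnj (\<delta> i k) * \<delta> j l * \<kappa> k l)"
      by (simp add: P_def kernel_space_def)
    then show ?thesis unfolding supp by (simp add: \<delta>_def)
  qed
  then show ?thesis
    using S.hilbert_space_completion S.completion_spanned
    by (intro exI[of _ S.completion] exI[of _ "\<lambda>i. S.limit_fun (\<lambda>n. \<delta> i)"]) (simp only: , blast)
qed


section \<open>Normal completely positive maps\<close>

locale normal_cp = W: wstar K \<nu> + H: hilbert_space H + V: op_module H V
  for K :: "'k hilb" and \<nu> :: "'o measure" and H :: "'h hilb" and V :: "('h \<Rightarrow> 'h, 'v) rmodule" +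
  fixes S :: "(('k \<times> ('o \<Rightarrow> complex) set \<Rightarrow> complex) \<Rightarrow> ('k \<times> ('o \<Rightarrow> complex) set \<Rightarrow> complex)) \<Rightarrow> 'v \<times> 'v \<Rightarrow> 'h \<Rightarrow> 'h"
  assumes cp: "cp_map (htensor K (L2 \<nu>)) (wstar_tensor K \<nu>) H V S"
    and normal: "normal_map (htensor K (L2 \<nu>)) (wstar_tensor K \<nu>) H V S"
begin

interpretation KK: hilbert_pair K K by unfold_locales
interpretation HH: hilbert_pair H H by unfold_locales

text \<open>Matrix elements, which turn identities and inequalities between operators into scalar ones.\<close>

definition s :: "(('k \<times> ('o \<Rightarrow> complex) set \<Rightarrow> complex) \<Rightarrow> ('k \<times> ('o \<Rightarrow> complex) set \<Rightarrow> complex)) \<Rightarrow> 'v \<Rightarrow> 'v \<Rightarrow> 'h \<Rightarrow> 'h \<Rightarrow> complex" where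
  "s d v w \<xi> \<eta> = ip H \<xi> (S d (v, w) \<eta>)"

lemma V_carrier:
  "\<lbrakk>v \<in> carrier V; w \<in> carrier V\<rbrakk> \<Longrightarrow> v \<oplus>\<^bsub>V\<^esub> w \<in> carrier V"
  "v \<in> carrier V \<Longrightarrow> c \<odot>\<^bsub>V\<^esub> v \<in> carrier V"
proof -
  interpret M: Module.module complex_ring V by (rule V.vector_space)
  show "\<lbrakk>v \<in> carrier V; w \<in> carrier V\<rbrakk> \<Longrightarrow> v \<oplus>\<^bsub>V\<^esub> w \<in> carrier V" by simp
  show "v \<in> carrier V \<Longrightarrow> c \<odot>\<^bsub>V\<^esub> v \<in> carrier V" using M.smult_closed[of c v] by (simp add: complex_ring_def)
qed

lemma S_linear: "linear_map W.D (sesq_forms H V) S"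
  using cp by (simp add: cp_map_def)

lemma S_sesq:
  assumes "d \<in> carrier W.D" shows "S d \<in> carrier (sesq_forms H V)"
  using S_linear assms by (auto simp: linear_map_def)

lemma S_ops:
  assumes "d \<in> carrier W.D" "v \<in> carrier V" "w \<in> carrier V"
  shows "S d (v, w) \<in> carrier (bounded_ops H H)"
  using S_sesq[OF assms(1)] assms(2,3) by (auto simp: sesq_forms_def Let_def)

lemma S_in: "\<lbrakk>d \<in> carrier W.D; v \<in> carrier V; w \<in> carrier V; \<eta> \<in> carrier H\<rbrakk> \<Longrightarrow> S d (v, w) \<eta> \<in> carrier H"
  using bounded_opsD(2)[OF S_ops] by blast

lemma s_add_op:
  assumes d: "d \<in> carrier W.D" "d' \<in> carrier W.D" and "v \<in> carrier V" "w \<in> carrier V" "\<xi> \<in> carrier H" "\<eta> \<in> carrier H"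
  shows "s (d \<oplus>\<^bsub>W.D\<^esub> d') v w \<xi> \<eta> = s d v w \<xi> \<eta> + s d' v w \<xi> \<eta>"
proof -
  have "S (d \<oplus>\<^bsub>W.D\<^esub> d') = S d \<oplus>\<^bsub>sesq_forms H V\<^esub> S d'" using S_linear d unfolding linear_map_def by blast
  then show ?thesis using assms S_in by (simp add: s_def sesq_forms_def Let_def H.ip_add del: W.wstar_simps)
qed

lemma s_smult_op:
  assumes d: "d \<in> carrier W.D" and "v \<in> carrier V" "w \<in> carrier V" "\<xi> \<in> carrier H" "\<eta> \<in> carrier H"
  shows "s (c \<odot>\<^bsub>W.D\<^esub> d) v w \<xi> \<eta> = c * s d v w \<xi> \<eta>"
proof -
  have "S (c \<odot>\<^bsub>W.D\<^esub> d) = c \<odot>\<^bsub>sesq_forms H V\<^esub> S d" using S_linear d unfolding linear_map_def by blast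
  then show ?thesis using assms S_in by (simp add: s_def sesq_forms_def Let_def H.ip_smult del: W.wstar_simps)
qed

context
  fixes d u v \<xi> \<eta>
  assumes d: "d \<in> carrier W.D" and u: "u \<in> carrier V" and v: "v \<in> carrier V" and \<xi>: "\<xi> \<in> carrier H" and \<eta>: "\<eta> \<in> carrier H"
begin

lemma s_add_right:
  assumes w: "w \<in> carrier V"
  shows "s d u (v \<oplus>\<^bsub>V\<^esub> w) \<xi> \<eta> = s d u v \<xi> \<eta> + s d u w \<xi> \<eta>"
proof -
  have "S d (u, v \<oplus>\<^bsub>V\<^esub> w) = S d (u, v) \<oplus>\<^bsub>op_algebra H\<^esub> S d (u, w)"
    using S_sesq[OF d] u v w by (simp add: sesq_forms_def Let_def del: op_algebra_simps)
  then show ?thesis using \<xi> \<eta> S_in d u v w by (simp add: s_def H.ip_add)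
qed

lemma s_add_left:
  assumes w: "w \<in> carrier V"
  shows "s d (w \<oplus>\<^bsub>V\<^esub> u) v \<xi> \<eta> = s d w v \<xi> \<eta> + s d u v \<xi> \<eta>"
proof -
  have "S d (w \<oplus>\<^bsub>V\<^esub> u, v) = S d (w, v) \<oplus>\<^bsub>op_algebra H\<^esub> S d (u, v)"
    using S_sesq[OF d] u v w by (simp add: sesq_forms_def Let_def del: op_algebra_simps)
  then show ?thesis using \<xi> \<eta> S_in d u v w by (simp add: s_def H.ip_add)
qed

lemma s_smult_right: "s d u (c \<odot>\<^bsub>V\<^esub> v) \<xi> \<eta> = c * s d u v \<xi> \<eta>"
proof -
  have "S d (u, c \<odot>\<^bsub>V\<^esub> v) = c \<odot>\<^bsub>op_algebra H\<^esub> S d (u, v)"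
    using S_sesq[OF d] u v by (simp add: sesq_forms_def Let_def del: op_algebra_simps)
  then show ?thesis using \<xi> \<eta> S_in d u v by (simp add: s_def H.ip_smult)
qed

lemma s_smult_left: "s d (c \<odot>\<^bsub>V\<^esub> u) v \<xi> \<eta> = cnj c * s d u v \<xi> \<eta>"
proof -
  have "S d (c \<odot>\<^bsub>V\<^esub> u, v) = cnj c \<odot>\<^bsub>op_algebra H\<^esub> S d (u, v)"
    using S_sesq[OF d] u v by (simp add: sesq_forms_def Let_def del: op_algebra_simps)
  then show ?thesis using \<xi> \<eta> S_in d u v by (simp add: s_def H.ip_smult)
qed

lemma s_act_right:
  assumes a: "a \<in> carrier (bounded_ops H H)"
  shows "s d u (v \<cdot>\<^bsub>V\<^esub> a) \<xi> \<eta> = s d u v \<xi> (a \<eta>)"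
proof -
  have "S d (u, v \<cdot>\<^bsub>V\<^esub> a) = S d (u, v) \<otimes>\<^bsub>op_algebra H\<^esub> a"
    using S_sesq[OF d] u v a by (simp add: sesq_forms_def Let_def del: op_algebra_simps(2-))
  then show ?thesis using \<eta> by (simp add: s_def compose_def)
qed

lemma s_act_left:
  assumes a: "a \<in> carrier (bounded_ops H H)"
  shows "s d (u \<cdot>\<^bsub>V\<^esub> a) v \<xi> \<eta> = s d u v (a \<xi>) \<eta>"
proof -
  have "S d (u \<cdot>\<^bsub>V\<^esub> a, v) = adj H H a \<otimes>\<^bsub>op_algebra H\<^esub> S d (u, v)"
    using S_sesq[OF d] u v a by (simp add: sesq_forms_def Let_def del: op_algebra_simps(2-))
  then show ?thesis using \<eta> HH.ip_adj[OF a \<xi> S_in[OF d u v \<eta>]] by (simp add: s_def compose_def)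
qed

lemma s_add_vec_right: "\<eta>' \<in> carrier H \<Longrightarrow> s d u v \<xi> (\<eta> \<oplus>\<^bsub>H\<^esub> \<eta>') = s d u v \<xi> \<eta> + s d u v \<xi> \<eta>'"
  using \<xi> \<eta> S_in[OF d u v] by (simp add: s_def bounded_opsD(3)[OF S_ops[OF d u v]] H.ip_add)

lemma s_smult_vec_right: "s d u v \<xi> (c \<odot>\<^bsub>H\<^esub> \<eta>) = c * s d u v \<xi> \<eta>"
  using \<xi> \<eta> S_in[OF d u v] by (simp add: s_def bounded_opsD(4)[OF S_ops[OF d u v]] H.ip_smult)

lemma s_smult_vec_left: "s d u v (c \<odot>\<^bsub>H\<^esub> \<xi>) \<eta> = cnj c * s d u v \<xi> \<eta>"
  using \<xi> \<eta> S_in[OF d u v] by (simp add: s_def H.ip_smult_left)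

end

text \<open>The module structure absorbs the vectors: \<open>\<xi> j = a j \<zeta>\<close> for a fixed unit vector \<open>\<zeta>\<close> and
  rank-one operators \<open>a j\<close>, which are moved into the elements \<open>v j\<close> of the module.\<close>

lemma s_positive:
  assumes A: "finite A"
    and d: "\<And>j. j \<in> A \<Longrightarrow> d j \<in> carrier W.D"
      "\<And>j k. \<lbrakk>j \<in> A; k \<in> A\<rbrakk> \<Longrightarrow> compose (carrier W.G) (adj W.G W.G (d j)) (d k) \<in> carrier W.D"
    and v: "\<And>j. j \<in> A \<Longrightarrow> v j \<in> carrier V" and \<xi>: "\<And>j. j \<in> A \<Longrightarrow> \<xi> j \<in> carrier H"
  shows "(\<Sum>j\<in>A. \<Sum>k\<in>A. s (compose (carrier W.G) (adj W.G W.G (d j)) (d k)) (v j) (v k) (\<xi> j) (\<xi> k)) \<in> \<real>\<^sub>\<ge>\<^sub>0"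
proof (cases "carrier H = {\<zero>\<^bsub>H\<^esub>}")
  case True
  have "s (compose (carrier W.G) (adj W.G W.G (d j)) (d k)) (v j) (v k) (\<xi> j) (\<xi> k) = 0" if jk: "j \<in> A" "k \<in> A" for j k
  proof -
    have "\<xi> j = \<zero>\<^bsub>H\<^esub>" using \<xi>[OF jk(1)] True by blast
    then show ?thesis using S_in[OF d(2)[OF jk] v[OF jk(1)] v[OF jk(2)] \<xi>[OF jk(2)]] by (simp add: s_def)
  qed
  then show ?thesis by simp
next
  case False
  then obtain z where z: "z \<in> carrier H" "z \<noteq> \<zero>\<^bsub>H\<^esub>" using H.M.zero_closed by blast
  then have n: "hnorm H z > 0" using H.hnorm_eq_zero[OF z(1)] H.hnorm_nonneg[OF z(1)] by linarith
  define \<zeta> where "\<zeta> = of_real (1 / hnorm H z) \<odot>\<^bsub>H\<^esub> z"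
  have \<zeta>: "\<zeta> \<in> carrier H" "ip H \<zeta> \<zeta> = 1"
    using z n H.ip_self[OF z(1)] by (simp_all add: \<zeta>_def H.ip_simps power2_eq_square)
  define a where "a j = rank_one H H (\<xi> j) \<zeta>" for j
  have a: "a j \<in> carrier (bounded_ops H H)" if "j \<in> A" for j
    unfolding a_def by (rule HH.rank_one_ops[OF \<xi>[OF that] \<zeta>(1)])
  have a\<zeta>: "a j \<zeta> = \<xi> j" if "j \<in> A" for j
    using \<zeta> \<xi>[OF that] by (auto simp: a_def rank_one_def H.ip_simps intro!: H.vec_eqI)
  have va: "v j \<cdot>\<^bsub>V\<^esub> a j \<in> carrier V" if "j \<in> A" for j
    using V.act_closed v[OF that] a[OF that] by simp
  obtain h where h: "bij_betw h {1..card A} A" using A ex_bij_betw_nat_finite_1 by blast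
  have hA: "h j \<in> A" if "j \<in> {1..card A}" for j using h that bij_betwE by blast
  let ?c = "\<lambda>j k. compose (carrier W.G) (adj W.G W.G (d (h j))) (d (h k))"
  let ?t = "\<lambda>j k. S (?c j k) (v (h j) \<cdot>\<^bsub>V\<^esub> a (h j), v (h k) \<cdot>\<^bsub>V\<^esub> a (h k))"
  have t: "?t j k \<in> carrier (op_algebra H)" if "j \<in> {1..card A}" "k \<in> {1..card A}" for j k
    unfolding op_algebra_simps(1) using that by (intro S_ops d(2) va hA)
  have "positive_op H (\<Oplus>\<^bsub>op_algebra H\<^esub>j\<in>{1..card A}. \<Oplus>\<^bsub>op_algebra H\<^esub>k\<in>{1..card A}. ?t j k)"
    using cp unfolding cp_map_def W.wstar_simps(3)
    by (elim conjE allE[of _ "card A"] allE[of _ "\<lambda>j. d (h j)"] allE[of _ "\<lambda>j. v (h j) \<cdot>\<^bsub>V\<^esub> a (h j)"])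
      (use hA d(1) va in auto)
  then have "ip H \<zeta> ((\<Oplus>\<^bsub>op_algebra H\<^esub>j\<in>{1..card A}. \<Oplus>\<^bsub>op_algebra H\<^esub>k\<in>{1..card A}. ?t j k) \<zeta>) \<in> \<real>\<^sub>\<ge>\<^sub>0"
    using \<zeta>(1) by (simp add: positive_op_def)
  also have "ip H \<zeta> ((\<Oplus>\<^bsub>op_algebra H\<^esub>j\<in>{1..card A}. \<Oplus>\<^bsub>op_algebra H\<^esub>k\<in>{1..card A}. ?t j k) \<zeta>)
      = (\<Sum>j\<in>{1..card A}. ip H \<zeta> ((\<Oplus>\<^bsub>op_algebra H\<^esub>k\<in>{1..card A}. ?t j k) \<zeta>))"
    by (rule H.ip_finsum_ops(2)[OF _ H.ip_finsum_ops(1)[OF _ t \<zeta>(1) \<zeta>(1)] \<zeta>(1) \<zeta>(1)]) auto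
  also have "\<dots> = (\<Sum>j\<in>{1..card A}. \<Sum>k\<in>{1..card A}. ip H \<zeta> (?t j k \<zeta>))"
    by (intro sum.cong refl H.ip_finsum_ops(2) t \<zeta>(1)) auto
  also have "\<dots> = (\<Sum>j\<in>{1..card A}. \<Sum>k\<in>{1..card A}. s (?c j k) (v (h j)) (v (h k)) (\<xi> (h j)) (\<xi> (h k)))"
  proof (intro sum.cong refl)
    fix j k assume "j \<in> {1..card A}" "k \<in> {1..card A}"
    then have jk: "h j \<in> A" "h k \<in> A" using hA by auto
    have "ip H \<zeta> (?t j k \<zeta>) = s (?c j k) (v (h j) \<cdot>\<^bsub>V\<^esub> a (h j)) (v (h k) \<cdot>\<^bsub>V\<^esub> a (h k)) \<zeta> \<zeta>" by (simp add: s_def)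
    also have "\<dots> = s (?c j k) (v (h j)) (v (h k)) (a (h j) \<zeta>) (a (h k) \<zeta>)"
      using s_act_right[OF d(2)[OF jk] va[OF jk(1)] v[OF jk(2)] \<zeta>(1) \<zeta>(1) a[OF jk(2)]]
        s_act_left[OF d(2)[OF jk] v[OF jk(1)] v[OF jk(2)] \<zeta>(1) _ a[OF jk(1)], of "a (h k) \<zeta>"] \<xi>[OF jk(2)] a\<zeta>[OF jk(2)] by simp
    finally show "ip H \<zeta> (?t j k \<zeta>) = s (?c j k) (v (h j)) (v (h k)) (\<xi> (h j)) (\<xi> (h k))"
      using a\<zeta>[OF jk(1)] a\<zeta>[OF jk(2)] by simp
  qed
  also have "\<dots> = (\<Sum>j\<in>{1..card A}. \<Sum>k\<in>A. s (compose (carrier W.G) (adj W.G W.G (d (h j))) (d k)) (v (h j)) (v k) (\<xi> (h j)) (\<xi> k))"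
    by (intro sum.cong refl sum.reindex_bij_betw[OF h])
  also have "\<dots> = (\<Sum>j\<in>A. \<Sum>k\<in>A. s (compose (carrier W.G) (adj W.G W.G (d j)) (d k)) (v j) (v k) (\<xi> j) (\<xi> k))"
    by (rule sum.reindex_bij_betw[OF h])
  finally show ?thesis .
qed

text \<open>Normality is only assumed on the diagonal and extends to all pairs by polarization.\<close>

lemma s_tendsto:
  assumes T: "limitin (sigma_weak W.G W.G) T L F" "\<forall>\<^sub>F n in F. T n \<in> carrier W.D" and L: "L \<in> carrier W.D"
    and v: "v \<in> carrier V" and w: "w \<in> carrier V" and \<xi>: "\<xi> \<in> carrier H" and \<eta>: "\<eta> \<in> carrier H"
  shows "((\<lambda>n. s (T n) v w \<xi> \<eta>) \<longlongrightarrow> s L v w \<xi> \<eta>) F"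
proof -
  have diag: "((\<lambda>n. s (T n) u u \<xi> \<eta>) \<longlongrightarrow> s L u u \<xi> \<eta>) F" if u: "u \<in> carrier V" for u
  proof -
    have "continuous_map (subtopology (sigma_weak W.G W.G) (carrier W.D)) (sigma_weak H H) (\<lambda>d. S d (u, u))"
      using normal u by (simp add: normal_map_def)
    moreover have "limitin (subtopology (sigma_weak W.G W.G) (carrier W.D)) T L F"
      using T L by (simp add: limitin_subtopology)
    ultimately have "limitin (sigma_weak H H) ((\<lambda>d. S d (u, u)) \<circ> T) (S L (u, u)) F"
      by (rule continuous_map_limit)
    from HH.limitin_sigma_weakD[OF this \<xi> \<eta>] show ?thesis by (simp add: s_def)
  qed
  define q where "q d u = s d u u \<xi> \<eta>" for d u
  have pol: "s d v w \<xi> \<eta> = (q d (v \<oplus>\<^bsub>V\<^esub> w) - q d (v \<oplus>\<^bsub>V\<^esub> (-1) \<odot>\<^bsub>V\<^esub> w) - \<i> * q d (v \<oplus>\<^bsub>V\<^esub> \<i> \<odot>\<^bsub>V\<^esub> w) + \<i> * q d (v \<oplus>\<^bsub>V\<^esub> (-\<i>) \<odot>\<^bsub>V\<^esub> w)) / 4"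
    if d: "d \<in> carrier W.D" for d
    using d v w \<xi> \<eta> by (simp add: q_def s_add_left s_add_right s_smult_left s_smult_right V_carrier algebra_simps)
  have "((\<lambda>n. (q (T n) (v \<oplus>\<^bsub>V\<^esub> w) - q (T n) (v \<oplus>\<^bsub>V\<^esub> (-1) \<odot>\<^bsub>V\<^esub> w) - \<i> * q (T n) (v \<oplus>\<^bsub>V\<^esub> \<i> \<odot>\<^bsub>V\<^esub> w) + \<i> * q (T n) (v \<oplus>\<^bsub>V\<^esub> (-\<i>) \<odot>\<^bsub>V\<^esub> w)) / 4)
      \<longlongrightarrow> s L v w \<xi> \<eta>) F"
    unfolding pol[OF L] unfolding q_def by (intro tendsto_intros diag V_carrier v w) simp
  moreover have "\<forall>\<^sub>F n in F. (q (T n) (v \<oplus>\<^bsub>V\<^esub> w) - q (T n) (v \<oplus>\<^bsub>V\<^esub> (-1) \<odot>\<^bsub>V\<^esub> w) - \<i> * q (T n) (v \<oplus>\<^bsub>V\<^esub> \<i> \<odot>\<^bsub>V\<^esub> w) + \<i> * q (T n) (v \<oplus>\<^bsub>V\<^esub> (-\<i>) \<odot>\<^bsub>V\<^esub> w)) / 4 = s (T n) v w \<xi> \<eta>"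
    using T(2) by (rule eventually_mono) (simp only: pol)
  ultimately show ?thesis by (rule Lim_transform_eventually)
qed

text \<open>The matrix elements at elementary tensors, again for functions in place of classes.\<close>

definition t :: "('k \<Rightarrow> 'k) \<Rightarrow> ('o \<Rightarrow> complex) \<Rightarrow> 'v \<Rightarrow> 'v \<Rightarrow> 'h \<Rightarrow> 'h \<Rightarrow> complex" where
  "t b f = s (W.ET b f)"

abbreviation "Lb \<equiv> ess_bounded \<nu>"
abbreviation "opsK \<equiv> carrier (bounded_ops K K)"

lemma t_cong_AE: "AE x in \<nu>. f x = g x \<Longrightarrow> t b f v w \<xi> \<eta> = t b g v w \<xi> \<eta>"
  unfolding t_def by (simp only: W.ET_cong_AE[of f g])

context
  fixes v w \<xi> \<eta>
  assumes v: "v \<in> carrier V" and w: "w \<in> carrier V" and \<xi>: "\<xi> \<in> carrier H" and \<eta>: "\<eta> \<in> carrier H"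
begin

lemma t_add_left:
  assumes "b \<in> opsK" "b' \<in> opsK" "f \<in> Lb"
  shows "t (b \<oplus>\<^bsub>bounded_ops K K\<^esub> b') f v w \<xi> \<eta> = t b f v w \<xi> \<eta> + t b' f v w \<xi> \<eta>"
  unfolding t_def W.ET_add_left[OF assms, symmetric] by (intro s_add_op W.ET_in assms v w \<xi> \<eta>)

lemma t_add_right:
  assumes "b \<in> opsK" "f \<in> Lb" "f' \<in> Lb"
  shows "t b (\<lambda>x. f x + f' x) v w \<xi> \<eta> = t b f v w \<xi> \<eta> + t b f' v w \<xi> \<eta>"
  unfolding t_def W.ET_add_right[OF assms, symmetric] by (intro s_add_op W.ET_in assms v w \<xi> \<eta>)

lemma t_smult_left:
  assumes "b \<in> opsK" "f \<in> Lb"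
  shows "t (c \<odot>\<^bsub>bounded_ops K K\<^esub> b) f v w \<xi> \<eta> = c * t b f v w \<xi> \<eta>"
  unfolding t_def W.ET_smult_left[OF assms, symmetric] by (intro s_smult_op W.ET_in assms v w \<xi> \<eta>)

lemma t_smult_right:
  assumes "b \<in> opsK" "f \<in> Lb"
  shows "t b (\<lambda>x. c * f x) v w \<xi> \<eta> = c * t b f v w \<xi> \<eta>"
  unfolding t_def W.ET_smult_right[OF assms, symmetric] by (intro s_smult_op W.ET_in assms v w \<xi> \<eta>)

lemma t_tendsto:
  assumes b: "b \<in> opsK" and f: "\<And>n. f n \<in> borel_measurable \<nu>" "\<And>n. AE x in \<nu>. cmod (f n x) \<le> C" and g: "g \<in> Lb"
    and lim: "AE x in \<nu>. (\<lambda>n. f n x) \<longlonglongrightarrow> g x"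
  shows "(\<lambda>n. t b (f n) v w \<xi> \<eta>) \<longlonglongrightarrow> t b g v w \<xi> \<eta>"
proof -
  have "f n \<in> Lb" for n using f unfolding ess_bounded_def by blast
  then show ?thesis
    unfolding t_def by (intro s_tendsto W.ET_limit_fun[OF b f g lim] always_eventually allI W.ET_in b g v w \<xi> \<eta>)
qed

text \<open>This is normality in the first factor: \<open>|e\<rangle>\<langle>b\<^sup>* e| = |e\<rangle>\<langle>e| b\<close>, and the sums of these operators over
  finite parts of the basis are the compressions of \<open>b\<close>.\<close>

lemma t_has_sum:
  assumes b: "b \<in> opsK" and f: "f \<in> Lb"
  shows "((\<lambda>e. t (rank_one K K e (adj K K b e)) f v w \<xi> \<eta>) has_sum t b f v w \<xi> \<eta>) (some_onb K)"
proof -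
  have sum: "(\<Sum>e\<in>A. t (rank_one K K e (adj K K b e)) f v w \<xi> \<eta>) = t (W.compress A b) f v w \<xi> \<eta>"
    if "finite A" "A \<subseteq> some_onb K" for A
    using that
  proof (induction A)
    case empty
    have "W.compress {} b = (\<lambda>x\<in>carrier K. \<zero>\<^bsub>K\<^esub>)" by (simp add: W.compress_def W.K.fourier_def)
    also have "\<dots> = 0 \<odot>\<^bsub>bounded_ops K K\<^esub> b"
      by (auto simp: bounded_opsD(2)[OF b] intro!: restrict_ext)
    finally have zero: "W.compress {} b = 0 \<odot>\<^bsub>bounded_ops K K\<^esub> b" .
    show ?case unfolding zero t_smult_left[OF b f] by simp
  next
    case (insert e A)
    have eK: "e \<in> carrier K" using insert.prems W.T.onbs(1) by blast
    have r: "rank_one K K e (adj K K b e) \<in> opsK"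
      by (rule KK.rank_one_ops[OF eK bounded_opsD(2)[OF KK.adj_ops[OF b] eK]])
    have c: "W.compress A b \<in> opsK" using insert by (intro W.compress_ops[OF b]) auto
    show ?case
      unfolding W.compress_insert[OF b insert.hyps(1) insert.prems insert.hyps(2)] t_add_left[OF r c f]
      using insert by simp
  qed
  have "((\<lambda>A. t (W.compress A b) f v w \<xi> \<eta>) \<longlongrightarrow> t b f v w \<xi> \<eta>) (finite_subsets_at_top (some_onb K))"
    unfolding t_def
  proof (rule s_tendsto[OF W.ET_limit_compress[OF b f] _ W.ET_in[OF b f] v w \<xi> \<eta>])
    show "\<forall>\<^sub>F A in finite_subsets_at_top (some_onb K). W.ET (W.compress A b) f \<in> carrier W.D"
      by (rule eventually_finite_subsets_at_top_weakI) (intro W.ET_in W.compress_ops b f)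
  qed
  moreover have "\<forall>\<^sub>F A in finite_subsets_at_top (some_onb K). t (W.compress A b) f v w \<xi> \<eta> = (\<Sum>e\<in>A. t (rank_one K K e (adj K K b e)) f v w \<xi> \<eta>)"
    by (rule eventually_finite_subsets_at_top_weakI) (simp only: sum)
  ultimately show ?thesis unfolding has_sum_def by (rule Lim_transform_eventually)
qed

end

lemma t_positive:
  assumes A: "finite A"
    and b: "\<And>j. j \<in> A \<Longrightarrow> b j \<in> opsK" and f: "\<And>j. j \<in> A \<Longrightarrow> f j \<in> Lb"
    and v: "\<And>j. j \<in> A \<Longrightarrow> v j \<in> carrier V" and \<xi>: "\<And>j. j \<in> A \<Longrightarrow> \<xi> j \<in> carrier H"
  shows "(\<Sum>j\<in>A. \<Sum>k\<in>A. t (compose (carrier K) (adj K K (b j)) (b k)) (\<lambda>x. cnj (f j x) * f k x) (v j) (v k) (\<xi> j) (\<xi> k)) \<in> \<real>\<^sub>\<ge>\<^sub>0"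
proof -
  have c: "compose (carrier W.G) (adj W.G W.G (W.ET (b j) (f j))) (W.ET (b k) (f k))
      = W.ET (compose (carrier K) (adj K K (b j)) (b k)) (\<lambda>x. cnj (f j x) * f k x)" if "j \<in> A" "k \<in> A" for j k
    unfolding W.adj_ET[OF b[OF that(1)] f[OF that(1)]]
    by (rule W.compose_ET[OF KK.adj_ops[OF b[OF that(1)]] b[OF that(2)] ess_bounded_cnj[OF f[OF that(1)]] f[OF that(2)]])
  have bb: "compose (carrier K) (adj K K (b j)) (b k) \<in> opsK" if "j \<in> A" "k \<in> A" for j k
    by (rule W.K.compose_ops[OF KK.adj_ops[OF b[OF that(1)]] b[OF that(2)]]) unfold_locales
  have "(\<Sum>j\<in>A. \<Sum>k\<in>A. s (compose (carrier W.G) (adj W.G W.G (W.ET (b j) (f j))) (W.ET (b k) (f k))) (v j) (v k) (\<xi> j) (\<xi> k)) \<in> \<real>\<^sub>\<ge>\<^sub>0"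
  proof (rule s_positive[OF A])
    show "j \<in> A \<Longrightarrow> W.ET (b j) (f j) \<in> carrier W.D" for j by (intro W.ET_in b f)
    show "\<lbrakk>j \<in> A; k \<in> A\<rbrakk> \<Longrightarrow> compose (carrier W.G) (adj W.G W.G (W.ET (b j) (f j))) (W.ET (b k) (f k)) \<in> carrier W.D" for j k
      unfolding c by (intro W.ET_in bb ess_bounded_mult ess_bounded_cnj f)
  qed (use v \<xi> in auto)
  also have "(\<Sum>j\<in>A. \<Sum>k\<in>A. s (compose (carrier W.G) (adj W.G W.G (W.ET (b j) (f j))) (W.ET (b k) (f k))) (v j) (v k) (\<xi> j) (\<xi> k))
      = (\<Sum>j\<in>A. \<Sum>k\<in>A. t (compose (carrier K) (adj K K (b j)) (b k)) (\<lambda>x. cnj (f j x) * f k x) (v j) (v k) (\<xi> j) (\<xi> k))"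
    by (intro sum.cong refl) (simp only: c t_def)
  finally show ?thesis .
qed

text \<open>With \<open>X \<inter> X'\<close> for \<open>X\<close>, the value of \<open>\<langle>ph k X v \<xi>, ph k' X' v' \<xi>'\<rangle>\<close> in a dilation.\<close>

definition kern :: "'k \<Rightarrow> 'k \<Rightarrow> 'o set \<Rightarrow> 'v \<Rightarrow> 'v \<Rightarrow> 'h \<Rightarrow> 'h \<Rightarrow> complex" where
  "kern k k' X = t (rank_one K K k k') (indicator X)"

text \<open>For any unit vector \<open>e\<close>, the operator \<open>|k\<rangle>\<langle>k'| \<otimes> \<chi>(X \<inter> X')\<close> is the product of the adjoint of
  \<open>|e\<rangle>\<langle>k| \<otimes> \<chi>(X)\<close> with \<open>|e\<rangle>\<langle>k'| \<otimes> \<chi>(X')\<close>.\<close>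

lemma kern_positive:
  assumes A: "finite A"
    and k: "\<And>j. j \<in> A \<Longrightarrow> k j \<in> carrier K" and X: "\<And>j. j \<in> A \<Longrightarrow> X j \<in> sets \<nu>"
    and v: "\<And>j. j \<in> A \<Longrightarrow> v j \<in> carrier V" and \<xi>: "\<And>j. j \<in> A \<Longrightarrow> \<xi> j \<in> carrier H"
  shows "(\<Sum>i\<in>A. \<Sum>j\<in>A. cnj (c i) * c j * kern (k i) (k j) (X i \<inter> X j) (v i) (v j) (\<xi> i) (\<xi> j)) \<in> \<real>\<^sub>\<ge>\<^sub>0"
proof (cases "carrier K = {\<zero>\<^bsub>K\<^esub>}")
  case True
  have "kern (k i) (k j) (X i \<inter> X j) (v i) (v j) (\<xi> i) (\<xi> j) = 0" if ij: "i \<in> A" "j \<in> A" for i j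
  proof -
    have r: "rank_one K K (k i) (k j) \<in> opsK" by (rule KK.rank_one_ops[OF k[OF ij(1)] k[OF ij(2)]])
    have "k i = \<zero>\<^bsub>K\<^esub>" using k[OF ij(1)] True by blast
    then have "rank_one K K (k i) (k j) = 0 \<odot>\<^bsub>bounded_ops K K\<^esub> rank_one K K (k i) (k j)"
      using k[OF ij(2)] by (auto simp: rank_one_def W.K.ip_simps intro!: restrict_ext W.K.vec_eqI)
    then have "kern (k i) (k j) (X i \<inter> X j) (v i) (v j) (\<xi> i) (\<xi> j) = t (0 \<odot>\<^bsub>bounded_ops K K\<^esub> rank_one K K (k i) (k j)) (indicator (X i \<inter> X j)) (v i) (v j) (\<xi> i) (\<xi> j)"
      by (simp only: kern_def)
    also have "\<dots> = 0 * t (rank_one K K (k i) (k j)) (indicator (X i \<inter> X j)) (v i) (v j) (\<xi> i) (\<xi> j)"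
      using ij by (intro t_smult_left r v \<xi> ess_bounded_indicator sets.Int X)
    finally show ?thesis by simp
  qed
  then show ?thesis by simp
next
  case False
  then obtain z where z: "z \<in> carrier K" "z \<noteq> \<zero>\<^bsub>K\<^esub>" using W.K.M.zero_closed by blast
  then have n: "hnorm K z > 0" using W.K.hnorm_eq_zero[OF z(1)] W.K.hnorm_nonneg[OF z(1)] by linarith
  define e where "e = of_real (1 / hnorm K z) \<odot>\<^bsub>K\<^esub> z"
  have e: "e \<in> carrier K" "ip K e e = 1"
    using z n W.K.ip_self[OF z(1)] by (simp_all add: e_def W.K.ip_simps power2_eq_square)
  define b where "b j = rank_one K K e (k j)" for j
  have b: "b j \<in> opsK" if "j \<in> A" for j unfolding b_def by (rule KK.rank_one_ops[OF e(1) k[OF that]])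
  have bb: "compose (carrier K) (adj K K (b i)) (b j) = rank_one K K (k i) (k j)" if ij: "i \<in> A" "j \<in> A" for i j
    unfolding b_def KK.adj_rank_one[OF e(1) k[OF ij(1)]]
    using e k[OF ij(1)] k[OF ij(2)] by (auto simp: compose_def rank_one_def W.K.ip_simps intro!: restrict_ext)
  have "(\<Sum>i\<in>A. \<Sum>j\<in>A. t (compose (carrier K) (adj K K (b i)) (b j)) (\<lambda>x. cnj (indicator (X i) x) * indicator (X j) x) (v i) (v j) (c i \<odot>\<^bsub>H\<^esub> \<xi> i) (c j \<odot>\<^bsub>H\<^esub> \<xi> j)) \<in> \<real>\<^sub>\<ge>\<^sub>0"
    by (rule t_positive[OF A]) (auto intro!: b ess_bounded_indicator[OF X] v H.smult_carrier \<xi>)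
  also have "(\<Sum>i\<in>A. \<Sum>j\<in>A. t (compose (carrier K) (adj K K (b i)) (b j)) (\<lambda>x. cnj (indicator (X i) x) * indicator (X j) x) (v i) (v j) (c i \<odot>\<^bsub>H\<^esub> \<xi> i) (c j \<odot>\<^bsub>H\<^esub> \<xi> j))
      = (\<Sum>i\<in>A. \<Sum>j\<in>A. cnj (c i) * c j * kern (k i) (k j) (X i \<inter> X j) (v i) (v j) (\<xi> i) (\<xi> j))"
  proof (intro sum.cong refl)
    fix i j assume ij: "i \<in> A" "j \<in> A"
    have ind: "(\<lambda>x. cnj (indicator (X i) x) * indicator (X j) x) = (indicator (X i \<inter> X j) :: 'o \<Rightarrow> complex)"
      by (auto simp: indicator_def)
    have D: "W.ET (rank_one K K (k i) (k j)) (indicator (X i \<inter> X j)) \<in> carrier W.D"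
      using ij by (intro W.ET_in KK.rank_one_ops k ess_bounded_indicator sets.Int X)
    show "t (compose (carrier K) (adj K K (b i)) (b j)) (\<lambda>x. cnj (indicator (X i) x) * indicator (X j) x) (v i) (v j) (c i \<odot>\<^bsub>H\<^esub> \<xi> i) (c j \<odot>\<^bsub>H\<^esub> \<xi> j)
        = cnj (c i) * c j * kern (k i) (k j) (X i \<inter> X j) (v i) (v j) (\<xi> i) (\<xi> j)"
      unfolding bb[OF ij] ind kern_def t_def
      using s_smult_vec_left[OF D v[OF ij(1)] v[OF ij(2)] \<xi>[OF ij(1)] H.smult_carrier[OF \<xi>[OF ij(2)]], of "c i" "c j"]
        s_smult_vec_right[OF D v[OF ij(1)] v[OF ij(2)] \<xi>[OF ij(1)] \<xi>[OF ij(2)], of "c j"] by (simp add: mult.assoc)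
  qed
  finally show ?thesis .
qed

end


section \<open>The spectral measure on the multiplicity space\<close>

text \<open>The vectors \<open>ph k X v \<xi>\<close> are the values of \<open>(\<langle>k| \<otimes> \<chi>(X)) v \<xi>\<close>, for a Stinespring representation in
  which the first factor of \<open>K \<otimes> H\<^sub>0\<close> has been split off.\<close>

locale dilated = normal_cp K \<nu> H V S + M: hilbert_space H0
  for K :: "'k hilb" and \<nu> :: "'o measure" and H :: "'h hilb" and V :: "('h \<Rightarrow> 'h, 'v) rmodule"
    and S :: "(('k \<times> ('o \<Rightarrow> complex) set \<Rightarrow> complex) \<Rightarrow> ('k \<times> ('o \<Rightarrow> complex) set \<Rightarrow> complex)) \<Rightarrow> 'v \<times> 'v \<Rightarrow> 'h \<Rightarrow> 'h"
    and H0 :: "'m hilb" +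
  fixes ph :: "'k \<Rightarrow> 'o set \<Rightarrow> 'v \<Rightarrow> 'h \<Rightarrow> 'm"
  assumes ph_in: "\<lbrakk>k \<in> carrier K; X \<in> sets \<nu>; v \<in> carrier V; \<xi> \<in> carrier H\<rbrakk> \<Longrightarrow> ph k X v \<xi> \<in> carrier H0"
    and ip_ph: "\<lbrakk>k \<in> carrier K; X \<in> sets \<nu>; v \<in> carrier V; \<xi> \<in> carrier H; k' \<in> carrier K; X' \<in> sets \<nu>; v' \<in> carrier V; \<xi>' \<in> carrier H\<rbrakk>
      \<Longrightarrow> ip H0 (ph k X v \<xi>) (ph k' X' v' \<xi>') = kern k k' (X \<inter> X') v v' \<xi> \<xi>'"
    and ph_total: "\<lbrakk>x \<in> carrier H0; \<And>k X v \<xi>. \<lbrakk>k \<in> carrier K; X \<in> sets \<nu>; v \<in> carrier V; \<xi> \<in> carrier H\<rbrakk> \<Longrightarrow> ip H0 (ph k X v \<xi>) x = 0\<rbrakk>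
      \<Longrightarrow> x = \<zero>\<^bsub>H0\<^esub>"
begin

interpretation KK: hilbert_pair K K by unfold_locales
interpretation MM: hilbert_pair H0 H0 by unfold_locales

abbreviation "opsM \<equiv> carrier (bounded_ops H0 H0)"

definition ph_index :: "('k \<times> 'o set \<times> 'v \<times> 'h) set" where
  "ph_index = carrier K \<times> sets \<nu> \<times> carrier V \<times> carrier H"

definition ph_family :: "'k \<times> 'o set \<times> 'v \<times> 'h \<Rightarrow> 'm" where
  "ph_family = (\<lambda>(k, X, v, \<xi>). ph k X v \<xi>)"

lemma total_ph_family: "M.total ph_family ph_index"
  unfolding M.total_def
proof (intro conjI ballI impI)
  show "ph_family ` ph_index \<subseteq> carrier H0" by (auto simp: ph_family_def ph_index_def ph_in)
  fix x assume x: "x \<in> carrier H0" and z: "\<forall>i\<in>ph_index. ip H0 (ph_family i) x = 0"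
  show "x = \<zero>\<^bsub>H0\<^esub>"
  proof (rule ph_total[OF x])
    fix k X v \<xi> assume "k \<in> carrier K" "X \<in> sets \<nu>" "v \<in> carrier V" "\<xi> \<in> carrier H"
    then have "(k, X, v, \<xi>) \<in> ph_index" by (simp add: ph_index_def)
    then have "ip H0 (ph_family (k, X, v, \<xi>)) x = 0" using z by blast
    then show "ip H0 (ph k X v \<xi>) x = 0" by (simp add: ph_family_def)
  qed
qed

text \<open>Since the vectors \<open>ph k X v \<xi>\<close> are total, identities between them are identities between values of the
  kernel; in this way \<open>ph\<close> inherits its algebraic properties from \<open>S\<close>.\<close>

lemma ph_eqI:
  assumes "x \<in> carrier H0" "y \<in> carrier H0"
    and "\<And>k X v \<xi>. \<lbrakk>k \<in> carrier K; X \<in> sets \<nu>; v \<in> carrier V; \<xi> \<in> carrier H\<rbrakk> \<Longrightarrow> ip H0 (ph k X v \<xi>) x = ip H0 (ph k X v \<xi>) y"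
  shows "x = y"
proof (rule M.total_eqI[OF total_ph_family assms(1,2)])
  fix i assume "i \<in> ph_index"
  then show "ip H0 (ph_family i) x = ip H0 (ph_family i) y" using assms(3) by (auto simp: ph_index_def ph_family_def)
qed

lemma ops_ph_eqI:
  assumes "T \<in> opsM" "U \<in> opsM"
    and "\<And>k X v \<xi>. \<lbrakk>k \<in> carrier K; X \<in> sets \<nu>; v \<in> carrier V; \<xi> \<in> carrier H\<rbrakk> \<Longrightarrow> T (ph k X v \<xi>) = U (ph k X v \<xi>)"
  shows "T = U"
proof (rule MM.ops_total_eqI[OF total_ph_family assms(1,2)])
  fix i assume "i \<in> ph_index"
  then show "T (ph_family i) = U (ph_family i)" using assms(3) by (auto simp: ph_index_def ph_family_def)
qed

context
  fixes k X v \<xi>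
  assumes k: "k \<in> carrier K" and X: "X \<in> sets \<nu>" and v: "v \<in> carrier V" and \<xi>: "\<xi> \<in> carrier H"
begin

lemma ph_add_first:
  assumes k': "k' \<in> carrier K"
  shows "ph (k \<oplus>\<^bsub>K\<^esub> k') X v \<xi> = ph k X v \<xi> \<oplus>\<^bsub>H0\<^esub> ph k' X v \<xi>"
  by (rule ph_eqI) (use k k' X v \<xi> in \<open>simp_all add: ph_in M.ip_add ip_ph kern_def KK.rank_one_add_right t_add_left KK.rank_one_ops ess_bounded_indicator del: bounded_ops_simps\<close>)

lemma ph_smult_first: "ph (c \<odot>\<^bsub>K\<^esub> k) X v \<xi> = cnj c \<odot>\<^bsub>H0\<^esub> ph k X v \<xi>"
  by (rule ph_eqI) (use k X v \<xi> in \<open>simp_all add: ph_in M.ip_smult ip_ph kern_def KK.rank_one_smult_right t_smult_left KK.rank_one_ops ess_bounded_indicator del: bounded_ops_simps\<close>)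

lemma ph_add_module:
  assumes w: "w \<in> carrier V"
  shows "ph k X (v \<oplus>\<^bsub>V\<^esub> w) \<xi> = ph k X v \<xi> \<oplus>\<^bsub>H0\<^esub> ph k X w \<xi>"
  by (rule ph_eqI) (use k X v w \<xi> in \<open>simp_all add: ph_in V_carrier M.ip_add ip_ph kern_def t_def s_add_right W.ET_in KK.rank_one_ops ess_bounded_indicator\<close>)

lemma ph_smult_module: "ph k X (c \<odot>\<^bsub>V\<^esub> v) \<xi> = c \<odot>\<^bsub>H0\<^esub> ph k X v \<xi>"
  by (rule ph_eqI) (use k X v \<xi> in \<open>simp_all add: ph_in V_carrier M.ip_smult ip_ph kern_def t_def s_smult_right W.ET_in KK.rank_one_ops ess_bounded_indicator\<close>)

lemma ph_act:
  assumes a: "a \<in> carrier (bounded_ops H H)"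
  shows "ph k X (v \<cdot>\<^bsub>V\<^esub> a) \<xi> = ph k X v (a \<xi>)"
proof -
  have "v \<cdot>\<^bsub>V\<^esub> a \<in> carrier V" "a \<xi> \<in> carrier H" using V.act_closed v a bounded_opsD(2)[OF a \<xi>] by simp_all
  then show ?thesis
    by (intro ph_eqI) (use k X v \<xi> a in \<open>simp_all add: ph_in ip_ph kern_def t_def s_act_right W.ET_in KK.rank_one_ops ess_bounded_indicator\<close>)
qed

lemma ph_add_vec:
  assumes \<xi>': "\<xi>' \<in> carrier H"
  shows "ph k X v (\<xi> \<oplus>\<^bsub>H\<^esub> \<xi>') = ph k X v \<xi> \<oplus>\<^bsub>H0\<^esub> ph k X v \<xi>'"
  by (rule ph_eqI) (use k X v \<xi> \<xi>' in \<open>simp_all add: ph_in M.ip_add ip_ph kern_def t_def s_add_vec_right W.ET_in KK.rank_one_ops ess_bounded_indicator\<close>)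

lemma ph_smult_vec: "ph k X v (c \<odot>\<^bsub>H\<^esub> \<xi>) = c \<odot>\<^bsub>H0\<^esub> ph k X v \<xi>"
  by (rule ph_eqI) (use k X v \<xi> in \<open>simp_all add: ph_in M.ip_smult ip_ph kern_def t_def s_smult_vec_right W.ET_in KK.rank_one_ops ess_bounded_indicator\<close>)

lemma ph_union:
  assumes Y: "Y \<in> sets \<nu>" "X \<inter> Y = {}"
  shows "ph k (X \<union> Y) v \<xi> = ph k X v \<xi> \<oplus>\<^bsub>H0\<^esub> ph k Y v \<xi>"
proof (rule ph_eqI)
  fix l Z w \<eta> assume l: "l \<in> carrier K" and Z: "Z \<in> sets \<nu>" and w: "w \<in> carrier V" and \<eta>: "\<eta> \<in> carrier H"
  have r: "rank_one K K l k \<in> opsK" by (rule KK.rank_one_ops[OF l k])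
  have e: "indicator (Z \<inter> (X \<union> Y)) = (\<lambda>x. indicator (Z \<inter> X) x + indicator (Z \<inter> Y) x :: complex)"
    using Y(2) by (auto simp: indicator_def fun_eq_iff)
  have "kern l k (Z \<inter> (X \<union> Y)) w v \<eta> \<xi> = kern l k (Z \<inter> X) w v \<eta> \<xi> + kern l k (Z \<inter> Y) w v \<eta> \<xi>"
    unfolding kern_def e by (intro t_add_right w v \<eta> \<xi> r ess_bounded_indicator sets.Int Z X Y)
  then show "ip H0 (ph l Z w \<eta>) (ph k (X \<union> Y) v \<xi>) = ip H0 (ph l Z w \<eta>) (ph k X v \<xi> \<oplus>\<^bsub>H0\<^esub> ph k Y v \<xi>)"
    using l Z w \<eta> k X v \<xi> Y by (simp add: ip_ph ph_in M.ip_add)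
qed (use k X v \<xi> Y in \<open>simp_all add: ph_in\<close>)

end

lemma kern_null:
  assumes "k \<in> carrier K" "k' \<in> carrier K" "v \<in> carrier V" "w \<in> carrier V" "\<xi> \<in> carrier H" "\<eta> \<in> carrier H" and X: "X \<in> null_sets \<nu>"
  shows "kern k k' X v w \<xi> \<eta> = 0"
proof -
  have "kern k k' X v w \<xi> \<eta> = t (rank_one K K k k') (\<lambda>x. 0 * indicator X x) v w \<xi> \<eta>"
    unfolding kern_def using AE_not_in[OF X] by (intro t_cong_AE) (auto elim!: eventually_mono simp: indicator_def)
  also have "\<dots> = 0 * t (rank_one K K k k') (indicator X) v w \<xi> \<eta>"
    using assms by (intro t_smult_right KK.rank_one_ops ess_bounded_indicator) auto
  finally show ?thesis by simp
qed

text \<open>The vectors \<open>ph k (Z \<inter> X) v \<xi>\<close> and \<open>ph k (Z - X) v \<xi>\<close> are orthogonal with sum \<open>ph k Z v \<xi>\<close>. The projection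
  onto the orthogonal complement of all vectors of the second kind therefore keeps the first summand.\<close>

lemma F_exists:
  assumes X: "X \<in> sets \<nu>"
  shows "\<exists>P. projection_op H0 P \<and> (\<forall>k\<in>carrier K. \<forall>Z\<in>sets \<nu>. \<forall>v\<in>carrier V. \<forall>\<xi>\<in>carrier H. P (ph k Z v \<xi>) = ph k (Z \<inter> X) v \<xi>)"
proof -
  define g where "g = (\<lambda>(k, Z, v, \<xi>). ph k (Z - X) v \<xi>)"
  define U where "U = {x \<in> carrier H0. \<forall>i\<in>ph_index. ip H0 (g i) x = 0}"
  have "g ` ph_index \<subseteq> carrier H0" using X by (auto simp: g_def ph_index_def ph_in)
  then have U: "M.closed_subspace U" unfolding U_def by (rule M.closed_subspace_orthogonal)
  obtain P where P: "projection_op H0 P" "\<And>x. x \<in> carrier H0 \<Longrightarrow> P x \<in> U" "\<And>x w. x \<in> carrier H0 \<Longrightarrow> w \<in> U \<Longrightarrow> ip H0 w (P x) = ip H0 w x"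
    using M.orthogonal_projection[OF U] by blast
  have "P (ph k Z v \<xi>) = ph k (Z \<inter> X) v \<xi>" if k: "k \<in> carrier K" and Z: "Z \<in> sets \<nu>" and v: "v \<in> carrier V" and \<xi>: "\<xi> \<in> carrier H" for k Z v \<xi>
  proof -
    define x y z where "x = ph k Z v \<xi>" and "y = ph k (Z \<inter> X) v \<xi>" and "z = ph k (Z - X) v \<xi>"
    have xyz: "x \<in> carrier H0" "y \<in> carrier H0" "z \<in> carrier H0" using k Z v \<xi> X by (simp_all add: x_def y_def z_def ph_in)
    have "x = y \<oplus>\<^bsub>H0\<^esub> z"
    proof -
      have "ph k ((Z \<inter> X) \<union> (Z - X)) v \<xi> = y \<oplus>\<^bsub>H0\<^esub> z"
        unfolding y_def z_def by (rule ph_union[OF k sets.Int[OF Z X] v \<xi> sets.Diff[OF Z X]]) blast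
      moreover have "(Z \<inter> X) \<union> (Z - X) = Z" by blast
      ultimately show ?thesis by (simp add: x_def)
    qed
    have yU: "y \<in> U"
      unfolding U_def
    proof (intro CollectI conjI ballI xyz(2))
      fix i assume "i \<in> ph_index"
      then obtain l Y w \<eta> where i: "i = (l, Y, w, \<eta>)" and l: "l \<in> carrier K" and Y: "Y \<in> sets \<nu>" and w: "w \<in> carrier V" and \<eta>: "\<eta> \<in> carrier H"
        by (auto simp: ph_index_def)
      have "ip H0 (g i) y = kern l k ((Y - X) \<inter> (Z \<inter> X)) w v \<eta> \<xi>"
        unfolding i g_def y_def prod.case using l Y w \<eta> k Z v \<xi> X by (intro ip_ph) auto
      also have "(Y - X) \<inter> (Z \<inter> X) = {}" by blast
      also have "kern l k {} w v \<eta> \<xi> = 0" by (intro kern_null l k w v \<eta> \<xi>) simp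
      finally show "ip H0 (g i) y = 0" .
    qed
    have wz: "ip H0 w z = 0" if "w \<in> U" for w
    proof -
      have w: "w \<in> carrier H0" using that by (simp add: U_def)
      have "(k, Z, v, \<xi>) \<in> ph_index" using k Z v \<xi> by (simp add: ph_index_def)
      then have "ip H0 (g (k, Z, v, \<xi>)) w = 0" using that unfolding U_def by blast
      then have "ip H0 z w = 0" by (simp add: g_def z_def)
      then show ?thesis using M.ip_commute[OF xyz(3) w] by simp
    qed
    have PU: "P x \<in> U" by (rule P(2)[OF xyz(1)])
    then have PC: "P x \<in> carrier H0" by (simp add: U_def)
    have dU: "P x \<oplus>\<^bsub>H0\<^esub> (-1) \<odot>\<^bsub>H0\<^esub> y \<in> U" using U PU yU unfolding M.closed_subspace_def by blast
    define d where "d = P x \<oplus>\<^bsub>H0\<^esub> (-1) \<odot>\<^bsub>H0\<^esub> y"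
    have dC: "d \<in> carrier H0" using PC xyz by (simp add: d_def)
    have "ip H0 d (P x) = ip H0 d x" unfolding d_def by (rule P(3)[OF xyz(1) dU])
    also have "\<dots> = ip H0 d y + ip H0 d z"
      unfolding \<open>x = y \<oplus>\<^bsub>H0\<^esub> z\<close> by (rule M.ip_add[OF dC xyz(2,3)])
    also have "ip H0 d z = 0" unfolding d_def by (rule wz[OF dU])
    finally have "ip H0 d (P x) = ip H0 d y" by simp
    then have "ip H0 d d = 0" using PC xyz dC by (subst (2) d_def) (simp add: M.ip_simps)
    then have "d = \<zero>\<^bsub>H0\<^esub>" by (rule M.ip_definite[OF dC])
    then have "P x \<ominus>\<^bsub>H0\<^esub> y = \<zero>\<^bsub>H0\<^esub>" using M.minus_eq_smult[OF PC xyz(2)] by (simp add: d_def)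
    then have "P x = y" using PC xyz(2) by (simp add: M.minus_eq_zero_iff)
    then show ?thesis by (simp add: x_def y_def)
  qed
  then show ?thesis using P(1) by blast
qed

definition F :: "'o set \<Rightarrow> 'm \<Rightarrow> 'm" where
  "F X = (SOME P. projection_op H0 P \<and> (\<forall>k\<in>carrier K. \<forall>Z\<in>sets \<nu>. \<forall>v\<in>carrier V. \<forall>\<xi>\<in>carrier H. P (ph k Z v \<xi>) = ph k (Z \<inter> X) v \<xi>))"

lemma F:
  assumes "X \<in> sets \<nu>"
  shows "projection_op H0 (F X)"
    and "\<lbrakk>k \<in> carrier K; Z \<in> sets \<nu>; v \<in> carrier V; \<xi> \<in> carrier H\<rbrakk> \<Longrightarrow> F X (ph k Z v \<xi>) = ph k (Z \<inter> X) v \<xi>"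
  using someI_ex[OF F_exists[OF assms]] unfolding F_def by blast+

lemma F_ops: "X \<in> sets \<nu> \<Longrightarrow> F X \<in> opsM"
  by (rule M.projection_opD(1)[OF F(1)])

lemma F_in: "\<lbrakk>X \<in> sets \<nu>; x \<in> carrier H0\<rbrakk> \<Longrightarrow> F X x \<in> carrier H0"
  by (rule M.projection_opD(2)[OF F(1)])

lemma F_space: "F (space \<nu>) = (\<lambda>x\<in>carrier H0. x)"
proof (rule ops_ph_eqI[OF F_ops[OF sets.top] M.one_ops])
  fix k X v \<xi> assume *: "k \<in> carrier K" "X \<in> sets \<nu>" "v \<in> carrier V" "\<xi> \<in> carrier H"
  have "X \<inter> space \<nu> = X" using sets.sets_into_space[OF *(2)] by blast
  then show "F (space \<nu>) (ph k X v \<xi>) = (\<lambda>x\<in>carrier H0. x) (ph k X v \<xi>)" using * by (simp add: F(2) ph_in)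
qed

lemma F_null:
  assumes X: "X \<in> null_sets \<nu>"
  shows "F X = (\<lambda>x\<in>carrier H0. \<zero>\<^bsub>H0\<^esub>)"
proof (rule ops_ph_eqI[OF F_ops MM.zero_ops])
  show Xs: "X \<in> sets \<nu>" using X by auto
  fix k Z v \<xi> assume *: "k \<in> carrier K" "Z \<in> sets \<nu>" "v \<in> carrier V" "\<xi> \<in> carrier H"
  have "ph k (Z \<inter> X) v \<xi> = \<zero>\<^bsub>H0\<^esub>"
  proof (rule M.ip_definite)
    have "Z \<inter> X \<in> null_sets \<nu>" using X *(2) by (rule null_set_Int1)
    then show "ip H0 (ph k (Z \<inter> X) v \<xi>) (ph k (Z \<inter> X) v \<xi>) = 0" using * Xs by (simp add: ip_ph kern_null)
  qed (use * Xs in \<open>simp add: ph_in\<close>)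
  then show "F X (ph k Z v \<xi>) = (\<lambda>x\<in>carrier H0. \<zero>\<^bsub>H0\<^esub>) (ph k Z v \<xi>)" using * Xs by (simp add: F(2) ph_in)
qed

lemma F_union:
  assumes X: "X \<in> sets \<nu>" and Y: "Y \<in> sets \<nu>" and XY: "X \<inter> Y = {}" and x: "x \<in> carrier H0"
  shows "F (X \<union> Y) x = F X x \<oplus>\<^bsub>H0\<^esub> F Y x"
proof -
  have "F (X \<union> Y) = (\<lambda>x\<in>carrier H0. F X x \<oplus>\<^bsub>H0\<^esub> F Y x)"
  proof (rule ops_ph_eqI[OF F_ops[OF sets.Un[OF X Y]] MM.add_ops[OF F_ops[OF X] F_ops[OF Y]]])
    fix k Z v \<xi> assume *: "k \<in> carrier K" "Z \<in> sets \<nu>" "v \<in> carrier V" "\<xi> \<in> carrier H"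
    have "ph k ((Z \<inter> X) \<union> (Z \<inter> Y)) v \<xi> = ph k (Z \<inter> X) v \<xi> \<oplus>\<^bsub>H0\<^esub> ph k (Z \<inter> Y) v \<xi>"
      by (rule ph_union[OF *(1) sets.Int[OF *(2) X] *(3,4) sets.Int[OF *(2) Y]]) (use XY in blast)
    then show "F (X \<union> Y) (ph k Z v \<xi>) = (\<lambda>x\<in>carrier H0. F X x \<oplus>\<^bsub>H0\<^esub> F Y x) (ph k Z v \<xi>)"
      using * X Y by (simp add: F(2) ph_in Int_Un_distrib)
  qed
  then show ?thesis using x by simp
qed

lemma ip_F_sum:
  fixes X :: "nat \<Rightarrow> 'o set"
  assumes X: "range X \<subseteq> sets \<nu>" "disjoint_family X" and x: "x \<in> carrier H0" and y: "y \<in> carrier H0"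
  shows "(\<Sum>n<N. ip H0 x (F (X n) y)) = ip H0 x (F (\<Union>n<N. X n) y)"
proof (induction N)
  case 0
  show ?case using x y F_null[of "{}"] by simp
next
  case (Suc N)
  have Xs: "X n \<in> sets \<nu>" for n using X(1) by blast
  have U: "(\<Union>n<N. X n) \<in> sets \<nu>" using Xs by blast
  have "X n \<inter> X N = {}" if "n < N" for n using X(2) that unfolding disjoint_family_on_def by simp
  then have dis: "(\<Union>n<N. X n) \<inter> X N = {}" by blast
  have "(\<Union>n<Suc N. X n) = (\<Union>n<N. X n) \<union> X N" by (auto simp: lessThan_Suc)
  then show ?case
    using Suc x y U Xs by (simp add: F_union[OF U Xs dis y] M.ip_add F_in)
qed

text \<open>Normality gives convergence of the matrix elements between the vectors \<open>ph k X v \<xi>\<close>. It extends to all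
  vectors, one argument at a time, because projections are bounded by \<open>1\<close>.\<close>

lemma F_countably_additive:
  assumes X: "range X \<subseteq> sets \<nu>" "disjoint_family X" and x: "x \<in> carrier H0" and y: "y \<in> carrier H0"
  shows "(\<lambda>n. ip H0 x (F (X n) y)) sums ip H0 x (F (\<Union>n. X n) y)"
proof -
  have Xs: "X n \<in> sets \<nu>" for n using X(1) by blast
  have Us: "(\<Union>n<N. X n) \<in> sets \<nu>" for N using Xs by blast
  have U: "(\<Union>n. X n) \<in> sets \<nu>" using Xs by blast
  have bnd: "\<forall>\<^sub>F N in sequentially. F (\<Union>n<N. X n) z \<in> carrier H0 \<and> hnorm H0 (F (\<Union>n<N. X n) z) \<le> hnorm H0 z" if z: "z \<in> carrier H0" for z
    by (rule always_eventually) (simp add: F_in Us z M.projection_opD(6)[OF F(1)[OF Us]])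
  have 1: "(\<lambda>N. ip H0 (ph_family i) (F (\<Union>n<N. X n) (ph_family j))) \<longlonglongrightarrow> ip H0 (ph_family i) (F (\<Union>n. X n) (ph_family j))" if ij: "i \<in> ph_index" "j \<in> ph_index" for i j
  proof -
    obtain k Z v \<xi> where i: "i = (k, Z, v, \<xi>)" and k: "k \<in> carrier K" and Z: "Z \<in> sets \<nu>" and v: "v \<in> carrier V" and \<xi>: "\<xi> \<in> carrier H"
      using ij(1) by (auto simp: ph_index_def)
    obtain l Y w \<eta> where j: "j = (l, Y, w, \<eta>)" and l: "l \<in> carrier K" and Y: "Y \<in> sets \<nu>" and w: "w \<in> carrier V" and \<eta>: "\<eta> \<in> carrier H"
      using ij(2) by (auto simp: ph_index_def)
    have e: "ip H0 (ph_family i) (F Q (ph_family j)) = t (rank_one K K k l) (\<lambda>x. indicator (Z \<inter> Y) x * indicator Q x) v w \<xi> \<eta>" if Q: "Q \<in> sets \<nu>" for Q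
    proof -
      have "ip H0 (ph_family i) (F Q (ph_family j)) = kern k l (Z \<inter> (Y \<inter> Q)) v w \<xi> \<eta>"
        unfolding i j ph_family_def prod.case F(2)[OF Q l Y w \<eta>] by (rule ip_ph[OF k Z v \<xi> l sets.Int[OF Y Q] w \<eta>])
      also have "indicator (Z \<inter> (Y \<inter> Q)) = (\<lambda>x. indicator (Z \<inter> Y) x * indicator Q x :: complex)"
        by (auto simp: indicator_def)
      then have "kern k l (Z \<inter> (Y \<inter> Q)) v w \<xi> \<eta> = t (rank_one K K k l) (\<lambda>x. indicator (Z \<inter> Y) x * indicator Q x) v w \<xi> \<eta>"
        by (simp only: kern_def)
      finally show ?thesis .
    qed
    have m: "(\<lambda>x. indicator (Z \<inter> Y) x * indicator Q x :: complex) \<in> ess_bounded \<nu>" if "Q \<in> sets \<nu>" for Q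
      by (intro ess_bounded_mult ess_bounded_indicator sets.Int Z Y that)
    show ?thesis
      unfolding e[OF Us] e[OF U]
    proof (rule t_tendsto[OF v w \<xi> \<eta> KK.rank_one_ops[OF k l], where C = 1])
      show "(\<lambda>x. indicator (Z \<inter> Y) x * indicator (\<Union>n<N. X n) x :: complex) \<in> borel_measurable \<nu>" for N
        by (rule ess_bounded_measurable[OF m[OF Us]])
      show "(\<lambda>x. indicator (Z \<inter> Y) x * indicator (\<Union>n. X n) x :: complex) \<in> Lb" by (rule m[OF U])
      show "AE x in \<nu>. (\<lambda>N. indicator (Z \<inter> Y) x * indicator (\<Union>n<N. X n) x :: complex) \<longlonglongrightarrow> indicator (Z \<inter> Y) x * indicator (\<Union>n. X n) x"
        by (intro AE_I2 tendsto_mult_left LIMSEQ_indicator_UN)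
    qed (auto simp: indicator_def)
  qed
  have ph_familyC: "ph_family j \<in> carrier H0" if "j \<in> ph_index" for j using total_ph_family that unfolding M.total_def by blast
  \<comment> \<open>from the total family to all vectors in the left argument\<close>
  have 2: "(\<lambda>N. ip H0 x (F (\<Union>n<N. X n) (ph_family j))) \<longlonglongrightarrow> ip H0 x (F (\<Union>n. X n) (ph_family j))" if j: "j \<in> ph_index" for j
    by (rule M.weak_convergence_total[OF total_ph_family bnd[OF ph_familyC[OF j]] F_in[OF U ph_familyC[OF j]] 1[OF _ j] x])
  have 3: "(\<lambda>N. ip H0 (ph_family j) (F (\<Union>n<N. X n) x)) \<longlonglongrightarrow> ip H0 (ph_family j) (F (\<Union>n. X n) x)" if j: "j \<in> ph_index" for j
  proof -
    have flip: "ip H0 (ph_family j) (F Q x) = cnj (ip H0 x (F Q (ph_family j)))" if Q: "Q \<in> sets \<nu>" for Q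
      using M.projection_opD(4)[OF F(1)[OF Q] ph_familyC[OF j] x] M.ip_commute[OF x F_in[OF Q ph_familyC[OF j]]] by simp
    show ?thesis unfolding flip[OF Us] flip[OF U] by (rule tendsto_cnj[OF 2[OF j]])
  qed
  \<comment> \<open>and, by self-adjointness, in the right argument\<close>
  have 4: "(\<lambda>N. ip H0 y (F (\<Union>n<N. X n) x)) \<longlonglongrightarrow> ip H0 y (F (\<Union>n. X n) x)"
    by (rule M.weak_convergence_total[OF total_ph_family bnd[OF x] F_in[OF U x] 3 y])
  have flip: "ip H0 x (F Q y) = cnj (ip H0 y (F Q x))" if Q: "Q \<in> sets \<nu>" for Q
    using M.projection_opD(4)[OF F(1)[OF Q] x y] M.ip_commute[OF y F_in[OF Q x]] by simp
  have "(\<lambda>N. ip H0 x (F (\<Union>n<N. X n) y)) \<longlonglongrightarrow> ip H0 x (F (\<Union>n. X n) y)"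
    unfolding flip[OF Us] flip[OF U] by (rule tendsto_cnj[OF 4])
  then show ?thesis unfolding sums_def ip_F_sum[OF X x y] .
qed

lemma spectral_measure_F: "spectral_measure \<nu> H0 F"
  unfolding spectral_measure_def using F(1) F_space F_countably_additive by simp

end


section \<open>Spectral integrals\<close>

context dilated
begin

interpretation KK: hilbert_pair K K by unfold_locales
interpretation MM: hilbert_pair H0 H0 by unfold_locales

definition mu :: "'m \<Rightarrow> 'o measure" where
  "mu x = measure_of (space \<nu>) (sets \<nu>) (\<lambda>X. ennreal (Re (ip H0 x (F X x))))"

lemma sets_mu [simp]: "sets (mu x) = sets \<nu>" and space_mu [simp]: "space (mu x) = space \<nu>"
  by (simp_all add: mu_def sets.sigma_sets_eq)

lemma ip_F_self: "\<lbrakk>X \<in> sets \<nu>; x \<in> carrier H0\<rbrakk> \<Longrightarrow> ip H0 x (F X x) = of_real ((hnorm H0 (F X x))\<^sup>2)"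
  by (rule M.projection_opD(5)[OF F(1)])

lemma emeasure_mu:
  assumes X: "X \<in> sets \<nu>" and x: "x \<in> carrier H0"
  shows "emeasure (mu x) X = ennreal (Re (ip H0 x (F X x)))"
  unfolding mu_def
proof (rule emeasure_measure_of_sigma[OF sets.sigma_algebra_axioms _ _ X])
  show "positive (sets \<nu>) (\<lambda>X. ennreal (Re (ip H0 x (F X x))))"
    using F_null[of "{}"] x by (simp add: positive_def)
  show "countably_additive (sets \<nu>) (\<lambda>X. ennreal (Re (ip H0 x (F X x))))"
    unfolding countably_additive_def
  proof (intro allI impI)
    fix A :: "nat \<Rightarrow> 'o set" assume A: "range A \<subseteq> sets \<nu>" "disjoint_family A"
    have As: "A n \<in> sets \<nu>" for n using A(1) by blast
    have "(\<lambda>n. Re (ip H0 x (F (A n) x))) sums Re (ip H0 x (F (\<Union>n. A n) x))"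
      by (rule sums_Re[OF F_countably_additive[OF A x x]])
    then show "(\<Sum>n. ennreal (Re (ip H0 x (F (A n) x)))) = ennreal (Re (ip H0 x (F (\<Union>n. A n) x)))"
      by (intro suminf_ennreal_eq) (simp_all add: ip_F_self[OF As x])
  qed
qed

lemma finite_measure_mu: "x \<in> carrier H0 \<Longrightarrow> finite_measure (mu x)"
  by (rule finite_measureI) (simp add: emeasure_mu)

lemma AE_mu:
  assumes "AE \<omega> in \<nu>. P \<omega>" and x: "x \<in> carrier H0"
  shows "AE \<omega> in mu x. P \<omega>"
proof -
  obtain N where N: "N \<in> null_sets \<nu>" "{\<omega> \<in> space \<nu>. \<not> P \<omega>} \<subseteq> N" using assms(1) unfolding eventually_ae_filter by blast
  have "emeasure (mu x) N = 0" using N(1) x by (subst emeasure_mu) (auto simp: F_null)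
  then have "N \<in> null_sets (mu x)" using N(1) by (auto simp: null_sets_def)
  then show ?thesis unfolding eventually_ae_filter using N(2) by auto
qed

lemma integrable_mu:
  assumes f: "f \<in> ess_bounded \<nu>" and x: "x \<in> carrier H0"
  shows "integrable (mu x) f"
proof -
  interpret m: finite_measure "mu x" by (rule finite_measure_mu[OF x])
  obtain C where C: "AE \<omega> in \<nu>. cmod (f \<omega>) \<le> C" "0 \<le> C" using f by (rule ess_boundedE)
  have "f \<in> borel_measurable (mu x)"
    using ess_bounded_measurable[OF f] measurable_cong_sets[OF sets_mu refl, of x borel] by blast
  then show ?thesis by (rule m.integrable_const_bound[OF AE_mu[OF C(1) x]])
qed

text \<open>Besides the quadratic form of a spectral integral, this records its matrix elements between the vectors
  \<open>ph k \<Omega> v \<xi>\<close>, which enter the dilation formula. Both are preserved by linear combinations and limits.\<close>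

definition integral_op :: "('o \<Rightarrow> complex) \<Rightarrow> ('m \<Rightarrow> 'm) \<Rightarrow> bool" where
  "integral_op f T \<longleftrightarrow> T \<in> opsM \<and> (\<forall>x\<in>carrier H0. ip H0 x (T x) = (\<integral>\<omega>. f \<omega> \<partial>mu x)) \<and>
    (\<forall>k\<in>carrier K. \<forall>l\<in>carrier K. \<forall>v\<in>carrier V. \<forall>w\<in>carrier V. \<forall>\<xi>\<in>carrier H. \<forall>\<eta>\<in>carrier H.
      ip H0 (ph k (space \<nu>) v \<xi>) (T (ph l (space \<nu>) w \<eta>)) = t (rank_one K K k l) f v w \<xi> \<eta>)"

lemma integral_opI:
  assumes "T \<in> opsM" "\<And>x. x \<in> carrier H0 \<Longrightarrow> ip H0 x (T x) = (\<integral>\<omega>. f \<omega> \<partial>mu x)"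
    and "\<And>k l v w \<xi> \<eta>. \<lbrakk>k \<in> carrier K; l \<in> carrier K; v \<in> carrier V; w \<in> carrier V; \<xi> \<in> carrier H; \<eta> \<in> carrier H\<rbrakk> \<Longrightarrow>
      ip H0 (ph k (space \<nu>) v \<xi>) (T (ph l (space \<nu>) w \<eta>)) = t (rank_one K K k l) f v w \<xi> \<eta>"
  shows "integral_op f T"
  using assms unfolding integral_op_def by blast

lemma integral_opD:
  assumes "integral_op f T"
  shows "T \<in> opsM" "x \<in> carrier H0 \<Longrightarrow> ip H0 x (T x) = (\<integral>\<omega>. f \<omega> \<partial>mu x)" "x \<in> carrier H0 \<Longrightarrow> T x \<in> carrier H0"
    and "\<lbrakk>k \<in> carrier K; l \<in> carrier K; v \<in> carrier V; w \<in> carrier V; \<xi> \<in> carrier H; \<eta> \<in> carrier H\<rbrakk> \<Longrightarrow>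
      ip H0 (ph k (space \<nu>) v \<xi>) (T (ph l (space \<nu>) w \<eta>)) = t (rank_one K K k l) f v w \<xi> \<eta>"
proof -
  show T: "T \<in> opsM" using assms unfolding integral_op_def by blast
  show "x \<in> carrier H0 \<Longrightarrow> T x \<in> carrier H0" by (rule bounded_opsD(2)[OF T])
qed (use assms in \<open>unfold integral_op_def, blast+\<close>)

lemma ph_space_in: "\<lbrakk>k \<in> carrier K; v \<in> carrier V; \<xi> \<in> carrier H\<rbrakk> \<Longrightarrow> ph k (space \<nu>) v \<xi> \<in> carrier H0"
  by (rule ph_in) auto

lemma integral_op_indicator:
  assumes X: "X \<in> sets \<nu>"
  shows "integral_op (indicator X) (F X)"
proof (rule integral_opI[OF F_ops[OF X]])
  fix x assume x: "x \<in> carrier H0"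
  interpret m: finite_measure "mu x" by (rule finite_measure_mu[OF x])
  have "(\<integral>\<omega>. indicator X \<omega> \<partial>mu x) = complex_of_real (measure (mu x) X)"
  proof -
    have "(\<integral>\<omega>. indicator X \<omega> \<partial>mu x) = (\<integral>\<omega>. complex_of_real (indicator X \<omega>) \<partial>mu x)"
      by (rule Bochner_Integration.integral_cong) (simp_all add: indicator_def)
    also have "\<dots> = complex_of_real (\<integral>\<omega>. indicator X \<omega> \<partial>mu x)" by simp
    also have "(\<integral>\<omega>. indicator X \<omega> \<partial>mu x) = measure (mu x) X"
      using sets.sets_into_space[OF X] by (simp add: Int_absorb2)
    finally show ?thesis .
  qed
  also have "measure (mu x) X = Re (ip H0 x (F X x))"
    using X x by (simp add: measure_def emeasure_mu ip_F_self)
  also have "complex_of_real (Re (ip H0 x (F X x))) = ip H0 x (F X x)" using X x by (simp add: ip_F_self)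
  finally show "ip H0 x (F X x) = (\<integral>\<omega>. indicator X \<omega> \<partial>mu x)" by (rule sym)
next
  fix k l v w \<xi> \<eta> assume *: "k \<in> carrier K" "l \<in> carrier K" "v \<in> carrier V" "w \<in> carrier V" "\<xi> \<in> carrier H" "\<eta> \<in> carrier H"
  have "space \<nu> \<inter> (space \<nu> \<inter> X) = X" using sets.sets_into_space[OF X] by blast
  then show "ip H0 (ph k (space \<nu>) v \<xi>) (F X (ph l (space \<nu>) w \<eta>)) = t (rank_one K K k l) (indicator X) v w \<xi> \<eta>"
    using * X by (simp add: F(2) ip_ph kern_def)
qed

lemma integral_op_add:
  assumes f: "f \<in> Lb" "integral_op f T" and g: "g \<in> Lb" "integral_op g U"
  shows "integral_op (\<lambda>x. f x + g x) (\<lambda>x\<in>carrier H0. T x \<oplus>\<^bsub>H0\<^esub> U x)"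
  by (rule integral_opI[OF MM.add_ops[OF integral_opD(1)[OF f(2)] integral_opD(1)[OF g(2)]]])
    (simp_all add: M.ip_add integral_opD(2,3,4)[OF f(2)] integral_opD(2,3,4)[OF g(2)] integrable_mu f(1) g(1) ph_space_in
      t_add_right KK.rank_one_ops)

lemma integral_op_smult:
  assumes f: "f \<in> Lb" "integral_op f T"
  shows "integral_op (\<lambda>x. c * f x) (\<lambda>x\<in>carrier H0. c \<odot>\<^bsub>H0\<^esub> T x)"
  by (rule integral_opI[OF MM.smult_ops[OF integral_opD(1)[OF f(2)]]])
    (simp_all add: M.ip_smult integral_opD(2,3,4)[OF f(2)] integrable_mu f(1) ph_space_in t_smult_right KK.rank_one_ops)

text \<open>Quadratic forms converge by dominated convergence, matrix elements by normality of \<open>S\<close>.\<close>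

lemma integral_op_limit:
  assumes f: "\<And>n. f n \<in> borel_measurable \<nu>" "\<And>n x. cmod (f n x) \<le> C" "\<And>n. integral_op (f n) (T n)"
    and g: "g \<in> Lb" "\<And>x. x \<in> space \<nu> \<Longrightarrow> (\<lambda>n. f n x) \<longlonglongrightarrow> g x"
    and L: "L \<in> opsM" "\<And>x y. \<lbrakk>x \<in> carrier H0; y \<in> carrier H0\<rbrakk> \<Longrightarrow> (\<lambda>n. ip H0 x (T n y)) \<longlonglongrightarrow> ip H0 x (L y)"
  shows "integral_op g L"
proof (rule integral_opI[OF L(1)])
  fix x assume x: "x \<in> carrier H0"
  interpret m: finite_measure "mu x" by (rule finite_measure_mu[OF x])
  have "(\<lambda>n. \<integral>\<omega>. f n \<omega> \<partial>mu x) \<longlonglongrightarrow> (\<integral>\<omega>. g \<omega> \<partial>mu x)"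
  proof (rule integral_dominated_convergence[where w = "\<lambda>_. C"])
    show "g \<in> borel_measurable (mu x)" by (rule borel_measurable_integrable[OF integrable_mu[OF g(1) x]])
    show "f n \<in> borel_measurable (mu x)" for n
      using f(1) measurable_cong_sets[OF sets_mu refl, of x borel] by blast
  qed (use f(2) g(2) in auto)
  then have "(\<lambda>n. ip H0 x (T n x)) \<longlonglongrightarrow> (\<integral>\<omega>. g \<omega> \<partial>mu x)" by (simp only: integral_opD(2)[OF f(3) x])
  then show "ip H0 x (L x) = (\<integral>\<omega>. g \<omega> \<partial>mu x)" by (rule LIMSEQ_unique[OF L(2)[OF x x]])
next
  fix k l v w \<xi> \<eta> assume *: "k \<in> carrier K" "l \<in> carrier K" "v \<in> carrier V" "w \<in> carrier V" "\<xi> \<in> carrier H" "\<eta> \<in> carrier H"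
  have "(\<lambda>n. t (rank_one K K k l) (f n) v w \<xi> \<eta>) \<longlonglongrightarrow> t (rank_one K K k l) g v w \<xi> \<eta>"
    by (rule t_tendsto[OF *(3-6) KK.rank_one_ops[OF *(1,2)] f(1) _ g(1)]) (use f(2) g(2) in auto)
  then have "(\<lambda>n. ip H0 (ph k (space \<nu>) v \<xi>) (T n (ph l (space \<nu>) w \<eta>))) \<longlonglongrightarrow> t (rank_one K K k l) g v w \<xi> \<eta>"
    by (simp only: integral_opD(4)[OF f(3) *])
  then show "ip H0 (ph k (space \<nu>) v \<xi>) (L (ph l (space \<nu>) w \<eta>)) = t (rank_one K K k l) g v w \<xi> \<eta>"
    by (rule LIMSEQ_unique[OF L(2)[OF ph_space_in[OF *(1,3,5)] ph_space_in[OF *(2,4,6)]]])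
qed

text \<open>A function with values in \<open>[0, 1)\<close> is the sum of \<open>2 ^ (-n - 1)\<close> times the indicator function of
  the set where its \<open>n\<close>-th binary digit is \<open>1\<close>, counted from \<open>n = 0\<close>. The corresponding series of projections converges
  weakly to its spectral integral.\<close>

lemma integral_op_unit_interval:
  fixes g :: "'o \<Rightarrow> real"
  assumes g: "g \<in> borel_measurable \<nu>" "\<And>x. 0 \<le> g x" "\<And>x. g x < 1"
  shows "\<exists>T. integral_op (\<lambda>x. of_real (g x)) T"
proof -
  note [measurable] = g(1)
  \<comment> \<open>the truncation of \<open>g x\<close> after \<open>n\<close> binary digits, and the set where the next digit is \<open>1\<close>\<close>
  define fl where "fl n x = real_of_int \<lfloor>2 ^ n * g x\<rfloor> / 2 ^ n" for n x
  define X where "X n = {x \<in> space \<nu>. real_of_int \<lfloor>2 ^ Suc n * g x\<rfloor> \<noteq> 2 * real_of_int \<lfloor>2 ^ n * g x\<rfloor>}" for n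
  have [measurable]: "(\<lambda>x. real_of_int \<lfloor>2 ^ n * g x\<rfloor>) \<in> borel_measurable \<nu>" for n
    by (rule measurable_compose[OF _ borel_measurable_real_floor]) simp
  have X: "X n \<in> sets \<nu>" for n unfolding X_def by measurable
  define c :: "nat \<Rightarrow> real" where "c n = (1/2) ^ Suc n" for n
  have c: "c sums 1" unfolding c_def by (rule power_half_series)
  have c0: "0 \<le> c n" for n by (simp add: c_def)
  have step: "fl (Suc n) x - fl n x = c n * indicator (X n) x" if x: "x \<in> space \<nu>" for n x
  proof -
    define y where "y = 2 ^ n * g x"
    have y2: "2 * 2 ^ n * g x = 2 * y" by (simp add: y_def)
    have "2 * \<lfloor>y\<rfloor> \<le> \<lfloor>2 * y\<rfloor>" using of_int_floor_le[of y] by (simp add: le_floor_iff)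
    moreover have "2 * y < of_int (2 * \<lfloor>y\<rfloor> + 2)" using floor_correct[of y] by simp linarith
    then have "\<lfloor>2 * y\<rfloor> < 2 * \<lfloor>y\<rfloor> + 2" by (simp only: floor_less_iff)
    ultimately consider "\<lfloor>2 * y\<rfloor> = 2 * \<lfloor>y\<rfloor>" | "\<lfloor>2 * y\<rfloor> = 2 * \<lfloor>y\<rfloor> + 1" by linarith
    then show ?thesis
    proof cases
      case 1
      then have "x \<notin> X n" by (simp add: X_def y2 flip: y_def)
      then show ?thesis using 1 by (simp add: fl_def y2 flip: y_def)
    next
      case 2
      then have "x \<in> X n" using x by (simp add: X_def y2 flip: y_def)
      moreover have "fl (Suc n) x = of_int \<lfloor>2 * y\<rfloor> / (2 * 2 ^ n)" "fl n x = of_int \<lfloor>y\<rfloor> / 2 ^ n"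
        by (simp_all add: fl_def y2 flip: y_def)
      ultimately show ?thesis using 2 by (simp add: c_def power_divide field_simps)
    qed
  qed
  define f where "f N x = (\<Sum>n<N. of_real (c n) * indicator (X n) x :: complex)" for N x
  have f_eq: "f N x = of_real (fl N x)" if x: "x \<in> space \<nu>" for N x
  proof (induction N)
    case 0
    have "\<lfloor>g x\<rfloor> = 0" using g(2,3)[of x] by (simp add: floor_eq_iff)
    then show ?case by (simp add: f_def fl_def)
  next
    case (Suc N)
    have "f (Suc N) x = of_real (fl N x + c N * indicator (X N) x)" using Suc by (simp add: f_def indicator_def)
    also have "fl N x + c N * indicator (X N) x = fl (Suc N) x" using step[OF x, of N] by simp
    finally show ?case .
  qed
  have lim: "(\<lambda>N. f N x) \<longlonglongrightarrow> of_real (g x)" if x: "x \<in> space \<nu>" for x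
    unfolding f_eq[OF x]
  proof (rule tendsto_of_real, rule tendsto_sandwich)
    have "fl N x \<le> g x \<and> g x - (1/2) ^ N \<le> fl N x" for N
    proof -
      define z :: real where "z = 2 ^ N"
      have z: "z > 0" "(1/2) ^ N = 1 / z" by (simp_all add: z_def power_divide)
      have "of_int \<lfloor>z * g x\<rfloor> \<le> z * g x" "z * g x \<le> of_int \<lfloor>z * g x\<rfloor> + 1" using floor_correct[of "z * g x"] by simp_all
      then show ?thesis unfolding fl_def z(2) z_def[symmetric] using z(1) by (simp add: pos_divide_le_eq pos_le_divide_eq right_diff_distrib mult.commute)
    qed
    then show "\<forall>\<^sub>F N in sequentially. g x - (1/2) ^ N \<le> fl N x" "\<forall>\<^sub>F N in sequentially. fl N x \<le> g x" by simp_all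
    have "(\<lambda>N. g x - (1/2) ^ N) \<longlonglongrightarrow> g x - 0" by (intro tendsto_diff tendsto_const LIMSEQ_power_zero) simp
    then show "(\<lambda>N. g x - (1/2) ^ N) \<longlonglongrightarrow> g x" by simp
  qed (rule tendsto_const)
  have f_bound: "cmod (f N x) \<le> 1" for N x
  proof -
    have "cmod (f N x) \<le> (\<Sum>n<N. c n)"
      unfolding f_def by (rule sum_norm_le) (simp add: norm_mult c0 indicator_def)
    also have "\<dots> \<le> suminf c" using c c0 by (intro sum_le_suminf) (auto simp: sums_iff)
    finally show ?thesis using c by (simp add: sums_iff)
  qed
  have f_meas: "f N \<in> borel_measurable \<nu>" for N
    unfolding f_def using X by measurable
  have fL: "f N \<in> Lb" for N by (rule ess_boundedI[OF f_meas f_bound])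
  have "\<exists>T. integral_op (f N) T \<and> (\<forall>x\<in>carrier H0. \<forall>y\<in>carrier H0. ip H0 x (T y) = (\<Sum>n<N. of_real (c n) * ip H0 x (F (X n) y)))" for N
  proof (induction N)
    case 0
    define U where "U = (\<lambda>x\<in>carrier H0. 0 \<odot>\<^bsub>H0\<^esub> F (X 0) x)"
    have "integral_op (\<lambda>x. 0 * indicator (X 0) x) U"
      unfolding U_def by (rule integral_op_smult[OF ess_bounded_indicator[OF X] integral_op_indicator[OF X]])
    then have "integral_op (f 0) U" by (simp add: f_def[abs_def])
    moreover have "ip H0 x (U y) = 0" if "x \<in> carrier H0" "y \<in> carrier H0" for x y
      using that F_in[OF X] by (simp add: U_def)
    ultimately show ?case by (intro exI[of _ U]) simp
  next
    case (Suc N)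
    then obtain T where T: "integral_op (f N) T"
      "\<And>x y. \<lbrakk>x \<in> carrier H0; y \<in> carrier H0\<rbrakk> \<Longrightarrow> ip H0 x (T y) = (\<Sum>n<N. of_real (c n) * ip H0 x (F (X n) y))" by blast
    define U where "U = (\<lambda>x\<in>carrier H0. of_real (c N) \<odot>\<^bsub>H0\<^esub> F (X N) x)"
    have I: "(indicator (X N) :: 'o \<Rightarrow> complex) \<in> Lb" by (rule ess_bounded_indicator[OF X])
    have U: "integral_op (\<lambda>x. of_real (c N) * indicator (X N) x) U"
      unfolding U_def by (rule integral_op_smult[OF I integral_op_indicator[OF X]])
    define R where "R = (\<lambda>x\<in>carrier H0. T x \<oplus>\<^bsub>H0\<^esub> U x)"
    have "integral_op (\<lambda>x. f N x + of_real (c N) * indicator (X N) x) R"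
      unfolding R_def by (rule integral_op_add[OF fL T(1) ess_bounded_mult[OF ess_bounded_const I] U])
    moreover have "f (Suc N) = (\<lambda>x. f N x + of_real (c N) * indicator (X N) x)"
      unfolding f_def by (rule ext) (rule sum.lessThan_Suc)
    ultimately have "integral_op (f (Suc N)) R" by (simp only:)
    moreover have "ip H0 x (R y) = (\<Sum>n<Suc N. of_real (c n) * ip H0 x (F (X n) y))"
      if "x \<in> carrier H0" "y \<in> carrier H0" for x y
      using that integral_opD(3)[OF T(1)] F_in[OF X] by (simp add: R_def U_def M.ip_add M.ip_smult T(2))
    ultimately show ?case by (intro exI[of _ R]) blast
  qed
  then have "\<exists>T. \<forall>N. integral_op (f N) (T N) \<and> (\<forall>x\<in>carrier H0. \<forall>y\<in>carrier H0. ip H0 x (T N y) = (\<Sum>n<N. of_real (c n) * ip H0 x (F (X n) y)))"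
    by (intro choice allI)
  then obtain T where T: "\<And>N. integral_op (f N) (T N)"
    "\<And>N x y. \<lbrakk>x \<in> carrier H0; y \<in> carrier H0\<rbrakk> \<Longrightarrow> ip H0 x (T N y) = (\<Sum>n<N. of_real (c n) * ip H0 x (F (X n) y))" by blast
  define b where "b x y = (\<Sum>n. of_real (c n) * ip H0 x (F (X n) y))" for x y
  have term_le: "norm (of_real (c n) * ip H0 x (F (X n) y)) \<le> c n * (hnorm H0 x * hnorm H0 y)" if x: "x \<in> carrier H0" and y: "y \<in> carrier H0" for n x y
  proof -
    have "cmod (ip H0 x (F (X n) y)) \<le> hnorm H0 x * hnorm H0 (F (X n) y)" by (rule M.Cauchy_Schwarz[OF x F_in[OF X y]])
    also have "\<dots> \<le> hnorm H0 x * hnorm H0 y" using x by (intro mult_left_mono M.projection_opD(6)[OF F(1)[OF X] y]) simp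
    finally show ?thesis using c0[of n] by (simp add: norm_mult mult_left_mono)
  qed
  have cs: "(\<lambda>n. c n * (hnorm H0 x * hnorm H0 y)) sums (hnorm H0 x * hnorm H0 y)" for x y
    using sums_mult2[OF c] by simp
  have summ: "summable (\<lambda>n. of_real (c n) * ip H0 x (F (X n) y))" if x: "x \<in> carrier H0" and y: "y \<in> carrier H0" for x y
    by (rule summable_comparison_test'[OF sums_summable[OF cs[of x y]]]) (rule term_le[OF x y])
  have "\<exists>L\<in>opsM. \<forall>x\<in>carrier H0. \<forall>y\<in>carrier H0. ip H0 x (L y) = b x y"
  proof (rule MM.op_of_form[where C = 1])
    fix x x' y assume "x \<in> carrier H0" "x' \<in> carrier H0" "y \<in> carrier H0"
    then show "b (x \<oplus>\<^bsub>H0\<^esub> x') y = b x y + b x' y"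
      using F_in[OF X] by (simp add: b_def suminf_add[OF summ summ] M.ip_add_left distrib_left)
  next
    fix z x y assume "x \<in> carrier H0" "y \<in> carrier H0"
    then show "b (z \<odot>\<^bsub>H0\<^esub> x) y = cnj z * b x y"
      using F_in[OF X] by (simp add: b_def suminf_mult[OF summ, symmetric] M.ip_smult_left mult.left_commute)
  next
    fix x y y' assume "x \<in> carrier H0" "y \<in> carrier H0" "y' \<in> carrier H0"
    then show "b x (y \<oplus>\<^bsub>H0\<^esub> y') = b x y + b x y'"
      using F_in[OF X] bounded_opsD(3)[OF F_ops[OF X]] by (simp add: b_def suminf_add[OF summ summ] M.ip_add distrib_left)
  next
    fix z x y assume "x \<in> carrier H0" "y \<in> carrier H0"
    then show "b x (z \<odot>\<^bsub>H0\<^esub> y) = z * b x y"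
      using F_in[OF X] bounded_opsD(4)[OF F_ops[OF X]] by (simp add: b_def suminf_mult[OF summ, symmetric] M.ip_smult mult.left_commute)
  next
    fix x y assume x: "x \<in> carrier H0" and y: "y \<in> carrier H0"
    have "cmod (b x y) \<le> (\<Sum>n. c n * (hnorm H0 x * hnorm H0 y))"
      unfolding b_def by (rule norm_suminf_le[OF term_le[OF x y] sums_summable[OF cs]])
    then show "cmod (b x y) \<le> 1 * hnorm H0 x * hnorm H0 y" using sums_unique[OF cs[of x y]] by simp
  qed
  then obtain L where L: "L \<in> opsM" "\<And>x y. \<lbrakk>x \<in> carrier H0; y \<in> carrier H0\<rbrakk> \<Longrightarrow> ip H0 x (L y) = b x y" by blast
  have "integral_op (\<lambda>x. of_real (g x)) L"
  proof (rule integral_op_limit[OF f_meas f_bound T(1) _ lim L(1)])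
    have "\<bar>g x\<bar> \<le> 1" for x using g(2,3)[of x] by simp
    then show "(\<lambda>x. complex_of_real (g x)) \<in> Lb" by (intro ess_boundedI[where C = 1]) simp_all
    show "(\<lambda>N. ip H0 x (T N y)) \<longlonglongrightarrow> ip H0 x (L y)" if "x \<in> carrier H0" "y \<in> carrier H0" for x y
      unfolding T(2)[OF that] L(2)[OF that] b_def by (rule summable_LIMSEQ[OF summ[OF that]])
  qed
  then show ?thesis by blast
qed

lemma integral_op_cong_AE:
  assumes f: "f \<in> Lb" and g: "g \<in> Lb" "integral_op g T" and eq: "AE x in \<nu>. f x = g x"
  shows "integral_op f T"
proof (rule integral_opI[OF integral_opD(1)[OF g(2)]])
  fix x assume x: "x \<in> carrier H0"
  have "(\<integral>\<omega>. f \<omega> \<partial>mu x) = (\<integral>\<omega>. g \<omega> \<partial>mu x)"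
    by (rule integral_cong_AE[OF _ _ AE_mu[OF eq x]])
      (rule borel_measurable_integrable[OF integrable_mu[OF f x]], rule borel_measurable_integrable[OF integrable_mu[OF g(1) x]])
  then show "ip H0 x (T x) = (\<integral>\<omega>. f \<omega> \<partial>mu x)" using integral_opD(2)[OF g(2) x] by simp
qed (simp add: integral_opD(4)[OF g(2)] t_cong_AE[OF eq])

text \<open>The real and imaginary parts of \<open>f\<close> are bounded by some \<open>C\<close>, so that each of them is an affine image of a
  function with values in \<open>[0, 1)\<close>.\<close>

lemma integral_op_exists:
  assumes f: "f \<in> Lb"
  shows "\<exists>T. integral_op f T"
proof -
  obtain C where C: "AE x in \<nu>. cmod (f x) \<le> C" "0 \<le> C" using f by (rule ess_boundedE)
  note [measurable] = ess_bounded_measurable[OF f]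
  define f' where "f' x = (if cmod (f x) \<le> C then f x else 0)" for x
  have [measurable]: "f' \<in> borel_measurable \<nu>" unfolding f'_def by measurable
  have f'C: "cmod (f' x) \<le> C" for x using C(2) by (simp add: f'_def)
  \<comment> \<open>\<open>C + 1\<close> in place of \<open>C\<close> excludes the value \<open>1\<close> and avoids division by \<open>0\<close>\<close>
  define g where "g h x = (h (f' x) / (C + 1) + 1) / 2" for h :: "complex \<Rightarrow> real" and x
  have g01: "0 \<le> g h x \<and> g h x < 1" if "\<bar>h (f' x)\<bar> \<le> cmod (f' x)" for h x
    using that f'C[of x] C(2) by (simp add: g_def field_simps abs_le_iff)
  have meas: "g Re \<in> borel_measurable \<nu>" "g Im \<in> borel_measurable \<nu>" unfolding g_def by measurable
  obtain T1 where T1: "integral_op (\<lambda>x. of_real (g Re x)) T1"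
    using integral_op_unit_interval[OF meas(1)] g01[of Re] abs_Re_le_cmod by blast
  obtain T2 where T2: "integral_op (\<lambda>x. of_real (g Im x)) T2"
    using integral_op_unit_interval[OF meas(2)] g01[of Im] abs_Im_le_cmod by blast
  obtain T3 where T3: "integral_op (\<lambda>x. of_real (1/2)) T3"
    using integral_op_unit_interval[of "\<lambda>_. 1/2"] by auto
  have Lg: "(\<lambda>x. complex_of_real (g h x)) \<in> Lb" if "g h \<in> borel_measurable \<nu>" "\<And>x. \<bar>h (f' x)\<bar> \<le> cmod (f' x)" for h
  proof -
    have "\<bar>g h x\<bar> \<le> 1" for x using g01[of h x] that(2)[of x] by simp
    then show ?thesis using that(1) by (intro ess_boundedI[where C = 1]) simp_all
  qed
  note L1 = Lg[OF meas(1) abs_Re_le_cmod] and L2 = Lg[OF meas(2) abs_Im_le_cmod]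
  note c = ess_bounded_const ess_bounded_mult ess_bounded_add L1 L2
  \<comment> \<open>the constant function \<open>1/2\<close> with coefficient \<open>?z3\<close> undoes both shifts\<close>
  let ?z1 = "complex_of_real (2 * (C + 1))" and ?z2 = "\<i> * complex_of_real (2 * (C + 1))"
    and ?z3 = "- (1 + \<i>) * complex_of_real (2 * (C + 1))"
  have "\<exists>T. integral_op (\<lambda>x. (?z1 * of_real (g Re x) + ?z2 * of_real (g Im x)) + ?z3 * of_real (1/2)) T"
    by (rule exI, rule integral_op_add[OF _ integral_op_add[OF _ integral_op_smult[OF L1 T1] _ integral_op_smult[OF L2 T2]] _ integral_op_smult[OF ess_bounded_const T3]])
      (intro c)+
  moreover have "(\<lambda>x. (?z1 * of_real (g Re x) + ?z2 * of_real (g Im x)) + ?z3 * of_real (1/2)) = f'"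
  proof
    fix x
    have e: "2 * (C + 1) * g h x = h (f' x) + (C + 1)" for h
    proof -
      define z where "z = C + 1"
      have "z \<noteq> 0" using C(2) by (simp add: z_def)
      then show ?thesis unfolding g_def z_def[symmetric] by (simp add: field_simps)
    qed
    show "(?z1 * of_real (g Re x) + ?z2 * of_real (g Im x)) + ?z3 * of_real (1/2) = f' x"
      using e[of Re] e[of Im] by (simp add: complex_eq_iff algebra_simps)
  qed
  ultimately obtain T where T: "integral_op f' T" by auto
  have f'L: "f' \<in> Lb" by (rule ess_boundedI[OF _ f'C]) measurable
  have "AE x in \<nu>. f x = f' x" using C(1) by eventually_elim (simp add: f'_def)
  then show ?thesis using integral_op_cong_AE[OF f f'L T] by blast
qed

lemma spectral_integral_eq:
  assumes T: "integral_op f T"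
  shows "spectral_integral \<nu> H0 F f = T"
  unfolding spectral_integral_def op_algebra_simps(1) mu_def[symmetric]
proof (rule the_equality)
  show "T \<in> opsM \<and> (\<forall>x\<in>carrier H0. ip H0 x (T x) = (\<integral>\<omega>. f \<omega> \<partial>mu x))" using integral_opD[OF T] by blast
  fix U assume "U \<in> opsM \<and> (\<forall>x\<in>carrier H0. ip H0 x (U x) = (\<integral>\<omega>. f \<omega> \<partial>mu x))"
  then show "U = T" by (intro M.ops_quadratic_eqI[OF _ integral_opD(1)[OF T]]) (simp_all add: integral_opD(2)[OF T])
qed

end


section \<open>The dilation\<close>

context dilated
begin

interpretation KK: hilbert_pair K K by unfold_locales
interpretation HH: hilbert_pair H H by unfold_locales
interpretation MM: hilbert_pair H0 H0 by unfold_locales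

sublocale TT: tensor_pair K H0
  by unfold_locales

interpretation HT: hilbert_pair H "htensor K H0" by unfold_locales

text \<open>This is \<open>\<Sum>e. e \<otimes> ph e \<Omega> v \<xi>\<close> as a Hilbert-Schmidt functional: its slice at \<open>a\<close> is the partial inner
  product with \<open>a\<close>, so that no basis is involved.\<close>

definition Y :: "'v \<Rightarrow> 'h \<Rightarrow> ('k \<times> 'm \<Rightarrow> complex)" where
  "Y v = (\<lambda>\<xi>\<in>carrier H. \<lambda>p\<in>carrier K \<times> carrier H0. ip H0 (snd p) (ph (fst p) (space \<nu>) v \<xi>))"

abbreviation "oneK \<equiv> (\<lambda>x\<in>carrier K. x)"
abbreviation "ind \<equiv> (indicator (space \<nu>) :: 'o \<Rightarrow> complex)"

lemma ind_Lb: "ind \<in> Lb"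
  by (rule ess_bounded_indicator) simp

lemma power2_hnorm_ph:
  assumes "k \<in> carrier K" "v \<in> carrier V" "\<xi> \<in> carrier H"
  shows "complex_of_real ((hnorm H0 (ph k (space \<nu>) v \<xi>))\<^sup>2) = t (rank_one K K k k) ind v v \<xi> \<xi>"
  using M.ip_self[OF ph_space_in[OF assms]] assms by (simp add: ip_ph kern_def)

text \<open>The rank-one projections of an orthonormal basis add up to \<open>1\<close>; this gives the square summability of
  \<open>Y v \<xi>\<close> and its norm.\<close>

lemma ph_has_sum:
  assumes v: "v \<in> carrier V" and \<xi>: "\<xi> \<in> carrier H"
  shows "((\<lambda>e. (hnorm H0 (ph e (space \<nu>) v \<xi>))\<^sup>2) has_sum Re (t oneK ind v v \<xi> \<xi>)) (some_onb K)"
proof -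
  have adj1: "adj K K oneK = oneK" by (rule KK.adj_eq[OF W.K.one_ops]) simp
  have "((\<lambda>e. t (rank_one K K e (adj K K oneK e)) ind v v \<xi> \<xi>) has_sum t oneK ind v v \<xi> \<xi>) (some_onb K)"
    by (rule t_has_sum[OF v v \<xi> \<xi> W.K.one_ops ind_Lb])
  then have "((\<lambda>e. complex_of_real ((hnorm H0 (ph e (space \<nu>) v \<xi>))\<^sup>2)) has_sum t oneK ind v v \<xi> \<xi>) (some_onb K)"
    by (rule has_sum_cong[THEN iffD1, rotated]) (simp add: adj1 power2_hnorm_ph[OF _ v \<xi>] TT.onbs(1) del: of_real_power)
  from has_sum_Re[OF this] show ?thesis by simp
qed

text \<open>For a unit vector \<open>u\<close> the operator \<open>1 - |u\<rangle>\<langle>u|\<close> is a projection, so that positivity compares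
  \<open>|u\<rangle>\<langle>u|\<close> with \<open>1\<close>.\<close>

lemma ph_bound:
  assumes k: "k \<in> carrier K" and v: "v \<in> carrier V" and \<xi>: "\<xi> \<in> carrier H"
  shows "hnorm H0 (ph k (space \<nu>) v \<xi>) \<le> sqrt (Re (t oneK ind v v \<xi> \<xi>)) * hnorm K k"
proof (cases "hnorm K k = 0")
  case True
  then have "k = \<zero>\<^bsub>K\<^esub>" using W.K.hnorm_eq_zero[OF k] by blast
  then have "k = 0 \<odot>\<^bsub>K\<^esub> k" using k by simp
  then have "ph k (space \<nu>) v \<xi> = cnj 0 \<odot>\<^bsub>H0\<^esub> ph k (space \<nu>) v \<xi>" using ph_smult_first[OF k sets.top v \<xi>, of 0] by simp
  then have "ph k (space \<nu>) v \<xi> = \<zero>\<^bsub>H0\<^esub>" using M.smult_zero[OF ph_space_in[OF k v \<xi>]] by simp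
  then show ?thesis using True by simp
next
  case False
  then have n: "hnorm K k > 0" using W.K.hnorm_nonneg[OF k] by linarith
  define u where "u = of_real (1 / hnorm K k) \<odot>\<^bsub>K\<^esub> k"
  have u: "u \<in> carrier K" "ip K u u = 1"
    using k n W.K.ip_self[OF k] by (simp_all add: u_def W.K.ip_simps power2_eq_square)
  have ku: "k = of_real (hnorm K k) \<odot>\<^bsub>K\<^esub> u"
    using k n by (intro W.K.vec_eqI) (auto simp: u_def W.K.ip_simps)
  define r where "r = rank_one K K u u"
  have r: "r \<in> opsK" unfolding r_def by (rule KK.rank_one_ops[OF u(1) u(1)])
  define m where "m = (-1) \<odot>\<^bsub>bounded_ops K K\<^esub> r"
  have m: "m \<in> opsK" unfolding m_def bounded_ops_simps by (rule KK.smult_ops[OF r])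
  define q where "q = oneK \<oplus>\<^bsub>bounded_ops K K\<^esub> m"
  have q: "q \<in> opsK" unfolding q_def bounded_ops_simps by (rule KK.add_ops[OF W.K.one_ops m])
  have qx: "q x = x \<ominus>\<^bsub>K\<^esub> ip K u x \<odot>\<^bsub>K\<^esub> u" if "x \<in> carrier K" for x
    using that u by (simp add: q_def m_def r_def rank_one_def W.K.minus_eq_smult)
  have adjq: "adj K K q = q"
  proof (rule KK.adj_eq[OF q])
    fix x y assume x: "x \<in> carrier K" and y: "y \<in> carrier K"
    show "ip K (q x) y = ip K x (q y)" using x y u W.K.ip_commute[OF u(1) x] by (simp add: qx W.K.ip_simps)
  qed
  have qq: "compose (carrier K) q q = q"
  proof (rule bounded_ops_eqI[OF _ q])
    show "compose (carrier K) q q \<in> opsK" by (rule W.K.compose_ops[OF q q]) unfold_locales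
    fix x assume x: "x \<in> carrier K"
    show "compose (carrier K) q q x = q x"
      using x u by (auto simp: compose_def qx W.K.ip_simps intro!: W.K.vec_eqI)
  qed
  have ii: "(\<lambda>x. cnj (ind x) * ind x) = ind" by (auto simp: indicator_def)
  have "(\<Sum>i\<in>{()}. \<Sum>j\<in>{()}. t (compose (carrier K) (adj K K q) q) (\<lambda>x. cnj (ind x) * ind x) v v \<xi> \<xi>) \<in> \<real>\<^sub>\<ge>\<^sub>0"
    by (rule t_positive[where b = "\<lambda>_. q" and f = "\<lambda>_. ind" and v = "\<lambda>_. v" and \<xi> = "\<lambda>_. \<xi>"]) (simp_all add: q ind_Lb v \<xi>)
  then have nonneg: "0 \<le> Re (t q ind v v \<xi> \<xi>)" unfolding adjq qq ii by (simp add: complex_nonneg_Reals_iff)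
  define N where "N = t oneK ind v v \<xi> \<xi>"
  note nonneg
  also have "t q ind v v \<xi> \<xi> = N + (-1) * t r ind v v \<xi> \<xi>"
    unfolding q_def t_add_left[OF v v \<xi> \<xi> W.K.one_ops m ind_Lb] unfolding m_def t_smult_left[OF v v \<xi> \<xi> r ind_Lb] N_def ..
  also have "t r ind v v \<xi> \<xi> = complex_of_real ((hnorm H0 (ph u (space \<nu>) v \<xi>))\<^sup>2)"
    unfolding r_def by (rule power2_hnorm_ph[OF u(1) v \<xi>, symmetric])
  finally have "(hnorm H0 (ph u (space \<nu>) v \<xi>))\<^sup>2 \<le> Re N" by simp
  then have "hnorm H0 (ph u (space \<nu>) v \<xi>) \<le> sqrt (Re N)" by (rule real_le_rsqrt)
  moreover have "hnorm H0 (ph k (space \<nu>) v \<xi>) = hnorm K k * hnorm H0 (ph u (space \<nu>) v \<xi>)"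
    using n by (subst ku, subst ph_smult_first[OF u(1) sets.top v \<xi>]) (simp add: M.hnorm_smult ph_space_in[OF u(1) v \<xi>])
  ultimately have "hnorm H0 (ph k (space \<nu>) v \<xi>) \<le> sqrt (Re N) * hnorm K k" using n by (simp add: mult.commute)
  then show ?thesis by (simp only: N_def)
qed

lemma Y_apply: "\<lbrakk>\<xi> \<in> carrier H; a \<in> carrier K; h \<in> carrier H0\<rbrakk> \<Longrightarrow> Y v \<xi> (a, h) = ip H0 h (ph a (space \<nu>) v \<xi>)"
  by (simp add: Y_def)

lemma Y_hs:
  assumes v: "v \<in> carrier V" and \<xi>: "\<xi> \<in> carrier H"
  shows "Y v \<xi> \<in> hs_functionals K H0" "(hnorm (htensor K H0) (Y v \<xi>))\<^sup>2 = Re (t oneK ind v v \<xi> \<xi>)"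
proof -
  have inner: "((\<lambda>h. (cmod (Y v \<xi> (e, h)))\<^sup>2) has_sum (hnorm H0 (ph e (space \<nu>) v \<xi>))\<^sup>2) (some_onb H0)" if e: "e \<in> some_onb K" for e
    using M.Parseval_norm[OF M.is_onb_some_onb ph_space_in[OF TT.onbs(1)[OF e] v \<xi>]]
    by (rule has_sum_cong[THEN iffD1, rotated]) (simp add: Y_apply[OF \<xi>] TT.onbs e)
  have "(\<lambda>p. (cmod (Y v \<xi> p))\<^sup>2) summable_on some_onb K \<times> some_onb H0"
    by (rule summable_on_SigmaI[OF inner has_sum_imp_summable[OF ph_has_sum[OF v \<xi>]]]) simp_all
  then show hs: "Y v \<xi> \<in> hs_functionals K H0"
  proof (intro hs_functionalsI)
    show "cmod (Y v \<xi> (a, h)) \<le> sqrt (Re (t oneK ind v v \<xi> \<xi>)) * (hnorm K a * hnorm H0 h)" if a: "a \<in> carrier K" and h: "h \<in> carrier H0" for a h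
    proof -
      have "cmod (Y v \<xi> (a, h)) \<le> hnorm H0 h * hnorm H0 (ph a (space \<nu>) v \<xi>)"
        unfolding Y_apply[OF \<xi> a h] by (rule M.Cauchy_Schwarz[OF h ph_space_in[OF a v \<xi>]])
      also have "\<dots> \<le> hnorm H0 h * (sqrt (Re (t oneK ind v v \<xi> \<xi>)) * hnorm K a)"
        using h by (intro mult_left_mono ph_bound a v \<xi>) simp
      finally show ?thesis by (simp add: mult_ac)
    qed
  qed (use v \<xi> in \<open>simp_all add: Y_def ph_add_first ph_smult_first ph_space_in M.ip_simps\<close>)
  have "(hnorm (htensor K H0) (Y v \<xi>))\<^sup>2 = (\<Sum>\<^sub>\<infinity>e\<in>some_onb K. \<Sum>\<^sub>\<infinity>h\<in>some_onb H0. (cmod (Y v \<xi> (e, h)))\<^sup>2)"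
    unfolding TT.hnorm_htensor[OF hs] using infsum_Sigma_banach[OF hs_functionalsD(7)[OF hs]] by simp
  also have "\<dots> = (\<Sum>\<^sub>\<infinity>e\<in>some_onb K. (hnorm H0 (ph e (space \<nu>) v \<xi>))\<^sup>2)"
    by (rule infsum_cong) (rule infsumI[OF inner])
  also have "\<dots> = Re (t oneK ind v v \<xi> \<xi>)" by (rule infsumI[OF ph_has_sum[OF v \<xi>]])
  finally show "(hnorm (htensor K H0) (Y v \<xi>))\<^sup>2 = Re (t oneK ind v v \<xi> \<xi>)" .
qed

lemma Y_ops:
  assumes v: "v \<in> carrier V"
  shows "Y v \<in> carrier (bounded_ops H (htensor K H0))"
proof -
  have D: "W.ET oneK ind \<in> carrier W.D" by (rule W.ET_in[OF W.K.one_ops ind_Lb])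
  obtain C where C: "C \<ge> 0" "\<And>\<xi>. \<xi> \<in> carrier H \<Longrightarrow> hnorm H (S (W.ET oneK ind) (v, v) \<xi>) \<le> C * hnorm H \<xi>"
    using HH.op_bound[OF S_ops[OF D v v]] by blast
  show ?thesis
  proof (rule bounded_opsI)
    fix \<xi> assume \<xi>: "\<xi> \<in> carrier H"
    show "hnorm (htensor K H0) (Y v \<xi>) \<le> sqrt C * hnorm H \<xi>"
    proof (rule power2_le_imp_le)
      have "(hnorm (htensor K H0) (Y v \<xi>))\<^sup>2 \<le> cmod (ip H \<xi> (S (W.ET oneK ind) (v, v) \<xi>))"
        unfolding Y_hs(2)[OF v \<xi>] t_def s_def by (rule complex_Re_le_cmod)
      also have "\<dots> \<le> hnorm H \<xi> * hnorm H (S (W.ET oneK ind) (v, v) \<xi>)" by (rule H.Cauchy_Schwarz[OF \<xi> S_in[OF D v v \<xi>]])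
      also have "\<dots> \<le> hnorm H \<xi> * (C * hnorm H \<xi>)" using \<xi> by (intro mult_left_mono C(2)) simp_all
      finally show "(hnorm (htensor K H0) (Y v \<xi>))\<^sup>2 \<le> (sqrt C * hnorm H \<xi>)\<^sup>2"
        using C(1) by (simp add: power_mult_distrib) (simp add: power2_eq_square mult_ac)
    qed (use C(1) \<xi> in simp)
    show "Y v \<xi> \<in> carrier (htensor K H0)" using Y_hs(1)[OF v \<xi>] by simp
  qed (use v in \<open>auto simp: Y_def ph_add_vec ph_smult_vec ph_space_in M.ip_simps intro!: restrict_ext\<close>)
qed

lemma op_linear_Y: "op_linear H V (htensor K H0) Y"
  unfolding op_linear_def linear_map_def
proof (intro conjI ballI allI)
  show "Y \<in> carrier V \<rightarrow> carrier (bounded_ops H (htensor K H0))" using Y_ops by blast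
  show "Y (v \<oplus>\<^bsub>V\<^esub> w) = Y v \<oplus>\<^bsub>bounded_ops H (htensor K H0)\<^esub> Y w" if "v \<in> carrier V" "w \<in> carrier V" for v w
    using that by (auto simp: Y_def ph_add_module ph_space_in M.ip_simps intro!: restrict_ext)
  show "Y (c \<odot>\<^bsub>V\<^esub> v) = c \<odot>\<^bsub>bounded_ops H (htensor K H0)\<^esub> Y v" if "v \<in> carrier V" for c v
    using that by (auto simp: Y_def ph_smult_module ph_space_in M.ip_simps intro!: restrict_ext)
  show "Y (v \<cdot>\<^bsub>V\<^esub> a) = compose (carrier H) (Y v) a" if v: "v \<in> carrier V" and a: "a \<in> carrier (op_algebra H)" for v a
  proof (rule extensionalityI[of _ "carrier H"])
    fix \<xi> assume \<xi>: "\<xi> \<in> carrier H"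
    have a': "a \<in> carrier (bounded_ops H H)" using a by simp
    have "ph k (space \<nu>) (v \<cdot>\<^bsub>V\<^esub> a) \<xi> = ph k (space \<nu>) v (a \<xi>)" if "k \<in> carrier K" for k
      by (rule ph_act[OF that sets.top v \<xi> a'])
    then show "Y (v \<cdot>\<^bsub>V\<^esub> a) \<xi> = compose (carrier H) (Y v) a \<xi>"
      using \<xi> bounded_opsD(2)[OF a' \<xi>] by (auto simp: Y_def compose_def intro!: restrict_ext)
  qed (simp_all add: Y_def)
qed

text \<open>The matrix element of the right-hand side is a double sum over the bases of \<open>K\<close> and \<open>H\<^sub>0\<close>. By Parseval's
  identity in \<open>H\<^sub>0\<close>, the inner sum for a basis vector \<open>e\<close> of \<open>K\<close> is
  \<open>\<langle>ph e \<Omega> v \<xi>, (\<integral>f dF) (ph (b\<^sup>* e) \<Omega> w \<eta>)\<rangle>\<close>, the matrix element of \<open>S (|e\<rangle>\<langle>b\<^sup>* e| \<otimes> f)\<close>, and by normality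
  these add up to that of \<open>S (b \<otimes> f)\<close>.\<close>

theorem S_dilation:
  assumes b: "b \<in> opsK" and f: "f \<in> Lb" and v: "v \<in> carrier V" and w: "w \<in> carrier V"
  shows "S (W.ET b f) (v, w) =
    compose (carrier H) (adj H (htensor K H0) (Y v))
      (compose (carrier H) (op_tensor K H0 b (spectral_integral \<nu> H0 F f)) (Y w))"
proof -
  obtain T where T: "integral_op f T" using integral_op_exists[OF f] by blast
  note To = integral_opD(1)[OF T]
  let ?Q = "op_tensor K H0 b T"
  have Q: "?Q \<in> carrier (bounded_ops (htensor K H0) (htensor K H0))" by (rule TT.op_tensor_ops[OF b To])
  have D: "W.ET b f \<in> carrier W.D" by (rule W.ET_in[OF b f])
  have QY: "compose (carrier H) ?Q (Y w) \<in> carrier (bounded_ops H (htensor K H0))"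
    by (rule TT.G.compose_ops[OF Q Y_ops[OF w]]) unfold_locales
  have R: "compose (carrier H) (adj H (htensor K H0) (Y v)) (compose (carrier H) ?Q (Y w)) \<in> carrier (bounded_ops H H)"
    by (rule TT.G.compose_ops[OF HT.adj_ops[OF Y_ops[OF v]] QY]) unfold_locales
  show ?thesis
    unfolding spectral_integral_eq[OF T]
  proof (rule bounded_ops_eqI[OF S_ops[OF D v w] R], rule H.vec_eqI)
    fix \<eta> \<xi> assume \<eta>: "\<eta> \<in> carrier H" and \<xi>: "\<xi> \<in> carrier H"
    note hs = Y_hs(1)[OF v \<xi>]
    have Qhs: "?Q (Y w \<eta>) \<in> hs_functionals K H0" using bounded_opsD(2)[OF Q, of "Y w \<eta>"] Y_hs(1)[OF w \<eta>] by simp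
    have ph_v: "ph e (space \<nu>) v \<xi> \<in> carrier H0" if "e \<in> some_onb K" for e by (rule ph_space_in[OF TT.onbs(1)[OF that] v \<xi>])
    have be: "adj K K b e \<in> carrier K" if "e \<in> some_onb K" for e by (rule bounded_opsD(2)[OF KK.adj_ops[OF b] TT.onbs(1)[OF that]])
    have Tph: "T (ph (adj K K b e) (space \<nu>) w \<eta>) \<in> carrier H0" if "e \<in> some_onb K" for e
      by (rule integral_opD(3)[OF T ph_space_in[OF be[OF that] w \<eta>]])
    have "ip (htensor K H0) (Y v \<xi>) (?Q (Y w \<eta>)) = (\<Sum>\<^sub>\<infinity>e\<in>some_onb K. \<Sum>\<^sub>\<infinity>h\<in>some_onb H0. cnj (Y v \<xi> (e, h)) * ?Q (Y w \<eta>) (e, h))"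
      unfolding TT.ip_htensor using infsum_Sigma_banach[OF TT.ip_htensor_summable[OF hs Qhs]] by simp
    also have "\<dots> = (\<Sum>\<^sub>\<infinity>e\<in>some_onb K. t (rank_one K K e (adj K K b e)) f v w \<xi> \<eta>)"
    proof (rule infsum_cong)
      fix e assume e: "e \<in> some_onb K"
      have "(\<Sum>\<^sub>\<infinity>h\<in>some_onb H0. cnj (Y v \<xi> (e, h)) * ?Q (Y w \<eta>) (e, h))
          = (\<Sum>\<^sub>\<infinity>h\<in>some_onb H0. cnj (ip H0 h (ph e (space \<nu>) v \<xi>)) * ip H0 h (T (ph (adj K K b e) (space \<nu>) w \<eta>)))"
      proof (rule infsum_cong)
        fix h assume h: "h \<in> some_onb H0"
        have hC: "h \<in> carrier H0" by (rule TT.onbs(2)[OF h])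
        have "?Q (Y w \<eta>) (e, h) = Y w \<eta> (adj K K b e, adj H0 H0 T h)"
          by (rule TT.op_tensor_apply[OF b To Y_hs(1)[OF w \<eta>] TT.onbs(1)[OF e] hC])
        also have "\<dots> = ip H0 (adj H0 H0 T h) (ph (adj K K b e) (space \<nu>) w \<eta>)"
          by (rule Y_apply[OF \<eta> be[OF e] bounded_opsD(2)[OF MM.adj_ops[OF To] hC]])
        also have "\<dots> = ip H0 h (T (ph (adj K K b e) (space \<nu>) w \<eta>))"
          by (rule MM.ip_adj_left[OF To ph_space_in[OF be[OF e] w \<eta>] hC])
        finally show "cnj (Y v \<xi> (e, h)) * ?Q (Y w \<eta>) (e, h) = cnj (ip H0 h (ph e (space \<nu>) v \<xi>)) * ip H0 h (T (ph (adj K K b e) (space \<nu>) w \<eta>))"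
          by (simp add: Y_apply[OF \<xi> TT.onbs(1)[OF e] hC])
      qed
      also have "\<dots> = ip H0 (ph e (space \<nu>) v \<xi>) (T (ph (adj K K b e) (space \<nu>) w \<eta>))"
        by (rule infsumI[OF M.Parseval[OF M.is_onb_some_onb ph_v[OF e] Tph[OF e]]])
      also have "\<dots> = t (rank_one K K e (adj K K b e)) f v w \<xi> \<eta>"
        by (rule integral_opD(4)[OF T TT.onbs(1)[OF e] be[OF e] v w \<xi> \<eta>])
      finally show "(\<Sum>\<^sub>\<infinity>h\<in>some_onb H0. cnj (Y v \<xi> (e, h)) * ?Q (Y w \<eta>) (e, h)) = t (rank_one K K e (adj K K b e)) f v w \<xi> \<eta>" .
    qed
    also have "\<dots> = t b f v w \<xi> \<eta>" by (rule infsumI[OF t_has_sum[OF v w \<xi> \<eta> b f]])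
    finally have "ip H \<xi> (S (W.ET b f) (v, w) \<eta>) = ip (htensor K H0) (Y v \<xi>) (?Q (Y w \<eta>))" by (simp add: t_def s_def)
    also have "\<dots> = ip H \<xi> (adj H (htensor K H0) (Y v) (?Q (Y w \<eta>)))"
      by (rule HT.ip_adj[OF Y_ops[OF v] \<xi>, symmetric]) (use Qhs in simp)
    finally show "ip H \<xi> (S (W.ET b f) (v, w) \<eta>) = ip H \<xi> (compose (carrier H) (adj H (htensor K H0) (Y v)) (compose (carrier H) ?Q (Y w)) \<eta>)"
      using \<eta> by (simp add: compose_def)
  qed (use S_in[OF D v w] bounded_opsD(2)[OF R] in auto)
qed

end


section \<open>Density\<close>

lemma lin_span_superset: "A \<subseteq> lin_span E A"
  unfolding lin_span_def by (rule hull_subset)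

lemma lin_span_add: "\<lbrakk>x \<in> lin_span E A; y \<in> lin_span E A\<rbrakk> \<Longrightarrow> x \<oplus>\<^bsub>E\<^esub> y \<in> lin_span E A"
  unfolding lin_span_def hull_def submodule_def using subgroup.m_closed[of _ "add_monoid E" x y] by auto

lemma lin_span_smult: "x \<in> lin_span E A \<Longrightarrow> c \<odot>\<^bsub>E\<^esub> x \<in> lin_span E A"
  unfolding lin_span_def hull_def using submodule.smult_closed[of _ complex_ring E c x]
  by (auto simp: complex_ring_def)

lemma limitin_in_closure_of:
  assumes "limitin X f l F" "F \<noteq> bot" "\<forall>\<^sub>F i in F. f i \<in> S"
  shows "l \<in> X closure_of S"
  unfolding in_closure_of
proof (intro conjI allI impI)
  show "l \<in> topspace X" using assms(1) by (simp add: limitin_def)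
  fix U assume "l \<in> U \<and> openin X U"
  then have "\<forall>\<^sub>F i in F. f i \<in> U" using assms(1) by (simp add: limitin_def)
  then have "\<forall>\<^sub>F i in F. f i \<in> U \<and> f i \<in> S" using assms(3) by (rule eventually_conj)
  then show "\<exists>y. y \<in> S \<and> y \<in> U" using eventually_happens'[OF assms(2)] by blast
qed

context hilbert_pair
begin

text \<open>For a fixed \<open>w\<close>, the vectors \<open>z\<close> for which \<open>|z\<rangle>\<langle>w|\<close> is a norm limit of operators in \<open>M\<close> form a closed
  subspace, which contains a total family. So all rank-one operators are norm limits, hence also \<open>T P\<close> for
  every operator \<open>T\<close> and every projection \<open>P\<close> onto a finite part of an orthonormal basis, and the net of
  these products is bounded and converges to \<open>T\<close> pointwise.\<close>

theorem sigma_strong_dense: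
  assumes M: "\<And>S T. \<lbrakk>S \<in> M; T \<in> M\<rbrakk> \<Longrightarrow> S \<oplus>\<^bsub>bounded_ops H H'\<^esub> T \<in> M"
      "\<And>c T. T \<in> M \<Longrightarrow> c \<odot>\<^bsub>bounded_ops H H'\<^esub> T \<in> M"
    and f: "B.total f I" "\<And>i w. \<lbrakk>i \<in> I; w \<in> carrier H\<rbrakk> \<Longrightarrow> rank_one H H' (f i) w \<in> M"
    and I: "I \<noteq> {}"
  shows "sigma_strong H H' closure_of M = ops"
proof
  show "sigma_strong H H' closure_of M \<subseteq> ops"
    using closure_of_subset_topspace topspace_sigma_strong by (rule order_trans)
  have fC: "f i \<in> carrier H'" if "i \<in> I" for i using f(1) that unfolding B.total_def by blast
  \<comment> \<open>the closure of \<open>M\<close> in the operator norm\<close>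
  define N where "N = {T \<in> ops. \<forall>e>0. \<exists>m\<in>M \<inter> ops. \<forall>x\<in>carrier H. hnorm H' (T x \<ominus>\<^bsub>H'\<^esub> m x) \<le> e * hnorm H x}"
  have N_ops: "T \<in> ops" if "T \<in> N" for T using that by (simp add: N_def)
  have N_M: "T \<in> N" if "T \<in> M" "T \<in> ops" for T
  proof -
    have "\<forall>x\<in>carrier H. hnorm H' (T x \<ominus>\<^bsub>H'\<^esub> T x) \<le> e * hnorm H x" if "e > 0" for e
      using that bounded_opsD(2)[OF \<open>T \<in> ops\<close>] by simp
    then show ?thesis unfolding N_def using that by blast
  qed
  have N_add: "(\<lambda>x\<in>carrier H. S x \<oplus>\<^bsub>H'\<^esub> T x) \<in> N" if S: "S \<in> N" and T: "T \<in> N" for S T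
  proof -
    have "\<exists>m\<in>M \<inter> ops. \<forall>x\<in>carrier H. hnorm H' ((\<lambda>x\<in>carrier H. S x \<oplus>\<^bsub>H'\<^esub> T x) x \<ominus>\<^bsub>H'\<^esub> m x) \<le> e * hnorm H x" if e: "e > 0" for e
    proof -
      have e2: "e / 2 > 0" using e by simp
      obtain m where m: "m \<in> M" "m \<in> ops" "\<And>x. x \<in> carrier H \<Longrightarrow> hnorm H' (S x \<ominus>\<^bsub>H'\<^esub> m x) \<le> e / 2 * hnorm H x" using S e2 unfolding N_def by blast
      obtain n where n: "n \<in> M" "n \<in> ops" "\<And>x. x \<in> carrier H \<Longrightarrow> hnorm H' (T x \<ominus>\<^bsub>H'\<^esub> n x) \<le> e / 2 * hnorm H x" using T e2 unfolding N_def by blast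
      have "hnorm H' ((S x \<oplus>\<^bsub>H'\<^esub> T x) \<ominus>\<^bsub>H'\<^esub> (m x \<oplus>\<^bsub>H'\<^esub> n x)) \<le> e * hnorm H x" if x: "x \<in> carrier H" for x
      proof -
        have c: "S x \<in> carrier H'" "T x \<in> carrier H'" "m x \<in> carrier H'" "n x \<in> carrier H'"
          by (rule bounded_opsD(2)[OF N_ops[OF S] x] bounded_opsD(2)[OF N_ops[OF T] x] bounded_opsD(2)[OF m(2) x] bounded_opsD(2)[OF n(2) x])+
        have "(S x \<oplus>\<^bsub>H'\<^esub> T x) \<ominus>\<^bsub>H'\<^esub> (m x \<oplus>\<^bsub>H'\<^esub> n x) = (S x \<ominus>\<^bsub>H'\<^esub> m x) \<oplus>\<^bsub>H'\<^esub> (T x \<ominus>\<^bsub>H'\<^esub> n x)"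
          using c by (intro B.vec_eqI) (auto simp: B.ip_simps)
        then have "hnorm H' ((S x \<oplus>\<^bsub>H'\<^esub> T x) \<ominus>\<^bsub>H'\<^esub> (m x \<oplus>\<^bsub>H'\<^esub> n x)) \<le> hnorm H' (S x \<ominus>\<^bsub>H'\<^esub> m x) + hnorm H' (T x \<ominus>\<^bsub>H'\<^esub> n x)"
          using c B.hnorm_triangle by simp
        then show ?thesis using m(3)[OF x] n(3)[OF x] by simp
      qed
      then show ?thesis
        using M(1)[OF m(1) n(1)] add_ops[OF m(2) n(2)] by (intro bexI[of _ "\<lambda>x\<in>carrier H. m x \<oplus>\<^bsub>H'\<^esub> n x"]) simp_all
    qed
    then show ?thesis unfolding N_def using add_ops[OF N_ops[OF S] N_ops[OF T]] by blast
  qed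
  have N_smult: "(\<lambda>x\<in>carrier H. c \<odot>\<^bsub>H'\<^esub> T x) \<in> N" if T: "T \<in> N" for T c
  proof -
    have "\<exists>m\<in>M \<inter> ops. \<forall>x\<in>carrier H. hnorm H' ((\<lambda>x\<in>carrier H. c \<odot>\<^bsub>H'\<^esub> T x) x \<ominus>\<^bsub>H'\<^esub> m x) \<le> e * hnorm H x" if e: "e > 0" for e
    proof -
      have e': "e / (cmod c + 1) > 0" using e by (simp add: add_nonneg_pos)
      obtain m where m: "m \<in> M" "m \<in> ops" "\<And>x. x \<in> carrier H \<Longrightarrow> hnorm H' (T x \<ominus>\<^bsub>H'\<^esub> m x) \<le> e / (cmod c + 1) * hnorm H x" using T e' unfolding N_def by blast
      have "hnorm H' (c \<odot>\<^bsub>H'\<^esub> T x \<ominus>\<^bsub>H'\<^esub> c \<odot>\<^bsub>H'\<^esub> m x) \<le> e * hnorm H x" if x: "x \<in> carrier H" for x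
      proof -
        have k: "T x \<in> carrier H'" "m x \<in> carrier H'"
          by (rule bounded_opsD(2)[OF N_ops[OF T] x] bounded_opsD(2)[OF m(2) x])+
        have "c \<odot>\<^bsub>H'\<^esub> T x \<ominus>\<^bsub>H'\<^esub> c \<odot>\<^bsub>H'\<^esub> m x = c \<odot>\<^bsub>H'\<^esub> (T x \<ominus>\<^bsub>H'\<^esub> m x)"
          using k by (intro B.vec_eqI) (auto simp: B.ip_simps algebra_simps)
        then have "hnorm H' (c \<odot>\<^bsub>H'\<^esub> T x \<ominus>\<^bsub>H'\<^esub> c \<odot>\<^bsub>H'\<^esub> m x) = cmod c * hnorm H' (T x \<ominus>\<^bsub>H'\<^esub> m x)"
          using k by (simp add: B.hnorm_smult)
        also have "\<dots> \<le> (cmod c + 1) * (e / (cmod c + 1) * hnorm H x)"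
          using k m(3)[OF x] by (intro mult_mono) auto
        also have "\<dots> = e * hnorm H x"
        proof -
          have "cmod c + 1 \<noteq> 0" using norm_ge_zero[of c] by linarith
          then show ?thesis by simp
        qed
        finally show ?thesis .
      qed
      then show ?thesis
        using M(2)[OF m(1), of c] smult_ops[OF m(2), of c] by (intro bexI[of _ "\<lambda>x\<in>carrier H. c \<odot>\<^bsub>H'\<^esub> m x"]) simp_all
    qed
    then show ?thesis unfolding N_def using smult_ops[OF N_ops[OF T]] by blast
  qed
  have N_closure: "T \<in> sigma_strong H H' closure_of M" if T: "T \<in> N" for T
  proof -
    have "\<exists>m\<in>M \<inter> ops. \<forall>x\<in>carrier H. hnorm H' (T x \<ominus>\<^bsub>H'\<^esub> m x) \<le> 1 / Suc n * hnorm H x" for n :: nat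
    proof -
      have "1 / real (Suc n) > 0" by simp
      with T show ?thesis unfolding N_def by blast
    qed
    then have "\<exists>m. \<forall>n. m n \<in> M \<inter> ops \<and> (\<forall>x\<in>carrier H. hnorm H' (T x \<ominus>\<^bsub>H'\<^esub> m n x) \<le> 1 / Suc n * hnorm H x)"
      by (intro choice allI) blast
    then obtain m where m: "\<And>n::nat. m n \<in> M" "\<And>n. m n \<in> ops"
      "\<And>n x. x \<in> carrier H \<Longrightarrow> hnorm H' (T x \<ominus>\<^bsub>H'\<^esub> m n x) \<le> 1 / Suc n * hnorm H x" by blast
    have To: "T \<in> ops" by (rule N_ops[OF T])
    obtain C where C: "C \<ge> 0" "\<And>x. x \<in> carrier H \<Longrightarrow> hnorm H' (T x) \<le> C * hnorm H x" using op_bound[OF To] by blast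
    have c: "T x \<in> carrier H'" "m n x \<in> carrier H'" if "x \<in> carrier H" for n x
      by (rule bounded_opsD(2)[OF To that] bounded_opsD(2)[OF m(2) that])+
    have "limitin (sigma_strong H H') m T sequentially"
    proof (rule limitin_sigma_strongI[OF _ _ To])
      have "hnorm H' (m n x) \<le> (C + 1) * hnorm H x" if x: "x \<in> carrier H" for n x
      proof -
        have "\<bar>hnorm H' (T x) - hnorm H' (m n x)\<bar> \<le> hnorm H' (T x \<ominus>\<^bsub>H'\<^esub> m n x)" by (rule B.hnorm_diff_le[OF c[OF x]])
        also have "\<dots> \<le> 1 / Suc n * hnorm H x" by (rule m(3)[OF x])
        also have "\<dots> \<le> 1 * hnorm H x" using x by (intro mult_right_mono) auto
        finally show ?thesis using C(2)[OF x] by (simp add: distrib_right)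
      qed
      then show "\<forall>\<^sub>F n in sequentially. m n \<in> ops \<and> (\<forall>x\<in>carrier H. hnorm H' (m n x) \<le> (C + 1) * hnorm H x)"
        using m(2) by simp
      fix x assume x: "x \<in> carrier H"
      show "(\<lambda>n. hnorm H' (m n x \<ominus>\<^bsub>H'\<^esub> T x)) \<longlonglongrightarrow> 0"
      proof (rule tendsto_sandwich)
        show "\<forall>\<^sub>F n in sequentially. 0 \<le> hnorm H' (m n x \<ominus>\<^bsub>H'\<^esub> T x)" using c[OF x] by simp
        show "\<forall>\<^sub>F n in sequentially. hnorm H' (m n x \<ominus>\<^bsub>H'\<^esub> T x) \<le> 1 / Suc n * hnorm H x"
          using m(3)[OF x] B.hnorm_minus_commute[OF c(2)[OF x] c(1)[OF x]] by simp
        show "(\<lambda>n. 1 / real (Suc n) * hnorm H x) \<longlonglongrightarrow> 0"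
          by (rule tendsto_mult_left_zero[OF LIMSEQ_Suc[OF lim_1_over_n]])
      qed (rule tendsto_const)
    qed simp
    then show ?thesis by (rule limitin_in_closure_of) (use m(1) in simp_all)
  qed
  have rank_one_N: "rank_one H H' z w \<in> N" if z: "z \<in> carrier H'" and w: "w \<in> carrier H" for z w
  proof -
    define W where "W = {z \<in> carrier H'. rank_one H H' z w \<in> N}"
    have f_W: "f i \<in> W" if "i \<in> I" for i
      unfolding W_def using fC[OF that] f(2)[OF that w] N_M rank_one_ops[OF fC[OF that] w] by blast
    have smult_W: "c \<odot>\<^bsub>H'\<^esub> x \<in> W" if x: "x \<in> W" for c x
    proof -
      have "rank_one H H' (c \<odot>\<^bsub>H'\<^esub> x) w = (\<lambda>y\<in>carrier H. c \<odot>\<^bsub>H'\<^esub> rank_one H H' x w y)"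
        using rank_one_smult[OF _ w, of x c] x by (simp add: W_def)
      then show ?thesis using N_smult x by (simp add: W_def)
    qed
    have "B.closed_subspace W"
      unfolding B.closed_subspace_def
    proof (intro conjI ballI allI impI)
      show "W \<subseteq> carrier H'" by (auto simp: W_def)
      obtain i where i: "i \<in> I" using I by blast
      have "0 \<odot>\<^bsub>H'\<^esub> f i \<in> W" by (rule smult_W[OF f_W[OF i]])
      then show "\<zero>\<^bsub>H'\<^esub> \<in> W" using fC[OF i] by simp
      show "c \<odot>\<^bsub>H'\<^esub> x \<in> W" if "x \<in> W" for c x by (rule smult_W[OF that])
    next
      fix x y assume x: "x \<in> W" and y: "y \<in> W"
      have "rank_one H H' (x \<oplus>\<^bsub>H'\<^esub> y) w = (\<lambda>v\<in>carrier H. rank_one H H' x w v \<oplus>\<^bsub>H'\<^esub> rank_one H H' y w v)"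
        using rank_one_add[OF _ _ w, of x y] x y by (simp add: W_def)
      then show "x \<oplus>\<^bsub>H'\<^esub> y \<in> W" using N_add x y by (simp add: W_def)
    next
      fix x assume x: "x \<in> carrier H'" and app: "\<forall>e>0. \<exists>y\<in>W. hnorm H' (x \<ominus>\<^bsub>H'\<^esub> y) < e"
      have "\<exists>m\<in>M \<inter> ops. \<forall>v\<in>carrier H. hnorm H' (rank_one H H' x w v \<ominus>\<^bsub>H'\<^esub> m v) \<le> e * hnorm H v" if e: "e > 0" for e
      proof -
        define d where "d = e / (2 * (hnorm H w + 1))"
        have d: "d > 0" using e w by (simp add: d_def add_nonneg_pos)
        have dw: "hnorm H w * d \<le> e / 2"
        proof -
          have "hnorm H w * d \<le> (hnorm H w + 1) * d" using d by simp
          also have "\<dots> = e / 2"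
          proof -
            define z where "z = hnorm H w + 1"
            have "z \<noteq> 0" using A.hnorm_nonneg[OF w] by (simp add: z_def)
            then show ?thesis unfolding d_def z_def[symmetric] by simp
          qed
          finally show ?thesis .
        qed
        obtain y where y: "y \<in> W" "hnorm H' (x \<ominus>\<^bsub>H'\<^esub> y) < d" using app d by blast
        have yC: "y \<in> carrier H'" and yN: "rank_one H H' y w \<in> N" using y(1) by (auto simp: W_def)
        obtain m where m: "m \<in> M" "m \<in> ops" "\<And>v. v \<in> carrier H \<Longrightarrow> hnorm H' (rank_one H H' y w v \<ominus>\<^bsub>H'\<^esub> m v) \<le> e / 2 * hnorm H v"
          using yN half_gt_zero[OF e] unfolding N_def by blast
        have "hnorm H' (rank_one H H' x w v \<ominus>\<^bsub>H'\<^esub> m v) \<le> e * hnorm H v" if v: "v \<in> carrier H" for v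
        proof -
          have c: "rank_one H H' x w v \<in> carrier H'" "rank_one H H' y w v \<in> carrier H'" "m v \<in> carrier H'"
            by (rule bounded_opsD(2)[OF rank_one_ops[OF x w] v] bounded_opsD(2)[OF rank_one_ops[OF yC w] v] bounded_opsD(2)[OF m(2) v])+
          have "rank_one H H' x w v \<ominus>\<^bsub>H'\<^esub> rank_one H H' y w v = ip H w v \<odot>\<^bsub>H'\<^esub> (x \<ominus>\<^bsub>H'\<^esub> y)"
            using x yC v by (intro B.vec_eqI) (auto simp: rank_one_def B.ip_simps algebra_simps)
          then have "hnorm H' (rank_one H H' x w v \<ominus>\<^bsub>H'\<^esub> rank_one H H' y w v) = cmod (ip H w v) * hnorm H' (x \<ominus>\<^bsub>H'\<^esub> y)"
            using x yC by (simp add: B.hnorm_smult)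
          also have "\<dots> \<le> (hnorm H w * hnorm H v) * d"
            using A.Cauchy_Schwarz[OF w v] y(2) x yC w v by (intro mult_mono) auto
          also have "\<dots> = (hnorm H w * d) * hnorm H v" by (simp only: mult_ac)
          also have "\<dots> \<le> e / 2 * hnorm H v" using dw v by (intro mult_right_mono) auto
          finally have "hnorm H' (rank_one H H' x w v \<ominus>\<^bsub>H'\<^esub> rank_one H H' y w v) \<le> e / 2 * hnorm H v" .
          then show ?thesis using B.hnorm_triangle_minus[OF c] m(3)[OF v] by simp
        qed
        then show ?thesis using m(1,2) by blast
      qed
      then show "x \<in> W" unfolding W_def N_def using x rank_one_ops[OF x w] by blast
    qed
    then have "z \<in> W" by (rule B.closed_subspace_total[OF _ f(1) f_W z])
    then show ?thesis by (simp add: W_def)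
  qed
  show "ops \<subseteq> sigma_strong H H' closure_of M"
  proof
    fix T assume T: "T \<in> ops"
    note onb = A.is_onb_some_onb
    define P where "P A = (\<lambda>x\<in>carrier H. T (A.fourier A x))" for A
    have P_N: "P A \<in> N" if "finite A" "A \<subseteq> some_onb H" for A
      using that
    proof (induction A)
      case empty
      obtain i where i: "i \<in> I" using I by blast
      have "P {} = rank_one H H' \<zero>\<^bsub>H'\<^esub> \<zero>\<^bsub>H\<^esub>"
        by (auto simp: P_def A.fourier_def ops_zero[OF T] rank_one_def intro!: restrict_ext)
      then show ?case using rank_one_N[of "\<zero>\<^bsub>H'\<^esub>" "\<zero>\<^bsub>H\<^esub>"] by simp
    next
      case (insert e A)
      have e: "e \<in> carrier H" and Te: "T e \<in> carrier H'" using A.onb_carrier[OF onb] bounded_opsD(2)[OF T] insert.prems by auto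
      have "P (insert e A) = (\<lambda>x\<in>carrier H. rank_one H H' (T e) e x \<oplus>\<^bsub>H'\<^esub> P A x)"
        unfolding P_def
      proof (rule restrict_ext)
        fix x assume x: "x \<in> carrier H"
        have FC: "A.fourier A x \<in> carrier H" using insert x by (intro A.fourier_carrier[OF onb]) auto
        have "A.fourier (insert e A) x = ip H e x \<odot>\<^bsub>H\<^esub> e \<oplus>\<^bsub>H\<^esub> A.fourier A x"
          unfolding A.fourier_def using A.onb_carrier[OF onb] insert.prems by (intro A.lincomb_insert insert.hyps) auto
        then show "T (A.fourier (insert e A) x) = rank_one H H' (T e) e x \<oplus>\<^bsub>H'\<^esub> (\<lambda>x\<in>carrier H. T (A.fourier A x)) x"
          using x e FC by (simp add: bounded_opsD(3,4)[OF T] rank_one_def)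
      qed
      moreover have "P A \<in> N" using insert by simp
      ultimately show ?case using N_add[OF rank_one_N[OF Te e]] by (simp only:)
    qed
    obtain C where C: "C \<ge> 0" "\<And>x. x \<in> carrier H \<Longrightarrow> hnorm H' (T x) \<le> C * hnorm H x" using op_bound[OF T] by blast
    have "limitin (sigma_strong H H') P T (finite_subsets_at_top (some_onb H))"
    proof (rule limitin_sigma_strongI[OF _ _ T])
      show "\<forall>\<^sub>F A in finite_subsets_at_top (some_onb H). P A \<in> ops \<and> (\<forall>x\<in>carrier H. hnorm H' (P A x) \<le> C * hnorm H x)"
      proof (rule eventually_finite_subsets_at_top_weakI, intro conjI ballI)
        fix A assume A: "finite A" "A \<subseteq> some_onb H"
        show "P A \<in> ops" by (rule N_ops[OF P_N[OF A]])
        fix x assume x: "x \<in> carrier H"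
        have "hnorm H' (P A x) \<le> C * hnorm H (A.fourier A x)" using x C(2)[OF A.fourier_carrier[OF onb A x]] by (simp add: P_def)
        also have "\<dots> \<le> C * hnorm H x" by (rule mult_left_mono[OF A.hnorm_fourier_le[OF onb A x] C(1)])
        finally show "hnorm H' (P A x) \<le> C * hnorm H x" .
      qed
      fix x assume x: "x \<in> carrier H"
      show "((\<lambda>A. hnorm H' (P A x \<ominus>\<^bsub>H'\<^esub> T x)) \<longlongrightarrow> 0) (finite_subsets_at_top (some_onb H))"
      proof (rule Lim_null_comparison)
        show "\<forall>\<^sub>F A in finite_subsets_at_top (some_onb H). norm (hnorm H' (P A x \<ominus>\<^bsub>H'\<^esub> T x)) \<le> C * hnorm H (x \<ominus>\<^bsub>H\<^esub> A.fourier A x)"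
        proof (rule eventually_finite_subsets_at_top_weakI)
          fix A assume A: "finite A" "A \<subseteq> some_onb H"
          have FC: "A.fourier A x \<in> carrier H" by (rule A.fourier_carrier[OF onb A x])
          have c: "T x \<in> carrier H'" "T (A.fourier A x) \<in> carrier H'" by (rule bounded_opsD(2)[OF T x] bounded_opsD(2)[OF T FC])+
          have "hnorm H' (P A x \<ominus>\<^bsub>H'\<^esub> T x) = hnorm H' (T x \<ominus>\<^bsub>H'\<^esub> T (A.fourier A x))"
            using x B.hnorm_minus_commute[OF c] by (simp add: P_def)
          also have "\<dots> = hnorm H' (T (x \<ominus>\<^bsub>H\<^esub> A.fourier A x))" using ops_minus[OF T x FC] by simp
          also have "\<dots> \<le> C * hnorm H (x \<ominus>\<^bsub>H\<^esub> A.fourier A x)" using x FC by (intro C(2)) simp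
          finally show "norm (hnorm H' (P A x \<ominus>\<^bsub>H'\<^esub> T x)) \<le> C * hnorm H (x \<ominus>\<^bsub>H\<^esub> A.fourier A x)" using x c by (simp add: P_def)
        qed
        show "((\<lambda>A. C * hnorm H (x \<ominus>\<^bsub>H\<^esub> A.fourier A x)) \<longlongrightarrow> 0) (finite_subsets_at_top (some_onb H))"
          by (rule tendsto_mult_right_zero[OF A.fourier_tendsto[OF onb x]])
      qed
    qed simp
    then have "T \<in> sigma_strong H H' closure_of (sigma_strong H H' closure_of M)"
      by (rule limitin_in_closure_of) (simp, rule eventually_finite_subsets_at_top_weakI, rule N_closure, rule P_N)
    then show "T \<in> sigma_strong H H' closure_of M" by simp
  qed
qed

end

context dilated
begin

interpretation KK: hilbert_pair K K by unfold_locales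
interpretation HH: hilbert_pair H H by unfold_locales
interpretation HT: hilbert_pair H "htensor K H0" by unfold_locales

lemma V_nonempty: "carrier V \<noteq> {}"
proof -
  interpret M: Module.module complex_ring V by (rule V.vector_space)
  show ?thesis using M.zero_closed by blast
qed

text \<open>A Hilbert-Schmidt functional orthogonal to all these tensors has slices orthogonal to a total family of
  \<open>H\<^sub>0\<close>.\<close>

lemma total_vec_ph:
  "TT.G.total (\<lambda>(k, i). vec_tensor K H0 k (ph_family i)) (carrier K \<times> ph_index)"
  unfolding TT.G.total_def
proof (intro conjI ballI impI)
  have ph_familyC: "ph_family i \<in> carrier H0" if "i \<in> ph_index" for i using total_ph_family that unfolding M.total_def by blast
  then show "(\<lambda>(k, i). vec_tensor K H0 k (ph_family i)) ` (carrier K \<times> ph_index) \<subseteq> carrier (htensor K H0)"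
    by (auto simp: TT.vec_tensor_hs)
  fix \<phi> assume \<phi>: "\<phi> \<in> carrier (htensor K H0)"
    and z: "\<forall>i\<in>carrier K \<times> ph_index. ip (htensor K H0) ((\<lambda>(k, i). vec_tensor K H0 k (ph_family i)) i) \<phi> = 0"
  have hs: "\<phi> \<in> hs_functionals K H0" using \<phi> by simp
  have "\<phi> (k, h) = 0" if k: "k \<in> carrier K" and h: "h \<in> carrier H0" for k h
  proof -
    obtain y where y: "y \<in> carrier H0" "\<forall>h\<in>carrier H0. \<phi> (k, h) = ip H0 h y" using TT.slice_right[OF hs k] by blast
    have "ip H0 (ph_family i) y = 0" if i: "i \<in> ph_index" for i
    proof -
      have "ip (htensor K H0) (vec_tensor K H0 k (ph_family i)) \<phi> = 0" using bspec[OF z, of "(k, i)"] k i by simp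
      then show ?thesis using y(2) ph_familyC[OF i] TT.ip_vec_tensor[OF k ph_familyC[OF i] hs] by simp
    qed
    then have "y = \<zero>\<^bsub>H0\<^esub>" using total_ph_family y(1) unfolding M.total_def by blast
    then show ?thesis using y(2) h by simp
  qed
  then show "\<phi> = \<zero>\<^bsub>htensor K H0\<^esub>"
    using hs_functionalsD(1)[OF hs] by (intro extensionalityI[of _ "carrier K \<times> carrier H0"]) auto
qed

text \<open>The operator \<open>|k\<rangle>\<langle>l| \<otimes> F X\<close> maps \<open>Y v \<xi>\<close> to \<open>k \<otimes> ph l X v \<xi>\<close>, and multiplication of \<open>v\<close> by a
  rank-one operator replaces \<open>Y v\<close> by a rank-one operator.\<close>

lemma dilation_rank_one:
  assumes k: "k \<in> carrier K" and l: "l \<in> carrier K" and X: "X \<in> sets \<nu>" and v: "v \<in> carrier V" and \<xi>: "\<xi> \<in> carrier H" and w: "w \<in> carrier H"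
  shows "rank_one H (htensor K H0) (vec_tensor K H0 k (ph l X v \<xi>)) w =
    compose (carrier H) (op_tensor K H0 (rank_one K K k l) (F X)) (Y (v \<cdot>\<^bsub>V\<^esub> rank_one H H \<xi> w))"
proof (rule extensionalityI[of _ "carrier H"])
  fix \<eta> assume \<eta>: "\<eta> \<in> carrier H"
  let ?b = "rank_one K K k l" and ?a = "rank_one H H \<xi> w"
  have b: "?b \<in> opsK" by (rule KK.rank_one_ops[OF k l])
  have a: "?a \<in> carrier (bounded_ops H H)" by (rule HH.rank_one_ops[OF \<xi> w])
  have va: "v \<cdot>\<^bsub>V\<^esub> ?a \<in> carrier V" using V.act_closed v a by simp
  have sp: "space \<nu> \<in> sets \<nu>" by simp
  have int: "space \<nu> \<inter> X = X" using sets.sets_into_space[OF X] by blast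
  have pC: "ph l X v \<xi> \<in> carrier H0" by (rule ph_in[OF l X v \<xi>])
  have "op_tensor K H0 ?b (F X) (Y (v \<cdot>\<^bsub>V\<^esub> ?a) \<eta>) = ip H w \<eta> \<odot>\<^bsub>htensor K H0\<^esub> vec_tensor K H0 k (ph l X v \<xi>)"
  proof (rule extensionalityI[of _ "carrier K \<times> carrier H0"])
    note hs = Y_hs(1)[OF va \<eta>]
    show "op_tensor K H0 ?b (F X) (Y (v \<cdot>\<^bsub>V\<^esub> ?a) \<eta>) \<in> extensional (carrier K \<times> carrier H0)"
      using bounded_opsD(2)[OF TT.op_tensor_ops[OF b F_ops[OF X]], of "Y (v \<cdot>\<^bsub>V\<^esub> ?a) \<eta>"] hs by (simp add: hs_functionalsD(1))
    fix p assume "p \<in> carrier K \<times> carrier H0"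
    then obtain c h where p: "p = (c, h)" and c: "c \<in> carrier K" and h: "h \<in> carrier H0" by blast
    have adjF: "adj H0 H0 (F X) = F X" using F(1)[OF X] by (simp add: projection_op_def)
    have adjb: "adj K K ?b c = ip K k c \<odot>\<^bsub>K\<^esub> l" unfolding KK.adj_rank_one[OF k l] using c by (simp add: rank_one_def)
    have a\<eta>: "?a \<eta> = ip H w \<eta> \<odot>\<^bsub>H\<^esub> \<xi>" using \<eta> by (simp add: rank_one_def)
    have Fh: "F X h \<in> carrier H0" by (rule F_in[OF X h])
    have lc: "ip K k c \<odot>\<^bsub>K\<^esub> l \<in> carrier K" using l by simp
    have "op_tensor K H0 ?b (F X) (Y (v \<cdot>\<^bsub>V\<^esub> ?a) \<eta>) (c, h) = ip H0 (F X h) (ph (ip K k c \<odot>\<^bsub>K\<^esub> l) (space \<nu>) (v \<cdot>\<^bsub>V\<^esub> ?a) \<eta>)"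
      unfolding TT.op_tensor_apply[OF b F_ops[OF X] hs c h] adjF adjb by (rule Y_apply[OF \<eta> lc Fh])
    also have "ph (ip K k c \<odot>\<^bsub>K\<^esub> l) (space \<nu>) (v \<cdot>\<^bsub>V\<^esub> ?a) \<eta> = cnj (ip K k c) \<odot>\<^bsub>H0\<^esub> (ip H w \<eta> \<odot>\<^bsub>H0\<^esub> ph l (space \<nu>) v \<xi>)"
      unfolding ph_smult_first[OF l sp va \<eta>] ph_act[OF l sp v \<eta> a] a\<eta> ph_smult_vec[OF l sp v \<xi>] ..
    also have "ip H0 (F X h) \<dots> = cnj (ip K k c) * (ip H w \<eta> * ip H0 (F X h) (ph l (space \<nu>) v \<xi>))"
      using Fh ph_space_in[OF l v \<xi>] by (simp add: M.ip_smult)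
    also have "ip H0 (F X h) (ph l (space \<nu>) v \<xi>) = ip H0 h (ph l X v \<xi>)"
      using M.projection_opD(4)[OF F(1)[OF X] h ph_space_in[OF l v \<xi>]] F(2)[OF X l sp v \<xi>] int by simp
    also have "cnj (ip K k c) = ip K c k" using W.K.ip_commute[OF k c] by simp
    finally show "op_tensor K H0 ?b (F X) (Y (v \<cdot>\<^bsub>V\<^esub> ?a) \<eta>) p = (ip H w \<eta> \<odot>\<^bsub>htensor K H0\<^esub> vec_tensor K H0 k (ph l X v \<xi>)) p"
      using p c h by (simp add: vec_tensor_def)
  qed simp
  then show "rank_one H (htensor K H0) (vec_tensor K H0 k (ph l X v \<xi>)) w \<eta> =
    compose (carrier H) (op_tensor K H0 ?b (F X)) (Y (v \<cdot>\<^bsub>V\<^esub> ?a)) \<eta>"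
    using \<eta> by (simp add: rank_one_def compose_def)
qed (simp_all add: rank_one_def)

theorem dilation_dense:
  "sigma_strong H (htensor K H0) closure_of
      lin_span (bounded_ops H (htensor K H0))
        {compose (carrier H) (op_tensor K H0 b (F X)) (Y v) | b X v.
          b \<in> carrier (op_algebra K) \<and> X \<in> sets \<nu> \<and> v \<in> carrier V}
      = carrier (bounded_ops H (htensor K H0))" (is "_ closure_of lin_span ?E ?A = _")
proof (rule HT.sigma_strong_dense[OF lin_span_add lin_span_smult total_vec_ph])
  fix i w assume "i \<in> carrier K \<times> ph_index" and w: "w \<in> carrier H"
  then obtain k l X v \<xi> where i: "i = (k, l, X, v, \<xi>)"
    and k: "k \<in> carrier K" and l: "l \<in> carrier K" and X: "X \<in> sets \<nu>" and v: "v \<in> carrier V" and \<xi>: "\<xi> \<in> carrier H"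
    by (auto simp: ph_index_def)
  have "rank_one H H \<xi> w \<in> carrier (op_algebra H)" using HH.rank_one_ops[OF \<xi> w] by simp
  then have va: "v \<cdot>\<^bsub>V\<^esub> rank_one H H \<xi> w \<in> carrier V" by (rule V.act_closed[OF v])
  have b: "rank_one K K k l \<in> carrier (op_algebra K)" using KK.rank_one_ops[OF k l] by simp
  have "compose (carrier H) (op_tensor K H0 (rank_one K K k l) (F X)) (Y (v \<cdot>\<^bsub>V\<^esub> rank_one H H \<xi> w)) \<in> ?A"
    using b X va by blast
  then have "rank_one H (htensor K H0) (vec_tensor K H0 k (ph l X v \<xi>)) w \<in> lin_span ?E ?A"
    unfolding dilation_rank_one[OF k l X v \<xi> w] using lin_span_superset by (rule rev_subsetD)
  then show "rank_one H (htensor K H0) ((\<lambda>(k, i). vec_tensor K H0 k (ph_family i)) i) w \<in> lin_span ?E ?A"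
    by (simp add: i ph_family_def)
next
  have "(\<zero>\<^bsub>K\<^esub>, \<zero>\<^bsub>K\<^esub>, space \<nu>, v, \<zero>\<^bsub>H\<^esub>) \<in> carrier K \<times> ph_index" if "v \<in> carrier V" for v
    using that by (simp add: ph_index_def)
  then show "carrier K \<times> ph_index \<noteq> {}" using V_nonempty by blast
qed

end

theorem proposition3:
  fixes H :: "'h hilb" and K :: "'k hilb" and V :: "('h \<Rightarrow> 'h, 'v) rmodule"
    and \<nu> :: "'o measure"
    and S :: "(('k \<times> ('o \<Rightarrow> complex) set \<Rightarrow> complex) \<Rightarrow> ('k \<times> ('o \<Rightarrow> complex) set \<Rightarrow> complex))
        \<Rightarrow> 'v \<times> 'v \<Rightarrow> 'h \<Rightarrow> 'h"
  assumes "hilbert_space H" and "hilbert_space K" and "op_module H V"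
    and "sigma_finite_measure \<nu>"
    and "cp_map (htensor K (L2 \<nu>)) (wstar_tensor K \<nu>) H V S"
    and "normal_map (htensor K (L2 \<nu>)) (wstar_tensor K \<nu>) H V S"
  shows "\<exists>(H\<^sub>0 :: ('k, 'o, 'v, 'h) dilation_vec hilb) F Y.
    hilbert_space H\<^sub>0 \<and>
    spectral_measure \<nu> H\<^sub>0 F \<and> (\<forall>X\<in>null_sets \<nu>. F X = \<zero>\<^bsub>op_algebra H\<^sub>0\<^esub>) \<and>
    op_linear H V (htensor K H\<^sub>0) Y \<and>
    (\<forall>b\<in>carrier (op_algebra K). \<forall>f\<in>Linf \<nu>. \<forall>v\<in>carrier V. \<forall>w\<in>carrier V.
      S (elem_tensor K \<nu> b f) (v, w) =
        compose (carrier H) (adj H (htensor K H\<^sub>0) (Y v))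
          (compose (carrier H) (op_tensor K H\<^sub>0 b (spectral_integral \<nu> H\<^sub>0 F (ae_rep f))) (Y w))) \<and>
    sigma_strong H (htensor K H\<^sub>0) closure_of
      lin_span (bounded_ops H (htensor K H\<^sub>0))
        {compose (carrier H) (op_tensor K H\<^sub>0 b (F X)) (Y v) | b X v.
          b \<in> carrier (op_algebra K) \<and> X \<in> sets \<nu> \<and> v \<in> carrier V}
      = carrier (bounded_ops H (htensor K H\<^sub>0))"
proof -
  interpret N: normal_cp K \<nu> H V S
    by (intro normal_cp.intro wstar.intro normal_cp_axioms.intro assms)
  \<comment> \<open>The first component of an index is an operator, by the choice of the vector type; the constant map
    with value \<open>k\<close> stands for the vector \<open>k\<close>, which is recovered as its value at any point.\<close>
  define I :: "(('k \<Rightarrow> 'k) \<times> 'o set \<times> 'v \<times> 'h) set" where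
    "I = {((\<lambda>_. k), X, v, \<xi>) | k X v \<xi>. k \<in> carrier K \<and> X \<in> sets \<nu> \<and> v \<in> carrier V \<and> \<xi> \<in> carrier H}"
  define kf where "kf p = fst p undefined" for p :: "('k \<Rightarrow> 'k) \<times> 'o set \<times> 'v \<times> 'h"
  define Xf where "Xf p = fst (snd p)" for p :: "('k \<Rightarrow> 'k) \<times> 'o set \<times> 'v \<times> 'h"
  define vf where "vf p = fst (snd (snd p))" for p :: "('k \<Rightarrow> 'k) \<times> 'o set \<times> 'v \<times> 'h"
  define xf where "xf p = snd (snd (snd p))" for p :: "('k \<Rightarrow> 'k) \<times> 'o set \<times> 'v \<times> 'h"
  define \<kappa> where "\<kappa> p q = N.kern (kf p) (kf q) (Xf p \<inter> Xf q) (vf p) (vf q) (xf p) (xf q)" for p q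
  have I: "kf p \<in> carrier K" "Xf p \<in> sets \<nu>" "vf p \<in> carrier V" "xf p \<in> carrier H" if "p \<in> I" for p
    using that by (auto simp: I_def kf_def Xf_def vf_def xf_def)
  have pos: "(\<Sum>i\<in>A. \<Sum>j\<in>A. cnj (c i) * c j * \<kappa> i j) \<in> \<real>\<^sub>\<ge>\<^sub>0" if A: "finite A" "A \<subseteq> I" for A c
    unfolding \<kappa>_def by (rule N.kern_positive[OF A(1)]) (use A(2) I in blast)+
  have "\<exists>(H0 :: ('k, 'o, 'v, 'h) dilation_vec hilb) \<phi>. hilbert_space H0 \<and> \<phi> ` I \<subseteq> carrier H0 \<and>
    (\<forall>i\<in>I. \<forall>j\<in>I. ip H0 (\<phi> i) (\<phi> j) = \<kappa> i j) \<and>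
    (\<forall>u\<in>carrier H0. (\<forall>i\<in>I. ip H0 (\<phi> i) u = 0) \<longrightarrow> u = \<zero>\<^bsub>H0\<^esub>)"
    by (rule Kolmogorov_decomposition) (rule pos)
  then obtain H0 :: "('k, 'o, 'v, 'h) dilation_vec hilb" and \<phi> where H0: "hilbert_space H0" "\<phi> ` I \<subseteq> carrier H0"
    "\<And>i j. \<lbrakk>i \<in> I; j \<in> I\<rbrakk> \<Longrightarrow> ip H0 (\<phi> i) (\<phi> j) = \<kappa> i j"
    "\<And>u. \<lbrakk>u \<in> carrier H0; \<forall>i\<in>I. ip H0 (\<phi> i) u = 0\<rbrakk> \<Longrightarrow> u = \<zero>\<^bsub>H0\<^esub>" by (elim exE conjE) blast
  define ph where "ph k X v \<xi> = \<phi> ((\<lambda>_. k), X, v, \<xi>)" for k X v \<xi>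
  have idx: "((\<lambda>_. k), X, v, \<xi>) \<in> I" if "k \<in> carrier K" "X \<in> sets \<nu>" "v \<in> carrier V" "\<xi> \<in> carrier H" for k X v \<xi>
    using that unfolding I_def by blast
  interpret D: dilated K \<nu> H V S H0 ph
  proof (intro dilated.intro dilated_axioms.intro H0(1))
    show "normal_cp K \<nu> H V S" by unfold_locales
    show "ph k X v \<xi> \<in> carrier H0" if "k \<in> carrier K" "X \<in> sets \<nu>" "v \<in> carrier V" "\<xi> \<in> carrier H" for k X v \<xi>
      unfolding ph_def using H0(2) idx[OF that] by blast
    show "ip H0 (ph k X v \<xi>) (ph k' X' v' \<xi>') = N.kern k k' (X \<inter> X') v v' \<xi> \<xi>'"
      if "k \<in> carrier K" "X \<in> sets \<nu>" "v \<in> carrier V" "\<xi> \<in> carrier H" "k' \<in> carrier K" "X' \<in> sets \<nu>" "v' \<in> carrier V" "\<xi>' \<in> carrier H"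
      for k X v \<xi> k' X' v' \<xi>'
      unfolding ph_def H0(3)[OF idx[OF that(1-4)] idx[OF that(5-8)]] by (simp add: \<kappa>_def kf_def Xf_def vf_def xf_def)
    show "x = \<zero>\<^bsub>H0\<^esub>" if x: "x \<in> carrier H0"
      and z: "\<And>k X v \<xi>. \<lbrakk>k \<in> carrier K; X \<in> sets \<nu>; v \<in> carrier V; \<xi> \<in> carrier H\<rbrakk> \<Longrightarrow> ip H0 (ph k X v \<xi>) x = 0" for x
      using z by (intro H0(4)[OF x]) (auto simp: I_def ph_def)
  qed
  have S: "S (elem_tensor K \<nu> b f) (v, w) =
        compose (carrier H) (adj H (htensor K H0) (D.Y v))
          (compose (carrier H) (op_tensor K H0 b (spectral_integral \<nu> H0 D.F (ae_rep f))) (D.Y w))"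
    if b: "b \<in> carrier (op_algebra K)" and f: "f \<in> Linf \<nu>" and v: "v \<in> carrier V" and w: "w \<in> carrier V" for b f v w
  proof -
    obtain g where g: "g \<in> ess_bounded \<nu>" "f = ae_class \<nu> g" using f unfolding Linf_eq by blast
    note rep = ae_rep_in[OF ess_bounded_measurable[OF g(1)], folded g(2)]
    obtain C where "AE x in \<nu>. cmod (g x) \<le> C" using g(1) by (rule ess_boundedE)
    then have "AE x in \<nu>. cmod (ae_rep f x) \<le> C" using rep(2) by eventually_elim simp
    then have L: "ae_rep f \<in> ess_bounded \<nu>" using rep(1) unfolding ess_bounded_def by blast
    have "f = ae_class \<nu> (ae_rep f)" using ae_class_eqI[OF rep(2)] g(2) by simp
    then have "elem_tensor K \<nu> b f = N.W.ET b (ae_rep f)" by (simp add: N.W.ET_def)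
    then show ?thesis using D.S_dilation[OF _ L v w, of b] b by simp
  qed
  have null: "\<forall>X\<in>null_sets \<nu>. D.F X = \<zero>\<^bsub>op_algebra H0\<^esub>" using D.F_null by simp
  show ?thesis
    by (intro exI[of _ H0] exI[of _ D.F] exI[of _ D.Y] conjI H0(1) D.spectral_measure_F null D.op_linear_Y D.dilation_dense ballI S)
qed

end
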